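(* Suppose that a non-elementary discrete group $\Gamma<\mathrm{Isom}(X)$ admits a proper SCC (statistically convex-cocompact) action on a proper geodesic Gromov hyperbolic space $X$. Let $f\in\Gamma$ be a loxodromic element. Then there exists a large integer $n$ such that the normal closure $\langle\langle f^n\rangle\rangle$ of $f^n$ in $\Gamma$ contains subgroups of second kind with nontrivial conservative part and nontrivial dissipative part; that is, subgroups $H$ with $\Lambda(Ho)\subsetneq\Lambda(\Gamma o)$ for which both the conservative part and the dissipative part of the action $H\curvearrowright(\partial X,\mu_o)$ have positive $\mu_o$-measure, where $\mu_o$ is the Patterson–Sullivan measure on the Gromov boundary $\partial X$ constructed from $\Gamma\curvearrowright X$.
   Context: Fix $o\in X$. A group is elementary if finite or virtually $\mathbb Z$. For $A\subseteq\Gamma$, $\omega_A=\limsup_n\frac1n\log\sharp\{go:g\in A,d(o,go)\le n\}$. SCC: for $0\le M_1\le M_2$ let $\mathcal O_{M_1,M_2}$ be the set of $g\in\Gamma$ such that some geodesic between $N_{M_2}(o)$ and $N_{M_2}(go)$ has interior outside $N_{M_1}(\Gamma o)$ ($N_r$ = $r$-neighborhood). The action is SCC if $\omega_{\mathcal O_{M_1,M_2}}<\omega_\Gamma<\infty$ for some $M_1,M_2>0$. $\Lambda(Ho)$ is the set of accumulation points of $Ho$ in the Gromov boundary $\partial X$; $H<\Gamma$ is of second kind if $\Lambda(Ho)\subsetneq\Lambda(\Gamma o)$. Patterson–Sullivan measure: weak limit on $X\cup\partial X$ along $s_i\searrow\omega_\Gamma$ of $\frac{1}{\mathcal P(s)}\sum_{g\in\Gamma}e^{-sd(o,go)}\delta_{go}$,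 $\mathcal P(s)=\sum_{g\in\Gamma}e^{-sd(o,go)}$ (for SCC actions $\mathcal P(\omega_\Gamma)=\infty$ and the measure class is unique). Hopf decomposition: for a measure-class-preserving action of a countable group $H$ on $(\partial X,\mu_o)$, a wandering set is a measurable $A$ with $hA\cap A=\emptyset$ for all $1\ne h\in H$; the dissipative part is (mod null sets) the union of the translates of a maximal wandering set, and the conservative part is its complement. *)

theory Defs
  imports "HOL-Analysis.Analysis" "HOL-Algebra.Elementary_Groups"
begin

section \<open>Isometry groups\<close>

definition isom_group :: "('a::metric_space \<Rightarrow> 'a) monoid" where
  "isom_group = \<lparr>carrier = {f. bij f \<and> (\<forall>x y. dist (f x) (f y) = dist x y)},
                 monoid.mult = (\<circ>), one = id\<rparr>"

text \<open>A group of isometries is called discrete if it satisfies the library predicate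
  \<^const>\<open>discrete\<close> for the topology of pointwise convergence on functions, which on
  isometries agrees with the compact-open topology.\<close>

abbreviation subgrp :: "('a::metric_space \<Rightarrow> 'a) set \<Rightarrow> ('a \<Rightarrow> 'a) monoid" where
  "subgrp H \<equiv> isom_group\<lparr>carrier := H\<rparr>"

lemma group_isom_group: "group (isom_group :: ('a::metric_space \<Rightarrow> 'a) monoid)"
proof (rule groupI)
  fix f :: "'a \<Rightarrow> 'a"
  assume "f \<in> carrier isom_group"
  then have b: "bij f" and d: "\<And>x y. dist (f x) (f y) = dist x y"
    by (auto simp: isom_group_def)
  have "dist (inv_into UNIV f x) (inv_into UNIV f y) = dist x y" for x y
    using d[of "inv_into UNIV f x" "inv_into UNIV f y"] b by (simp add: bij_is_surj surj_f_inv_f)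
  then have "inv_into UNIV f \<in> carrier isom_group"
    using b by (simp add: isom_group_def bij_imp_bij_inv)
  moreover have "inv_into UNIV f \<otimes>\<^bsub>isom_group\<^esub> f = \<one>\<^bsub>isom_group\<^esub>"
    using b by (simp add: isom_group_def bij_is_inj)
  ultimately show "\<exists>g\<in>carrier isom_group. g \<otimes>\<^bsub>isom_group\<^esub> f = \<one>\<^bsub>isom_group\<^esub>"
    by blast
qed (simp_all add: isom_group_def bij_comp comp_assoc)

definition virtually_Z :: "('g, 'm) monoid_scheme \<Rightarrow> bool" where
  "virtually_Z G \<longleftrightarrow>
     (\<exists>K. subgroup K G \<and> finite (rcosets\<^bsub>G\<^esub> K) \<and> G\<lparr>carrier := K\<rparr> \<cong> integer_group)"

definition elementary :: "('g, 'm) monoid_scheme \<Rightarrow> bool" where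
  "elementary G \<longleftrightarrow> finite (carrier G) \<or> virtually_Z G"

definition normal_closure :: "('g, 'm) monoid_scheme \<Rightarrow> 'g set \<Rightarrow> 'g set" where
  "normal_closure G S = \<Inter>{N. N \<lhd> G \<and> S \<subseteq> N}"

definition proper_action :: "('a::metric_space \<Rightarrow> 'a) set \<Rightarrow> bool" where
  "proper_action \<Gamma> \<longleftrightarrow> (\<forall>K. compact K \<longrightarrow> finite {g \<in> \<Gamma>. g ` K \<inter> K \<noteq> {}})"

text \<open>Loxodromic: the orbit map of the integers through the base point \<open>p\<close> is a
  quasi-isometric embedding (a condition which does not depend on \<open>p\<close>).\<close>

definition loxodromic :: "'a::metric_space \<Rightarrow> ('a \<Rightarrow> 'a) \<Rightarrow> bool" where
  "loxodromic p f \<longleftrightarrow> f \<in> carrier isom_group \<and>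
     (\<exists>K\<ge>1. \<exists>C\<ge>0. \<forall>(i::int) (j::int).
        \<bar>real_of_int (i - j)\<bar> / K - C
          \<le> dist ((f [^]\<^bsub>isom_group\<^esub> i) p) ((f [^]\<^bsub>isom_group\<^esub> j) p) \<and>
        dist ((f [^]\<^bsub>isom_group\<^esub> i) p) ((f [^]\<^bsub>isom_group\<^esub> j) p)
          \<le> K * \<bar>real_of_int (i - j)\<bar> + C)"


section \<open>Geodesics and statistical convex-cocompactness\<close>

definition geodesic :: "(real \<Rightarrow> 'a::metric_space) \<Rightarrow> real \<Rightarrow> bool" where
  "geodesic c L \<longleftrightarrow> 0 \<le> L \<and> (\<forall>s\<in>{0..L}. \<forall>t\<in>{0..L}. dist (c s) (c t) = \<bar>s - t\<bar>)"

definition geodesic_space :: "'a::metric_space itself \<Rightarrow> bool" where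
  "geodesic_space _ \<longleftrightarrow> (\<forall>(x::'a) y. \<exists>c L. geodesic c L \<and> c 0 = x \<and> c L = y)"

definition proper_space :: "'a::metric_space itself \<Rightarrow> bool" where
  "proper_space _ \<longleftrightarrow> (\<forall>(x::'a) r. compact (cball x r))"

text \<open>Closed neighbourhoods, so that \<open>nbhd 0 {p} = {p}\<close>; only used for nonempty \<open>A\<close>.\<close>

definition nbhd :: "real \<Rightarrow> 'a::metric_space set \<Rightarrow> 'a set" where
  "nbhd r A = {x. infdist x A \<le> r}"

definition orbit_of :: "'a \<Rightarrow> ('a \<Rightarrow> 'a) set \<Rightarrow> 'a set" where
  "orbit_of p A = (\<lambda>g. g p) ` A"

definition log_card :: "'b set \<Rightarrow> ereal" where
  "log_card S = (if infinite S then \<infinity> else if S = {} then -\<infinity> else ereal (ln (real (card S))))"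

definition growth :: "'a::metric_space \<Rightarrow> ('a \<Rightarrow> 'a) set \<Rightarrow> ereal" where
  "growth p A =
     limsup (\<lambda>n. log_card {g p |g. g \<in> A \<and> dist p (g p) \<le> real n} / ereal (real n))"

definition concave_region ::
    "'a::metric_space \<Rightarrow> ('a \<Rightarrow> 'a) set \<Rightarrow> real \<Rightarrow> real \<Rightarrow> ('a \<Rightarrow> 'a) set" where
  "concave_region p \<Gamma> M1 M2 =
     {g \<in> \<Gamma>. \<exists>c L. geodesic c L \<and> c 0 \<in> nbhd M2 {p} \<and> c L \<in> nbhd M2 {g p} \<and>
                  c ` {0<..<L} \<inter> nbhd M1 (orbit_of p \<Gamma>) = {}}"

definition SCC :: "'a::metric_space \<Rightarrow> ('a \<Rightarrow> 'a) set \<Rightarrow> bool" where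
  "SCC p \<Gamma> \<longleftrightarrow> (\<exists>M1 M2. 0 < M1 \<and> M1 \<le> M2 \<and>
     growth p (concave_region p \<Gamma> M1 M2) < growth p \<Gamma> \<and> growth p \<Gamma> < \<infinity>)"


section \<open>Gromov hyperbolicity, the Gromov boundary and the compactification\<close>

definition gromov_product :: "'a::metric_space \<Rightarrow> 'a \<Rightarrow> 'a \<Rightarrow> real" where
  "gromov_product p x y = (dist x p + dist y p - dist x y) / 2"

definition gromov_hyperbolic :: "'a::metric_space itself \<Rightarrow> bool" where
  "gromov_hyperbolic _ \<longleftrightarrow> (\<exists>\<delta>\<ge>0. \<forall>(w::'a) x y z.
     gromov_product w x z \<ge> min (gromov_product w x y) (gromov_product w y z) - \<delta>)"

text \<open>A boundary point is an equivalence class of sequences converging to infinity.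
  The compactification \<open>X \<union> \<partial>X\<close> is modelled inside a sum type: \<open>Inl x\<close> is a point of the
  space and \<open>Inr \<xi>\<close> a boundary point, \<open>\<xi>\<close> being an equivalence class.\<close>

type_synonym 'a bordification = "'a + (nat \<Rightarrow> 'a) set"

definition gromov_equiv :: "'a::metric_space \<Rightarrow> (nat \<Rightarrow> 'a) \<Rightarrow> (nat \<Rightarrow> 'a) \<Rightarrow> bool" where
  "gromov_equiv p u v \<longleftrightarrow>
     filterlim (\<lambda>(m, n). gromov_product p (u m) (v n)) at_top (sequentially \<times>\<^sub>F sequentially)"

definition gromov_sequences :: "'a::metric_space \<Rightarrow> (nat \<Rightarrow> 'a) set" where
  "gromov_sequences p = {u. gromov_equiv p u u}"

definition gromov_boundary :: "'a::metric_space \<Rightarrow> 'a bordification set" where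
  "gromov_boundary p = Inr ` (gromov_sequences p //
     {(u, v). u \<in> gromov_sequences p \<and> v \<in> gromov_sequences p \<and> gromov_equiv p u v})"

definition gromov_closure :: "'a::metric_space \<Rightarrow> 'a bordification set" where
  "gromov_closure p = range Inl \<union> gromov_boundary p"

text \<open>The Gromov product extended to \<open>X \<union> \<partial>X\<close>: the supremum of
  \<open>liminf (u m | v n)\<close> over sequences \<open>u\<close>, \<open>v\<close> representing the two points,
  a point of \<open>X\<close> being represented by the constant sequence.\<close>

definition representatives :: "'a bordification \<Rightarrow> (nat \<Rightarrow> 'a) set" where
  "representatives z = (case z of Inl x \<Rightarrow> {\<lambda>_. x} | Inr \<xi> \<Rightarrow> \<xi>)"

definition ext_gromov_product ::
    "'a::metric_space \<Rightarrow> 'a bordification \<Rightarrow> 'a bordification \<Rightarrow> ereal" where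
  "ext_gromov_product p a b =
     (SUP u\<in>representatives a. SUP v\<in>representatives b.
        Liminf (sequentially \<times>\<^sub>F sequentially) (\<lambda>(m, n). ereal (gromov_product p (u m) (v n))))"

text \<open>The metric topology on \<open>X\<close>, and the sets \<open>{z. (\<xi>|z) > r}\<close> as a base of
  neighbourhoods of a boundary point \<open>\<xi>\<close>.\<close>

definition gromov_open :: "'a::metric_space \<Rightarrow> 'a bordification set \<Rightarrow> bool" where
  "gromov_open p U \<longleftrightarrow> U \<subseteq> gromov_closure p \<and> open (Inl -` U) \<and>
     (\<forall>\<xi>\<in>U \<inter> gromov_boundary p.
        \<exists>r::real. {z \<in> gromov_closure p. ereal r < ext_gromov_product p \<xi> z} \<subseteq> U)"

definition gromov_topology :: "'a::metric_space \<Rightarrow> 'a bordification topology" where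
  "gromov_topology p = topology (gromov_open p)"

lemma istopology_gromov_open: "istopology (gromov_open p)"
  unfolding istopology_def
proof (intro conjI allI impI)
  define B where "B \<xi> r = {z \<in> gromov_closure p. ereal r < ext_gromov_product p \<xi> z}" for \<xi> r
  have open_iff: "gromov_open p U \<longleftrightarrow> U \<subseteq> gromov_closure p \<and> open (Inl -` U) \<and>
      (\<forall>\<xi>\<in>U \<inter> gromov_boundary p. \<exists>r. B \<xi> r \<subseteq> U)" for U
    unfolding gromov_open_def B_def by (rule refl)
  have B_mono: "B \<xi> s \<subseteq> B \<xi> r" if "r \<le> s" for \<xi> r s
  proof
    fix z assume z: "z \<in> B \<xi> s"
    have "ereal r \<le> ereal s" using that by simp
    also have "\<dots> < ext_gromov_product p \<xi> z" using z unfolding B_def by blast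
    finally show "z \<in> B \<xi> r" using z unfolding B_def by blast
  qed
  {
    fix S T assume S: "gromov_open p S" and T: "gromov_open p T"
    show "gromov_open p (S \<inter> T)"
      unfolding open_iff
    proof (intro conjI ballI)
      show "S \<inter> T \<subseteq> gromov_closure p" using S unfolding open_iff by blast
      have "open (Inl -` S \<inter> Inl -` T)" by (rule open_Int) (use S T open_iff in blast)+
      then show "open (Inl -` (S \<inter> T))" by (simp only: vimage_Int)
      fix \<xi> assume \<xi>: "\<xi> \<in> S \<inter> T \<inter> gromov_boundary p"
      obtain r where r: "B \<xi> r \<subseteq> S" using S \<xi> unfolding open_iff by blast
      obtain s where s: "B \<xi> s \<subseteq> T" using T \<xi> unfolding open_iff by blast
      have "B \<xi> (max r s) \<subseteq> S \<inter> T"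
        using r s B_mono[OF max.cobounded1] B_mono[OF max.cobounded2] by blast
      then show "\<exists>r. B \<xi> r \<subseteq> S \<inter> T" by blast
    qed
  next
    fix \<K> assume K: "\<forall>S\<in>\<K>. gromov_open p S"
    show "gromov_open p (\<Union>\<K>)"
      unfolding open_iff
    proof (intro conjI ballI)
      show "\<Union>\<K> \<subseteq> gromov_closure p" using K unfolding open_iff by blast
      have "open (\<Union>S\<in>\<K>. Inl -` S)" by (rule open_UN) (use K open_iff in blast)
      then show "open (Inl -` \<Union>\<K>)" by (simp only: vimage_Union)
      fix \<xi> assume \<xi>: "\<xi> \<in> \<Union>\<K> \<inter> gromov_boundary p"
      then obtain S where S: "S \<in> \<K>" "\<xi> \<in> S \<inter> gromov_boundary p" by blast
      have "gromov_open p S" using K S(1) by (rule bspec)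
      then obtain r where "B \<xi> r \<subseteq> S" using S(2) unfolding open_iff by blast
      then show "\<exists>r. B \<xi> r \<subseteq> \<Union>\<K>" using S(1) by blast
    qed
  }
qed

lemma openin_gromov_topology: "openin (gromov_topology p) U \<longleftrightarrow> gromov_open p U"
  unfolding gromov_topology_def topology_inverse'[OF istopology_gromov_open] ..

lemma topspace_gromov_topology: "topspace (gromov_topology p) = gromov_closure p"
proof
  show "topspace (gromov_topology p) \<subseteq> gromov_closure p"
    by (auto simp: topspace_def openin_gromov_topology gromov_open_def)
  have "Inl -` gromov_closure p = (UNIV :: 'a set)"
    by (auto simp: gromov_closure_def)
  then have "gromov_open p (gromov_closure p)"
    by (auto simp: gromov_open_def)
  then show "gromov_closure p \<subseteq> topspace (gromov_topology p)"
    by (simp add: openin_gromov_topology openin_subset)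
qed

definition ext_action :: "('a \<Rightarrow> 'a) \<Rightarrow> 'a bordification \<Rightarrow> 'a bordification" where
  "ext_action g = map_sum g (\<lambda>\<xi>. (\<lambda>u. g \<circ> u) ` \<xi>)"

definition limit_set :: "'a::metric_space \<Rightarrow> ('a \<Rightarrow> 'a) set \<Rightarrow> 'a bordification set" where
  "limit_set p H =
     (gromov_topology p derived_set_of (Inl ` orbit_of p H)) \<inter> gromov_boundary p"

definition second_kind ::
    "'a::metric_space \<Rightarrow> ('a \<Rightarrow> 'a) set \<Rightarrow> ('a \<Rightarrow> 'a) set \<Rightarrow> bool" where
  "second_kind p \<Gamma> H \<longleftrightarrow> limit_set p H \<subset> limit_set p \<Gamma>"


section \<open>Patterson--Sullivan measures\<close>

definition borel_sets_measure :: "'b topology \<Rightarrow> 'b measure" where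
  "borel_sets_measure T = sigma (topspace T) {U. openin T U}"

definition poincare_series :: "'a::metric_space \<Rightarrow> ('a \<Rightarrow> 'a) set \<Rightarrow> real \<Rightarrow> real" where
  "poincare_series p \<Gamma> s = (\<Sum>\<^sub>\<infinity>g\<in>\<Gamma>. exp (- s * dist p (g p)))"

text \<open>The measure \<open>1/\<P>(s) \<Sum>\<^sub>g exp (-s d(p,gp)) \<delta>\<^bsub>gp\<^esub>\<close>, as the image under the orbit map of the
  measure on the (discrete) set \<open>\<Gamma>\<close> with these weights.\<close>

definition ps_approx ::
    "'a::metric_space \<Rightarrow> ('a \<Rightarrow> 'a) set \<Rightarrow> real \<Rightarrow> 'a bordification measure" where
  "ps_approx p \<Gamma> s =
     distr (point_measure \<Gamma> (\<lambda>g. ennreal (exp (- s * dist p (g p)) / poincare_series p \<Gamma> s)))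
       (borel_sets_measure (gromov_topology p)) (\<lambda>g. Inl (g p))"

definition ps_weak_limit ::
    "'a::metric_space \<Rightarrow> ('a \<Rightarrow> 'a) set \<Rightarrow> 'a bordification measure \<Rightarrow> bool" where
  "ps_weak_limit p \<Gamma> \<nu> \<longleftrightarrow>
     finite_measure \<nu> \<and> sets \<nu> = sets (borel_sets_measure (gromov_topology p)) \<and>
     (\<exists>s :: nat \<Rightarrow> real.
        decseq s \<and> (\<forall>i. growth p \<Gamma> < ereal (s i)) \<and> (\<lambda>i. ereal (s i)) \<longlonglongrightarrow> growth p \<Gamma> \<and>
        (\<forall>\<phi> :: 'a bordification \<Rightarrow> real.
           continuous_map (gromov_topology p) euclideanreal \<phi> \<and>
           bounded (\<phi> ` topspace (gromov_topology p)) \<longrightarrow>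
           (\<lambda>i. integral\<^sup>L (ps_approx p \<Gamma> (s i)) \<phi>) \<longlonglongrightarrow> integral\<^sup>L \<nu> \<phi>))"

text \<open>The Patterson--Sullivan measure as a measure on the boundary alone.\<close>

definition patterson_sullivan ::
    "'a::metric_space \<Rightarrow> ('a \<Rightarrow> 'a) set \<Rightarrow> 'a bordification measure \<Rightarrow> bool" where
  "patterson_sullivan p \<Gamma> \<mu> \<longleftrightarrow>
     (\<exists>\<nu>. ps_weak_limit p \<Gamma> \<nu> \<and> \<mu> = restrict_space \<nu> (gromov_boundary p))"


section \<open>Hopf decomposition\<close>

definition wandering_set ::
    "('g, 'm) monoid_scheme \<Rightarrow> ('g \<Rightarrow> 'b \<Rightarrow> 'b) \<Rightarrow> 'b measure \<Rightarrow> 'b set \<Rightarrow> bool" where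
  "wandering_set H \<phi> M A \<longleftrightarrow>
     A \<in> sets M \<and> (\<forall>h\<in>carrier H. h \<noteq> \<one>\<^bsub>H\<^esub> \<longrightarrow> \<phi> h ` A \<inter> A = {})"

text \<open>Maximality of wandering sets is understood modulo null sets.\<close>

definition maximal_wandering_set ::
    "('g, 'm) monoid_scheme \<Rightarrow> ('g \<Rightarrow> 'b \<Rightarrow> 'b) \<Rightarrow> 'b measure \<Rightarrow> 'b set \<Rightarrow> bool" where
  "maximal_wandering_set H \<phi> M A \<longleftrightarrow> wandering_set H \<phi> M A \<and>
     (\<forall>B. wandering_set H \<phi> M B \<and> A \<subseteq> B \<longrightarrow> B - A \<in> null_sets M)"

definition hopf_decomposition ::
    "('g, 'm) monoid_scheme \<Rightarrow> ('g \<Rightarrow> 'b \<Rightarrow> 'b) \<Rightarrow> 'b measure \<Rightarrow> 'b set \<Rightarrow> 'b set \<Rightarrow> bool" where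
  "hopf_decomposition H \<phi> M Con Dis \<longleftrightarrow>
     Dis \<in> sets M \<and> Con = space M - Dis \<and>
     (\<exists>A. maximal_wandering_set H \<phi> M A \<and>
          sym_diff Dis (\<Union>h\<in>carrier H. \<phi> h ` A) \<in> null_sets M)"

end

theory Submission
  imports Defs
begin

text \<open>Fix a large power \<open>k\<close> of \<open>f\<close> and disjoint closed sets \<open>D\<^sup>+\<close>, \<open>D\<^sup>-\<close> such that \<open>k\<close> maps the
  complement of \<open>D\<^sup>-\<close> into \<open>D\<^sup>+\<close>. The group \<open>H\<close> is freely generated by conjugates \<open>g k g\<^sup>-\<^sup>1\<close> for
  infinitely many \<open>g\<close>, chosen inductively such that the sets \<open>g D\<^sup>\<plusminus>\<close> are disjoint from each other and
  from \<open>D\<^sup>+\<close> itself. By ping-pong, \<open>D\<^sup>+\<close> is wandering for \<open>H\<close>, and its interior, which contains limit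
  points of \<open>\<Gamma>\<close>, misses the limit set of \<open>H\<close>.

  Let \<open>A\<close> be a set of positive measure away from \<open>D\<^sup>\<plusminus>\<close>. At each stage finitely many very long \<open>g\<close> are
  added. The shadow principle for the Patterson--Sullivan measure shows that the orbit \<open>H D\<^sup>+\<close> then
  grows by arbitrarily little measure, while a Vitali selection makes the translates \<open>h g A\<close>, where
  \<open>h\<close> is in the group of the previous stage, cover almost all of the complement of \<open>H D\<^sup>+\<close>. The element
  \<open>(h g) k (h g)\<^sup>-\<^sup>1\<close> of \<open>H\<close> moves subsets of \<open>h g A\<close> with bounded distortion of the measure, so by the
  Borel--Cantelli lemma every wandering set is contained in \<open>H D\<^sup>+\<close> up to a null set. Hence \<open>H D\<^sup>+\<close> is
  the dissipative part, and its complement, which has positive measure, is the conservative part.\<close>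

section \<open>Isometries\<close>

text \<open>A finite configuration never suffices: the translates of its fundamental domain are
  disjoint and cover almost everything (\<open>ae_cover\<close>), so its group acts dissipatively
  and conservativity can only arise in the limit. The same covering lets each stage place new
  generators near almost every point still to be caught. Against this, every new generator enlarges
  the orbit of \<open>Dp\<close>, which must not become conull. The constants \<open>c0\<close> and
  \<open>c1\<close> of the selection do not depend on the stage, so a fixed proportion is gained
  each time. Statistical convex-cocompactness enters twice: the Poincare series diverges at
  \<open>om\<close>, which puts the limit measure on the boundary, and excursions are rare, which
  makes almost every boundary point conical. Non-elementarity enters through
  \<open>direction_lemma\<close>: a conical element can be corrected by one of finitely many
  \<open>b\<close> so that \<open>ivt g p\<close> points away from the axis; then \<open>g\<close>
  compresses \<open>Dp\<close>, \<open>Dm\<close> and \<open>A\<close> at comparable rates. The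
  domains are cut at a level set of measure zero, so that coding points by reduced words is
  unambiguous almost everywhere.\<close>

definition isometry :: "('a::metric_space \<Rightarrow> 'a) \<Rightarrow> bool" where
  "isometry g \<longleftrightarrow> bij g \<and> (\<forall>x y. dist (g x) (g y) = dist x y)"

abbreviation ivt :: "('a \<Rightarrow> 'a) \<Rightarrow> 'a \<Rightarrow> 'a" where
  "ivt g \<equiv> inv_into UNIV g"

lemma isometry_dist: "isometry g \<Longrightarrow> dist (g x) (g y) = dist x y"
  by (simp add: isometry_def)

lemma isometry_bij: "isometry g \<Longrightarrow> bij g"
  by (simp add: isometry_def)

lemma isometry_id [simp]: "isometry id"
  by (simp add: isometry_def)

lemma isometry_comp: "isometry g \<Longrightarrow> isometry h \<Longrightarrow> isometry (g \<circ> h)"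
  by (auto simp: isometry_def bij_comp)

lemma isometry_ivt_apply [simp]:
  assumes "isometry g"
  shows "g (ivt g x) = x" "ivt g (g x) = x"
  using isometry_bij[OF assms] by (simp_all add: bij_is_surj surj_f_inv_f bij_is_inj)

lemma isometry_ivt_comp [simp]:
  assumes "isometry g"
  shows "g \<circ> ivt g = id" "ivt g \<circ> g = id"
  using assms by (auto simp: fun_eq_iff)

lemma isometry_ivt:
  assumes "isometry g" shows "isometry (ivt g)"
  unfolding isometry_def
proof (intro conjI allI)
  show "bij (ivt g)" using assms by (simp add: bij_imp_bij_inv isometry_bij)
  fix x y
  show "dist (ivt g x) (ivt g y) = dist x y"
    using isometry_dist[OF assms, of "ivt g x" "ivt g y"] assms by simp
qed

lemma ivt_comp:
  assumes "isometry g" "isometry h" shows "ivt (g \<circ> h) = ivt h \<circ> ivt g"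
  using assms by (simp add: o_inv_distrib isometry_bij)

lemma ivt_ivt [simp]: "isometry g \<Longrightarrow> ivt (ivt g) = g"
  by (simp add: inv_inv_eq isometry_bij)

lemma ivt_id [simp]: "ivt id = id"
  by (rule inv_id)

lemma carrier_isom_group: "carrier isom_group = Collect isometry"
  by (auto simp: isom_group_def isometry_def)

lemma isom_group_mult [simp]: "g \<otimes>\<^bsub>isom_group\<^esub> h = g \<circ> h"
  by (simp add: isom_group_def)

lemma isom_group_one [simp]: "\<one>\<^bsub>isom_group\<^esub> = id"
  by (simp add: isom_group_def)

lemma isom_group_inv: "isometry g \<Longrightarrow> inv\<^bsub>isom_group\<^esub> g = ivt g"
  by (rule group.inv_equality[OF group_isom_group])
    (auto simp: carrier_isom_group isometry_ivt)


section \<open>Gromov products in a hyperbolic space\<close>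

locale hyp_space =
  fixes p :: "'a::metric_space" and \<delta> :: real
  assumes proper: "compact (cball (x::'a) r)"
    and geod: "\<exists>c L. geodesic c L \<and> c 0 = (x::'a) \<and> c L = y"
    and delta_pos: "0 < \<delta>"
    and hyp_min: "min (gromov_product w x y) (gromov_product w y z) - \<delta> \<le> gromov_product (w::'a) x z"
begin

abbreviation gp :: "'a \<Rightarrow> 'a \<Rightarrow> real" where
  "gp \<equiv> gromov_product p"

abbreviation (input) nrm :: "'a \<Rightarrow> real" where
  "nrm x \<equiv> dist p x"

abbreviation (input) len :: "('a \<Rightarrow> 'a) \<Rightarrow> real" where
  "len g \<equiv> dist p (g p)"

abbreviation Z :: "'a bordification set" where
  "Z \<equiv> gromov_closure p"

abbreviation Bd :: "'a bordification set" where
  "Bd \<equiv> gromov_boundary p"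

abbreviation T :: "'a bordification topology" where
  "T \<equiv> gromov_topology p"

lemma gp_hyp: "r \<le> gp x y \<Longrightarrow> r \<le> gp y z \<Longrightarrow> r - \<delta> \<le> gp x z"
  using hyp_min[of p x y z] by linarith

lemma gp_sym: "gp x y = gp y x"
  by (simp add: gromov_product_def dist_commute)

lemma gp_nonneg: "0 \<le> gp x y"
  using dist_triangle[of x y p] by (simp add: gromov_product_def dist_commute)

lemma gp_le: "gp x y \<le> nrm x" "gp x y \<le> nrm y"
  using dist_triangle[of x p y] dist_triangle[of y p x]
  by (simp_all add: gromov_product_def dist_commute)

lemma gp_self [simp]: "gp x x = nrm x"
  by (simp add: gromov_product_def dist_commute)

lemma gp_base [simp]: "gp x p = 0" "gp p x = 0"
  by (simp_all add: gromov_product_def dist_commute)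

lemma gp_lipschitz: "gp x y \<le> gp x z + dist y z"
  using dist_triangle[of y p z] dist_triangle[of x z y]
  by (simp add: gromov_product_def dist_commute field_simps)

lemma len_ivt: "isometry g \<Longrightarrow> nrm (ivt g p) = len g"
  using isometry_dist[of g "ivt g p" p] by (simp add: dist_commute)

lemma len_comp_le: "isometry g \<Longrightarrow> len (g \<circ> h) \<le> len g + len h"
  using dist_triangle[of p "g (h p)" "g p"] isometry_dist[of g p "h p"] by simp

text \<open>Isometries move the base point: the left side is the product of \<open>x\<close> and
  \<open>y\<close> based at \<open>ivt g p\<close>, rewritten with base \<open>p\<close>.\<close>

lemma gp_isometry:
  assumes "isometry g"
  shows "gp (g x) (g y) = gp x y - gp x (ivt g p) - gp y (ivt g p) + len g"
proof -
  have *: "dist (g u) p = dist u (ivt g p)" for u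
    using isometry_dist[OF assms, of u "ivt g p"] assms by simp
  have "len g = dist p (ivt g p)" using *[of p] by (simp add: dist_commute)
  then show ?thesis using isometry_dist[OF assms, of x y] *[of x] *[of y]
    by (simp add: gromov_product_def dist_commute[of _ p] dist_commute[of "ivt g p"] field_simps)
qed

subsection \<open>Gromov sequences\<close>

lemma gromov_equiv_iff:
  "gromov_equiv p u v \<longleftrightarrow> (\<forall>r. \<exists>N. \<forall>m\<ge>N. \<forall>n\<ge>N. r \<le> gp (u m) (v n))"
proof -
  have "gromov_equiv p u v \<longleftrightarrow>
      (\<forall>r. \<forall>\<^sub>F (m, n) in sequentially \<times>\<^sub>F sequentially. r \<le> gp (u m) (v n))"
    by (simp add: gromov_equiv_def filterlim_at_top case_prod_unfold)
  also have "\<dots> \<longleftrightarrow> (\<forall>r. \<exists>N. \<forall>m\<ge>N. \<forall>n\<ge>N. r \<le> gp (u m) (v n))"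
    (is "(\<forall>r. ?A r) \<longleftrightarrow> (\<forall>r. ?B r)")
  proof (rule all_cong1)
    fix r
    show "?A r \<longleftrightarrow> ?B r"
      unfolding eventually_prod_sequentially by auto
  qed
  finally show ?thesis .
qed

lemma gromov_equiv_sym: "gromov_equiv p u v \<Longrightarrow> gromov_equiv p v u"
  unfolding gromov_equiv_iff by (metis gp_sym)

lemma gromov_equiv_trans:
  assumes "gromov_equiv p u v" "gromov_equiv p v w" shows "gromov_equiv p u w"
  unfolding gromov_equiv_iff
proof
  fix r
  obtain N where N: "\<And>m n. m \<ge> N \<Longrightarrow> n \<ge> N \<Longrightarrow> r + \<delta> \<le> gp (u m) (v n)"
    using assms(1) unfolding gromov_equiv_iff by blast
  obtain M where M: "\<And>m n. m \<ge> M \<Longrightarrow> n \<ge> M \<Longrightarrow> r + \<delta> \<le> gp (v m) (w n)"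
    using assms(2) unfolding gromov_equiv_iff by blast
  have "r \<le> gp (u m) (w n)" if "m \<ge> max N M" "n \<ge> max N M" for m n
    using gp_hyp[OF N[of m m] M[of m n]] gp_hyp[OF N[of m "max N M"] M[of "max N M" n]] that by simp
  then show "\<exists>N. \<forall>m\<ge>N. \<forall>n\<ge>N. r \<le> gp (u m) (w n)" by blast
qed

definition gsrel :: "((nat \<Rightarrow> 'a) \<times> (nat \<Rightarrow> 'a)) set" where
  "gsrel = {(u, v). u \<in> gromov_sequences p \<and> v \<in> gromov_sequences p \<and> gromov_equiv p u v}"

lemma equiv_gsrel: "equiv (gromov_sequences p) gsrel"
proof (rule equivI)
  show "gsrel \<subseteq> gromov_sequences p \<times> gromov_sequences p" by (auto simp: gsrel_def)
  show "refl_on (gromov_sequences p) gsrel"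
    by (auto simp: refl_on_def gsrel_def gromov_sequences_def)
  show "sym gsrel" by (auto simp: sym_def gsrel_def intro: gromov_equiv_sym)
  show "trans gsrel" unfolding trans_def gsrel_def by (blast intro: gromov_equiv_trans)
qed

lemma Bd_eq: "Bd = Inr ` (gromov_sequences p // gsrel)"
  by (simp add: gromov_boundary_def gsrel_def)

lemma BdE:
  assumes "z \<in> Bd"
  obtains \<xi> u where "z = Inr \<xi>" "u \<in> \<xi>" "u \<in> gromov_sequences p" "\<xi> = gsrel `` {u}"
proof -
  obtain \<xi> where x: "z = Inr \<xi>" "\<xi> \<in> gromov_sequences p // gsrel" using assms Bd_eq by auto
  then obtain u where u: "u \<in> gromov_sequences p" "\<xi> = gsrel `` {u}" by (blast elim: quotientE)
  then have "u \<in> \<xi>" using equiv_class_self[OF equiv_gsrel u(1)] by simp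
  with x u that show thesis by blast
qed

lemma BdI: "u \<in> gromov_sequences p \<Longrightarrow> Inr (gsrel `` {u}) \<in> Bd"
  unfolding Bd_eq by (blast intro: quotientI)

lemma Bd_reps_equiv:
  assumes "Inr \<xi> \<in> Bd" "u \<in> \<xi>" "v \<in> \<xi>" shows "gromov_equiv p u v"
proof -
  have "\<xi> \<in> gromov_sequences p // gsrel" using assms(1) Bd_eq by auto
  then have "(u, v) \<in> gsrel" using assms(2,3) equiv_gsrel quotient_eq_iff by fastforce
  then show ?thesis by (simp add: gsrel_def)
qed

lemma Bd_eqI:
  assumes "Inr \<xi> \<in> Bd" "Inr \<eta> \<in> Bd" "u \<in> \<xi>" "v \<in> \<eta>" "gromov_equiv p u v" shows "\<xi> = \<eta>"
proof -
  have q: "\<xi> \<in> gromov_sequences p // gsrel" "\<eta> \<in> gromov_sequences p // gsrel"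
    using assms(1,2) Bd_eq by auto
  then have "u \<in> gromov_sequences p" "v \<in> gromov_sequences p"
    using in_quotient_imp_subset[OF equiv_gsrel] assms(3,4) by blast+
  then have "(u, v) \<in> gsrel" using assms(5) by (simp add: gsrel_def)
  then show ?thesis using q assms(3,4) equiv_gsrel quotient_eqI by fastforce
qed

lemma Z_cases:
  assumes "z \<in> Z"
  obtains x where "z = Inl x" | "z \<in> Bd"
  using assms by (auto simp: gromov_closure_def)

lemma Inl_in_Z [simp]: "Inl x \<in> Z"
  by (simp add: gromov_closure_def)

lemma Bd_in_Z: "z \<in> Bd \<Longrightarrow> z \<in> Z"
  by (simp add: gromov_closure_def)

lemma Inl_notin_Bd [simp]: "Inl x \<notin> Bd"
  by (auto simp: gromov_boundary_def)

subsection \<open>The Gromov product of a point of the compactification and a point of the space\<close>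

text \<open>Along a sequence representing a boundary point the products with \<open>x\<close> need
  not converge. They do stabilise up to a bounded error, uniformly over the representatives, and one
  such approximate value is chosen. A real value without limits keeps the later estimates linear, at
  the price that neither continuity nor measurability of \<open>bp\<close> is available.\<close>

definition bp :: "'a bordification \<Rightarrow> 'a \<Rightarrow> real" where
  "bp z x = (case z of Inl y \<Rightarrow> gp y x |
     Inr \<xi> \<Rightarrow> (SOME r. \<forall>u\<in>\<xi>. \<forall>\<^sub>F n in sequentially. \<bar>gp (u n) x - r\<bar> \<le> 2 * \<delta>))"

lemma bp_Inl [simp]: "bp (Inl y) x = gp y x"
  by (simp add: bp_def)

lemma bp_approx_Bd:
  assumes "Inr \<xi> \<in> Bd" "u \<in> \<xi>"
  shows "\<forall>\<^sub>F n in sequentially. \<bar>gp (u n) x - bp (Inr \<xi>) x\<bar> \<le> 2 * \<delta>"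
proof -
  obtain N where N: "\<And>m n. m \<ge> N \<Longrightarrow> n \<ge> N \<Longrightarrow> nrm x \<le> gp (u m) (u n)"
    using Bd_reps_equiv[OF assms assms(2)] unfolding gromov_equiv_iff by blast
  \<comment> \<open>The witness is \<open>gp (u N) x\<close>. No product with \<open>x\<close>
    exceeds \<open>nrm x\<close>, so two points whose mutual product is at least
    \<open>nrm x\<close> have the same product with \<open>x\<close> up to \<delta>; the detour
    through \<open>u (max N M)\<close> costs this twice.\<close>
  have "\<forall>v\<in>\<xi>. \<forall>\<^sub>F n in sequentially. \<bar>gp (v n) x - gp (u N) x\<bar> \<le> 2 * \<delta>"
  proof
    fix v assume "v \<in> \<xi>"
    obtain M where M: "\<And>m n. m \<ge> M \<Longrightarrow> n \<ge> M \<Longrightarrow> nrm x \<le> gp (u m) (v n)"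
      using Bd_reps_equiv[OF assms \<open>v \<in> \<xi>\<close>] unfolding gromov_equiv_iff by blast
    have "\<bar>gp (v n) x - gp (u N) x\<bar> \<le> 2 * \<delta>" if n: "n \<ge> max N M" for n
    proof -
      define w where "w = u (max N M)"
      have 1: "nrm x \<le> gp w (v n)" using M n by (simp add: w_def)
      have 2: "nrm x \<le> gp w (u N)" using N by (simp add: w_def)
      have a: "gp a x - \<delta> \<le> gp b x" if "nrm x \<le> gp a b" for a b
        using gp_hyp[of "gp a x" b a x] that gp_le(2)[of a x] gp_sym[of a b] by linarith
      show ?thesis
        using a[OF 1] a[OF 2] a[of "v n" w] a[of "u N" w] 1 2 gp_sym[of w "v n"] gp_sym[of w "u N"]
        by linarith
    qed
    then show "\<forall>\<^sub>F n in sequentially. \<bar>gp (v n) x - gp (u N) x\<bar> \<le> 2 * \<delta>"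
      unfolding eventually_sequentially by blast
  qed
  then have "\<forall>v\<in>\<xi>. \<forall>\<^sub>F n in sequentially. \<bar>gp (v n) x - bp (Inr \<xi>) x\<bar> \<le> 2 * \<delta>"
    unfolding bp_def by simp (rule someI)
  then show ?thesis using assms(2) by blast
qed

text \<open>Inequalities between Gromov products pass from the space to the compactification along
  a representing sequence, at the cost of \<open>2\<delta>\<close> for each product.\<close>

lemma bp_approx:
  assumes "z \<in> Z"
  obtains u where "u \<in> representatives z"
    "\<And>x. \<forall>\<^sub>F n in sequentially. \<bar>gp (u n) x - bp z x\<bar> \<le> 2 * \<delta>"
  using assms
proof (cases rule: Z_cases)
  case (1 x)
  show thesis by (rule that[of "\<lambda>_. x"]) (use 1 delta_pos in \<open>auto simp: representatives_def\<close>)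
next
  case 2
  then obtain \<xi> u where "z = Inr \<xi>" "u \<in> \<xi>" by (auto elim: BdE)
  then show thesis using that[of u] bp_approx_Bd[of \<xi> u] 2 by (auto simp: representatives_def)
qed

lemma bp_hyp:
  assumes "z \<in> Z" "r \<le> bp z y" "r \<le> gp y x" shows "r - 5 * \<delta> \<le> bp z x"
proof -
  obtain u where u: "\<And>x. \<forall>\<^sub>F n in sequentially. \<bar>gp (u n) x - bp z x\<bar> \<le> 2 * \<delta>"
    using bp_approx[OF assms(1)] by metis
  have "\<forall>\<^sub>F n in sequentially. r - 5 * \<delta> \<le> bp z x"
    using u[of x] u[of y]
  proof eventually_elim
    case (elim n)
    then show ?case using assms(2,3) gp_hyp[of "r - 2 * \<delta>" "u n" y x] delta_pos by linarith
  qed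
  then show ?thesis by simp
qed

lemma gp_bp_hyp:
  assumes "z \<in> Z" "r \<le> bp z x" "r \<le> bp z y" shows "r - 3 * \<delta> \<le> gp x y"
proof -
  obtain u where u: "\<And>x. \<forall>\<^sub>F n in sequentially. \<bar>gp (u n) x - bp z x\<bar> \<le> 2 * \<delta>"
    using bp_approx[OF assms(1)] by metis
  have "\<forall>\<^sub>F n in sequentially. r - 3 * \<delta> \<le> gp x y"
    using u[of x] u[of y]
  proof eventually_elim
    case (elim n)
    then show ?case
      using assms(2,3) gp_hyp[of "r - 2 * \<delta>" x "u n" y] gp_sym[of x "u n"] by linarith
  qed
  then show ?thesis by simp
qed

lemma bp_bounds:
  assumes "z \<in> Z" shows "- 2 * \<delta> \<le> bp z x" "bp z x \<le> nrm x + 2 * \<delta>"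
proof -
  obtain u where u: "\<And>x. \<forall>\<^sub>F n in sequentially. \<bar>gp (u n) x - bp z x\<bar> \<le> 2 * \<delta>"
    using bp_approx[OF assms(1)] by metis
  have "\<forall>\<^sub>F n in sequentially. - 2 * \<delta> \<le> bp z x \<and> bp z x \<le> nrm x + 2 * \<delta>"
    using u[of x]
  proof eventually_elim
    case (elim n)
    then show ?case using gp_nonneg[of "u n" x] gp_le(2)[of "u n" x] by linarith
  qed
  then show "- 2 * \<delta> \<le> bp z x" "bp z x \<le> nrm x + 2 * \<delta>" by simp_all
qed

lemma bp_lipschitz:
  assumes "z \<in> Z" shows "bp z x \<le> bp z y + dist x y + 4 * \<delta>"
proof -
  obtain u where u: "\<And>x. \<forall>\<^sub>F n in sequentially. \<bar>gp (u n) x - bp z x\<bar> \<le> 2 * \<delta>"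
    using bp_approx[OF assms(1)] by metis
  have "\<forall>\<^sub>F n in sequentially. bp z x \<le> bp z y + dist x y + 4 * \<delta>"
    using u[of x] u[of y]
  proof eventually_elim
    case (elim n)
    then show ?case using gp_lipschitz[of "u n" x y] by linarith
  qed
  then show ?thesis by simp
qed

subsection \<open>The action of isometries on the compactification\<close>

abbreviation act :: "('a \<Rightarrow> 'a) \<Rightarrow> 'a bordification \<Rightarrow> 'a bordification" where
  "act \<equiv> ext_action"

lemma act_Inl [simp]: "act g (Inl x) = Inl (g x)"
  by (simp add: ext_action_def)

lemma act_id [simp]: "act id z = z"
  by (cases z) (simp_all add: ext_action_def)

lemma act_comp: "act (g \<circ> h) z = act g (act h z)"
  by (cases z) (auto simp: ext_action_def image_image comp_assoc)

lemma act_comp_image: "act (g \<circ> h) ` A = act g ` act h ` A"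
  by (auto simp: act_comp)

lemma gromov_equiv_isometry:
  assumes "isometry g" "gromov_equiv p u v" shows "gromov_equiv p (g \<circ> u) (g \<circ> v)"
  unfolding gromov_equiv_iff
proof
  fix r
  obtain N where N: "\<And>m n. m \<ge> N \<Longrightarrow> n \<ge> N \<Longrightarrow> r + len g \<le> gp (u m) (v n)"
    using assms(2) unfolding gromov_equiv_iff by blast
  have "r \<le> gp ((g \<circ> u) m) ((g \<circ> v) n)" if "m \<ge> N" "n \<ge> N" for m n
    using N[OF that] gp_isometry[OF assms(1), of "u m" "v n"] gp_le(2)[of "u m" "ivt g p"]
      gp_le(2)[of "v n" "ivt g p"] len_ivt[OF assms(1)] by simp
  then show "\<exists>N. \<forall>m\<ge>N. \<forall>n\<ge>N. r \<le> gp ((g \<circ> u) m) ((g \<circ> v) n)" by blast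
qed

lemma act_class:
  assumes "isometry g" "u \<in> gromov_sequences p"
  shows "act g (Inr (gsrel `` {u})) = Inr (gsrel `` {g \<circ> u})"
proof -
  have sub: "(\<lambda>v. h \<circ> v) ` (gsrel `` {w}) \<subseteq> gsrel `` {h \<circ> w}" if "isometry h" for h w
    using gromov_equiv_isometry[OF that] by (auto simp: gsrel_def gromov_sequences_def)
  have "gsrel `` {g \<circ> u} \<subseteq> (\<lambda>v. g \<circ> v) ` (gsrel `` {u})"
  proof
    fix v assume v: "v \<in> gsrel `` {g \<circ> u}"
    have "ivt g \<circ> v \<in> gsrel `` {ivt g \<circ> (g \<circ> u)}" using sub[OF isometry_ivt[OF assms(1)], of "g \<circ> u"] v by blast
    moreover have "ivt g \<circ> (g \<circ> u) = u" "g \<circ> (ivt g \<circ> v) = v"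
      using assms(1) by (auto simp: fun_eq_iff)
    ultimately show "v \<in> (\<lambda>v. g \<circ> v) ` (gsrel `` {u})" by (metis imageI)
  qed
  then show ?thesis using sub[OF assms(1), of u] by (auto simp: ext_action_def)
qed

lemma act_Bd:
  assumes "isometry g" "z \<in> Bd" shows "act g z \<in> Bd"
proof -
  obtain \<xi> u where "z = Inr \<xi>" "u \<in> gromov_sequences p" "\<xi> = gsrel `` {u}"
    using assms(2) by (auto elim: BdE)
  moreover have "g \<circ> u \<in> gromov_sequences p"
    using gromov_equiv_isometry[OF assms(1)] calculation(2) by (simp add: gromov_sequences_def)
  ultimately show ?thesis using act_class[OF assms(1)] BdI by simp
qed

lemma act_Z: "isometry g \<Longrightarrow> z \<in> Z \<Longrightarrow> act g z \<in> Z"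
  using act_Bd by (auto elim!: Z_cases simp: Bd_in_Z)

lemma act_ivt [simp]:
  assumes "isometry g" shows "act g (act (ivt g) z) = z" "act (ivt g) (act g z) = z"
  using assms by (simp_all flip: act_comp)

lemma act_inj: "isometry g \<Longrightarrow> inj (act g)"
  by (metis act_ivt(2) injI)

lemma act_image_eq:
  assumes "isometry g" shows "act g ` A = {z. act (ivt g) z \<in> A}"
proof
  show "act g ` A \<subseteq> {z. act (ivt g) z \<in> A}" using assms by auto
  show "{z. act (ivt g) z \<in> A} \<subseteq> act g ` A"
  proof
    fix z assume "z \<in> {z. act (ivt g) z \<in> A}"
    then show "z \<in> act g ` A" using act_ivt(1)[OF assms, of z] by (metis imageI mem_Collect_eq)
  qed
qed

lemma bp_act:
  assumes "isometry g" "z \<in> Z"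
  shows "\<bar>bp (act g z) (g x) - (bp z x - bp z (ivt g p) - gp x (ivt g p) + len g)\<bar> \<le> 6 * \<delta>"
  using assms(2)
proof (cases rule: Z_cases)
  case (1 y)
  then show ?thesis using gp_isometry[OF assms(1), of y x] delta_pos by simp
next
  case 2
  then obtain \<xi> u where u: "z = Inr \<xi>" "u \<in> \<xi>" by (auto elim: BdE)
  obtain \<eta> where e: "act g z = Inr \<eta>" "g \<circ> u \<in> \<eta>"
    using u by (auto simp: ext_action_def)
  have *: "\<forall>\<^sub>F n in sequentially. \<bar>gp (g (u n)) (g x) - bp (act g z) (g x)\<bar> \<le> 2 * \<delta>"
    using bp_approx_Bd[of \<eta> "g \<circ> u" "g x"] act_Bd[OF assms(1) 2] e by simp
  have "\<forall>\<^sub>F n in sequentially. \<bar>bp (act g z) (g x) - (bp z x - bp z (ivt g p) - gp x (ivt g p) + len g)\<bar> \<le> 6 * \<delta>"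
  proof -
    have "\<forall>\<^sub>F n in sequentially. \<bar>gp (u n) x - bp z x\<bar> \<le> 2 * \<delta>"
      and "\<forall>\<^sub>F n in sequentially. \<bar>gp (u n) (ivt g p) - bp z (ivt g p)\<bar> \<le> 2 * \<delta>"
      using bp_approx_Bd[of \<xi> u] 2 u by auto
    then show ?thesis using *
    proof eventually_elim
      case (elim n)
      then show ?case using gp_isometry[OF assms(1), of "u n" x] by linarith
    qed
  qed
  then show ?thesis by simp
qed

text \<open>The basic contraction estimate: the less \<open>z\<close> points towards
  \<open>ivt g p\<close>, the deeper its image lies in the shadow of \<open>g p\<close>.\<close>

lemma bp_act_base:
  assumes "isometry g" "z \<in> Z"
  shows "\<bar>bp (act g z) (g p) - (len g - bp z (ivt g p))\<bar> \<le> 8 * \<delta>"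
  using bp_act[OF assms, of p] bp_bounds[OF assms(2), of p] by simp

end

context hyp_space
begin

section \<open>The topology of the compactification\<close>

lemma bp_approx_any:
  assumes "z \<in> Z" "v \<in> representatives z"
  shows "\<forall>\<^sub>F n in sequentially. \<bar>gp (v n) x - bp z x\<bar> \<le> 2 * \<delta>"
  using assms(1)
proof (cases rule: Z_cases)
  case (1 y)
  then show ?thesis using assms(2) delta_pos by (simp add: representatives_def)
next
  case 2
  then obtain \<xi> where "z = Inr \<xi>" by (auto elim: BdE)
  then show ?thesis using bp_approx_Bd[of \<xi> v] 2 assms(2) by (simp add: representatives_def)
qed

lemma bp_deep:
  assumes "Inr \<xi> \<in> Bd" "u \<in> \<xi>" shows "\<exists>N. \<forall>m\<ge>N. R \<le> bp (Inr \<xi>) (u m)"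
proof -
  obtain N where N: "\<And>m n. m \<ge> N \<Longrightarrow> n \<ge> N \<Longrightarrow> R + 2 * \<delta> \<le> gp (u m) (u n)"
    using Bd_reps_equiv[OF assms assms(2)] unfolding gromov_equiv_iff by blast
  have "R \<le> bp (Inr \<xi>) (u m)" if "m \<ge> N" for m
  proof -
    have "\<forall>\<^sub>F n in sequentially. n \<ge> N" by simp
    then have "\<forall>\<^sub>F n in sequentially. R \<le> bp (Inr \<xi>) (u m)"
      using bp_approx_Bd[OF assms, of "u m"]
      by eventually_elim (use N[of _ m] that in \<open>fastforce\<close>)
    then show ?thesis by simp
  qed
  then show ?thesis by blast
qed

lemma bp_deep_ex: "\<xi> \<in> Bd \<Longrightarrow> \<exists>x. R \<le> bp \<xi> x"
  using bp_deep by (metis BdE order_refl)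

text \<open>For \<open>r\<close> close to \<open>nrm x\<close> this is the shadow of a ball around
  \<open>x\<close> seen from \<open>p\<close>, together with the region of the space behind it.
  Parametrising by points of the space gives neighbourhoods that can be compared through
  \<open>bp\<close>.\<close>

definition Sh :: "'a \<Rightarrow> real \<Rightarrow> 'a bordification set" where
  "Sh x r = {z \<in> Z. r \<le> bp z x}"

lemma Sh_mono: "r \<le> s \<Longrightarrow> Sh x s \<subseteq> Sh x r"
  by (auto simp: Sh_def)

lemma ext_greaterD:
  assumes "ereal r < ext_gromov_product p (Inr \<xi>) z"
  obtains u v N where "u \<in> \<xi>" "v \<in> representatives z"
    "\<And>m n. m \<ge> N \<Longrightarrow> n \<ge> N \<Longrightarrow> r < gp (u m) (v n)"
proof -
  obtain u v where uv: "u \<in> \<xi>" "v \<in> representatives z" and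
    "ereal r < Liminf (sequentially \<times>\<^sub>F sequentially) (\<lambda>(m, n). ereal (gp (u m) (v n)))"
    using assms unfolding ext_gromov_product_def less_SUP_iff
    by (auto simp: representatives_def)
  then have "\<forall>\<^sub>F x in sequentially \<times>\<^sub>F sequentially. ereal r < (case x of (m, n) \<Rightarrow> ereal (gp (u m) (v n)))"
    by (intro less_LiminfD)
  then obtain N where "\<forall>n\<ge>N. \<forall>m\<ge>N. r < gp (u n) (v m)"
    unfolding eventually_prod_sequentially by auto
  with uv show thesis by (intro that[of u v N]) auto
qed

lemma ext_greaterI:
  assumes "u \<in> \<xi>" "v \<in> representatives z"
    "\<And>m n. m \<ge> N \<Longrightarrow> n \<ge> N \<Longrightarrow> s \<le> gp (u m) (v n)" "r < s"
  shows "ereal r < ext_gromov_product p (Inr \<xi>) z"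
proof -
  have "\<forall>\<^sub>F x in sequentially \<times>\<^sub>F sequentially. ereal s \<le> (case x of (m, n) \<Rightarrow> ereal (gp (u m) (v n)))"
    unfolding eventually_prod_sequentially using assms(3) by auto
  then have "ereal s \<le> Liminf (sequentially \<times>\<^sub>F sequentially) (\<lambda>(m, n). ereal (gp (u m) (v n)))"
    by (intro Liminf_bounded)
  also have "\<dots> \<le> ext_gromov_product p (Inr \<xi>) z"
    unfolding ext_gromov_product_def using assms(1,2)
    by (intro SUP_upper2[of u] SUP_upper2[of v]) (auto simp: representatives_def)
  finally show ?thesis using assms(4) by (meson ereal_less(2) less_ereal.simps(1) less_le_trans)
qed

text \<open>A point \<open>x\<close> deep in the direction of \<xi> can replace \<xi> in the Gromov
  product, because below the depth of \<open>x\<close> the two products with a third point agree up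
  to multiples of \<delta>. The margin \<open>20 * \<delta>\<close> absorbs these errors in both
  directions.\<close>

lemma open_char:
  "openin T U \<longleftrightarrow> U \<subseteq> Z \<and> open (Inl -` U) \<and>
     (\<forall>\<xi>\<in>U \<inter> Bd. \<exists>x r. r + 20 * \<delta> \<le> bp \<xi> x \<and> Sh x r \<subseteq> U)"
proof -
  have "(\<exists>r. {z \<in> Z. ereal r < ext_gromov_product p \<xi> z} \<subseteq> U) \<longleftrightarrow>
      (\<exists>x r. r + 20 * \<delta> \<le> bp \<xi> x \<and> Sh x r \<subseteq> U)" if bd: "\<xi> \<in> Bd" for \<xi>
  proof
    assume "\<exists>r. {z \<in> Z. ereal r < ext_gromov_product p \<xi> z} \<subseteq> U"
    then obtain r where r: "{z \<in> Z. ereal r < ext_gromov_product p \<xi> z} \<subseteq> U" by blast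
    obtain x where x: "r + 30 * \<delta> \<le> bp \<xi> x" using bp_deep_ex[OF bd] by blast
    obtain \<zeta> u where z: "\<xi> = Inr \<zeta>" "u \<in> \<zeta>" using bd by (auto elim: BdE)
    obtain N where N: "\<And>m. m \<ge> N \<Longrightarrow> \<bar>gp (u m) x - bp \<xi> x\<bar> \<le> 2 * \<delta>"
      using bp_approx_Bd[of \<zeta> u x] bd z unfolding eventually_sequentially by blast
    have "Sh x (r + 10 * \<delta>) \<subseteq> {z \<in> Z. ereal r < ext_gromov_product p \<xi> z}"
    proof
      fix w assume w: "w \<in> Sh x (r + 10 * \<delta>)"
      then have wZ: "w \<in> Z" and wx: "r + 10 * \<delta> \<le> bp w x" by (auto simp: Sh_def)
      obtain v where v: "v \<in> representatives w"
        "\<And>x. \<forall>\<^sub>F n in sequentially. \<bar>gp (v n) x - bp w x\<bar> \<le> 2 * \<delta>"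
        using bp_approx[OF wZ] by metis
      obtain M where M: "\<And>m. m \<ge> M \<Longrightarrow> \<bar>gp (v m) x - bp w x\<bar> \<le> 2 * \<delta>"
        using v(2)[of x] unfolding eventually_sequentially by blast
      have "r + 7 * \<delta> \<le> gp (u m) (v n)" if "m \<ge> max N M" "n \<ge> max N M" for m n
        using N[of m] M[of n] that wx x delta_pos gp_sym[of x "v n"]
          gp_hyp[of "r + 8 * \<delta>" "u m" x "v n"] by force
      then have "ereal r < ext_gromov_product p \<xi> w"
        unfolding z(1) using z(2) v(1) delta_pos by (intro ext_greaterI[of u \<zeta> v w "max N M" "r + 7 * \<delta>"]) auto
      then show "w \<in> {z \<in> Z. ereal r < ext_gromov_product p \<xi> z}" using wZ by blast
    qed
    then show "\<exists>x r. r + 20 * \<delta> \<le> bp \<xi> x \<and> Sh x r \<subseteq> U"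
      using r x by (intro exI[of _ x] exI[of _ "r + 10 * \<delta>"]) auto
  next
    assume "\<exists>x r. r + 20 * \<delta> \<le> bp \<xi> x \<and> Sh x r \<subseteq> U"
    then obtain x r where xr: "r + 20 * \<delta> \<le> bp \<xi> x" "Sh x r \<subseteq> U" by blast
    obtain \<zeta> where z: "\<xi> = Inr \<zeta>" using bd by (auto elim: BdE)
    \<comment> \<open>Level \<open>nrm x\<close> is enough: points whose mutual product exceeds it
      have the same product with \<open>x\<close> up to \<delta>, so \<open>w\<close> inherits the
      large product of \<xi> with \<open>x\<close>.\<close>
    have "{z \<in> Z. ereal (nrm x) < ext_gromov_product p \<xi> z} \<subseteq> Sh x r"
    proof
      fix w assume w: "w \<in> {z \<in> Z. ereal (nrm x) < ext_gromov_product p \<xi> z}"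
      then obtain u v N where uv: "u \<in> \<zeta>" "v \<in> representatives w"
        "\<And>m n. m \<ge> N \<Longrightarrow> n \<ge> N \<Longrightarrow> nrm x < gp (u m) (v n)"
        using ext_greaterD[of "nrm x" \<zeta> w] unfolding z by (metis (no_types, lifting) mem_Collect_eq)
      have wZ: "w \<in> Z" using w by blast
      obtain M where M: "\<And>m. m \<ge> M \<Longrightarrow> \<bar>gp (u m) x - bp \<xi> x\<bar> \<le> 2 * \<delta>"
        using bp_approx_Bd[of \<zeta> u x] bd z uv(1) unfolding eventually_sequentially by blast
      obtain L where L: "\<And>m. m \<ge> L \<Longrightarrow> \<bar>gp (v m) x - bp w x\<bar> \<le> 2 * \<delta>"
        using bp_approx_any[OF wZ uv(2)] unfolding eventually_sequentially by blast
      define n where "n = max N (max M L)"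
      have "nrm x \<le> gp (v n) (u n)" using uv(3)[of n n] gp_sym[of "u n"] by (simp add: n_def)
      moreover have "\<bar>gp (u n) x - bp \<xi> x\<bar> \<le> 2 * \<delta>" "\<bar>gp (v n) x - bp w x\<bar> \<le> 2 * \<delta>"
        using M[of n] L[of n] by (simp_all add: n_def)
      ultimately have "r \<le> bp w x"
        using gp_hyp[of "r + 18 * \<delta>" "v n" "u n" x] gp_le(2)[of "u n" x] xr(1) delta_pos by linarith
      then show "w \<in> Sh x r" using wZ by (simp add: Sh_def)
    qed
    then show "\<exists>r. {z \<in> Z. ereal r < ext_gromov_product p \<xi> z} \<subseteq> U" using xr(2) by blast
  qed
  then show ?thesis unfolding openin_gromov_topology gromov_open_def by blast
qed

lemma topspace_T [simp]: "topspace T = Z"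
  by (rule topspace_gromov_topology)

text \<open>The threshold \<open>nrm x0 + 2 * \<delta>\<close> dominates every value
  \<open>bp z x0\<close>, so a shadow around \<xi> at this depth cannot leave the given basic
  neighbourhood. One \<open>r\<close> works for all \<open>x\<close>, which later yields estimates
  uniform over compact sets.\<close>

lemma open_shadow:
  assumes "openin T U" "\<xi> \<in> U" "\<xi> \<in> Bd"
  shows "\<exists>r. \<forall>x. r \<le> bp \<xi> x \<longrightarrow> Sh x r \<subseteq> U"
proof -
  obtain x0 r0 where x0: "r0 + 20 * \<delta> \<le> bp \<xi> x0" "Sh x0 r0 \<subseteq> U"
    using assms open_char[of U] by blast
  have xZ: "\<xi> \<in> Z" using assms(3) by (rule Bd_in_Z)
  have "Sh x (nrm x0 + 2 * \<delta>) \<subseteq> Sh x0 r0" if "nrm x0 + 2 * \<delta> \<le> bp \<xi> x" for x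
  proof
    fix z assume "z \<in> Sh x (nrm x0 + 2 * \<delta>)"
    then have z: "z \<in> Z" "nrm x0 + 2 * \<delta> \<le> bp z x" by (auto simp: Sh_def)
    have "bp \<xi> x0 - 3 * \<delta> \<le> gp x x0"
      using gp_bp_hyp[OF xZ, of "bp \<xi> x0" x x0] that bp_bounds(2)[OF xZ, of x0] by linarith
    then have "bp \<xi> x0 - 3 * \<delta> - 5 * \<delta> \<le> bp z x0"
      using bp_hyp[OF z(1), of "bp \<xi> x0 - 3 * \<delta>" x x0] z(2) bp_bounds(2)[OF xZ, of x0] delta_pos by linarith
    then show "z \<in> Sh x0 r0" using z(1) x0(1) delta_pos by (simp add: Sh_def)
  qed
  then show ?thesis using x0(2) by blast
qed

lemma openin_Inl: "open A \<Longrightarrow> openin T (Inl ` A)"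
  by (auto simp: open_char vimage_def inj_image_mem_iff)

lemma open_gp: "open {y. r < gp y x}" "open {y. gp y x < r}"
  unfolding gromov_product_def by (intro open_Collect_less continuous_intros; simp)+

text \<open>As \<open>bp\<close> may jump by multiples of \<delta>, shadows need be neither open nor
  closed. Together with \<open>Sh_closure\<close> this bounds the defect: a change of level by
  \<open>30 * \<delta>\<close> passes to the interior or absorbs the closure.\<close>

lemma Sh_interior:
  assumes "z \<in> Z" "r + 30 * \<delta> < bp z x"
  shows "z \<in> T interior_of Sh x r"
proof -
  define good where "good \<xi> x' r' \<longleftrightarrow> r' + 20 * \<delta> \<le> bp \<xi> x' \<and> (\<forall>y. r' \<le> gp y x' \<longrightarrow> r + 2 * \<delta> < gp y x)"
    for \<xi> x' r'
  define W where "W = Inl ` {y. r + 2 * \<delta> < gp y x} \<union> {\<xi> \<in> Bd. \<exists>x' r'. good \<xi> x' r'}"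
  have "openin T W"
    unfolding open_char
  proof (intro conjI ballI)
    show "W \<subseteq> Z" by (auto simp: W_def Bd_in_Z)
    have "Inl -` W = {y. r + 2 * \<delta> < gp y x}" by (auto simp: W_def)
    then show "open (Inl -` W)" by (simp add: open_gp)
    fix \<xi> assume "\<xi> \<in> W \<inter> Bd"
    then obtain x' r' where bd: "\<xi> \<in> Bd" and g: "good \<xi> x' r'" by (auto simp: W_def)
    have xZ: "\<xi> \<in> Z" using bd by (rule Bd_in_Z)
    define s where "s = nrm x' + 10 * \<delta>"
    obtain x2 where x2: "s + 20 * \<delta> \<le> bp \<xi> x2" using bp_deep_ex[OF bd] by blast
    have le: "bp \<xi> x' \<le> nrm x' + 2 * \<delta>" using bp_bounds(2)[OF xZ] .
    have c2: "bp \<xi> x' - 3 * \<delta> \<le> gp x2 x'"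
      using gp_bp_hyp[OF xZ, of "bp \<xi> x'" x2 x'] x2 le delta_pos unfolding s_def by linarith
    have key: "r + 2 * \<delta> < gp y x" if y: "s - 4 * \<delta> \<le> gp y x2" for y
    proof -
      have "bp \<xi> x' - 4 * \<delta> \<le> gp y x'"
        using gp_hyp[of "bp \<xi> x' - 3 * \<delta>" y x2 x'] c2 y le delta_pos unfolding s_def by linarith
      then show ?thesis using g delta_pos unfolding good_def by (smt (verit))
    qed
    have "Sh x2 s \<subseteq> W"
    proof
      fix \<eta> assume "\<eta> \<in> Sh x2 s"
      then have e: "\<eta> \<in> Z" "s \<le> bp \<eta> x2" by (auto simp: Sh_def)
      from e(1) show "\<eta> \<in> W"
      proof (cases rule: Z_cases)
        case (1 y)
        then show ?thesis using key[of y] e(2) delta_pos by (auto simp: W_def)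
      next
        case 2
        obtain x3 where x3: "nrm x2 + 10 * \<delta> + 20 * \<delta> \<le> bp \<eta> x3" using bp_deep_ex[OF 2] by blast
        have le2: "bp \<eta> x2 \<le> nrm x2 + 2 * \<delta>" using bp_bounds(2)[OF e(1)] .
        have c3: "s - 3 * \<delta> \<le> gp x3 x2"
          using gp_bp_hyp[OF e(1), of s x3 x2] x3 e(2) le2 delta_pos by linarith
        have "s - 4 * \<delta> \<le> gp y x2" if "nrm x2 + 10 * \<delta> \<le> gp y x3" for y
          using gp_hyp[of "s - 3 * \<delta>" y x3 x2] c3 that le2 e(2) delta_pos by linarith
        then have "good \<eta> x3 (nrm x2 + 10 * \<delta>)" using x3 key unfolding good_def by blast
        then show ?thesis using 2 by (auto simp: W_def)
      qed
    qed
    then show "\<exists>x r. r + 20 * \<delta> \<le> bp \<xi> x \<and> Sh x r \<subseteq> W" using x2 by blast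
  qed
  moreover have "W \<subseteq> Sh x r"
  proof
    fix \<xi> assume "\<xi> \<in> W"
    then consider y where "\<xi> = Inl y" "r + 2 * \<delta> < gp y x" | x' r' where "\<xi> \<in> Bd" "good \<xi> x' r'"
      by (auto simp: W_def)
    then show "\<xi> \<in> Sh x r"
    proof cases
      case 1
      then show ?thesis using delta_pos by (simp add: Sh_def)
    next
      case 2
      have xZ: "\<xi> \<in> Z" using 2(1) by (rule Bd_in_Z)
      obtain u where u: "\<And>x. \<forall>\<^sub>F n in sequentially. \<bar>gp (u n) x - bp \<xi> x\<bar> \<le> 2 * \<delta>"
        using bp_approx[OF xZ] by metis
      have "\<forall>\<^sub>F n in sequentially. r \<le> bp \<xi> x"
        using u[of x] u[of x']
      proof eventually_elim
        case (elim n)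
        have "r' \<le> gp (u n) x'" using elim(2) 2(2) delta_pos unfolding good_def by linarith
        then have "r + 2 * \<delta> < gp (u n) x" using 2(2) unfolding good_def by blast
        then show ?case using elim(1) by linarith
      qed
      then show ?thesis using xZ by (simp add: Sh_def)
    qed
  qed
  moreover have "z \<in> W"
    using assms(1)
  proof (cases rule: Z_cases)
    case (1 y)
    then show ?thesis using assms(2) delta_pos by (simp add: W_def)
  next
    case 2
    have "good z x (bp z x - 20 * \<delta>)" using assms(2) delta_pos unfolding good_def by auto
    then show ?thesis using 2 by (auto simp: W_def)
  qed
  ultimately show ?thesis unfolding interior_of_def by blast
qed

lemma Sh_closure: "T closure_of Sh x r \<subseteq> Sh x (r - 30 * \<delta>)"
proof
  fix z assume z: "z \<in> T closure_of Sh x r"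
  then have zZ: "z \<in> Z" by (simp add: in_closure_of)
  show "z \<in> Sh x (r - 30 * \<delta>)"
  proof (rule ccontr)
    assume "z \<notin> Sh x (r - 30 * \<delta>)"
    then have lt: "bp z x < r - 30 * \<delta>" using zZ by (auto simp: Sh_def)
    from zZ have "\<exists>V. openin T V \<and> z \<in> V \<and> V \<inter> Sh x r = {}"
    proof (cases rule: Z_cases)
      case (1 y)
      have "Inl ` {y. gp y x < r} \<inter> Sh x r = {}" by (auto simp: Sh_def)
      then show ?thesis using openin_Inl[OF open_gp(2)[of x r]] 1 lt delta_pos by (metis bp_Inl imageI less_trans mem_Collect_eq mult_pos_pos diff_less_eq less_add_same_cancel1 zero_less_numeral)
    next
      case 2
      \<comment> \<open>Since \<open>s\<close> exceeds \<open>nrm x\<close>, all points of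
        \<open>Sh w s\<close> have nearly the same product with \<open>x\<close> as
        \<open>z\<close>; a common point with \<open>Sh x r\<close> would force
        \<open>bp z x\<close> to be at least \<open>r - 8 * \<delta>\<close>.\<close>
      define s where "s = nrm x + 10 * \<delta>"
      obtain w where w: "s + 31 * \<delta> \<le> bp z w" using bp_deep_ex[OF 2] by blast
      have "z \<in> T interior_of Sh w s" using Sh_interior[OF zZ, of s w] w delta_pos by linarith
      moreover have "Sh w s \<inter> Sh x r = {}"
      proof (rule ccontr)
        assume "Sh w s \<inter> Sh x r \<noteq> {}"
        then obtain v where v: "v \<in> Z" "s \<le> bp v w" "r \<le> bp v x" by (auto simp: Sh_def)
        have "r \<le> nrm x + 2 * \<delta>" using v(3) bp_bounds(2)[OF v(1), of x] by linarith
        then have "r - 3 * \<delta> \<le> gp w x"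
          using gp_bp_hyp[OF v(1), of r w x] v delta_pos unfolding s_def by linarith
        then have "r - 3 * \<delta> - 5 * \<delta> \<le> bp z x"
          using bp_hyp[OF zZ, of "r - 3 * \<delta>" w x] w \<open>r \<le> nrm x + 2 * \<delta>\<close> delta_pos unfolding s_def by linarith
        then show False using lt delta_pos by linarith
      qed
      ultimately show ?thesis
        using interior_of_subset[of T "Sh w s"] openin_interior_of[of T "Sh w s"] by blast
    qed
    then show False using z unfolding in_closure_of by blast
  qed
qed

subsection \<open>Compactness\<close>

text \<open>A geodesic from \<open>p\<close> to a point beyond distance \<open>n\<close> crosses the
  sphere of radius \<open>n\<close>, which lies in a compact ball and has a finite net of mesh 1.
  The mesh costs the 1; for boundary points the passage to a sequence costs
  \<open>2 * \<delta>\<close>.\<close>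

lemma finite_net:
  "\<exists>Y. finite Y \<and> (\<forall>z\<in>Z. (\<exists>x. z = Inl x \<and> nrm x \<le> real n) \<or> (\<exists>y\<in>Y. real n - 1 - 2 * \<delta> \<le> bp z y))"
proof -
  have "compact (cball p (real n))" by (rule proper)
  then obtain Y where Y: "finite Y" "cball p (real n) \<subseteq> (\<Union>y\<in>Y. ball y 1)"
    unfolding compact_eq_totally_bounded by (meson zero_less_one)
  have X: "\<exists>y\<in>Y. real n - 1 \<le> gp x y" if x: "real n < nrm x" for x
  proof -
    obtain c L where c: "geodesic c L" "c 0 = p" "c L = x" using geod by blast
    have L0: "0 \<le> L" using c(1) by (simp add: geodesic_def)
    have g: "dist (c s) (c t) = \<bar>s - t\<bar>" if "s \<in> {0..L}" "t \<in> {0..L}" for s t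
      using c(1) that by (simp add: geodesic_def)
    have L: "L = nrm x" using g[of 0 L] c(2,3) L0 by simp
    have d: "dist p (c (real n)) = real n" "dist (c (real n)) x = nrm x - real n"
      using g[of 0 "real n"] g[of "real n" L] c(2,3) L0 L x by simp_all
    have "c (real n) \<in> cball p (real n)" using d(1) by simp
    then have "c (real n) \<in> (\<Union>y\<in>Y. ball y 1)" using Y(2) by (rule rev_subsetD)
    then obtain y where y: "y \<in> Y" "dist y (c (real n)) < 1" unfolding UN_iff mem_ball by blast
    have "gp x (c (real n)) = real n" using d by (simp add: gromov_product_def dist_commute field_simps)
    then have "real n - 1 \<le> gp x y"
      using gp_lipschitz[of x "c (real n)" y] y(2) by (simp add: dist_commute)
    then show ?thesis using y(1) by blast
  qed
  have "(\<exists>x. z = Inl x \<and> nrm x \<le> real n) \<or> (\<exists>y\<in>Y. real n - 1 - 2 * \<delta> \<le> bp z y)" if "z \<in> Z" for z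
    using that
  proof (cases rule: Z_cases)
    case (1 x)
    then show ?thesis using X[of x] delta_pos by (cases "nrm x \<le> real n") force+
  next
    case 2
    then obtain \<xi> u where u: "z = Inr \<xi>" "u \<in> \<xi>" by (auto elim: BdE)
    obtain N where N: "\<And>m k. m \<ge> N \<Longrightarrow> k \<ge> N \<Longrightarrow> real n + 1 \<le> gp (u m) (u k)"
      using Bd_reps_equiv[of \<xi> u u] u 2 unfolding gromov_equiv_iff by blast
    have "\<exists>y\<in>Y. real n - 1 \<le> gp (u m) y" if "m \<ge> N" for m
      using X[of "u m"] N[OF that that] by simp
    then obtain y where y: "\<And>m. m \<ge> N \<Longrightarrow> y m \<in> Y \<and> real n - 1 \<le> gp (u m) (y m)" by metis
    have "\<forall>\<^sub>F m in sequentially. \<forall>a\<in>Y. \<bar>gp (u m) a - bp z a\<bar> \<le> 2 * \<delta>"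
      using Y(1) bp_approx_Bd[of \<xi> u] u 2 by (simp add: eventually_ball_finite)
    then have "\<forall>\<^sub>F m in sequentially. \<exists>y\<in>Y. real n - 1 - 2 * \<delta> \<le> bp z y"
      using eventually_ge_at_top[of N]
    proof eventually_elim
      case (elim m)
      then show ?case using y[of m] by (intro bexI[of _ "y m"]) fastforce+
    qed
    then show ?thesis by simp
  qed
  then show ?thesis using Y(1) by blast
qed

text \<open>If no finite subfamily covers, the finite nets produce nested sets that still have no
  finite cover, lying in ever deeper shadows of net points \<open>y n\<close>. These points converge
  to a boundary point, and the member of the cover containing it swallows one of the nested
  sets.\<close>

lemma compact_T: "compact_space T"
  unfolding compact_space_alt
proof (intro allI impI, elim conjE)
  fix \<U> assume op: "\<forall>U\<in>\<U>. openin T U" and "topspace T \<subseteq> \<Union> \<U>"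
  then have cov: "Z \<subseteq> \<Union>\<U>" by simp
  define fin where "fin A \<longleftrightarrow> (\<exists>\<F>. finite \<F> \<and> \<F> \<subseteq> \<U> \<and> A \<subseteq> \<Union>\<F>)" for A
  have fin_Un: "fin (\<Union>\<A>)" if fA: "finite \<A>" "\<And>A. A \<in> \<A> \<Longrightarrow> fin A" for \<A>
    using that
  proof (induction \<A>)
    case empty
    show ?case by (auto simp: fin_def)
  next
    case (insert A \<A>)
    then obtain F G where "finite F" "F \<subseteq> \<U>" "A \<subseteq> \<Union>F" "finite G" "G \<subseteq> \<U>" "\<Union>\<A> \<subseteq> \<Union>G"
      unfolding fin_def by (metis insertCI)
    then show ?case unfolding fin_def by (intro exI[of _ "F \<union> G"]) auto
  qed
  have fin_sub: "fin B \<Longrightarrow> A \<subseteq> B \<Longrightarrow> fin A" for A B unfolding fin_def by (meson order_trans)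
  have fin_ball: "fin (Inl ` cball p r)" for r
  proof -
    have "compact (cball p r)" by (rule proper)
    moreover have "\<forall>U\<in>\<U>. open (Inl -` U)" using op open_char by blast
    moreover have "cball p r \<subseteq> (\<Union>U\<in>\<U>. Inl -` U)" using cov Inl_in_Z by blast
    ultimately obtain \<F> where "\<F> \<subseteq> \<U>" "finite \<F>" "cball p r \<subseteq> (\<Union>U\<in>\<F>. Inl -` U)"
      by (meson compactE_image)
    then show ?thesis unfolding fin_def by (intro exI[of _ \<F>]) auto
  qed
  define e where "e n = real n - 1 - 2 * \<delta>" for n
  have step: "\<exists>y. \<not> fin (A \<inter> Sh y (e n))" if A: "\<not> fin A" "A \<subseteq> Z" for A n
  proof (rule ccontr)
    assume c: "\<not> ?thesis"
    obtain Y where Y: "finite Y" "\<And>z. z \<in> Z \<Longrightarrow> (\<exists>x. z = Inl x \<and> nrm x \<le> real n) \<or> (\<exists>y\<in>Y. e n \<le> bp z y)"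
      unfolding e_def using finite_net[of n] by metis
    have "fin (\<Union>(insert (Inl ` cball p (real n)) ((\<lambda>y. A \<inter> Sh y (e n)) ` Y)))"
      using Y(1) c fin_ball by (intro fin_Un) auto
    moreover have "A \<subseteq> \<Union>(insert (Inl ` cball p (real n)) ((\<lambda>y. A \<inter> Sh y (e n)) ` Y))"
    proof
      fix z assume z: "z \<in> A"
      show "z \<in> \<Union>(insert (Inl ` cball p (real n)) ((\<lambda>y. A \<inter> Sh y (e n)) ` Y))"
        using Y(2)[of z] z A(2) by (fastforce simp: Sh_def)
    qed
    ultimately show False using A(1) fin_sub by blast
  qed
  show "\<exists>\<F>. finite \<F> \<and> \<F> \<subseteq> \<U> \<and> topspace T \<subseteq> \<Union>\<F>"
  proof (rule ccontr)
    assume "\<not> ?thesis"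
    then have nZ: "\<not> fin Z" by (simp add: fin_def)
    have "\<exists>s. \<forall>n. (\<not> fin (fst (s n)) \<and> fst (s n) \<subseteq> Z) \<and> fst (s (Suc n)) = fst (s n) \<inter> Sh (snd (s (Suc n))) (e n)"
    proof (rule dependent_nat_choice)
      show "\<exists>x :: 'a bordification set \<times> 'a. \<not> fin (fst x) \<and> fst x \<subseteq> Z" using nZ by (intro exI[of _ "(Z, p)"]) auto
      fix x :: "'a bordification set \<times> 'a" and n :: nat
      assume x: "\<not> fin (fst x) \<and> fst x \<subseteq> Z"
      obtain y where "\<not> fin (fst x \<inter> Sh y (e n))" using step[of "fst x" n] x by blast
      then show "\<exists>y. (\<not> fin (fst y) \<and> fst y \<subseteq> Z) \<and> fst y = fst x \<inter> Sh (snd y) (e n)"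
        using x by (intro exI[of _ "(fst x \<inter> Sh y (e n), y)"]) auto
    qed
    then obtain s where s0: "\<forall>n. (\<not> fin (fst (s n)) \<and> fst (s n) \<subseteq> Z) \<and> fst (s (Suc n)) = fst (s n) \<inter> Sh (snd (s (Suc n))) (e n)" ..
    have s: "\<not> fin (fst (s n))" "fst (s n) \<subseteq> Z"
      "fst (s (Suc n)) = fst (s n) \<inter> Sh (snd (s (Suc n))) (e n)" for n using s0 by blast+
    define A where "A n = fst (s (Suc n))" for n
    define y where "y n = snd (s (Suc n))" for n
    have Asub: "A n \<subseteq> Sh (y n) (e n)" for n using s(3)[of n] by (auto simp: A_def y_def)
    have "A (Suc n) \<subseteq> A n" for n using s(3)[of "Suc n"] by (auto simp: A_def)
    then have Adec: "A m \<subseteq> A n" if "n \<le> m" for m n using lift_Suc_antimono_le[of A n m] that by blast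
    have Ane: "A n \<noteq> {}" for n using s(1)[of "Suc n"] unfolding A_def fin_def by (metis empty_subsetI finite.emptyI)
    \<comment> \<open>A nested set that has no finite cover is nonempty, so the shadows of
      \<open>y m\<close> and \<open>y n\<close> have a common point; this makes \<open>y\<close> a
      Gromov sequence.\<close>
    have yy: "real (min m n) - 1 - 5 * \<delta> \<le> gp (y m) (y n)" for m n
    proof -
      obtain z where z: "z \<in> A (max m n)" using Ane by blast
      then have "z \<in> Sh (y m) (e m)" "z \<in> Sh (y n) (e n)"
        using Adec[of m "max m n"] Adec[of n "max m n"] Asub by auto
      then show ?thesis using gp_bp_hyp[of z "real (min m n) - 1 - 2 * \<delta>" "y m" "y n"]
        by (auto simp: Sh_def e_def)
    qed
    have "y \<in> gromov_sequences p"
      unfolding gromov_sequences_def mem_Collect_eq gromov_equiv_iff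
    proof
      fix r :: real
      obtain N :: nat where N: "r + 1 + 5 * \<delta> \<le> real N" using real_arch_simple by blast
      have "r \<le> gp (y m) (y n)" if "m \<ge> N" "n \<ge> N" for m n
        using yy[of m n] N that by (simp add: min_def split: if_splits)
      then show "\<exists>N. \<forall>m\<ge>N. \<forall>n\<ge>N. r \<le> gp (y m) (y n)" by blast
    qed
    then have bd: "Inr (gsrel `` {y}) \<in> Bd" and yin: "y \<in> gsrel `` {y}"
      using BdI equiv_class_self[OF equiv_gsrel] by auto
    obtain U where U: "U \<in> \<U>" "Inr (gsrel `` {y}) \<in> U" using cov bd Bd_in_Z by blast
    obtain r where r: "\<And>x. r \<le> bp (Inr (gsrel `` {y})) x \<Longrightarrow> Sh x r \<subseteq> U"
      using open_shadow[OF _ U(2) bd] op U(1) by blast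
    obtain N where N: "\<And>m. m \<ge> N \<Longrightarrow> r \<le> bp (Inr (gsrel `` {y})) (y m)"
      using bp_deep[OF bd yin] by blast
    obtain M :: nat where M: "r + 1 + 2 * \<delta> \<le> real M" using real_arch_simple by blast
    define n where "n = max N M"
    have "A n \<subseteq> Sh (y n) (e n)" by (rule Asub)
    also have "\<dots> \<subseteq> Sh (y n) r" using M by (intro Sh_mono) (simp add: e_def n_def)
    also have "\<dots> \<subseteq> U" using r N[of n] by (simp add: n_def)
    finally have "fin (A n)" unfolding fin_def using U(1) by (intro exI[of _ "{U}"]) auto
    then show False using s(1)[of "Suc n"] by (simp add: A_def)
  qed
qed

lemma Hausdorff_T: "Hausdorff_space T"
proof -
  have sep: "\<exists>U V. openin T U \<and> openin T V \<and> x \<in> U \<and> y \<in> V \<and> disjnt U V"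
    if x: "x \<in> Bd" and y: "y \<in> Z" and "x \<noteq> y" for x y
    using y
  proof (cases rule: Z_cases)
    case (1 a)
    obtain w where w: "nrm a + 1 + 31 * \<delta> \<le> bp x w" using bp_deep_ex[OF x] by blast
    have "x \<in> T interior_of Sh w (nrm a + 1)"
      using Sh_interior[OF Bd_in_Z[OF x]] w delta_pos by force
    moreover have "Inl ` ball p (nrm a + 1) \<inter> Sh w (nrm a + 1) = {}"
    proof -
      have False if "dist p b < nrm a + 1" "nrm a + 1 \<le> gp b w" for b
        using gp_le(1)[of b w] that by linarith
      then show ?thesis by (auto simp: Sh_def)
    qed
    then have "disjnt (T interior_of Sh w (nrm a + 1)) (Inl ` ball p (nrm a + 1))"
      using interior_of_subset[of T "Sh w (nrm a + 1)"] by (auto simp: disjnt_def)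
    ultimately show ?thesis
      using 1 openin_Inl[OF open_ball[of p "nrm a + 1"]] openin_interior_of[of T "Sh w (nrm a + 1)"]
      by (metis centre_in_ball imageI less_add_same_cancel1 mem_ball zero_less_one)
  next
    case 2
    obtain \<xi> u where u: "x = Inr \<xi>" "u \<in> \<xi>" using x by (auto elim: BdE)
    obtain \<eta> v where v: "y = Inr \<eta>" "v \<in> \<eta>" using 2 by (auto elim: BdE)
    have "\<not> gromov_equiv p u v" using Bd_eqI[of \<xi> \<eta> u v] u v x 2 \<open>x \<noteq> y\<close> by auto
    then obtain r where r: "\<And>N. \<exists>m\<ge>N. \<exists>n\<ge>N. gp (u m) (v n) < r"
      unfolding gromov_equiv_iff by (meson not_le)
    define s where "s = r + 3 * \<delta>"
    obtain N where N: "\<And>m. m \<ge> N \<Longrightarrow> s + 31 * \<delta> \<le> bp x (u m)"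
      using bp_deep[of \<xi> u] u x by metis
    obtain M where M: "\<And>m. m \<ge> M \<Longrightarrow> s + 31 * \<delta> \<le> bp y (v m)"
      using bp_deep[of \<eta> v] v 2 by metis
    obtain m n where mn: "m \<ge> max N M" "n \<ge> max N M" "gp (u m) (v n) < r" using r by blast
    have "x \<in> T interior_of Sh (u m) s" "y \<in> T interior_of Sh (v n) s"
      using Sh_interior[OF Bd_in_Z[OF x], of s "u m"] Sh_interior[OF Bd_in_Z[OF 2], of s "v n"] N[of m] M[of n] mn delta_pos
      by force+
    moreover have "Sh (u m) s \<inter> Sh (v n) s = {}"
      using gp_bp_hyp[of _ s "u m" "v n"] mn(3) by (force simp: Sh_def s_def)
    then have "disjnt (T interior_of Sh (u m) s) (T interior_of Sh (v n) s)"
      using interior_of_subset[of T "Sh (u m) s"] interior_of_subset[of T "Sh (v n) s"]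
      by (auto simp: disjnt_def)
    ultimately show ?thesis using openin_interior_of by blast
  qed
  show ?thesis
    unfolding Hausdorff_space_def topspace_T
  proof (intro allI impI)
    fix x y assume a: "x \<in> Z \<and> y \<in> Z \<and> x \<noteq> y"
    consider "x \<in> Bd" | "y \<in> Bd" | a b where "x = Inl a" "y = Inl b"
      using a by (auto elim!: Z_cases)
    then show "\<exists>U V. openin T U \<and> openin T V \<and> x \<in> U \<and> y \<in> V \<and> disjnt U V"
    proof cases
      case 1
      then show ?thesis using sep[of x y] a by blast
    next
      case 2
      then show ?thesis using sep[of y x] a disjnt_sym by metis
    next
      case 3
      then obtain U V where "open U" "open V" "a \<in> U" "b \<in> V" "U \<inter> V = {}"
        using a separation_t2[of a b] by auto
      then show ?thesis using 3 openin_Inl[of U] openin_Inl[of V]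
        by (intro exI[of _ "Inl ` U"] exI[of _ "Inl ` V"]) (auto simp: disjnt_def)
    qed
  qed
qed

section \<open>Separating functions and exhaustion of open sets\<close>

definition testfun :: "('a bordification \<Rightarrow> real) \<Rightarrow> bool" where
  "testfun \<phi> \<longleftrightarrow> continuous_map T euclideanreal \<phi> \<and> (\<forall>z\<in>Z. 0 \<le> \<phi> z \<and> \<phi> z \<le> 1)"

lemma Urysohn_T:
  assumes "closedin T A" "closedin T B" "A \<inter> B = {}"
  shows "\<exists>\<phi>. testfun \<phi> \<and> (\<forall>z\<in>A. \<phi> z = 0) \<and> (\<forall>z\<in>B. \<phi> z = 1)"
proof -
  have "normal_space T"
    using compact_T Hausdorff_T compact_Hausdorff_or_regular_imp_normal_space by blast
  then obtain \<phi> where "continuous_map T (top_of_set {0..1::real}) \<phi>" "\<phi> ` A \<subseteq> {0}" "\<phi> ` B \<subseteq> {1}"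
    using Urysohn_lemma[of T A B 0 1] assms by (auto simp: disjnt_def)
  then show ?thesis
    by (intro exI[of _ \<phi>]) (auto simp: continuous_map_in_subtopology testfun_def)
qed

text \<open>Countability comes from the finite nets: the closures of the shadows of net points that
  stay inside \<open>U\<close> exhaust its boundary part. This takes the place of a metric in the
  proof of regularity; points of the space may be left out, as they will have measure zero.\<close>

lemma open_Fsigma:
  assumes "openin T U"
  shows "\<exists>\<K>. countable \<K> \<and> (\<forall>K\<in>\<K>. closedin T K \<and> K \<subseteq> U) \<and> U \<inter> Bd \<subseteq> \<Union>\<K>"
proof -
  define e where "e n = real n - 1 - 2 * \<delta>" for n
  obtain Y where Y: "\<And>n. finite (Y n)"
    "\<And>n z. z \<in> Z \<Longrightarrow> (\<exists>x. z = Inl x \<and> nrm x \<le> real n) \<or> (\<exists>y\<in>Y n. e n \<le> bp z y)"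
    unfolding e_def using finite_net by metis
  define \<K> where "\<K> = {K \<in> (\<Union>n. (\<lambda>y. T closure_of Sh y (e n)) ` Y n). K \<subseteq> U}"
  have "countable \<K>" unfolding \<K>_def
    by (rule countable_subset[of _ "\<Union>n. (\<lambda>y. T closure_of Sh y (e n)) ` Y n"]) (use Y(1) in \<open>auto simp: countable_finite\<close>)
  moreover have "U \<inter> Bd \<subseteq> \<Union>\<K>"
  proof
    fix \<xi> assume x: "\<xi> \<in> U \<inter> Bd"
    then obtain r where r: "\<And>x. r \<le> bp \<xi> x \<Longrightarrow> Sh x r \<subseteq> U" using open_shadow[OF assms] by blast
    obtain n :: nat where n: "r + 1 + 40 * \<delta> \<le> real n" using real_arch_simple by blast
    obtain y where y: "y \<in> Y n" "e n \<le> bp \<xi> y" using Y(2)[of \<xi> n] x by (auto simp: Bd_in_Z)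
    have "T closure_of Sh y (e n) \<subseteq> Sh y (e n - 30 * \<delta>)" by (rule Sh_closure)
    also have "\<dots> \<subseteq> Sh y r" using n delta_pos by (intro Sh_mono) (simp add: e_def)
    also have "\<dots> \<subseteq> U" using r y(2) n delta_pos by (simp add: e_def)
    finally have "T closure_of Sh y (e n) \<in> \<K>" using y(1) by (auto simp: \<K>_def)
    moreover have "\<xi> \<in> T closure_of Sh y (e n)"
      using y(2) x closure_of_subset[of "Sh y (e n)" T] by (auto simp: Sh_def Bd_in_Z)
    ultimately show "\<xi> \<in> \<Union>\<K>" by blast
  qed
  ultimately show ?thesis unfolding \<K>_def by (intro exI[of _ \<K>]) (auto simp: \<K>_def)
qed

section \<open>Isometries act by homeomorphisms of the compactification\<close>

lemma bp_act_diff: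
  assumes "isometry g" "z \<in> Z" shows "\<bar>bp (act g z) (g x) - bp z x\<bar> \<le> len g + 8 * \<delta>"
  using bp_act[OF assms, of x] bp_bounds[OF assms(2), of "ivt g p"] gp_le(2)[of x "ivt g p"]
    gp_nonneg[of x "ivt g p"] len_ivt[OF assms(1)] by linarith

lemma openin_act:
  assumes "isometry g" "openin T U" shows "openin T (act g ` U)"
  unfolding open_char
proof (intro conjI ballI)
  have U: "U \<subseteq> Z" "open (Inl -` U)" using assms(2) open_char by blast+
  show "act g ` U \<subseteq> Z" using U(1) act_Z[OF assms(1)] by blast
  have "Inl -` (act g ` U) = ivt g -` (Inl -` U)"
    unfolding act_image_eq[OF assms(1)] by auto
  moreover have "continuous_on UNIV (ivt g)"
    using isometry_dist[OF isometry_ivt[OF assms(1)]] by (auto simp: continuous_on_iff)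
  ultimately show "open (Inl -` (act g ` U))" using U(2) by (simp add: open_vimage)
  fix \<xi> assume "\<xi> \<in> act g ` U \<inter> Bd"
  then have x: "act (ivt g) \<xi> \<in> U" "\<xi> \<in> Bd" unfolding act_image_eq[OF assms(1)] by auto
  define \<eta> where "\<eta> = act (ivt g) \<xi>"
  have e: "\<eta> \<in> U" "\<eta> \<in> Bd" "act g \<eta> = \<xi>"
    using x act_Bd[OF isometry_ivt[OF assms(1)]] assms(1) by (auto simp: \<eta>_def)
  obtain r where r: "\<And>x. r \<le> bp \<eta> x \<Longrightarrow> Sh x r \<subseteq> U" using open_shadow[OF assms(2) e(1,2)] by blast
  obtain y where y: "r + 2 * len g + 36 * \<delta> \<le> bp \<eta> y" using bp_deep_ex[OF e(2)] by blast
  have "Sh (g y) (r + len g + 8 * \<delta>) \<subseteq> act g ` U"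
  proof
    fix z assume "z \<in> Sh (g y) (r + len g + 8 * \<delta>)"
    then have z: "z \<in> Z" "r + len g + 8 * \<delta> \<le> bp z (g y)" by (auto simp: Sh_def)
    have "act (ivt g) z \<in> Z" using act_Z[OF isometry_ivt[OF assms(1)] z(1)] .
    moreover have "r \<le> bp (act (ivt g) z) y"
      using bp_act_diff[OF assms(1) calculation, of y] z(2) assms(1) by simp
    ultimately have "act (ivt g) z \<in> Sh y r" by (simp add: Sh_def)
    moreover have "Sh y r \<subseteq> U" using r[of y] y delta_pos zero_le_dist[of p "g p"] by linarith
    ultimately show "z \<in> act g ` U" unfolding act_image_eq[OF assms(1)] by blast
  qed
  moreover have "r + len g + 8 * \<delta> + 20 * \<delta> \<le> bp \<xi> (g y)"
    using bp_act_diff[OF assms(1) Bd_in_Z[OF e(2)], of y] y e(3) by simp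
  ultimately show "\<exists>x r. r + 20 * \<delta> \<le> bp \<xi> x \<and> Sh x r \<subseteq> act g ` U" by blast
qed

lemma act_image_Z: "isometry g \<Longrightarrow> act g ` Z = Z"
  unfolding act_image_eq using act_Z act_ivt isometry_ivt
  by (metis (mono_tags, lifting) Collect_cong Collect_mem_eq)

lemma act_image_diff: "isometry g \<Longrightarrow> act g ` (A - B) = act g ` A - act g ` B"
  by (simp add: act_inj image_set_diff)

lemma closedin_act:
  assumes "isometry g" "closedin T A" shows "closedin T (act g ` A)"
proof -
  have "openin T (act g ` (Z - A))" using assms by (intro openin_act) (auto simp: closedin_def)
  then have "openin T (Z - act g ` A)" using act_image_Z[OF assms(1)] by (simp add: act_image_diff assms(1))
  moreover have "act g ` A \<subseteq> Z" using assms(2) act_Z[OF assms(1)] by (auto simp: closedin_def)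
  ultimately show ?thesis by (simp add: closedin_def)
qed

lemma continuous_act:
  assumes "isometry g" shows "continuous_map T T (act g)"
  unfolding continuous_map_def
proof (intro conjI allI impI)
  show "act g \<in> topspace T \<rightarrow> topspace T" using act_Z[OF assms] by auto
  fix U assume U: "openin T U"
  have "{x \<in> topspace T. act g x \<in> U} = act (ivt g) ` U"
    using act_image_eq[OF isometry_ivt[OF assms], of U] openin_subset[OF U] act_Z[OF isometry_ivt[OF assms]] assms by fastforce
  then show "openin T {x \<in> topspace T. act g x \<in> U}" using openin_act[OF isometry_ivt[OF assms] U] by simp
qed

end

section \<open>Statistical convex-cocompactness and the Poincare series\<close>

lemma sum_sum_const_mult:
  "(\<Sum>x\<in>Q. \<Sum>w\<in>B. c * (f x * g w)) = (c :: real) * (sum f Q * sum g B)"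
  by (subst sum_product) (simp add: sum_distrib_left)

locale hyp_action = hyp_space p \<delta> for p :: "'a::metric_space" and \<delta> :: real +
  fixes \<Gamma> :: "('a \<Rightarrow> 'a) set"
  assumes G_id: "id \<in> \<Gamma>"
    and G_comp: "g \<in> \<Gamma> \<Longrightarrow> h \<in> \<Gamma> \<Longrightarrow> g \<circ> h \<in> \<Gamma>"
    and G_ivt: "g \<in> \<Gamma> \<Longrightarrow> ivt g \<in> \<Gamma>"
    and G_isom: "g \<in> \<Gamma> \<Longrightarrow> isometry g"
    and G_proper: "proper_action \<Gamma>"
begin

lemma finite_ball: "finite {g \<in> \<Gamma>. len g \<le> r}"
proof -
  have "finite {g \<in> \<Gamma>. g ` cball p r \<inter> cball p r \<noteq> {}}"
    using G_proper proper unfolding proper_action_def by blast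
  moreover have "{g \<in> \<Gamma>. len g \<le> r} \<subseteq> {g \<in> \<Gamma>. g ` cball p r \<inter> cball p r \<noteq> {}}"
  proof
    fix g assume g: "g \<in> {g \<in> \<Gamma>. len g \<le> r}"
    then have "0 \<le> r" using zero_le_dist[of p "g p"] by (metis (mono_tags, lifting) mem_Collect_eq order_trans)
    then have "g p \<in> g ` cball p r \<inter> cball p r" using g by auto
    then show "g \<in> {g \<in> \<Gamma>. g ` cball p r \<inter> cball p r \<noteq> {}}" using g by blast
  qed
  ultimately show ?thesis by (rule rev_finite_subset)
qed

lemma countable_G: "countable \<Gamma>"
proof -
  have "\<Gamma> \<subseteq> (\<Union>n::nat. {g \<in> \<Gamma>. len g \<le> real n})" using real_arch_simple by auto
  then show ?thesis
    by (rule countable_subset) (intro countable_UN countableI_type, simp add: countable_finite finite_ball)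
qed

lemma summable_tail:
  assumes "(f :: ('a \<Rightarrow> 'a) \<Rightarrow> real) summable_on A" "\<And>g. g \<in> A \<Longrightarrow> 0 \<le> f g" "0 < e"
  shows "\<exists>R. \<forall>F. finite F \<and> F \<subseteq> A \<and> (\<forall>g\<in>F. R < len g) \<longrightarrow> sum f F \<le> e"
proof -
  have "(sum f \<longlongrightarrow> infsum f A) (finite_subsets_at_top A)"
    using assms(1) by (simp add: infsum_tendsto)
  then have "\<forall>\<^sub>F F in finite_subsets_at_top A. dist (sum f F) (infsum f A) < e"
    using assms(3) by (rule tendstoD)
  then obtain F0 where F0: "finite F0" "F0 \<subseteq> A"
    "\<And>F. finite F \<Longrightarrow> F0 \<subseteq> F \<Longrightarrow> F \<subseteq> A \<Longrightarrow> dist (sum f F) (infsum f A) < e"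
    unfolding eventually_finite_subsets_at_top by metis
  have "sum f F \<le> e" if F: "finite F" "F \<subseteq> A" "\<And>g. g \<in> F \<Longrightarrow> Max (insert 0 (len ` F0)) < len g" for F
  proof -
    have "F \<inter> F0 = {}"
    proof -
      have "len g \<le> Max (insert 0 (len ` F0))" if "g \<in> F0" for g using that F0(1) by (intro Max_ge) auto
      then show ?thesis using F(3) by force
    qed
    then have "sum f F + sum f F0 = sum f (F \<union> F0)" using F F0 by (simp add: sum.union_disjoint)
    also have "\<dots> \<le> infsum f A"
      using assms(1,2) F F0 by (intro finite_sum_le_infsum) auto
    finally show ?thesis using F0(3)[of F0] F0(1,2) by (simp add: dist_real_def)
  qed
  then show ?thesis by (intro exI[of _ "Max (insert 0 (len ` F0))"]) simp
qed

text \<open>\<open>growth\<close> counts orbit points while the series runs over group elements; the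
  counts differ by at most the factor \<open>M\<close>, the order of the stabiliser of
  \<open>p\<close>, which is finite by properness. An exponent \<open>s'\<close> strictly in between
  gives a geometric majorant over integer annuli.\<close>

lemma growth_summable:
  assumes "A \<subseteq> \<Gamma>" "growth p A < ereal s" "0 < s"
  shows "(\<lambda>g. exp (- s * len g)) summable_on A"
proof -
  obtain s' where s': "growth p A < ereal s'" "s' < s"
    using ereal_dense2[OF assms(2)] by auto
  define pts where "pts n = {g p |g. g \<in> A \<and> len g \<le> real n}" for n :: nat
  define els where "els n = {g \<in> A. len g \<le> real n}" for n :: nat
  have fin: "finite (els n)" for n
    by (rule finite_subset[OF _ finite_ball[of "real n"]]) (use assms(1) in \<open>auto simp: els_def\<close>)
  have pe: "pts n = (\<lambda>g. g p) ` els n" for n by (auto simp: pts_def els_def)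
  define M where "M = card {g \<in> \<Gamma>. len g \<le> 0}"
  have ce: "card (els n) \<le> M * card (pts n)" for n
  proof -
    have "card (els n) = (\<Sum>y\<in>pts n. card {g \<in> els n. g p = y})"
      using sum.image_gen[OF fin[of n], of "\<lambda>_. 1::nat" "\<lambda>g. g p"] unfolding pe by simp
    also have "\<dots> \<le> (\<Sum>y\<in>pts n. M)"
    proof (rule sum_mono)
      fix y assume "y \<in> pts n"
      then obtain h where h: "h \<in> A" "h p = y" by (auto simp: pts_def)
      have hG: "h \<in> \<Gamma>" using h assms(1) by blast
      have "card {g \<in> els n. g p = y} \<le> card {g \<in> \<Gamma>. len g \<le> 0}"
      proof (rule card_inj_on_le[of "\<lambda>g. ivt h \<circ> g"])
        show "inj_on (\<lambda>g. ivt h \<circ> g) {g \<in> els n. g p = y}"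
        proof (rule inj_onI)
          fix g k assume "ivt h \<circ> g = ivt h \<circ> k"
          then have "h \<circ> (ivt h \<circ> g) = h \<circ> (ivt h \<circ> k)" by simp
          then show "g = k" using G_isom[OF hG] by (simp flip: comp_assoc)
        qed
        show "(\<lambda>g. ivt h \<circ> g) ` {g \<in> els n. g p = y} \<subseteq> {g \<in> \<Gamma>. len g \<le> 0}"
        proof clarsimp
          fix g assume g: "g \<in> els n" "y = g p"
          have "ivt h (g p) = p" using h(2) g(2) G_isom[OF hG] by (metis isometry_ivt_apply(2))
          moreover have "g \<in> \<Gamma>" using g(1) assms(1) by (auto simp: els_def)
          ultimately show "ivt h \<circ> g \<in> \<Gamma> \<and> p = ivt h (g p)" using G_comp[OF G_ivt[OF hG]] by simp
        qed
      qed (rule finite_ball)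
      then show "card {g \<in> els n. g p = y} \<le> M" by (simp add: M_def)
    qed
    finally show ?thesis by (simp add: mult.commute)
  qed
  have "\<forall>\<^sub>F n in sequentially. log_card (pts n) / ereal (real n) < ereal s'"
    using s'(1) unfolding growth_def pts_def by (rule Limsup_lessD)
  then obtain N where N: "\<And>n. n \<ge> N \<Longrightarrow> log_card (pts n) / ereal (real n) < ereal s'"
    unfolding eventually_sequentially by blast
  define c where "c n = real (card (els n)) * exp (- s * (real n - 1))" for n
  have cb: "c n \<le> real M * exp s * exp (- (s - s')) ^ n" if n: "n \<ge> max N 1" for n
  proof -
    have "real (card (pts n)) \<le> exp (s' * real n)"
    proof (cases "pts n = {}")
      case False
      have "finite (pts n)" using fin pe by simp
      then have "ereal (ln (real (card (pts n))) / real n) < ereal s'"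
        using N[of n] n False by (simp add: log_card_def)
      then have "ln (real (card (pts n))) < s' * real n" using n by (simp add: divide_less_eq)
      then show ?thesis using False \<open>finite (pts n)\<close>
        by (metis card_gt_0_iff exp_le_cancel_iff exp_ln less_imp_le of_nat_0_less_iff)
    qed simp
    then have "real (card (els n)) \<le> real M * exp (s' * real n)"
      using ce[of n] by (metis (no_types, opaque_lifting) mult_left_mono of_nat_0_le_iff of_nat_mono of_nat_mult order_trans)
    then have "c n \<le> real M * exp (s' * real n) * exp (- s * (real n - 1))"
      unfolding c_def by (rule mult_right_mono) simp
    also have "\<dots> = real M * exp s * exp (- (s - s')) ^ n"
      by (simp add: algebra_simps flip: exp_add exp_of_nat_mult)
    finally show ?thesis .
  qed
  have "summable (\<lambda>n. real M * exp s * exp (- (s - s')) ^ n)"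
    using s'(2) by (intro summable_mult summable_geometric) simp
  then have sc: "summable c"
    by (rule summable_comparison_test[rotated]) (use cb in \<open>auto simp: c_def intro!: exI[of _ "max N 1"]\<close>)
  have c0: "0 \<le> c n" for n by (simp add: c_def)
  show ?thesis
  proof (rule nonneg_bdd_above_summable_on)
    show "bdd_above (sum (\<lambda>g. exp (- s * len g)) ` {F. F \<subseteq> A \<and> finite F})"
    proof (rule bdd_aboveI2)
      fix F assume "F \<in> {F. F \<subseteq> A \<and> finite F}"
      then have F: "F \<subseteq> A" "finite F" by auto
      define f where "f g = nat \<lceil>len g\<rceil>" for g :: "'a \<Rightarrow> 'a"
      have f: "real (f g) - 1 \<le> len g" "len g \<le> real (f g)" for g
      proof -
        have "real (f g) = real_of_int \<lceil>len g\<rceil>" by (simp add: f_def)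
        then show "real (f g) - 1 \<le> len g" "len g \<le> real (f g)"
          using ceiling_correct[of "len g"] by simp_all
      qed
      have "sum (\<lambda>g. exp (- s * len g)) F = (\<Sum>n\<in>f ` F. \<Sum>g\<in>{g \<in> F. f g = n}. exp (- s * len g))"
        by (rule sum.image_gen[OF F(2)])
      also have "\<dots> \<le> (\<Sum>n\<in>f ` F. c n)"
      proof (rule sum_mono)
        fix n assume "n \<in> f ` F"
        have "(\<Sum>g\<in>{g \<in> F. f g = n}. exp (- s * len g)) \<le> (\<Sum>g\<in>{g \<in> F. f g = n}. exp (- s * (real n - 1)))"
          using f(1) assms(3) by (intro sum_mono) auto
        also have "\<dots> = real (card {g \<in> F. f g = n}) * exp (- s * (real n - 1))" by simp
        also have "\<dots> \<le> c n"
        proof -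
          have "card {g \<in> F. f g = n} \<le> card (els n)"
            using F(1) f(2) by (intro card_mono fin) (auto simp: els_def)
          then show ?thesis by (simp add: c_def)
        qed
        finally show "(\<Sum>g\<in>{g \<in> F. f g = n}. exp (- s * len g)) \<le> c n" .
      qed
      also have "\<dots> \<le> suminf c" using F(2) c0 sc by (intro sum_le_suminf) auto
      finally show "sum (\<lambda>g. exp (- s * len g)) F \<le> suminf c" .
    qed
  qed simp
qed

lemma summable_growth:
  assumes "A \<subseteq> \<Gamma>" "(\<lambda>g. exp (- s * len g)) summable_on A" "0 \<le> s"
  shows "growth p A \<le> ereal s"
proof -
  define C where "C = max 1 (infsum (\<lambda>g. exp (- s * len g)) A)"
  define pts where "pts n = {g p |g. g \<in> A \<and> len g \<le> real n}" for n :: nat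
  have b: "log_card (pts n) / ereal (real n) \<le> ereal (s + ln C / real n)" if n: "n \<ge> 1" for n
  proof -
    define els where "els = {g \<in> A. len g \<le> real n}"
    have fin: "finite els"
      by (rule finite_subset[OF _ finite_ball[of "real n"]]) (use assms(1) in \<open>auto simp: els_def\<close>)
    have pe: "pts n = (\<lambda>g. g p) ` els" by (auto simp: pts_def els_def)
    show ?thesis
    proof (cases "els = {}")
      case True
      then show ?thesis using n pe by (simp add: log_card_def)
    next
      case False
      have "real (card els) * exp (- s * real n) = (\<Sum>g\<in>els. exp (- s * real n))" by simp
      also have "\<dots> \<le> (\<Sum>g\<in>els. exp (- s * len g))"
        using assms(3) by (intro sum_mono) (auto simp: els_def mult_left_mono)
      also have "\<dots> \<le> C" unfolding C_def
        using assms(2) fin by (intro max.coboundedI2 finite_sum_le_infsum) (auto simp: els_def)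
      finally have "real (card els) \<le> C * exp (s * real n)" by (simp add: exp_minus field_simps)
      moreover have "card (pts n) \<le> card els" unfolding pe using fin by (rule card_image_le)
      ultimately have "real (card (pts n)) \<le> C * exp (s * real n)" by linarith
      moreover have pos: "0 < card (pts n)" using False fin pe by (simp add: card_gt_0_iff)
      ultimately have "ln (real (card (pts n))) \<le> ln (C * exp (s * real n))" by simp
      also have "\<dots> = ln C + s * real n" by (subst ln_mult) (auto simp: C_def)
      finally have "ln (real (card (pts n))) / real n \<le> (ln C + s * real n) / real n"
        using n by (simp add: divide_right_mono)
      also have "\<dots> = s + ln C / real n" using n by (simp add: field_simps)
      finally show ?thesis using n pos fin pe by (auto simp: log_card_def card_gt_0_iff)
    qed
  qed
  have "growth p A \<le> limsup (\<lambda>n. ereal (s + ln C / real n))"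
    unfolding growth_def pts_def[symmetric]
    by (rule Limsup_mono) (use b in \<open>auto simp: eventually_sequentially\<close>)
  also have "\<dots> = ereal s"
  proof (rule lim_imp_Limsup)
    have "(\<lambda>n. s + ln C / real n) \<longlonglongrightarrow> s + 0" by (intro tendsto_intros lim_const_over_n)
    then show "(\<lambda>n. ereal (s + ln C / real n)) \<longlonglongrightarrow> ereal s" by simp
  qed simp
  finally show ?thesis .
qed

text \<open>Every ball contains only finitely many orbit points, so the infimum defining the
  distance is attained.\<close>

lemma infdist_orbit:
  assumes "infdist x (orbit_of p \<Gamma>) \<le> M" shows "\<exists>u\<in>\<Gamma>. dist x (u p) \<le> M"
proof (rule ccontr)
  assume "\<not> ?thesis"
  then have far: "\<And>u. u \<in> \<Gamma> \<Longrightarrow> M < dist x (u p)" by force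
  define F where "F = {u \<in> \<Gamma>. dist x (u p) \<le> M + 1}"
  have "finite F"
  proof (rule finite_subset[OF _ finite_ball[of "dist p x + (M + 1)"]])
    show "F \<subseteq> {g \<in> \<Gamma>. len g \<le> dist p x + (M + 1)}"
    proof
      fix g assume "g \<in> F"
      then show "g \<in> {g \<in> \<Gamma>. len g \<le> dist p x + (M + 1)}"
        using dist_triangle[of p "g p" x] by (simp add: F_def)
    qed
  qed
  define m where "m = Min (insert (M + 1) ((\<lambda>u. dist x (u p)) ` F))"
  have "M < m" unfolding m_def using \<open>finite F\<close> far by (subst Min_gr_iff) (auto simp: F_def)
  have "m \<le> dist x (u p)" if "u \<in> \<Gamma>" for u
  proof (cases "u \<in> F")
    case True
    then show ?thesis unfolding m_def using \<open>finite F\<close> by (intro Min_le) auto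
  next
    case False
    then have "M + 1 \<le> dist x (u p)" using that by (auto simp: F_def)
    moreover have "m \<le> M + 1" unfolding m_def using \<open>finite F\<close> by (intro Min_le) auto
    ultimately show ?thesis by linarith
  qed
  then have "m \<le> infdist x (orbit_of p \<Gamma>)"
    unfolding infdist_def orbit_of_def using G_id by (auto intro!: cINF_greatest)
  then show False using \<open>M < m\<close> assms by linarith
qed

lemma orbit_infdist: "u \<in> \<Gamma> \<Longrightarrow> dist x (u p) \<le> M \<Longrightarrow> infdist x (orbit_of p \<Gamma>) \<le> M"
  by (rule order_trans[OF infdist_le]) (auto simp: orbit_of_def)

text \<open>Cut a geodesic from \<open>p\<close> to \<open>g p\<close> at time \<open>t\<close>: either there is an orbit point nearby, or
  \<open>t\<close> lies in an excursion, whose endpoints are close to the orbit.\<close>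

lemma decompose:
  assumes "0 < M1" "M1 \<le> M2" "g \<in> \<Gamma>" "0 \<le> t" "t \<le> len g"
  obtains u b w where "u \<in> \<Gamma>" "b \<in> concave_region p \<Gamma> M1 M2" "w \<in> \<Gamma>" "g = u \<circ> b \<circ> w"
    "len u \<le> t + M1" "len w \<le> len g - t + M1" "len u + len b + len w \<le> len g + 4 * M1"
    "len u - M1 \<le> gp (u p) (g p)"
proof -
  obtain c L where c: "geodesic c L" "c 0 = p" "c L = g p" using geod by blast
  have L0: "0 \<le> L" using c(1) by (simp add: geodesic_def)
  have gd: "dist (c s) (c t) = \<bar>s - t\<bar>" if "s \<in> {0..L}" "t \<in> {0..L}" for s t
    using c(1) that by (simp add: geodesic_def)
  have L: "L = len g" using gd[of 0 L] c(2,3) L0 by simp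
  define near where "near s \<longleftrightarrow> infdist (c s) (orbit_of p \<Gamma>) \<le> M1" for s
  have cc: "continuous_on {0..L} c"
    unfolding continuous_on_iff dist_real_def using gd by auto
  have cn: "compact {s \<in> {a..b}. near s}" if "0 \<le> a" "b \<le> L" for a b
  proof -
    have "continuous_on {a..b} (\<lambda>s. infdist (c s) (orbit_of p \<Gamma>))"
      using that by (intro continuous_on_infdist continuous_on_subset[OF cc]) auto
    then have "closed ({a..b} \<inter> (\<lambda>s. infdist (c s) (orbit_of p \<Gamma>)) -` {..M1})"
      by (intro continuous_closed_preimage) auto
    moreover have "{a..b} \<inter> (\<lambda>s. infdist (c s) (orbit_of p \<Gamma>)) -` {..M1} = {s \<in> {a..b}. near s}"
      by (auto simp: near_def)
    ultimately have "closed {s \<in> {a..b}. near s}" by simp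
    then show ?thesis by (rule compact_eq_bounded_closed[THEN iffD2, OF conjI, rotated])
        (rule bounded_subset[OF bounded_closed_interval[of a b]], auto)
  qed
  \<comment> \<open>Both endpoints are orbit points. By compactness there are therefore a last time
    \<open>s1\<close> up to \<open>t\<close> and a first time \<open>s2\<close> from
    \<open>t\<close> on at which the geodesic is within \<open>M1\<close> of the orbit.\<close>
  have "near 0" unfolding near_def using orbit_infdist[OF G_id, of "c 0" M1] c(2) assms(1) by simp
  then have "0 \<in> {s \<in> {0..t}. near s}" using assms(4) by simp
  moreover have "compact {s \<in> {0..t}. near s}" using cn[of 0 t] assms(5) L by simp
  ultimately obtain s1 where s1: "s1 \<in> {s \<in> {0..t}. near s}" "\<And>s. s \<in> {s \<in> {0..t}. near s} \<Longrightarrow> s \<le> s1"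
    using compact_attains_sup[of "{s \<in> {0..t}. near s}"] by blast
  have "near L" unfolding near_def using orbit_infdist[OF assms(3), of "c L" M1] c(3) assms(1) by simp
  then have "L \<in> {s \<in> {t..L}. near s}" using assms(5) L by simp
  moreover have "compact {s \<in> {t..L}. near s}" using cn[of t L] assms(4) L by simp
  ultimately obtain s2 where s2: "s2 \<in> {s \<in> {t..L}. near s}" "\<And>s. s \<in> {s \<in> {t..L}. near s} \<Longrightarrow> s2 \<le> s"
    using compact_attains_inf[of "{s \<in> {t..L}. near s}"] by blast
  obtain u where u: "u \<in> \<Gamma>" "dist (c s1) (u p) \<le> M1"
    using infdist_orbit[of "c s1" M1] s1(1) by (auto simp: near_def)
  obtain v where v: "v \<in> \<Gamma>" "dist (c s2) (v p) \<le> M1"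
    using infdist_orbit[of "c s2" M1] s2(1) by (auto simp: near_def)
  have s12: "0 \<le> s1" "s1 \<le> t" "t \<le> s2" "s2 \<le> L" using s1(1) s2(1) by auto
  have iu: "isometry u" and iv: "isometry v" and ig: "isometry g" using G_isom u v assms(3) by auto
  define b where "b = ivt u \<circ> v"
  define w where "w = ivt v \<circ> g"
  \<comment> \<open>Translation by \<open>ivt u\<close> moves the piece between \<open>s1\<close>
    and \<open>s2\<close> so that it starts near \<open>p\<close> and ends near \<open>b p\<close>,
    the form demanded by \<open>concave_region\<close>.\<close>
  define c' where "c' s = ivt u (c (s1 + s))" for s
  have d': "dist (ivt u x) y = dist x (u y)" for x y
    using isometry_dist[OF iu, of "ivt u x" y] iu by simp
  have dv: "dist (ivt v x) y = dist x (v y)" for x y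
    using isometry_dist[OF iv, of "ivt v x" y] iv by simp
  have "b \<in> concave_region p \<Gamma> M1 M2"
    unfolding concave_region_def mem_Collect_eq
  proof (intro conjI exI)
    show "b \<in> \<Gamma>" unfolding b_def using G_comp G_ivt u v by blast
    show "geodesic c' (s2 - s1)"
      unfolding geodesic_def c'_def using s12 gd by (auto simp: isometry_dist[OF isometry_ivt[OF iu]])
    show "c' 0 \<in> nbhd M2 {p}"
      using u(2) assms(2) by (simp add: nbhd_def c'_def d')
    show "c' (s2 - s1) \<in> nbhd M2 {b p}"
      using v(2) assms(2) iu by (simp add: nbhd_def c'_def d' b_def)
    show "c' ` {0<..<s2 - s1} \<inter> nbhd M1 (orbit_of p \<Gamma>) = {}"
    proof (rule ccontr)
      assume "c' ` {0<..<s2 - s1} \<inter> nbhd M1 (orbit_of p \<Gamma>) \<noteq> {}"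
      then obtain s where s: "0 < s" "s < s2 - s1" "infdist (c' s) (orbit_of p \<Gamma>) \<le> M1"
        by (auto simp: nbhd_def)
      obtain h where h: "h \<in> \<Gamma>" "dist (c' s) (h p) \<le> M1" using infdist_orbit[OF s(3)] by blast
      have "near (s1 + s)" unfolding near_def
        using orbit_infdist[OF G_comp[OF u(1) h(1)], of "c (s1 + s)" M1] h(2) by (simp add: c'_def d')
      then show False using s1(2)[of "s1 + s"] s2(2)[of "s1 + s"] s s12 by (cases "s1 + s \<le> t") auto
    qed
  qed
  moreover have "w \<in> \<Gamma>" unfolding w_def using G_comp G_ivt v(1) assms(3) by blast
  moreover have "g = u \<circ> b \<circ> w" using iu iv by (simp add: b_def w_def fun_eq_iff)
  moreover have e: "dist p (c s1) = s1" "dist (c s2) (g p) = L - s2" "dist (c s1) (c s2) = s2 - s1"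
      "dist (c s1) (g p) = L - s1"
    using gd[of 0 s1] gd[of s2 L] gd[of s1 s2] gd[of s1 L] s12 c(2,3) by simp_all
  have lu: "len u \<le> s1 + M1" "s1 \<le> len u + M1"
    using e(1) u(2) dist_triangle[of p "u p" "c s1"] dist_triangle[of p "c s1" "u p"]
      dist_commute[of "u p" "c s1"] by linarith+
  have "len w = dist (v p) (g p)"
    using dv[of "g p" p] dist_commute[of p "w p"] dist_commute[of "g p" "v p"] by (simp add: w_def)
  then have lw: "len w \<le> L - s2 + M1"
    using e(2) v(2) dist_triangle[of "v p" "g p" "c s2"] dist_commute[of "v p" "c s2"] by linarith
  have "len b = dist (u p) (v p)"
    using d'[of "v p" p] dist_commute[of p "b p"] dist_commute[of "v p" "u p"] by (simp add: b_def)
  then have lb: "len b \<le> s2 - s1 + 2 * M1"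
    using e(3) u(2) v(2) dist_triangle[of "u p" "v p" "c s1"] dist_triangle[of "c s1" "v p" "c s2"]
      dist_commute[of "u p" "c s1"] by linarith
  moreover have "len u - M1 \<le> gp (u p) (g p)"
  proof -
    have "dist (u p) (g p) \<le> L - s1 + M1"
      using e(4) u(2) dist_triangle[of "u p" "g p" "c s1"] dist_commute[of "u p" "c s1"] by linarith
    then show ?thesis using lu L by (simp add: gromov_product_def dist_commute[of _ p] field_simps)
  qed
  ultimately show thesis using that[of u b w] u(1) lu lw lb s12 L by auto
qed

end

locale scc_action = hyp_action p \<delta> \<Gamma> for p :: "'a::metric_space" and \<delta> :: real and \<Gamma> +
  assumes G_SCC: "SCC p \<Gamma>"
begin

definition om :: real where "om = real_of_ereal (growth p \<Gamma>)"

lemma scc_data: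
  obtains M1 M2 s0 where "0 < M1" "M1 \<le> M2" "0 < s0" "s0 < om" "growth p \<Gamma> = ereal om"
    "(\<lambda>b. exp (- s0 * len b)) summable_on concave_region p \<Gamma> M1 M2"
proof -
  obtain M1 M2 where M: "0 < M1" "M1 \<le> M2"
    "growth p (concave_region p \<Gamma> M1 M2) < growth p \<Gamma>" "growth p \<Gamma> < \<infinity>"
    using G_SCC unfolding SCC_def by blast
  define A where "A = concave_region p \<Gamma> M1 M2"
  \<comment> \<open>The constant path of length 0 has empty interior, so the identity lies in the
    concave region. The growth of that region is therefore nonnegative, and the strict inequality of
    the SCC condition makes \<open>om\<close> positive.\<close>
  have idA: "id \<in> A"
    unfolding A_def concave_region_def using G_id M(1,2)
    by (auto simp: geodesic_def nbhd_def intro!: exI[of _ "\<lambda>_. p"] exI[of _ "0::real"])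
  have "0 \<le> log_card {g p |g. g \<in> A \<and> len g \<le> real n} / ereal (real n)" if n: "n \<ge> 1" for n
  proof -
    define S where "S = {g p |g. g \<in> A \<and> len g \<le> real n}"
    have "p \<in> S" unfolding S_def using idA by (force intro: exI[of _ id])
    then have "0 \<le> log_card S"
      by (auto simp: log_card_def Suc_le_eq card_gt_0_iff intro!: ln_ge_zero)
    then show ?thesis unfolding S_def[symmetric] using n by (simp add: zero_le_divide_ereal)
  qed
  then have "\<forall>\<^sub>F n in sequentially. 0 \<le> log_card {g p |g. g \<in> A \<and> len g \<le> real n} / ereal (real n)"
    by (auto simp: eventually_sequentially intro!: exI[of _ 1])
  then have "0 \<le> growth p A" unfolding growth_def by (intro le_Limsup) auto
  then have "0 < growth p \<Gamma>" using M(3) by (simp add: A_def)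
  then obtain r where r: "growth p \<Gamma> = ereal r" "0 < r" using M(4) by (cases "growth p \<Gamma>") auto
  then have om: "growth p \<Gamma> = ereal om" "0 < om" by (simp_all add: om_def)
  obtain s0 where s0: "growth p A < ereal s0" "ereal s0 < growth p \<Gamma>"
    using ereal_dense2[OF M(3)] by (auto simp: A_def)
  have "0 < s0" using \<open>0 \<le> growth p A\<close> s0(1) by (metis ereal_less(2) le_less_trans)
  moreover have "A \<subseteq> \<Gamma>" by (auto simp: A_def concave_region_def)
  ultimately show thesis
    using that[of M1 M2 s0] M(1,2) om s0 growth_summable[of A s0] by (simp add: A_def)
qed

lemma om_pos: "0 < om"
  by (rule scc_data) auto

lemma growth_om: "growth p \<Gamma> = ereal om"
  by (rule scc_data) auto

text \<open>If the series converged, cutting group elements at a large time \<open>R\<close> would bound a tail of the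
  series at some exponent \<open>s < om\<close> by half of the series itself, so it would converge at \<open>s\<close>.\<close>

theorem poincare_divergence: "\<not> (\<lambda>g. exp (- om * len g)) summable_on \<Gamma>"
proof
  assume sum: "(\<lambda>g. exp (- om * len g)) summable_on \<Gamma>"
  obtain M1 M2 s0 where M: "0 < M1" "M1 \<le> M2" "0 < s0" "s0 < om" "growth p \<Gamma> = ereal om"
    "(\<lambda>b. exp (- s0 * len b)) summable_on concave_region p \<Gamma> M1 M2" by (rule scc_data)
  define A where "A = concave_region p \<Gamma> M1 M2"
  have AG: "A \<subseteq> \<Gamma>" by (auto simp: A_def concave_region_def)
  define PG where "PG = infsum (\<lambda>g. exp (- om * len g)) \<Gamma>"
  define PA where "PA = infsum (\<lambda>g. exp (- s0 * len g)) A"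
  have PG0: "0 \<le> PG" and PA0: "0 \<le> PA" by (auto simp: PG_def PA_def intro!: infsum_nonneg)
  have PG: "(\<Sum>g\<in>F. exp (- om * len g)) \<le> PG" if "finite F" "F \<subseteq> \<Gamma>" for F
    unfolding PG_def using sum that by (intro finite_sum_le_infsum) auto
  have PA: "(\<Sum>g\<in>F. exp (- s0 * len g)) \<le> PA" if "finite F" "F \<subseteq> A" for F
    unfolding PA_def using M(6) that by (intro finite_sum_le_infsum) (auto simp: A_def)
  \<comment> \<open>Chosen so that the constants collected below, \<open>exp (4 * M1 * om)\<close>
    from the excess of lengths and \<open>exp 1\<close> from the change of exponent, leave a factor
    at most \<open>1 / 2\<close>.\<close>
  define e where "e = exp (- 4 * M1 * om) / (4 * exp 1 * (PG + PA + 1))"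
  have e0: "0 < e" unfolding e_def using PG0 PA0 by simp
  obtain R1 where R1: "\<And>F. finite F \<Longrightarrow> F \<subseteq> \<Gamma> \<Longrightarrow> (\<And>g. g \<in> F \<Longrightarrow> R1 < len g) \<Longrightarrow> (\<Sum>g\<in>F. exp (- om * len g)) \<le> e"
    using summable_tail[OF sum exp_ge_zero e0] by metis
  obtain R2 where R2: "\<And>F. finite F \<Longrightarrow> F \<subseteq> A \<Longrightarrow> (\<And>g. g \<in> F \<Longrightarrow> R2 < len g) \<Longrightarrow> (\<Sum>g\<in>F. exp (- s0 * len g)) \<le> e"
    using summable_tail[OF M(6) exp_ge_zero e0] unfolding A_def by metis
  \<comment> \<open>In a decomposition at time \<open>R\<close> the sum \<open>len u + len b\<close>
    is at least \<open>R - M1\<close>, so either \<open>u\<close> is longer than \<open>R1\<close>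
    or \<open>b\<close> is longer than \<open>R2\<close>; one of the two factors then lies in a tail
    of total weight at most \<open>e\<close>.\<close>
  define R where "R = 2 * max R1 R2 + M1 + 1 + 2 * max 0 (- max R1 R2)"
  have R: "M1 \<le> R" "0 < R" "2 * R1 < R - M1" "2 * R2 < R - M1" unfolding R_def using M(1) by auto
  \<comment> \<open>On elements of length at most \<open>R + M1\<close> the weights for
    \<open>s\<close> and for \<open>om\<close> differ by a factor at most \<open>exp 1\<close>, so
    the series at \<open>om\<close> still controls the factors \<open>u\<close> although
    \<open>s < om\<close>.\<close>
  define s where "s = max s0 (om - 1 / (R + M1))"
  have s: "s0 \<le> s" "s < om" "(om - s) * (R + M1) \<le> 1" "0 < s"
  proof -
    show "s0 \<le> s" "s < om" "0 < s" using M R by (auto simp: s_def)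
    have "om - s \<le> 1 / (R + M1)" by (simp add: s_def)
    then show "(om - s) * (R + M1) \<le> 1" using M(1) R(2) by (simp add: pos_le_divide_eq)
  qed
  define E where "E g = exp (- s * len g)" for g :: "'a \<Rightarrow> 'a"
  have E0: "0 \<le> E g" for g by (simp add: E_def)
  define B where "B n = {g \<in> \<Gamma>. len g \<le> n}" for n
  have finB: "finite (B n)" for n unfolding B_def by (rule finite_ball)
  \<comment> \<open>Truncation at length \<open>n\<close> makes the sum finite. Since
    \<open>M1 \<le> R\<close>, the factor \<open>w\<close> of an element of length at most
    \<open>n\<close> is again of length at most \<open>n\<close>, so half of the same truncated sum
    appears on the right and can be absorbed, uniformly in \<open>n\<close>.\<close>
  have main: "sum E (B n) \<le> sum E (B R) + sum E (B n) / 2" for n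
  proof -
    define D where "D = {g \<in> B n. R < len g}"
    define dec where "dec g u b w \<longleftrightarrow> u \<in> \<Gamma> \<and> b \<in> A \<and> w \<in> \<Gamma> \<and> g = u \<circ> b \<circ> w \<and>
        len u \<le> R + M1 \<and> len w \<le> len g - R + M1 \<and> len u + len b + len w \<le> len g + 4 * M1" for g u b w
    have "\<forall>g\<in>D. \<exists>x. dec g (fst (fst x)) (snd (fst x)) (snd x)"
    proof
      fix g assume g: "g \<in> D"
      then have "g \<in> \<Gamma>" "0 \<le> R" "R \<le> len g" using R(2) by (auto simp: D_def B_def)
      then obtain u b w where "dec g u b w"
        using decompose[OF M(1,2), of g R] unfolding A_def dec_def by metis
      then show "\<exists>x. dec g (fst (fst x)) (snd (fst x)) (snd x)" by (intro exI[of _ "((u, b), w)"]) simp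
    qed
    from bchoice[OF this] obtain \<theta>' where
      "\<forall>g\<in>D. dec g (fst (fst (\<theta>' g))) (snd (fst (\<theta>' g))) (snd (\<theta>' g))" ..
    then have th: "dec g (fst (fst (\<theta>' g))) (snd (fst (\<theta>' g))) (snd (\<theta>' g))" if "g \<in> D" for g
      using that by blast
    define U where "U = B (R + M1)"
    define U' where "U' = {u \<in> U. R1 < len u}"
    define O' where "O' = {b \<in> A. len b \<le> n + 4 * M1}"
    define O'' where "O'' = {b \<in> O'. R2 < len b}"
    have "O' \<subseteq> {g \<in> \<Gamma>. len g \<le> n + 4 * M1}" using AG by (auto simp: O'_def)
    then have "finite O'" using finite_ball by (rule finite_subset)
    moreover have "finite U" unfolding U_def by (rule finB)
    ultimately have fin: "finite U" "finite U'" "finite O'" "finite O''"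
      by (simp_all add: U'_def O''_def)
    define X where "X = (U' \<times> O' \<union> U \<times> O'') \<times> B n"
    have finX: "finite X" using fin finB by (simp add: X_def)
    define W where "W x = exp (4 * M1 * om) * (E (fst (fst x)) * E (snd (fst x)) * E (snd x))"
      for x :: "(('a \<Rightarrow> 'a) \<times> ('a \<Rightarrow> 'a)) \<times> ('a \<Rightarrow> 'a)"
    have inj: "inj_on \<theta>' D"
    proof (rule inj_onI)
      fix g h assume gh: "g \<in> D" "h \<in> D" "\<theta>' g = \<theta>' h"
      have "g = fst (fst (\<theta>' g)) \<circ> snd (fst (\<theta>' g)) \<circ> snd (\<theta>' g)"
        using th[OF gh(1)] unfolding dec_def by (elim conjE)
      moreover have "h = fst (fst (\<theta>' h)) \<circ> snd (fst (\<theta>' h)) \<circ> snd (\<theta>' h)"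
        using th[OF gh(2)] unfolding dec_def by (elim conjE)
      ultimately show "g = h" using gh(3) by simp
    qed
    have img: "\<theta>' ` D \<subseteq> X"
    proof
      fix x assume "x \<in> \<theta>' ` D"
      then obtain g where g: "g \<in> D" "x = \<theta>' g" by blast
      obtain u b w where t: "\<theta>' g = ((u, b), w)" by (metis surj_pair)
      have h: "u \<in> \<Gamma>" "b \<in> A" "w \<in> \<Gamma>" "g = u \<circ> b \<circ> w" "len u \<le> R + M1" "len w \<le> len g - R + M1"
        "len u + len b + len w \<le> len g + 4 * M1" using th[OF g(1)] unfolding t dec_def by auto
      have gn: "len g \<le> n" using g(1) by (simp add: D_def B_def)
      have "len g \<le> len u + len b + len w"
        using len_comp_le[of "u \<circ> b" w] len_comp_le[of u b] G_isom h(1,2) AG isometry_comp h(4)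
        by (smt (verit) comp_apply subsetD)
      then have ub: "R - M1 \<le> len u + len b" using h(6) by linarith
      have "b \<in> O'" using h(2,7) gn zero_le_dist[of p "u p"] zero_le_dist[of p "w p"] unfolding O'_def mem_Collect_eq by linarith
      moreover have "w \<in> B n" using h(3,6) gn R(1) unfolding B_def mem_Collect_eq by linarith
      moreover have "u \<in> U" using h by (simp add: U_def B_def)
      moreover have "R1 < len u \<or> R2 < len b" using ub R(3,4) by linarith
      ultimately show "x \<in> X" using g(2) t by (auto simp: X_def U'_def O''_def)
    qed
    have "E g \<le> W (\<theta>' g)" if "g \<in> D" for g
    proof -
      obtain u b w where t: "\<theta>' g = ((u, b), w)" by (metis surj_pair)
      have "len u + len b + len w \<le> len g + 4 * M1" using th[OF that] unfolding t dec_def by auto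
      then have "s * (len u + len b + len w) \<le> s * (len g + 4 * M1)" using s(4) by simp
      also have "\<dots> \<le> s * len g + 4 * M1 * om" using s(2) M(1) by (simp add: algebra_simps mult_left_mono)
      finally have "E g \<le> exp (4 * M1 * om + (- s * len u) + (- s * len b) + (- s * len w))"
        unfolding E_def exp_le_cancel_iff by (simp add: distrib_left)
      also have "\<dots> = W (\<theta>' g)" unfolding W_def t E_def exp_add fst_conv snd_conv by (simp only: mult.assoc)
      finally show ?thesis .
    qed
    then have D1: "sum E D \<le> (\<Sum>g\<in>D. W (\<theta>' g))" by (rule sum_mono)
    have D2: "sum W (\<theta>' ` D) = (\<Sum>g\<in>D. W (\<theta>' g))" using sum.reindex[OF inj, of W] by simp
    have D3: "sum W (\<theta>' ` D) \<le> sum W X"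
    proof (rule sum_mono2[OF finX img])
      show "0 \<le> W x" for x unfolding W_def by (intro mult_nonneg_nonneg E0 exp_ge_zero)
    qed
    define Q where "Q = (\<Sum>x\<in>U' \<times> O' \<union> U \<times> O''. E (fst x) * E (snd x))"
    have D4: "sum W X = exp (4 * M1 * om) * (Q * sum E (B n))"
    proof -
      have "sum W X = (\<Sum>x\<in>U' \<times> O' \<union> U \<times> O''. \<Sum>w\<in>B n. W (x, w))"
        unfolding X_def by (simp add: sum.cartesian_product)
      also have "\<dots> = (\<Sum>x\<in>U' \<times> O' \<union> U \<times> O''. \<Sum>w\<in>B n. exp (4 * M1 * om) * ((E (fst x) * E (snd x)) * E w))"
        by (simp only: W_def fst_conv snd_conv)
      also have "\<dots> = exp (4 * M1 * om) * (Q * sum E (B n))"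
        using sum_sum_const_mult[where f = "\<lambda>x. E (fst x) * E (snd x)" and g = E
          and c = "exp (4 * M1 * om)" and Q = "U' \<times> O' \<union> U \<times> O''" and B = "B n"]
        by (simp only: Q_def)
      finally show ?thesis .
    qed
    have EU: "E u \<le> exp 1 * exp (- om * len u)" if "u \<in> U" for u
    proof -
      have "(om - s) * len u \<le> (om - s) * (R + M1)"
        using that s(2) by (intro mult_left_mono) (auto simp: U_def B_def)
      then have "- s * len u \<le> 1 + (- om * len u)" using s(3) by (simp add: algebra_simps)
      then show ?thesis unfolding E_def by (metis exp_add exp_le_cancel_iff)
    qed
    have EO: "E b \<le> exp (- s0 * len b)" for b using s(1) by (simp add: E_def mult_right_mono)
    have Q0: "Q \<le> (\<Sum>x\<in>U' \<times> O'. E (fst x) * E (snd x)) + (\<Sum>x\<in>U \<times> O''. E (fst x) * E (snd x))"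
    proof -
      have "0 \<le> (\<Sum>x\<in>(U' \<times> O') \<inter> (U \<times> O''). E (fst x) * E (snd x))"
        by (intro sum_nonneg mult_nonneg_nonneg E0)
      then show ?thesis unfolding Q_def
        using sum_Un[of "U' \<times> O'" "U \<times> O''" "\<lambda>x. E (fst x) * E (snd x)"] fin by simp
    qed
    have cart: "(\<Sum>x\<in>P \<times> P'. E (fst x) * E (snd x)) = sum E P * sum E P'" for P P'
      unfolding sum_product sum.cartesian_product by (simp only: case_prod_unfold)
    have Q1: "Q \<le> sum E U' * sum E O' + sum E U * sum E O''"
      using Q0 unfolding cart .
    have U'1: "(\<Sum>u\<in>U'. exp (- om * len u)) \<le> e"
      by (rule R1) (use fin in \<open>auto simp: U'_def U_def B_def\<close>)
    have "sum E U' \<le> (\<Sum>u\<in>U'. exp 1 * exp (- om * len u))" by (intro sum_mono EU) (auto simp: U'_def)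
    also have "\<dots> = exp 1 * (\<Sum>u\<in>U'. exp (- om * len u))" by (rule sum_distrib_left[symmetric])
    also have "\<dots> \<le> exp 1 * e" using U'1 by (rule mult_left_mono) simp
    finally have Q2: "sum E U' \<le> exp 1 * e" .
    have U1: "(\<Sum>u\<in>U. exp (- om * len u)) \<le> PG"
      by (rule PG) (use fin in \<open>auto simp: U_def B_def\<close>)
    have "sum E U \<le> (\<Sum>u\<in>U. exp 1 * exp (- om * len u))" by (intro sum_mono EU)
    also have "\<dots> = exp 1 * (\<Sum>u\<in>U. exp (- om * len u))" by (rule sum_distrib_left[symmetric])
    also have "\<dots> \<le> exp 1 * PG" using U1 by (rule mult_left_mono) simp
    finally have Q3: "sum E U \<le> exp 1 * PG" .
    have "sum E O' \<le> (\<Sum>b\<in>O'. exp (- s0 * len b))" by (rule sum_mono) (rule EO)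
    also have "\<dots> \<le> PA" by (rule PA) (use fin in \<open>auto simp: O'_def\<close>)
    finally have Q4: "sum E O' \<le> PA" .
    have "sum E O'' \<le> (\<Sum>b\<in>O''. exp (- s0 * len b))" by (rule sum_mono) (rule EO)
    also have "\<dots> \<le> e" by (rule R2) (use fin in \<open>auto simp: O'_def O''_def\<close>)
    finally have Q5: "sum E O'' \<le> e" .
    have S0: "0 \<le> sum E Y" for Y by (intro sum_nonneg E0)
    have "sum E U' * sum E O' \<le> (exp 1 * e) * PA"
      using Q2 Q4 e0 by (intro mult_mono S0) auto
    moreover have "sum E U * sum E O'' \<le> (exp 1 * PG) * e"
      using Q3 Q5 PG0 by (intro mult_mono S0) auto
    ultimately have Q6: "Q \<le> exp 1 * e * (PA + PG)" using Q1 by (simp add: algebra_simps)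
    have "exp (4 * M1 * om) * (exp 1 * e * (PA + PG)) = (PA + PG) / (4 * (PG + PA + 1))"
      unfolding e_def using PG0 PA0 by (simp add: exp_minus divide_simps)
    also have "\<dots> \<le> 1 / 2" using PG0 PA0 by (simp add: divide_simps)
    finally have Q7: "exp (4 * M1 * om) * (exp 1 * e * (PA + PG)) \<le> 1 / 2" .
    have "exp (4 * M1 * om) * Q \<le> 1 / 2"
      by (rule order_trans[OF mult_left_mono[OF Q6] Q7]) simp
    then have "exp (4 * M1 * om) * Q * sum E (B n) \<le> 1 / 2 * sum E (B n)"
      by (rule mult_right_mono[OF _ S0])
    then have "sum E D \<le> sum E (B n) / 2" using D1 D2 D3 D4 by (simp add: mult.assoc)
    moreover have "sum E (B n) \<le> sum E (B R) + sum E D"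
    proof -
      have fD: "finite D" using finB[of n] by (simp add: D_def)
      have "sum E (B n) \<le> sum E (B R \<union> D)"
        by (rule sum_mono2) (use finB[of R] fD E0 in \<open>auto simp: D_def B_def\<close>)
      also have "\<dots> = sum E (B R) + sum E D"
        by (rule sum.union_disjoint) (use finB[of R] fD in \<open>auto simp: D_def B_def\<close>)
      finally show ?thesis .
    qed
    ultimately show ?thesis by linarith
  qed
  have "E summable_on \<Gamma>"
  proof (rule nonneg_bdd_above_summable_on)
    show "bdd_above (sum E ` {F. F \<subseteq> \<Gamma> \<and> finite F})"
    proof (rule bdd_aboveI2)
      fix F assume "F \<in> {F. F \<subseteq> \<Gamma> \<and> finite F}"
      then have F: "F \<subseteq> \<Gamma>" "finite F" by auto
      define n where "n = Max (insert 0 (len ` F))"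
      have "F \<subseteq> B n" using F by (auto simp: B_def n_def intro!: Max_ge)
      then have "sum E F \<le> sum E (B n)" by (rule sum_mono2[OF finB]) (rule E0)
      also have "\<dots> \<le> 2 * sum E (B R)" using main[of n] by linarith
      finally show "sum E F \<le> 2 * sum E (B R)" .
    qed
  qed (rule E0)
  then have "growth p \<Gamma> \<le> ereal s"
    unfolding E_def using s(4) by (intro summable_growth) auto
  then show False using M(5) s(2) by simp
qed

end

section \<open>The Patterson--Sullivan measure\<close>

context hyp_action
begin

lemma decomp_sum:
  assumes "finite U" "finite V" "finite W" "0 \<le> s"
    and "\<And>g. g \<in> D \<Longrightarrow> \<exists>u\<in>U. \<exists>b\<in>V. \<exists>w\<in>W. g = u \<circ> b \<circ> w \<and> len u + len b + len w \<le> len g + c"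
  shows "(\<Sum>g\<in>D. exp (- s * len g)) \<le>
    exp (s * c) * ((\<Sum>u\<in>U. exp (- s * len u)) * (\<Sum>b\<in>V. exp (- s * len b)) * (\<Sum>w\<in>W. exp (- s * len w)))"
proof -
  define E where "E g = exp (- s * len g)" for g :: "'a \<Rightarrow> 'a"
  define F where "F x = fst (fst x) \<circ> snd (fst x) \<circ> snd x" for x :: "(('a \<Rightarrow> 'a) \<times> ('a \<Rightarrow> 'a)) \<times> ('a \<Rightarrow> 'a)"
  define X where "X = {x \<in> (U \<times> V) \<times> W. len (fst (fst x)) + len (snd (fst x)) + len (snd x) \<le> len (F x) + c}"
  define H where "H x = E (fst (fst x)) * E (snd (fst x)) * E (snd x)" for x
  have E0: "0 \<le> E g" for g by (simp add: E_def)
  have fX: "finite X" using assms(1-3) by (simp add: X_def)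
  have sub: "D \<subseteq> F ` X"
  proof
    fix g assume "g \<in> D"
    then obtain u b w where "u \<in> U" "b \<in> V" "w \<in> W" "g = u \<circ> b \<circ> w" "len u + len b + len w \<le> len g + c"
      using assms(5) by blast
    then show "g \<in> F ` X" by (intro image_eqI[of _ _ "((u, b), w)"]) (auto simp: X_def F_def)
  qed
  have "sum E D \<le> sum E (F ` X)" by (rule sum_mono2) (use sub fX E0 in auto)
  also have "\<dots> \<le> (\<Sum>x\<in>X. E (F x))" using sum_image_le[of X E F] fX E0 by simp
  also have "\<dots> \<le> (\<Sum>x\<in>X. exp (s * c) * H x)"
  proof (rule sum_mono)
    fix x assume x: "x \<in> X"
    obtain u b w where t: "x = ((u, b), w)" by (metis surj_pair)
    have "len u + len b + len w \<le> len (F x) + c" using x unfolding X_def t by simp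
    then have "s * (len u + len b + len w) \<le> s * (len (F x) + c)" using assms(4) by (rule mult_left_mono)
    then have "E (F x) \<le> exp (s * c + (- s * len u + - s * len b + - s * len w))"
      unfolding E_def exp_le_cancel_iff by (simp add: distrib_left)
    also have "\<dots> = exp (s * c) * H x" unfolding H_def E_def t exp_add by simp
    finally show "E (F x) \<le> exp (s * c) * H x" .
  qed
  also have "\<dots> \<le> (\<Sum>x\<in>(U \<times> V) \<times> W. exp (s * c) * H x)"
    by (rule sum_mono2) (use assms(1-3) E0 in \<open>auto simp: X_def H_def\<close>)
  also have "\<dots> = exp (s * c) * (\<Sum>x\<in>(U \<times> V) \<times> W. H x)" by (rule sum_distrib_left[symmetric])
  also have "(\<Sum>x\<in>(U \<times> V) \<times> W. H x) = (\<Sum>y\<in>U \<times> V. \<Sum>w\<in>W. H (y, w))"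
    unfolding sum.cartesian_product by (simp add: case_prod_unfold)
  also have "\<dots> = (\<Sum>y\<in>U \<times> V. E (fst y) * E (snd y)) * sum E W"
    unfolding H_def fst_conv snd_conv sum_product by (rule refl)
  also have "(\<Sum>y\<in>U \<times> V. E (fst y) * E (snd y)) = sum E U * sum E V"
    unfolding sum_product sum.cartesian_product by (simp add: case_prod_unfold)
  finally show ?thesis unfolding E_def .
qed

end

locale ps_action = scc_action p \<delta> \<Gamma> for p :: "'a::metric_space" and \<delta> :: real and \<Gamma> +
  fixes \<nu> :: "'a bordification measure"
  assumes psw: "ps_weak_limit p \<Gamma> \<nu>"
begin

sublocale finite_measure \<nu>
  using psw by (simp add: ps_weak_limit_def)

lemma sets_nu: "sets \<nu> = sigma_sets Z {U. openin T U}"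
  using psw openin_subset[of T]
  by (auto simp: ps_weak_limit_def borel_sets_measure_def sets_measure_of_conv)

lemma space_nu [simp]: "space \<nu> = Z"
  using psw sets_eq_imp_space_eq[of \<nu> "borel_sets_measure T"]
  by (simp add: ps_weak_limit_def borel_sets_measure_def space_measure_of_conv)

lemma open_sets: "openin T U \<Longrightarrow> U \<in> sets \<nu>"
  by (simp add: sets_nu sigma_sets.Basic)

lemma closed_sets: "closedin T K \<Longrightarrow> K \<in> sets \<nu>"
  using sets.compl_sets[of "Z - K" \<nu>] open_sets[of "Z - K"]
  by (metis Diff_Diff_Int closedin_def inf.absorb_iff2 space_nu sets.compl_sets topspace_T)

lemma continuous_measurable:
  assumes "continuous_map T euclideanreal \<phi>" shows "\<phi> \<in> borel_measurable \<nu>"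
proof (rule borel_measurableI)
  fix S :: "real set" assume "open S"
  then have "openin T {x \<in> topspace T. \<phi> x \<in> S}"
    using assms by (simp add: continuous_map_def)
  then have "{x \<in> topspace T. \<phi> x \<in> S} \<in> sets \<nu>" by (rule open_sets)
  moreover have "{x \<in> topspace T. \<phi> x \<in> S} = \<phi> -` S \<inter> space \<nu>" by auto
  ultimately show "\<phi> -` S \<inter> space \<nu> \<in> sets \<nu>" by simp
qed

lemma act_measurable:
  assumes "isometry g" shows "act g \<in> measurable \<nu> \<nu>"
proof (rule measurable_sigma_sets[OF sets_nu])
  show "{U. openin T U} \<subseteq> Pow Z" using openin_subset by force
  show "act g \<in> space \<nu> \<rightarrow> Z" using act_Z[OF assms] by auto
  fix U assume "U \<in> {U. openin T U}"
  then have "openin T {x \<in> topspace T. act g x \<in> U}"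
    using continuous_act[OF assms] by (simp add: continuous_map_def)
  moreover have "{x \<in> topspace T. act g x \<in> U} = act g -` U \<inter> space \<nu>" by auto
  ultimately show "act g -` U \<inter> space \<nu> \<in> sets \<nu>" using open_sets by metis
qed

lemma act_sets:
  assumes "isometry g" "E \<in> sets \<nu>" shows "act g ` E \<in> sets \<nu>"
proof -
  have "act (ivt g) -` E \<inter> space \<nu> \<in> sets \<nu>"
    using act_measurable[OF isometry_ivt[OF assms(1)]] assms(2) by (rule measurable_sets)
  moreover have "E \<subseteq> Z" using sets.sets_into_space[OF assms(2)] by simp
  then have "act (ivt g) -` E \<inter> space \<nu> = act g ` E"
    unfolding act_image_eq[OF assms(1)] using act_Z[OF assms(1)] act_ivt(1)[OF assms(1)]
    by (auto simp del: act_ivt) (metis subsetD)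
  ultimately show ?thesis by simp
qed

lemma nu_mono: "A \<subseteq> B \<Longrightarrow> B \<in> sets \<nu> \<Longrightarrow> measure \<nu> A \<le> measure \<nu> B"
  by (rule finite_measure_mono)

section \<open>Poincare sums over subsets and the passage to the weak limit\<close>

definition PS :: "('a \<Rightarrow> 'a) set \<Rightarrow> real \<Rightarrow> real" where
  "PS A s = (\<Sum>\<^sub>\<infinity>g\<in>A. exp (- s * len g))"

lemma PS_summable: "A \<subseteq> \<Gamma> \<Longrightarrow> om < s \<Longrightarrow> (\<lambda>g. exp (- s * len g)) summable_on A"
  using growth_summable[of \<Gamma> s] growth_om om_pos summable_on_subset_banach by fastforce

lemma PS_nonneg: "0 \<le> PS A s"
  by (simp add: PS_def infsum_nonneg)

lemma PS_finite_le: "A \<subseteq> \<Gamma> \<Longrightarrow> om < s \<Longrightarrow> finite F \<Longrightarrow> F \<subseteq> A \<Longrightarrow> (\<Sum>g\<in>F. exp (- s * len g)) \<le> PS A s"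
  unfolding PS_def using PS_summable by (intro finite_sum_le_infsum) auto

lemma PS_leI:
  assumes "A \<subseteq> \<Gamma>" "om < s" "\<And>F. finite F \<Longrightarrow> F \<subseteq> A \<Longrightarrow> (\<Sum>g\<in>F. exp (- s * len g)) \<le> c"
  shows "PS A s \<le> c"
  unfolding PS_def using PS_summable[OF assms(1,2)] assms(3) by (rule infsum_le_finite_sums)

lemma PS_pos: assumes "om < s" shows "0 < PS \<Gamma> s"
proof -
  have "exp (- s * len id) \<le> PS \<Gamma> s" using PS_finite_le[of \<Gamma> s "{id}"] assms G_id by simp
  then show ?thesis by simp
qed

definition PSf :: "('a bordification \<Rightarrow> real) \<Rightarrow> real \<Rightarrow> real" where
  "PSf \<phi> s = (\<Sum>\<^sub>\<infinity>g\<in>\<Gamma>. exp (- s * len g) * \<phi> (Inl (g p)))"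

lemma PSf_summable:
  assumes "om < s" "\<And>z. z \<in> Z \<Longrightarrow> 0 \<le> \<phi> z" "\<And>z. z \<in> Z \<Longrightarrow> \<phi> z \<le> 1"
  shows "(\<lambda>g. exp (- s * len g) * \<phi> (Inl (g p))) summable_on \<Gamma>"
  by (rule summable_on_comparison_test[OF PS_summable[OF order_refl assms(1)]])
    (use assms(2,3) in \<open>auto simp: mult_left_le\<close>)

lemma integral_ps_approx:
  assumes s: "om < s" and c: "continuous_map T euclideanreal \<phi>"
    and b: "\<And>z. z \<in> Z \<Longrightarrow> 0 \<le> \<phi> z" "\<And>z. z \<in> Z \<Longrightarrow> \<phi> z \<le> 1"
  shows "integral\<^sup>L (ps_approx p \<Gamma> s) \<phi> = PSf \<phi> s / PS \<Gamma> s"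
proof -
  define w where "w g = exp (- s * len g) / PS \<Gamma> s" for g :: "'a \<Rightarrow> 'a"
  have w0: "0 \<le> w g" for g using PS_nonneg by (simp add: w_def)
  have sets_eq: "sets (borel_sets_measure T) = sets \<nu>" using psw by (simp add: ps_weak_limit_def)
  have sp: "space (borel_sets_measure T) = Z" using sets_eq_imp_space_eq[OF sets_eq] by simp
  have \<phi>m: "\<phi> \<in> borel_measurable (borel_sets_measure T)"
    using continuous_measurable[OF c] measurable_cong_sets[OF sets_eq refl] by blast
  have "integral\<^sup>L (ps_approx p \<Gamma> s) \<phi> = integral\<^sup>L (point_measure \<Gamma> (\<lambda>g. ennreal (w g))) (\<lambda>g. \<phi> (Inl (g p)))"
    unfolding ps_approx_def w_def PS_def poincare_series_def
    by (rule integral_distr[OF _ \<phi>m]) (auto simp: measurable_def sp space_point_measure sets_point_measure)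
  also have "\<dots> = integral\<^sup>L (count_space \<Gamma>) (\<lambda>g. w g *\<^sub>R \<phi> (Inl (g p)))"
    unfolding point_measure_def by (rule integral_density) (auto simp: w0)
  also have "\<dots> = infsetsum (\<lambda>g. w g * \<phi> (Inl (g p))) \<Gamma>" by (simp add: infsetsum_def)
  also have "\<dots> = infsum (\<lambda>g. w g * \<phi> (Inl (g p))) \<Gamma>"
  proof (rule infsetsum_infsum[OF abs_summable_equivalent[THEN iffD1]])
    have "(\<lambda>g. (1 / PS \<Gamma> s) * (exp (- s * len g) * \<phi> (Inl (g p)))) summable_on \<Gamma>"
      by (rule summable_on_cmult_right[OF PSf_summable[OF s b]])
    moreover have "norm (w g * \<phi> (Inl (g p))) = (1 / PS \<Gamma> s) * (exp (- s * len g) * \<phi> (Inl (g p)))" for g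
      using b w0 by (simp add: abs_mult w_def PS_nonneg)
    ultimately show "(\<lambda>g. norm (w g * \<phi> (Inl (g p)))) summable_on \<Gamma>" by simp
  qed
  also have "\<dots> = infsum (\<lambda>g. (1 / PS \<Gamma> s) * (exp (- s * len g) * \<phi> (Inl (g p)))) \<Gamma>"
    by (simp add: w_def)
  also have "\<dots> = (1 / PS \<Gamma> s) * PSf \<phi> s" unfolding PSf_def by (rule infsum_cmult_right')
  finally show ?thesis by simp
qed

text \<open>Finite partial sums are continuous in the exponent, so divergence at \<open>om\<close>
  drives the normalising series to infinity along \<open>s i\<close>. Every contribution that stays
  bounded then disappears in the limit.\<close>

lemma ps_sequence:
  "\<exists>s :: nat \<Rightarrow> real. (\<forall>i. om < s i) \<and> s \<longlonglongrightarrow> om \<and> filterlim (\<lambda>i. PS \<Gamma> (s i)) at_top sequentially \<and>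
    (\<forall>\<phi>. testfun \<phi> \<longrightarrow> (\<lambda>i. PSf \<phi> (s i) / PS \<Gamma> (s i)) \<longlonglongrightarrow> integral\<^sup>L \<nu> \<phi>)"
proof -
  obtain s where s: "decseq s" "\<And>i. growth p \<Gamma> < ereal (s i)" "(\<lambda>i. ereal (s i)) \<longlonglongrightarrow> growth p \<Gamma>"
    and w: "\<And>\<phi> :: 'a bordification \<Rightarrow> real. continuous_map T euclideanreal \<phi> \<Longrightarrow> bounded (\<phi> ` Z) \<Longrightarrow>
        (\<lambda>i. integral\<^sup>L (ps_approx p \<Gamma> (s i)) \<phi>) \<longlonglongrightarrow> integral\<^sup>L \<nu> \<phi>"
    using psw unfolding ps_weak_limit_def topspace_T by blast
  have om_s: "om < s i" for i using s(2)[of i] growth_om by simp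
  have lim: "s \<longlonglongrightarrow> om" using s(3) growth_om by simp
  have "filterlim (\<lambda>i. PS \<Gamma> (s i)) at_top sequentially"
    unfolding filterlim_at_top
  proof
    fix K :: real
    have "\<not> bdd_above (sum (\<lambda>g. exp (- om * len g)) ` {F. F \<subseteq> \<Gamma> \<and> finite F})"
      using poincare_divergence nonneg_bdd_above_summable_on[of \<Gamma> "\<lambda>g. exp (- om * len g)"] by auto
    then obtain F where F: "F \<subseteq> \<Gamma>" "finite F" "K < (\<Sum>g\<in>F. exp (- om * len g))"
      unfolding bdd_above_def by (metis (mono_tags, lifting) imageE mem_Collect_eq not_le)
    have "(\<lambda>i. \<Sum>g\<in>F. exp (- s i * len g)) \<longlonglongrightarrow> (\<Sum>g\<in>F. exp (- om * len g))"
      by (intro tendsto_intros lim)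
    then have "\<forall>\<^sub>F i in sequentially. K < (\<Sum>g\<in>F. exp (- s i * len g))"
      using F(3) by (rule order_tendstoD(1))
    then show "\<forall>\<^sub>F i in sequentially. K \<le> PS \<Gamma> (s i)"
      by eventually_elim (use PS_finite_le[OF order_refl om_s F(2,1)] in \<open>meson less_imp_le order_trans\<close>)
  qed
  moreover have "(\<lambda>i. PSf \<phi> (s i) / PS \<Gamma> (s i)) \<longlonglongrightarrow> integral\<^sup>L \<nu> \<phi>"
    if "testfun \<phi>" for \<phi>
  proof -
    have t: "continuous_map T euclideanreal \<phi>" "\<And>z. z \<in> Z \<Longrightarrow> 0 \<le> \<phi> z" "\<And>z. z \<in> Z \<Longrightarrow> \<phi> z \<le> 1"
      using that by (simp_all add: testfun_def)
    have "bounded (\<phi> ` Z)" using t(2,3) unfolding bounded_iff by (intro exI[of _ 1]) auto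
    then show ?thesis using w[OF t(1)] integral_ps_approx[OF om_s t] by simp
  qed
  ultimately show ?thesis using om_s lim by (intro exI[of _ s]) simp
qed

lemma nu_integrable:
  assumes "continuous_map T euclideanreal \<phi>" "\<And>z. z \<in> Z \<Longrightarrow> 0 \<le> \<phi> z" "\<And>z. z \<in> Z \<Longrightarrow> \<phi> z \<le> 1"
  shows "integrable \<nu> \<phi>"
  by (rule integrable_const_bound[where B = 1])
    (use assms continuous_measurable in \<open>auto intro!: AE_I2\<close>)

lemma measure_le_integral:
  assumes "continuous_map T euclideanreal \<phi>" "\<And>z. z \<in> Z \<Longrightarrow> 0 \<le> \<phi> z" "\<And>z. z \<in> Z \<Longrightarrow> \<phi> z \<le> 1"
    "K \<in> sets \<nu>" "\<And>z. z \<in> K \<Longrightarrow> \<phi> z = 1"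
  shows "measure \<nu> K \<le> integral\<^sup>L \<nu> \<phi>"
proof -
  have KZ: "K \<inter> Z = K" using sets.sets_into_space[OF assms(4)] by auto
  have "measure \<nu> K = integral\<^sup>L \<nu> (indicator K)" using KZ by simp
  also have "\<dots> \<le> integral\<^sup>L \<nu> \<phi>"
    by (rule integral_mono[OF _ nu_integrable[OF assms(1-3)]])
      (use assms KZ in \<open>auto simp: indicator_def integrable_indicator_iff emeasure_eq_measure\<close>)
  finally show ?thesis .
qed

lemma integral_le_measure:
  assumes "continuous_map T euclideanreal \<phi>" "\<And>z. z \<in> Z \<Longrightarrow> 0 \<le> \<phi> z" "\<And>z. z \<in> Z \<Longrightarrow> \<phi> z \<le> 1"
    "V \<in> sets \<nu>" "\<And>z. z \<in> Z - V \<Longrightarrow> \<phi> z = 0"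
  shows "integral\<^sup>L \<nu> \<phi> \<le> measure \<nu> V"
proof -
  have VZ: "V \<inter> Z = V" using sets.sets_into_space[OF assms(4)] by auto
  have "integral\<^sup>L \<nu> \<phi> \<le> integral\<^sup>L \<nu> (indicator V)"
    by (rule integral_mono[OF nu_integrable[OF assms(1-3)]])
      (use assms VZ in \<open>auto simp: indicator_def integrable_indicator_iff emeasure_eq_measure\<close>)
  also have "\<dots> = measure \<nu> V" using VZ by simp
  finally show ?thesis .
qed

text \<open>The additive \<open>b\<close> collects the finitely many elements of bounded length that
  an estimate at a fixed scale does not control; division by the diverging normalisation removes
  it.\<close>

lemma portmanteau_upper:
  assumes "closedin T K" "openin T V" "K \<subseteq> V"
    and bound: "\<And>s. om < s \<Longrightarrow> s \<le> om + 1 \<Longrightarrow> PS {g \<in> \<Gamma>. Inl (g p) \<in> V} s \<le> a * PS \<Gamma> s + b"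
  shows "measure \<nu> K \<le> a"
proof -
  obtain s :: "nat \<Rightarrow> real" where s: "\<And>i. om < s i" "s \<longlonglongrightarrow> om"
    "filterlim (\<lambda>i. PS \<Gamma> (s i)) at_top sequentially"
    and w: "\<And>\<phi>. testfun \<phi> \<Longrightarrow> (\<lambda>i. PSf \<phi> (s i) / PS \<Gamma> (s i)) \<longlonglongrightarrow> integral\<^sup>L \<nu> \<phi>"
    using ps_sequence by blast
  have c: "closedin T (Z - V)" "(Z - V) \<inter> K = {}"
    using closedin_diff[OF closedin_topspace assms(2)] assms(3) by auto
  obtain \<phi> where tf: "testfun \<phi>" and \<phi>45: "\<forall>z\<in>Z - V. \<phi> z = 0" "\<forall>z\<in>K. \<phi> z = 1"
    using Urysohn_T[OF c(1) assms(1) c(2)] by blast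
  have \<phi>: "continuous_map T euclideanreal \<phi>" "\<And>z. z \<in> Z \<Longrightarrow> 0 \<le> \<phi> z" "\<And>z. z \<in> Z \<Longrightarrow> \<phi> z \<le> 1"
    "\<And>z. z \<in> Z - V \<Longrightarrow> \<phi> z = 0" "\<And>z. z \<in> K \<Longrightarrow> \<phi> z = 1"
    using tf \<phi>45 by (simp_all add: testfun_def)
  have le: "PSf \<phi> t \<le> PS {g \<in> \<Gamma>. Inl (g p) \<in> V} t" if t: "om < t" for t
  proof -
    have "PSf \<phi> t = (\<Sum>\<^sub>\<infinity>g\<in>{g \<in> \<Gamma>. Inl (g p) \<in> V}. exp (- t * len g) * \<phi> (Inl (g p)))"
      unfolding PSf_def by (rule infsum_cong_neutral) (use \<phi>(4) in auto)
    also have "\<dots> \<le> PS {g \<in> \<Gamma>. Inl (g p) \<in> V} t"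
      unfolding PS_def
    proof (rule infsum_mono)
      show "(\<lambda>g. exp (- t * len g) * \<phi> (Inl (g p))) summable_on {g \<in> \<Gamma>. Inl (g p) \<in> V}"
        by (rule summable_on_subset_banach[OF PSf_summable[OF t \<phi>(2,3)]]) auto
      show "(\<lambda>g. exp (- t * len g)) summable_on {g \<in> \<Gamma>. Inl (g p) \<in> V}"
        by (rule PS_summable[OF _ t]) auto
    qed (use \<phi>(3) in \<open>auto simp: mult_left_le\<close>)
    finally show ?thesis .
  qed
  have ev: "\<forall>\<^sub>F i in sequentially. s i < om + 1" using s(2) by (rule order_tendstoD(2)) simp
  have "(\<lambda>i. a + b / PS \<Gamma> (s i)) \<longlonglongrightarrow> a + 0"
    by (intro tendsto_intros real_tendsto_divide_at_top[OF tendsto_const s(3)])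
  moreover have "\<forall>\<^sub>F i in sequentially. PSf \<phi> (s i) / PS \<Gamma> (s i) \<le> a + b / PS \<Gamma> (s i)"
    using ev
  proof eventually_elim
    case (elim i)
    have "PSf \<phi> (s i) \<le> a * PS \<Gamma> (s i) + b" using le[OF s(1)] bound[OF s(1), of i] elim by (meson less_imp_le order_trans)
    then show ?case using PS_pos[OF s(1), of i] by (simp add: divide_simps)
  qed
  ultimately have "integral\<^sup>L \<nu> \<phi> \<le> a"
    using tendsto_le[OF trivial_limit_sequentially _ w[OF tf]] by fastforce
  then show ?thesis
    using measure_le_integral[OF \<phi>(1-3) closed_sets[OF assms(1)] \<phi>(5)] by linarith
qed

lemma nu_Z: "measure \<nu> Z = 1"
proof -
  obtain s :: "nat \<Rightarrow> real" where s: "\<And>i. om < s i" "s \<longlonglongrightarrow> om"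
    "filterlim (\<lambda>i. PS \<Gamma> (s i)) at_top sequentially"
    and w: "\<And>\<phi>. testfun \<phi> \<Longrightarrow> (\<lambda>i. PSf \<phi> (s i) / PS \<Gamma> (s i)) \<longlonglongrightarrow> integral\<^sup>L \<nu> \<phi>"
    using ps_sequence by blast
  have "PSf (\<lambda>_. 1) (s i) / PS \<Gamma> (s i) = 1" for i
    using PS_pos[OF s(1), of i] by (simp add: PSf_def PS_def)
  moreover have "(\<lambda>i. PSf (\<lambda>_. 1) (s i) / PS \<Gamma> (s i)) \<longlonglongrightarrow> integral\<^sup>L \<nu> (\<lambda>_. 1)"
    by (rule w) (simp add: testfun_def)
  ultimately have "(\<lambda>i::nat. 1) \<longlonglongrightarrow> integral\<^sup>L \<nu> (\<lambda>_. 1 :: real)" by (simp only:)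
  then have "integral\<^sup>L \<nu> (\<lambda>_. 1 :: real) = 1" by (rule LIMSEQ_unique[OF _ tendsto_const])
  then show ?thesis by simp
qed

lemma closedin_Inl_cball: "closedin T (Inl ` cball p r)"
proof -
  have "compactin T (Inl ` cball p r)"
  proof (rule image_compactin)
    show "compactin euclidean (cball p r)" using proper by simp
    show "continuous_map euclidean T (Inl :: 'a \<Rightarrow> 'a bordification)"
      unfolding continuous_map_def using open_char by (auto simp: vimage_def)
  qed
  then show ?thesis using compactin_imp_closedin Hausdorff_T by blast
qed

lemma closedin_Bd: "closedin T Bd"
proof -
  have "Z - Bd = range Inl" by (auto simp: gromov_closure_def)
  then show ?thesis unfolding closedin_def using openin_Inl[OF open_UNIV] Bd_in_Z by auto
qed

text \<open>A ball contains the orbit points of finitely many elements only, so its contribution is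
  bounded and \<open>portmanteau_upper\<close> applies with \<open>a = 0\<close>. Countably many
  balls exhaust the space.\<close>

lemma nu_interior: "measure \<nu> (range Inl) = 0"
proof -
  have z: "measure \<nu> (Inl ` cball p r) = 0" for r
  proof -
    have "measure \<nu> (Inl ` cball p r) \<le> 0"
    proof (rule portmanteau_upper[OF closedin_Inl_cball openin_Inl[OF open_ball[of p "r + 1"]]])
      define F where "F = {g \<in> \<Gamma>. len g \<le> r + 1}"
      fix s assume s: "om < s"
      have "PS {g \<in> \<Gamma>. Inl (g p) \<in> (Inl ` ball p (r + 1) :: 'a bordification set)} s \<le> real (card F)"
      proof (rule PS_leI[OF _ s])
        fix D assume D: "finite D" "D \<subseteq> {g \<in> \<Gamma>. Inl (g p) \<in> (Inl ` ball p (r + 1) :: 'a bordification set)}"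
        have "(\<Sum>g\<in>D. exp (- s * len g)) \<le> (\<Sum>g\<in>D. 1)"
          using s om_pos by (intro sum_mono) auto
        also have "\<dots> \<le> real (card F)"
        proof -
          have "D \<subseteq> F" using D(2) by (auto simp: F_def)
          then show ?thesis using card_mono[of F D] finite_ball[of "r + 1"] by (simp add: F_def)
        qed
        finally show "(\<Sum>g\<in>D. exp (- s * len g)) \<le> real (card F)" .
      qed auto
      then show "PS {g \<in> \<Gamma>. Inl (g p) \<in> (Inl ` ball p (r + 1) :: 'a bordification set)} s \<le> 0 * PS \<Gamma> s + real (card F)"
        by simp
    qed auto
    then show ?thesis by (simp add: measure_le_0_iff)
  qed
  have "range Inl = (\<Union>n::nat. Inl ` cball p (real n) :: 'a bordification set)"
    using real_arch_simple by (force simp: image_iff)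
  moreover have "(\<Union>n::nat. Inl ` cball p (real n)) \<in> null_sets \<nu>"
    using z closed_sets[OF closedin_Inl_cball]
    by (intro null_sets_UN) (auto simp: null_sets_def emeasure_eq_measure)
  ultimately show ?thesis by (simp add: measure_eq_0_null_sets)
qed

lemma Inl_sets: "range Inl \<in> sets \<nu>"
  using open_sets[OF openin_Inl[OF open_UNIV]] .

lemma Bd_sets: "Bd \<in> sets \<nu>"
  by (rule closed_sets[OF closedin_Bd])

lemma nu_Int_Bd: "E \<in> sets \<nu> \<Longrightarrow> measure \<nu> (E \<inter> Bd) = measure \<nu> E"
proof -
  assume E: "E \<in> sets \<nu>"
  have "E = (E \<inter> Bd) \<union> (E \<inter> range Inl)" "(E \<inter> Bd) \<inter> (E \<inter> range Inl) = {}"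
    using sets.sets_into_space[OF E] by (auto simp: gromov_closure_def)
  then have "measure \<nu> E = measure \<nu> (E \<inter> Bd) + measure \<nu> (E \<inter> range Inl)"
    using finite_measure_Union[of "E \<inter> Bd" "E \<inter> range Inl"] E Bd_sets Inl_sets by auto
  moreover have "measure \<nu> (E \<inter> range Inl) \<le> 0"
    using nu_mono[OF _ Inl_sets, of "E \<inter> range Inl"] nu_interior by auto
  ultimately show ?thesis using measure_nonneg[of \<nu> "E \<inter> range Inl"] by linarith
qed

lemma nu_Bd: "measure \<nu> Bd = 1"
  using nu_Int_Bd[OF sets.top, of] nu_Z Bd_in_Z by (simp add: Int_absorb1 subsetI)

end

context ps_action
begin

subsection \<open>Regularity\<close>

text \<open>Sets that can be squeezed between closed and open sets are stable under complements and
  countable unions. For an open set the closed exhaustion of its boundary part is enough, because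
  \<open>range Inl\<close> is null.\<close>

lemma regular:
  assumes "E \<in> sets \<nu>" "0 < e"
  shows "\<exists>K V. closedin T K \<and> openin T V \<and> K \<subseteq> E \<and> E \<subseteq> V \<and> measure \<nu> (V - K) < e"
proof -
  have "E \<in> sigma_sets Z {U. openin T U}" using assms(1) sets_nu by simp
  then show ?thesis using assms(2)
  proof (induction arbitrary: e rule: sigma_sets.induct)
    case (Basic U)
    then have U: "openin T U" by simp
    obtain \<K> where K: "countable \<K>" "\<forall>K\<in>\<K>. closedin T K \<and> K \<subseteq> U" "U \<inter> Bd \<subseteq> \<Union>\<K>"
      using open_Fsigma[OF U] by (elim exE conjE)
    define k where "k n = from_nat_into (insert {} \<K>) n" for n
    have k: "closedin T (k n)" "k n \<subseteq> U" for n
    proof -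
      have "k n \<in> insert {} \<K>" unfolding k_def by (rule from_nat_into) simp
      then consider "k n = {}" | "k n \<in> \<K>" by (rule insertE)
      then have "closedin T (k n) \<and> k n \<subseteq> U"
      proof cases
        case 1
        then show ?thesis by simp
      next
        case 2
        with K(2) show ?thesis by (rule bspec)
      qed
      then show "closedin T (k n)" "k n \<subseteq> U" by blast+
    qed
    have kU: "(\<Union>n. k n) = \<Union>\<K>"
    proof -
      have "range k = insert {} \<K>" unfolding k_def using K(1) by (intro range_from_nat_into) auto
      then show ?thesis by simp
    qed
    define L where "L n = (\<Union>i<n. k i)" for n
    have L: "closedin T (L n)" "L n \<subseteq> U" for n
      using k by (auto simp: L_def intro!: closedin_Union)
    have "incseq L" unfolding L_def by (intro incseq_SucI) (auto simp: lessThan_Suc)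
    moreover have "range L \<subseteq> sets \<nu>" by (intro image_subsetI closed_sets L(1))
    ultimately have "(\<lambda>n. measure \<nu> (L n)) \<longlonglongrightarrow> measure \<nu> (\<Union>n. L n)"
      by (intro finite_Lim_measure_incseq)
    moreover have "(\<Union>n. L n) = (\<Union>n. k n)" by (auto simp: L_def)
    moreover have "measure \<nu> (\<Union>n. k n) = measure \<nu> U"
    proof (rule antisym)
      show "measure \<nu> (\<Union>n. k n) \<le> measure \<nu> U" using k(2) by (intro nu_mono open_sets[OF U]) blast
      have "measure \<nu> U = measure \<nu> (U \<inter> Bd)" by (rule nu_Int_Bd[OF open_sets[OF U], symmetric])
      also have "\<dots> \<le> measure \<nu> (\<Union>n. k n)" 
      proof (rule nu_mono)
        show "U \<inter> Bd \<subseteq> (\<Union>n. k n)" using K(3) kU by simp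
        show "(\<Union>n. k n) \<in> sets \<nu>" by (intro sets.countable_UN image_subsetI closed_sets k(1))
      qed
      finally show "measure \<nu> U \<le> measure \<nu> (\<Union>n. k n)" .
    qed
    ultimately have "(\<lambda>n. measure \<nu> (L n)) \<longlonglongrightarrow> measure \<nu> U" by simp
    then have "\<forall>\<^sub>F n in sequentially. measure \<nu> U - e < measure \<nu> (L n)"
      using \<open>0 < e\<close> by (intro order_tendstoD(1)) auto
    then obtain n where n: "measure \<nu> U - e < measure \<nu> (L n)"
      by (auto simp: eventually_sequentially)
    have "measure \<nu> (U - L n) = measure \<nu> U - measure \<nu> (L n)"
      by (intro finite_measure_Diff open_sets[OF U] closed_sets L)
    then show ?case using n L U by (intro exI[of _ "L n"] exI[of _ U]) auto
  next
    case Empty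
    then show ?case by (intro exI[of _ "{}"]) auto
  next
    case (Compl E)
    obtain K V where KV: "closedin T K" "openin T V" "K \<subseteq> E" "E \<subseteq> V" "measure \<nu> (V - K) < e"
      using Compl.IH[OF Compl.prems] by blast
    have "(Z - K) - (Z - V) = V - K" using openin_subset[OF KV(2)] by auto
    moreover have "closedin T (Z - V)" "openin T (Z - K)"
      using closedin_diff[OF closedin_topspace KV(2)] openin_diff[OF openin_topspace KV(1)] by simp_all
    ultimately show ?case using KV(3-5) by (intro exI[of _ "Z - V"] exI[of _ "Z - K"]) auto
  next
    case (Union E)
    \<comment> \<open>Half of \<open>e\<close> is spread over the members of the union; the other
      half pays for cutting the union of the closed sets down to a finite one.\<close>
    have e2: "0 < e / 2 * (1/2) ^ Suc i" for i using Union.prems by simp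
    have "\<forall>i. \<exists>X. closedin T (fst X) \<and> openin T (snd X) \<and> fst X \<subseteq> E i \<and> E i \<subseteq> snd X \<and>
        measure \<nu> (snd X - fst X) < e / 2 * (1/2) ^ Suc i"
      using Union.IH[OF e2] by (metis fst_conv snd_conv)
    from choice[OF this] obtain X where
      "\<forall>i. closedin T (fst (X i)) \<and> openin T (snd (X i)) \<and> fst (X i) \<subseteq> E i \<and> E i \<subseteq> snd (X i) \<and>
        measure \<nu> (snd (X i) - fst (X i)) < e / 2 * (1/2) ^ Suc i" ..
    then have X: "closedin T (fst (X i))" "openin T (snd (X i))" "fst (X i) \<subseteq> E i" "E i \<subseteq> snd (X i)"
        "measure \<nu> (snd (X i) - fst (X i)) < e / 2 * (1/2) ^ Suc i" for i
      by blast+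
    define V where "V = (\<Union>i. snd (X i))"
    define L where "L n = (\<Union>i<n. fst (X i))" for n
    have V: "openin T V" unfolding V_def using X(2) by blast
    have L: "closedin T (L n)" "L n \<subseteq> (\<Union>i. E i)" "L n \<subseteq> V" for n
    proof -
      show "closedin T (L n)" unfolding L_def using X(1) by (intro closedin_Union) auto
      show "L n \<subseteq> (\<Union>i. E i)" unfolding L_def using X(3) by blast
      have "fst (X i) \<subseteq> snd (X i)" for i using X(3,4)[of i] by (rule order_trans)
      then show "L n \<subseteq> V" unfolding L_def V_def by blast
    qed
    have Ls: "L n \<in> sets \<nu>" for n by (rule closed_sets[OF L(1)])
    have "incseq L" unfolding L_def by (intro incseq_SucI) (auto simp: lessThan_Suc)
    then have lim: "(\<lambda>n. measure \<nu> (L n)) \<longlonglongrightarrow> measure \<nu> (\<Union>n. L n)"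
      by (intro finite_Lim_measure_incseq image_subsetI Ls)
    have UL: "(\<Union>n. L n) = (\<Union>i. fst (X i))" by (auto simp: L_def)
    have ms: "snd (X i) - fst (X i) \<in> sets \<nu>" for i by (intro sets.Diff open_sets[OF X(2)] closed_sets[OF X(1)])
    have sm: "(\<lambda>i. e / 2 * (1/2::real) ^ Suc i) sums (e / 2)"
      using sums_mult[OF power_half_series, of "e / 2"] by simp
    have sm': "summable (\<lambda>i. measure \<nu> (snd (X i) - fst (X i)))"
      by (rule summable_comparison_test[OF _ sums_summable[OF sm]]) (use X(5) in \<open>auto intro!: exI[of _ 0] less_imp_le\<close>)
    have "measure \<nu> (V - (\<Union>n. L n)) \<le> measure \<nu> (\<Union>i. snd (X i) - fst (X i))"
    proof (intro nu_mono sets.countable_UN image_subsetI ms)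
      show "V - (\<Union>n. L n) \<subseteq> (\<Union>i. snd (X i) - fst (X i))" unfolding V_def UL by blast
    qed
    also have "\<dots> \<le> (\<Sum>i. measure \<nu> (snd (X i) - fst (X i)))"
      by (intro finite_measure_subadditive_countably image_subsetI ms sm')
    also have "\<dots> \<le> (\<Sum>i. e / 2 * (1/2) ^ Suc i)"
      using X(5) sm' sums_summable[OF sm] by (intro suminf_le) (auto intro: less_imp_le)
    also have "\<dots> = e / 2" using sums_unique[OF sm] by simp
    finally have 1: "measure \<nu> (V - (\<Union>n. L n)) \<le> e / 2" .
    have "measure \<nu> (V - (\<Union>n. L n)) = measure \<nu> V - measure \<nu> (\<Union>n. L n)"
      using L(3) by (intro finite_measure_Diff open_sets[OF V] sets.countable_UN image_subsetI Ls UN_least)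
    with 1 have "measure \<nu> V - e < measure \<nu> (\<Union>n. L n)" using Union.prems by linarith
    then have "\<forall>\<^sub>F n in sequentially. measure \<nu> V - e < measure \<nu> (L n)"
      using lim by (intro order_tendstoD(1))
    then obtain n where n: "measure \<nu> V - e < measure \<nu> (L n)"
      by (auto simp: eventually_sequentially)
    have "measure \<nu> (V - L n) = measure \<nu> V - measure \<nu> (L n)"
      by (intro finite_measure_Diff open_sets[OF V] Ls L)
    then have "measure \<nu> (V - L n) < e" using n by simp
    moreover have "(\<Union>i. E i) \<subseteq> V" using X(4) unfolding V_def by blast
    ultimately show ?case using L V by (intro exI[of _ "L n"] exI[of _ V]) auto
  qed
qed

lemma inner_regular:
  assumes "E \<in> sets \<nu>" "0 < e"
  shows "\<exists>K. closedin T K \<and> K \<subseteq> E \<and> K \<subseteq> Bd \<and> measure \<nu> E - e < measure \<nu> K"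
proof -
  have s: "E \<inter> Bd \<in> sets \<nu>" using assms(1) Bd_sets by auto
  obtain K V where KV: "closedin T K" "openin T V" "K \<subseteq> E \<inter> Bd" "E \<inter> Bd \<subseteq> V" "measure \<nu> (V - K) < e"
    using regular[OF s assms(2)] by blast
  have "measure \<nu> E = measure \<nu> (E \<inter> Bd)" using nu_Int_Bd[OF assms(1)] by simp
  also have "\<dots> \<le> measure \<nu> V" using KV open_sets by (intro nu_mono) auto
  also have "\<dots> = measure \<nu> (V - K) + measure \<nu> K"
    using KV open_sets closed_sets by (subst finite_measure_Diff) auto
  finally show ?thesis using KV by (intro exI[of _ K]) auto
qed

lemma outer_regular:
  assumes "E \<in> sets \<nu>" "0 < e"
  shows "\<exists>V. openin T V \<and> E \<subseteq> V \<and> measure \<nu> V < measure \<nu> E + e"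
proof -
  obtain K V where KV: "closedin T K" "openin T V" "K \<subseteq> E" "E \<subseteq> V" "measure \<nu> (V - K) < e"
    using regular[OF assms] by blast
  have "measure \<nu> V = measure \<nu> (V - K) + measure \<nu> K"
    using KV open_sets closed_sets by (subst finite_measure_Diff) auto
  moreover have "measure \<nu> K \<le> measure \<nu> E" using KV assms(1) by (intro nu_mono)
  ultimately show ?thesis using KV by (intro exI[of _ V]) auto
qed

subsection \<open>Quasi-conformality\<close>

lemma len_ivt_comp:
  assumes "isometry g" shows "len (ivt g \<circ> h) = len g + len h - 2 * gp (h p) (g p)"
proof -
  have "len (ivt g \<circ> h) = dist (g p) (h p)"
    using isometry_dist[OF assms, of p "ivt g (h p)"] assms by simp
  then show ?thesis by (simp add: gromov_product_def dist_commute[of _ p] dist_commute[of "g p"] field_simps)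
qed

text \<open>Replacing \<open>h\<close> by \<open>ivt g \<circ> h\<close> permutes \<Gamma> and
  multiplies the weight of \<open>h\<close> by
  \<open>exp (t * (2 * gp (h p) (g p) - len g))\<close>; on the support of the test function this
  product is at most \<open>a\<close>. The resulting inequality between test integrals survives the
  weak limit.\<close>

lemma qc_closed:
  assumes g: "g \<in> \<Gamma>" and "closedin T K" "openin T V" "K \<subseteq> V"
    and a: "\<And>h. h \<in> \<Gamma> \<Longrightarrow> Inl (h p) \<in> V \<Longrightarrow> gp (h p) (g p) \<le> a"
  shows "measure \<nu> (act (ivt g) ` K) \<le> exp (om * (2 * a - len g)) * measure \<nu> V"
proof -
  have ig: "isometry g" and ii: "isometry (ivt g)" using G_isom g G_ivt by auto
  obtain s :: "nat \<Rightarrow> real" where s: "\<And>i. om < s i" "s \<longlonglongrightarrow> om"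
    "filterlim (\<lambda>i. PS \<Gamma> (s i)) at_top sequentially"
    and w: "\<And>\<phi>. testfun \<phi> \<Longrightarrow> (\<lambda>i. PSf \<phi> (s i) / PS \<Gamma> (s i)) \<longlonglongrightarrow> integral\<^sup>L \<nu> \<phi>"
    using ps_sequence by blast
  have c: "closedin T (Z - V)" "(Z - V) \<inter> K = {}"
    using closedin_diff[OF closedin_topspace assms(3)] assms(4) by auto
  obtain \<phi> where tf: "testfun \<phi>" and \<phi>45: "\<forall>z\<in>Z - V. \<phi> z = 0" "\<forall>z\<in>K. \<phi> z = 1"
    using Urysohn_T[OF c(1) assms(2) c(2)] by blast
  have \<phi>: "continuous_map T euclideanreal \<phi>" "\<And>z. z \<in> Z \<Longrightarrow> 0 \<le> \<phi> z" "\<And>z. z \<in> Z \<Longrightarrow> \<phi> z \<le> 1"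
    "\<And>z. z \<in> Z - V \<Longrightarrow> \<phi> z = 0" "\<And>z. z \<in> K \<Longrightarrow> \<phi> z = 1"
    using tf \<phi>45 by (simp_all add: testfun_def)
  define \<psi> where "\<psi> = \<phi> \<circ> act g"
  have tp: "testfun \<psi>"
    unfolding testfun_def \<psi>_def using continuous_map_compose[OF continuous_act[OF ig] \<phi>(1)] \<phi>(2,3) act_Z[OF ig] by simp
  have le: "PSf \<psi> t \<le> exp (t * (2 * a - len g)) * PSf \<phi> t" if t: "om < t" for t
  proof -
    define f where "f h = exp (- t * len h) * \<psi> (Inl (h p))" for h
    have sf: "f summable_on \<Gamma>" unfolding f_def using tp by (intro PSf_summable[OF t]) (auto simp: testfun_def)
    have bij: "bij_betw (\<lambda>h. ivt g \<circ> h) \<Gamma> \<Gamma>"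
    proof (rule bij_betw_byWitness[where f' = "\<lambda>h. g \<circ> h"])
      show "\<forall>h\<in>\<Gamma>. g \<circ> (ivt g \<circ> h) = h" "\<forall>h\<in>\<Gamma>. ivt g \<circ> (g \<circ> h) = h"
        using ig by (auto simp: fun_eq_iff)
    qed (use G_comp g G_ivt in auto)
    have eq: "f (ivt g \<circ> h) = exp (- t * (len g + len h - 2 * gp (h p) (g p))) * \<phi> (Inl (h p))" for h
      unfolding f_def len_ivt_comp[OF ig] using ig by (simp add: \<psi>_def)
    have "PSf \<psi> t = infsum f \<Gamma>" unfolding PSf_def f_def by (rule refl)
    also have "\<dots> = infsum (\<lambda>h. f (ivt g \<circ> h)) \<Gamma>"
      by (rule infsum_reindex_bij_betw[OF bij, symmetric])
    also have "\<dots> \<le> infsum (\<lambda>h. exp (t * (2 * a - len g)) * (exp (- t * len h) * \<phi> (Inl (h p)))) \<Gamma>"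
    proof (rule infsum_mono)
      show "(\<lambda>h. f (ivt g \<circ> h)) summable_on \<Gamma>" using summable_on_reindex_bij_betw[OF bij, of f] sf by simp
      show "(\<lambda>h. exp (t * (2 * a - len g)) * (exp (- t * len h) * \<phi> (Inl (h p)))) summable_on \<Gamma>"
        by (intro summable_on_cmult_right PSf_summable[OF t]) (use \<phi> in auto)
      fix h assume h: "h \<in> \<Gamma>"
      show "f (ivt g \<circ> h) \<le> exp (t * (2 * a - len g)) * (exp (- t * len h) * \<phi> (Inl (h p)))"
      proof (cases "Inl (h p) \<in> V")
        case True
        have "t * (2 * gp (h p) (g p)) \<le> t * (2 * a)" using a[OF h True] t om_pos by (intro mult_left_mono) auto
        then have "exp (- t * (len g + len h - 2 * gp (h p) (g p))) \<le> exp (t * (2 * a - len g) + (- t * len h))"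
          by (simp add: algebra_simps)
        then have "exp (- t * (len g + len h - 2 * gp (h p) (g p))) * \<phi> (Inl (h p)) \<le>
            exp (t * (2 * a - len g) + (- t * len h)) * \<phi> (Inl (h p))"
          by (rule mult_right_mono) (use \<phi>(2) in auto)
        then show ?thesis unfolding eq exp_add by (simp add: mult.assoc)
      next
        case False
        then have "\<phi> (Inl (h p)) = 0" using \<phi>(4) by simp
        then show ?thesis unfolding eq by simp
      qed
    qed
    also have "\<dots> = exp (t * (2 * a - len g)) * PSf \<phi> t" unfolding PSf_def by (rule infsum_cmult_right')
    finally show ?thesis .
  qed
  have "integral\<^sup>L \<nu> \<psi> \<le> exp (om * (2 * a - len g)) * integral\<^sup>L \<nu> \<phi>"
  proof (rule tendsto_le[OF trivial_limit_sequentially])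
    show "(\<lambda>i. PSf \<psi> (s i) / PS \<Gamma> (s i)) \<longlonglongrightarrow> integral\<^sup>L \<nu> \<psi>" by (rule w[OF tp])
    show "(\<lambda>i. exp (s i * (2 * a - len g)) * (PSf \<phi> (s i) / PS \<Gamma> (s i))) \<longlonglongrightarrow> exp (om * (2 * a - len g)) * integral\<^sup>L \<nu> \<phi>"
      by (intro tendsto_intros s(2) w[OF tf])
    show "\<forall>\<^sub>F i in sequentially. PSf \<psi> (s i) / PS \<Gamma> (s i) \<le> exp (s i * (2 * a - len g)) * (PSf \<phi> (s i) / PS \<Gamma> (s i))"
    proof (rule always_eventually, rule allI)
      fix i
      show "PSf \<psi> (s i) / PS \<Gamma> (s i) \<le> exp (s i * (2 * a - len g)) * (PSf \<phi> (s i) / PS \<Gamma> (s i))"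
        using divide_right_mono[OF le[OF s(1)] PS_nonneg[of \<Gamma> "s i"], of i] by simp
    qed
  qed
  moreover have "measure \<nu> (act (ivt g) ` K) \<le> integral\<^sup>L \<nu> \<psi>"
  proof (rule measure_le_integral)
    show "act (ivt g) ` K \<in> sets \<nu>" by (rule act_sets[OF ii closed_sets[OF assms(2)]])
    fix z assume "z \<in> act (ivt g) ` K"
    then show "\<psi> z = 1" using \<phi>(5) ig by (auto simp: \<psi>_def)
  qed (use tp in \<open>auto simp: testfun_def\<close>)
  moreover have "integral\<^sup>L \<nu> \<phi> \<le> measure \<nu> V"
    by (rule integral_le_measure[OF \<phi>(1-3) open_sets[OF assms(3)] \<phi>(4)])
  moreover have "exp (om * (2 * a - len g)) * integral\<^sup>L \<nu> \<phi> \<le> exp (om * (2 * a - len g)) * measure \<nu> V"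
    using calculation(3) by simp
  ultimately show ?thesis by linarith
qed

lemma quasi_conformal:
  assumes g: "g \<in> \<Gamma>" and E: "E \<in> sets \<nu>" and a: "\<And>\<zeta>. \<zeta> \<in> E \<Longrightarrow> \<zeta> \<in> Bd \<Longrightarrow> bp \<zeta> (g p) \<le> a"
  shows "measure \<nu> (act (ivt g) ` E) \<le> exp (om * (2 * a + 70 * \<delta> - len g)) * measure \<nu> E"
proof (rule field_le_epsilon)
  fix e :: real assume e: "0 < e"
  have ig: "isometry g" and ii: "isometry (ivt g)" using G_isom g G_ivt by auto
  define C where "C = exp (om * (2 * a + 70 * \<delta> - len g))"
  have C: "0 < C" by (simp add: C_def)
  obtain K' where K': "closedin T K'" "K' \<subseteq> act (ivt g) ` E" "K' \<subseteq> Bd"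
    "measure \<nu> (act (ivt g) ` E) - e / 2 < measure \<nu> K'"
    using inner_regular[OF act_sets[OF ii E], of "e / 2"] e by auto
  define K where "K = act g ` K'"
  have K: "closedin T K" unfolding K_def by (rule closedin_act[OF ig K'(1)])
  have KE: "K \<subseteq> E" using K'(2) ig unfolding K_def by auto
  have KB: "K \<subseteq> Bd" using K'(3) act_Bd[OF ig] unfolding K_def by auto
  have K'eq: "K' = act (ivt g) ` K" unfolding K_def using ig by (simp add: image_image)
  obtain V1 where V1: "openin T V1" "K \<subseteq> V1" "measure \<nu> V1 < measure \<nu> K + e / (2 * C)"
    using outer_regular[OF closed_sets[OF K], of "e / (2 * C)"] e C by auto
  \<comment> \<open>The bound on \<open>bp\<close> over \<open>E\<close> has to be spread to the
    orbit points of an open set. Removing the closed hull of the shadow at level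
    \<open>a + 35 * \<delta>\<close> does this; that hull lies in the shadow at level
    \<open>a + 5 * \<delta>\<close>, which misses \<open>K\<close>. Doubling 35 gives the constant
    70.\<close>
  define V where "V = V1 - T closure_of Sh (g p) (a + 35 * \<delta>)"
  have V: "openin T V" unfolding V_def using V1(1) by (intro openin_diff) auto
  have "K \<inter> T closure_of Sh (g p) (a + 35 * \<delta>) = {}"
  proof (rule ccontr)
    assume "\<not> ?thesis"
    then obtain z where z: "z \<in> K" "z \<in> Sh (g p) (a + 35 * \<delta> - 30 * \<delta>)"
      using Sh_closure[of "g p" "a + 35 * \<delta>"] by blast
    then show False using a[of z] KE KB delta_pos by (auto simp: Sh_def)
  qed
  then have KV: "K \<subseteq> V" using V1(2) by (auto simp: V_def)
  have "measure \<nu> K' \<le> exp (om * (2 * (a + 35 * \<delta>) - len g)) * measure \<nu> V"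
    unfolding K'eq
  proof (rule qc_closed[OF g K V KV])
    fix h assume h: "h \<in> \<Gamma>" "Inl (h p) \<in> V"
    show "gp (h p) (g p) \<le> a + 35 * \<delta>"
    proof (rule ccontr)
      assume "\<not> ?thesis"
      then have "Inl (h p) \<in> Sh (g p) (a + 35 * \<delta>)" by (simp add: Sh_def)
      then have "Inl (h p) \<in> T closure_of Sh (g p) (a + 35 * \<delta>)"
        using closure_of_subset[of "Sh (g p) (a + 35 * \<delta>)" T] by (auto simp: Sh_def)
      then show False using h(2) by (simp add: V_def)
    qed
  qed
  also have "exp (om * (2 * (a + 35 * \<delta>) - len g)) = C" by (simp add: C_def algebra_simps)
  also have "C * measure \<nu> V \<le> C * (measure \<nu> E + e / (2 * C))"
  proof (rule mult_left_mono)
    have "measure \<nu> V \<le> measure \<nu> V1" using open_sets[OF V1(1)] by (intro nu_mono) (auto simp: V_def)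
    moreover have "measure \<nu> K \<le> measure \<nu> E" using E KE by (intro nu_mono)
    ultimately show "measure \<nu> V \<le> measure \<nu> E + e / (2 * C)" using V1(3) by linarith
  qed (use C in auto)
  also have "\<dots> = C * measure \<nu> E + e / 2" using C by (simp add: field_simps)
  finally show "measure \<nu> (act (ivt g) ` E) \<le> exp (om * (2 * a + 70 * \<delta> - len g)) * measure \<nu> E + e"
    using K'(4) unfolding C_def by linarith
qed

subsection \<open>Almost every boundary point is conical\<close>

text \<open>An orbit point outside all deep shadows is reached through an excursion in the concave
  region around time \<open>t\<close>; these excursions carry an arbitrarily small part of the series as \<open>t\<close> grows.\<close>

lemma conical_ae:
  "\<exists>\<rho>. \<exists>N\<in>null_sets \<nu>. \<forall>\<xi>\<in>Bd - N. \<forall>R. \<exists>u\<in>\<Gamma>. R \<le> len u \<and> len u - \<rho> \<le> bp \<xi> (u p)"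
proof -
  obtain M1 M2 s0 where M: "0 < M1" "M1 \<le> M2" "0 < s0" "s0 < om" "growth p \<Gamma> = ereal om"
    "(\<lambda>b. exp (- s0 * len b)) summable_on concave_region p \<Gamma> M1 M2" by (rule scc_data)
  define A where "A = concave_region p \<Gamma> M1 M2"
  have AG: "A \<subseteq> \<Gamma>" by (auto simp: A_def concave_region_def)
  define \<rho> where "\<rho> = M1 + 100 * \<delta>"
  \<comment> \<open>A closed set containing every boundary point for which no element of length at
    least \<open>R\<close> is a conical witness. It suffices that each \<open>L R\<close> is
    null.\<close>
  define L where "L R = Bd - (\<Union>u\<in>{u \<in> \<Gamma>. R \<le> len u}. T interior_of Sh (u p) (len u - \<rho>))" for R
  have Lc: "closedin T (L R)" for R
    unfolding L_def by (intro closedin_diff closedin_Bd openin_Union) auto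
  have null: "measure \<nu> (L R) = 0" for R
  proof -
    define NR where "NR = real (card {u \<in> \<Gamma>. len u \<le> R})"
    define C where "C = exp ((om + 1) * (4 * M1)) * (NR + 1)"
    have C: "0 < C" by (simp add: C_def NR_def add_nonneg_pos)
    have "measure \<nu> (L R) \<le> e" if e: "0 < e" for e
    proof -
      obtain R2 where R2: "\<And>F. finite F \<Longrightarrow> F \<subseteq> A \<Longrightarrow> (\<And>g. g \<in> F \<Longrightarrow> R2 < len g) \<Longrightarrow> (\<Sum>g\<in>F. exp (- s0 * len g)) \<le> e / C"
        using summable_tail[OF M(6) exp_ge_zero divide_pos_pos[OF e C]] unfolding A_def by metis
      \<comment> \<open>If \<open>u\<close> is shorter than \<open>R\<close>, the middle factor of a
        decomposition at time \<open>t\<close> is longer than \<open>R2\<close>, and such excursions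
        contribute at most \<open>e / C\<close>.\<close>
      define t where "t = max 0 (R2 + R + M1 + 1)"
      define W where "W = {u \<in> \<Gamma>. len u \<le> t + M1}"
      \<comment> \<open>Only the finitely many \<open>u\<close> that a decomposition at time
        \<open>t\<close> can produce are excluded, so \<open>V\<close> is open. The exchange of
        closures here for interiors in \<open>L\<close> is paid for by the
        \<open>100 * \<delta>\<close> in \<open>\<rho>\<close>.\<close>
      define V where "V = Z - (\<Union>u\<in>{u \<in> W. R \<le> len u}. T closure_of Sh (u p) (len u - M1))"
      have "finite W" unfolding W_def by (rule finite_ball)
      then have "finite {u \<in> W. R \<le> len u}" by simp
      then have V: "openin T V"
        unfolding V_def using openin_topspace[of T] by (intro openin_diff closedin_Union) auto
      have LV: "L R \<subseteq> V"
      proof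
        fix \<xi> assume x: "\<xi> \<in> L R"
        have "\<xi> \<notin> T closure_of Sh (u p) (len u - M1)" if u: "u \<in> W" "R \<le> len u" for u
        proof
          assume "\<xi> \<in> T closure_of Sh (u p) (len u - M1)"
          then have "\<xi> \<in> Sh (u p) (len u - M1 - 30 * \<delta>)" using Sh_closure by blast
          then have "\<xi> \<in> T interior_of Sh (u p) (len u - \<rho>)"
            using Sh_interior[of \<xi> "len u - \<rho>" "u p"] delta_pos by (simp add: Sh_def \<rho>_def)
          then show False using x u by (auto simp: L_def W_def)
        qed
        then show "\<xi> \<in> V" using x Bd_in_Z by (auto simp: V_def L_def)
      qed
      show ?thesis
      proof (rule portmanteau_upper[OF Lc V LV])
        fix s assume s: "om < s" "s \<le> om + 1"
        show "PS {g \<in> \<Gamma>. Inl (g p) \<in> V} s \<le> e * PS \<Gamma> s + real (card {g \<in> \<Gamma>. len g \<le> t})"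
        proof (rule PS_leI[OF _ s(1)])
          fix F assume F: "finite F" "F \<subseteq> {g \<in> \<Gamma>. Inl (g p) \<in> V}"
          define F1 where "F1 = {g \<in> F. len g \<le> t}"
          define F2 where "F2 = {g \<in> F. t < len g}"
          have s0: "0 \<le> s" using s om_pos by linarith
          have "(\<Sum>g\<in>F1. exp (- s * len g)) \<le> (\<Sum>g\<in>F1. 1)" using s0 by (intro sum_mono) simp
          also have "\<dots> \<le> real (card {g \<in> \<Gamma>. len g \<le> t})"
          proof -
            have "F1 \<subseteq> {g \<in> \<Gamma>. len g \<le> t}" using F(2) by (auto simp: F1_def)
            then show ?thesis using card_mono[OF finite_ball] by simp
          qed
          finally have 1: "(\<Sum>g\<in>F1. exp (- s * len g)) \<le> real (card {g \<in> \<Gamma>. len g \<le> t})" .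
          define n where "n = Max (insert 0 (len ` F))"
          define U where "U = {u \<in> \<Gamma>. len u \<le> R}"
          define Q where "Q = {b \<in> A. R2 < len b \<and> len b \<le> n + 4 * M1}"
          define Y where "Y = {w \<in> \<Gamma>. len w \<le> n + 4 * M1}"
          have fin: "finite U" "finite Q" "finite Y"
          proof -
            show "finite U" "finite Y" unfolding U_def Y_def by (rule finite_ball)+
            show "finite Q" by (rule finite_subset[OF _ finite_ball[of "n + 4 * M1"]]) (use AG in \<open>auto simp: Q_def\<close>)
          qed
          have "(\<Sum>g\<in>F2. exp (- s * len g)) \<le> exp (s * (4 * M1)) * ((\<Sum>u\<in>U. exp (- s * len u)) *
              (\<Sum>b\<in>Q. exp (- s * len b)) * (\<Sum>w\<in>Y. exp (- s * len w)))"
          proof (rule decomp_sum[OF fin s0])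
            fix g assume g: "g \<in> F2"
            then have gG: "g \<in> \<Gamma>" and gV: "Inl (g p) \<in> V" and gt: "t < len g" using F(2) by (auto simp: F2_def)
            have gn: "len g \<le> n" using g F(1) by (auto simp: n_def F2_def)
            have t0: "0 \<le> t" by (simp add: t_def)
            obtain u b w where h: "u \<in> \<Gamma>" "b \<in> A" "w \<in> \<Gamma>" "g = u \<circ> b \<circ> w"
              "len u \<le> t + M1" "len w \<le> len g - t + M1" "len u + len b + len w \<le> len g + 4 * M1"
              "len u - M1 \<le> gp (u p) (g p)"
              using decompose[OF M(1,2) gG t0 less_imp_le[OF gt]] unfolding A_def by metis
            have uR: "len u < R"
            proof (rule ccontr)
              assume "\<not> len u < R"
              then have "u \<in> {u \<in> W. R \<le> len u}" using h by (simp add: W_def)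
              moreover have "Inl (g p) \<in> Sh (u p) (len u - M1)" using h(8) by (simp add: Sh_def gp_sym)
              then have "Inl (g p) \<in> T closure_of Sh (u p) (len u - M1)"
                using closure_of_subset[of "Sh (u p) (len u - M1)" T] by (auto simp: Sh_def)
              ultimately show False using gV by (auto simp: V_def)
            qed
            have "len g \<le> len u + len b + len w"
              using len_comp_le[of "u \<circ> b" w] len_comp_le[of u b] G_isom[OF h(1)] G_isom[of b] h(2) AG isometry_comp h(4)
              by (smt (verit) comp_apply subsetD)
            then have "R2 < len b" using uR h(6) by (simp add: t_def)
            then have "b \<in> Q" using h(2,7) gn zero_le_dist[of p "u p"] zero_le_dist[of p "w p"] unfolding Q_def mem_Collect_eq by linarith
            moreover have "w \<in> Y" using h(3,7) gn zero_le_dist[of p "u p"] zero_le_dist[of p "b p"] unfolding Y_def mem_Collect_eq by linarith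
            moreover have "u \<in> U" using h(1) uR by (simp add: U_def)
            ultimately show "\<exists>u\<in>U. \<exists>b\<in>Q. \<exists>w\<in>Y. g = u \<circ> b \<circ> w \<and> len u + len b + len w \<le> len g + 4 * M1"
              using h(4,7) by blast
          qed
          also have "\<dots> \<le> exp ((om + 1) * (4 * M1)) * ((NR + 1) * (e / C) * PS \<Gamma> s)"
          proof (intro mult_mono)
            show "exp (s * (4 * M1)) \<le> exp ((om + 1) * (4 * M1))" using s M(1) by simp
            have "(\<Sum>u\<in>U. exp (- s * len u)) \<le> (\<Sum>u\<in>U. 1)" using s0 by (intro sum_mono) simp
            then show "(\<Sum>u\<in>U. exp (- s * len u)) \<le> NR + 1" by (simp add: NR_def U_def)
            have "(\<Sum>b\<in>Q. exp (- s * len b)) \<le> (\<Sum>b\<in>Q. exp (- s0 * len b))"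
              using s M(4) by (intro sum_mono) (simp add: mult_right_mono)
            also have "\<dots> \<le> e / C" by (rule R2) (use fin in \<open>auto simp: Q_def\<close>)
            finally show "(\<Sum>b\<in>Q. exp (- s * len b)) \<le> e / C" .
            show "(\<Sum>w\<in>Y. exp (- s * len w)) \<le> PS \<Gamma> s"
              by (rule PS_finite_le[OF order_refl s(1)]) (use fin in \<open>auto simp: Y_def\<close>)
          qed (use e C in \<open>auto intro!: sum_nonneg mult_nonneg_nonneg simp: NR_def PS_nonneg\<close>)
          also have "\<dots> = (exp ((om + 1) * (4 * M1)) * (NR + 1)) * (e / C) * PS \<Gamma> s"
            by (simp only: mult.assoc)
          also have "\<dots> = e * PS \<Gamma> s" unfolding C_def[symmetric] using C by simp
          finally have 2: "(\<Sum>g\<in>F2. exp (- s * len g)) \<le> e * PS \<Gamma> s" .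
          have "(\<Sum>g\<in>F. exp (- s * len g)) = (\<Sum>g\<in>F1. exp (- s * len g)) + (\<Sum>g\<in>F2. exp (- s * len g))"
          proof -
            have "F = F1 \<union> F2" "F1 \<inter> F2 = {}" by (auto simp: F1_def F2_def)
            then show ?thesis using F(1) by (metis finite_Un sum.union_disjoint)
          qed
          with 1 2 show "(\<Sum>g\<in>F. exp (- s * len g)) \<le> e * PS \<Gamma> s + real (card {g \<in> \<Gamma>. len g \<le> t})"
            by linarith
        qed auto
      qed
    qed
    then have "measure \<nu> (L R) \<le> 0" by (rule field_le_epsilon[where y = 0, simplified])
    then show ?thesis by (simp add: measure_le_0_iff)
  qed
  define N where "N = (\<Union>n::nat. L (real n))"
  have "N \<in> null_sets \<nu>"
    unfolding N_def using null closed_sets[OF Lc] by (intro null_sets_UN) (auto simp: null_sets_def emeasure_eq_measure)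
  moreover have "\<exists>u\<in>\<Gamma>. R \<le> len u \<and> len u - \<rho> \<le> bp \<xi> (u p)" if x: "\<xi> \<in> Bd - N" for \<xi> R
  proof -
    obtain n :: nat where n: "R \<le> real n" using real_arch_simple by blast
    have "\<xi> \<notin> L (real n)" using x by (auto simp: N_def)
    then obtain u where u: "u \<in> \<Gamma>" "real n \<le> len u" "\<xi> \<in> T interior_of Sh (u p) (len u - \<rho>)"
      using x by (auto simp: L_def)
    have "\<xi> \<in> Sh (u p) (len u - \<rho>)" using u(3) interior_of_subset[of T "Sh (u p) (len u - \<rho>)"] by blast
    then show ?thesis using u n by (intro bexI[of _ u]) (auto simp: Sh_def)
  qed
  ultimately show ?thesis by blast
qed

end

section \<open>Loxodromic elements\<close>

definition zp :: "('a::metric_space \<Rightarrow> 'a) \<Rightarrow> int \<Rightarrow> 'a \<Rightarrow> 'a" where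
  "zp F j = F [^]\<^bsub>isom_group\<^esub> j"

lemma zp_0 [simp]: "zp F 0 = id"
  by (simp add: zp_def)

lemma zp_1 [simp]: "isometry F \<Longrightarrow> zp F 1 = F"
  unfolding zp_def by (rule group.int_pow_1[OF group_isom_group]) (simp add: carrier_isom_group)

lemma zp_isometry: "isometry F \<Longrightarrow> isometry (zp F j)"
  using group.int_pow_closed[OF group_isom_group, of F j] by (simp add: carrier_isom_group zp_def)

lemma zp_add: "isometry F \<Longrightarrow> zp F (i + j) = zp F i \<circ> zp F j"
  using group.int_pow_mult[OF group_isom_group, of F i j] by (simp add: carrier_isom_group zp_def)

lemma zp_apply: "isometry F \<Longrightarrow> zp F i (zp F j x) = zp F (i + j) x"
  by (simp add: zp_add)

lemma zp_neg: "isometry F \<Longrightarrow> zp F (- j) = ivt (zp F j)"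
  using group.int_pow_neg[OF group_isom_group, of F j] isom_group_inv[OF zp_isometry[of F j]]
  by (simp add: carrier_isom_group zp_def)

lemma zp_mult: "isometry F \<Longrightarrow> zp (zp F i) j = zp F (i * j)"
  using group.int_pow_pow[OF group_isom_group, of F i j] by (simp add: carrier_isom_group zp_def)

lemma zp_nat: "F [^]\<^bsub>isom_group\<^esub> n = zp F (int n)"
  by (simp add: zp_def int_pow_int)

lemma linear_less_power2: "\<exists>k. A + B * real k < 2 ^ k"
proof -
  have "(\<lambda>k. A * (1 / 2 ^ k) + B * (real k / 2 ^ k)) \<longlonglongrightarrow> A * 0 + B * 0"
    using lim_n_over_pown[of "2 :: real"] LIMSEQ_inverse_realpow_zero[of 2]
    by (intro tendsto_intros) (simp_all add: inverse_eq_divide)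
  then have "\<forall>\<^sub>F k in sequentially. A * (1 / 2 ^ k) + B * (real k / 2 ^ k) < 1"
    by (intro order_tendstoD(2)) auto
  then obtain k where k: "A * (1 / 2 ^ k) + B * (real k / 2 ^ k) < 1"
    by (auto simp: eventually_sequentially)
  have "A * (1 / 2 ^ k) + B * (real k / 2 ^ k) = (A + B * real k) / 2 ^ k" by (simp add: add_divide_distrib)
  then show ?thesis using k by (intro exI[of _ k]) (simp add: divide_less_eq)
qed

context hyp_space
begin

lemma gp_hyp_less: "gp x z \<le> c \<Longrightarrow> c + \<delta> < gp y z \<Longrightarrow> gp x y \<le> c + \<delta>"
  using hyp_min[of p x y z] by linarith

lemma gp_translate:
  assumes "isometry g" shows "gp (g p) (g x) = len g - gp x (ivt g p)"
  using gp_isometry[OF assms, of p x] by simp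

lemma len_zp_neg: "isometry F \<Longrightarrow> len (zp F (- j)) = len (zp F j)"
  by (simp add: zp_neg len_ivt zp_isometry)

text \<open>A local-to-global principle: when the steps are much longer than the backtracking
  \<open>a\<close> at one vertex, the orbit cannot turn back later, because each translated estimate
  feeds the next through the hyperbolic inequality. The one-sided bound \<open>one\<close> is
  applied to \<open>F\<close> and to its inverse, and the two halves are joined at the cost of one
  more \<delta>.\<close>

lemma zp_chain:
  assumes F: "isometry F" and a: "gp (zp F (- 1) p) (F p) \<le> a" and L: "2 * a + 6 * \<delta> < len F"
  shows "gp (zp F (- int i) p) (zp F (int j) p) \<le> a + 2 * \<delta>"
proof -
  have one: "gp (zp G (- 1) p) (zp G (1 + int n) p) \<le> a + \<delta>"
    if G: "isometry G" "gp (zp G (- 1) p) (G p) \<le> a" "2 * a + 6 * \<delta> < len G" for G n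
  proof (induction n)
    case 0
    then show ?case using G delta_pos by simp
  next
    case (Suc n)
    have e: "G (zp G (1 + int n) p) = zp G (1 + int (Suc n)) p"
      using zp_apply[OF G(1), of 1 "1 + int n" p] G(1) by simp
    have "gp (G p) (zp G (1 + int (Suc n)) p) = len G - gp (zp G (1 + int n) p) (zp G (- 1) p)"
      using gp_translate[OF G(1), of "zp G (1 + int n) p"] zp_neg[OF G(1), of 1] G(1) unfolding e by simp
    then have "a + \<delta> < gp (zp G (1 + int (Suc n)) p) (G p)"
      using Suc G(3) gp_sym[of "zp G (1 + int n) p" "zp G (- 1) p"]
        gp_sym[of "G p" "zp G (1 + int (Suc n)) p"] delta_pos by linarith
    then show ?case using gp_hyp_less[OF G(2)] by blast
  qed
  define G where "G = zp F (- 1)"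
  have G: "isometry G" using zp_isometry[OF F] by (simp add: G_def)
  have zG: "zp G k = zp F (- k)" for k unfolding G_def zp_mult[OF F] by simp
  have Gp: "G p = zp F (- 1) p" by (simp add: G_def)
  have lG: "len G = len F" using len_zp_neg[OF F, of 1] F by (simp add: G_def)
  have oneG: "gp (F p) (zp F (- 1 - int n) p) \<le> a + \<delta>" for n
    using one[OF G, of n] a L lG F zG[of "-1"] zG[of "1 + int n"] Gp gp_sym[of "F p"] by simp
  have far: "a + 2 * \<delta> < gp (zp F (- 1 - int n) p) (zp F (- 1) p)" for n
  proof -
    have "gp (G p) (G (zp F (- int n) p)) = len F - gp (zp F (- int n) p) (F p)"
      using gp_translate[OF G] lG zp_neg[OF F, of 1] F by (simp add: G_def)
    moreover have "G (zp F (- int n) p) = zp F (- 1 - int n) p"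
      using zp_apply[OF F, of "- 1" "- int n" p] by (simp add: G_def)
    moreover have "gp (zp F (- int n) p) (F p) \<le> a + \<delta>"
    proof (cases n)
      case 0
      then show ?thesis using a delta_pos gp_nonneg[of "zp F (- 1) p" "F p"] by simp
    next
      case (Suc m)
      then show ?thesis using oneG[of m] gp_sym[of "F p"] by simp
    qed
    ultimately show ?thesis using L Gp gp_sym[of "zp F (- 1) p"] delta_pos by simp
  qed
  show ?thesis
  proof (cases "i = 0 \<or> j = 0")
    case True
    then show ?thesis using a gp_nonneg[of "zp F (- 1) p" "F p"] delta_pos by auto
  next
    case False
    then obtain m n where mn: "i = Suc m" "j = Suc n" by (metis not0_implies_Suc)
    have "gp (zp F (1 + int n) p) (zp F (- 1) p) \<le> a + \<delta>"
      using one[OF F a L, of n] gp_sym by metis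
    moreover have "a + \<delta> + \<delta> < gp (zp F (- 1 - int m) p) (zp F (- 1) p)" using far[of m] by simp
    ultimately have "gp (zp F (1 + int n) p) (zp F (- 1 - int m) p) \<le> a + \<delta> + \<delta>" by (rule gp_hyp_less)
    then show ?thesis using mn gp_sym[of "zp F (1 + int n) p"] by simp
  qed
qed

text \<open>If doubling an exponent never increased the length by more than
  \<open>7 * \<delta>\<close>, the length of \<open>f\<close> to the power \<open>2 ^ k\<close>
  would be at most linear in \<open>k\<close>, against the linear lower bound in the exponent. A
  doubling that gains more means that the backtracking is small compared with the step.\<close>

lemma loxodromic_power:
  assumes "loxodromic p f"
  obtains n a where "0 < n" "gp (zp (zp f (int n)) (- 1) p) (zp f (int n) p) \<le> a"
    "2 * a + 6 * \<delta> < len (zp f (int n))"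
proof -
  have f: "isometry f" using assms by (simp add: loxodromic_def carrier_isom_group)
  obtain K C where K: "1 \<le> K" "0 \<le> C" "\<And>i j. \<bar>real_of_int (i - j)\<bar> / K - C \<le> dist (zp f i p) (zp f j p)"
    using assms unfolding loxodromic_def zp_def by metis
  have low: "real_of_int i / K - C \<le> len (zp f i)" if "0 \<le> i" for i
    using K(3)[of 0 i] that by simp
  have "\<exists>n>0. len (zp f (int n)) + 7 * \<delta> < len (zp f (2 * int n))"
  proof (rule ccontr)
    assume "\<not> ?thesis"
    then have step: "\<And>n. 0 < n \<Longrightarrow> len (zp f (2 * int n)) \<le> len (zp f (int n)) + 7 * \<delta>" by (meson not_less)
    have up: "len (zp f (2 ^ k)) \<le> len f + 7 * \<delta> * real k" for k
    proof (induction k)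
      case 0
      then show ?case using f by simp
    next
      case (Suc k)
      have "len (zp f (2 * 2 ^ k)) \<le> len (zp f (2 ^ k)) + 7 * \<delta>" using step[of "2 ^ k"] by simp
      then show ?case using Suc by (simp add: algebra_simps)
    qed
    obtain k where k: "K * (len f + C) + K * 7 * \<delta> * real k < 2 ^ k" using linear_less_power2 by blast
    have "2 ^ k / K - C \<le> len (zp f (2 ^ k))" using low[of "2 ^ k"] by simp
    then have "2 ^ k / K \<le> len f + 7 * \<delta> * real k + C" using up[of k] by linarith
    then have "2 ^ k \<le> (len f + 7 * \<delta> * real k + C) * K" using K(1) by (simp add: divide_le_eq)
    then show False using k by (simp add: algebra_simps)
  qed
  then obtain n where n: "0 < n" "len (zp f (int n)) + 7 * \<delta> < len (zp f (2 * int n))" by blast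
  define F where "F = zp f (int n)"
  have F: "isometry F" unfolding F_def by (rule zp_isometry[OF f])
  have d: "dist (zp F (- 1) p) (F p) = len (zp f (2 * int n))"
  proof -
    have "dist (zp F (- 1) p) (F p) = dist (F (zp F (- 1) p)) (F (F p))" by (simp add: isometry_dist[OF F])
    also have "F (zp F (- 1) p) = p" using zp_apply[OF F, of 1 "- 1" p] F by simp
    also have "F (F p) = zp f (2 * int n) p" unfolding F_def zp_apply[OF f] by simp
    finally show ?thesis .
  qed
  define a where "a = (2 * len (zp f (int n)) - len (zp f (2 * int n))) / 2"
  have "gp (zp F (- 1) p) (F p) = a"
    using d len_zp_neg[OF F, of 1] F by (simp add: gromov_product_def dist_commute[of _ p] F_def a_def)
  moreover have "2 * a + 6 * \<delta> < len (zp f (int n))" using n(2) delta_pos by (simp add: a_def field_simps)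
  ultimately show thesis using that[of n a] n(1) by (simp add: F_def)
qed

end

locale lox_action = hyp_action p \<delta> \<Gamma> for p :: "'a::metric_space" and \<delta> :: real and \<Gamma> +
  fixes F :: "'a \<Rightarrow> 'a" and a :: real
  assumes FG: "F \<in> \<Gamma>"
    and F_axis: "gp (zp F (- int i) p) (zp F (int j) p) \<le> a"
    and F_long: "2 * a + \<delta> < len F"
    and F_a: "0 \<le> a"
    and nonelem: "\<not> elementary (subgrp \<Gamma>)"
begin

lemma F_isom: "isometry F"
  by (rule G_isom[OF FG])

abbreviation z :: "int \<Rightarrow> 'a \<Rightarrow> 'a" where
  "z j \<equiv> zp F j"

lemma z_isom: "isometry (z j)"
  by (rule zp_isometry[OF F_isom])

lemma z_apply: "z i (z j x) = z (i + j) x"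
  by (rule zp_apply[OF F_isom])

lemma z_comp: "z i \<circ> z j = z (i + j)"
  by (rule zp_add[OF F_isom, symmetric])

lemma ivt_z: "ivt (z j) = z (- j)"
  by (rule zp_neg[OF F_isom, symmetric])

lemma zG: "z j \<in> \<Gamma>"
proof -
  have n: "z (int n) \<in> \<Gamma>" for n
  proof (induction n)
    case 0
    show ?case using G_id by (simp only: of_nat_0 zp_0)
  next
    case (Suc n)
    have "z (int (Suc n)) = F \<circ> z (int n)" using zp_add[OF F_isom, of 1 "int n"] F_isom by simp
    then show ?case using G_comp[OF FG Suc] by metis
  qed
  show ?thesis
  proof (cases "0 \<le> j")
    case True
    then show ?thesis using n[of "nat j"] by simp
  next
    case False
    then show ?thesis using G_ivt[OF n[of "nat (- j)"]] ivt_z[of "- j"] by simp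
  qed
qed

section \<open>Lengths and directions along the axis\<close>

abbreviation lz :: "int \<Rightarrow> real" where
  "lz j \<equiv> dist p (z j p)"

lemma lz_neg: "lz (- j) = lz j"
  by (rule len_zp_neg[OF F_isom])

lemma z_dist: "dist (z i p) (z j p) = lz (j - i)"
  using isometry_dist[OF z_isom, of i p "z (j - i) p"] by (simp add: z_apply)

lemma z_axis:
  assumes "0 \<le> i" "0 \<le> j" shows "gp (z (- i) p) (z j p) \<le> a" "gp (z i p) (z (- j) p) \<le> a"
proof -
  have *: "gp (z (- i) p) (z j p) \<le> a" if "0 \<le> i" "0 \<le> j" for i j
    using F_axis[of "nat i" "nat j"] that by simp
  show "gp (z (- i) p) (z j p) \<le> a" by (rule *[OF assms])
  show "gp (z i p) (z (- j) p) \<le> a" using *[OF assms(2,1)] gp_sym by metis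
qed

lemma lz_add_ge:
  assumes "0 \<le> i" "0 \<le> j" shows "lz i + lz j - 2 * a \<le> lz (i + j)"
  using z_axis(1)[OF assms] z_dist[of "- i" j] lz_neg[of i]
  by (simp add: gromov_product_def dist_commute[of _ p] add.commute)

lemma lz_le: "lz (i + j) \<le> lz i + lz j"
  using len_comp_le[OF z_isom, of i "z j"] by (simp add: z_apply)

lemma lz_step: "lz (i + 1) \<le> lz i + len F" "lz i \<le> lz (i + 1) + len F"
  using lz_le[of i 1] lz_le[of "i + 1" "- 1"] lz_neg[of 1] F_isom by simp_all

lemma lz_lower: "real n * \<delta> \<le> lz (int n)"
proof (induction n)
  case (Suc n)
  have "lz (int n) + lz 1 - 2 * a \<le> lz (int n + 1)" by (rule lz_add_ge) auto
  then show ?case using Suc F_long F_isom by (simp add: algebra_simps)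
qed simp

lemma lz_unbounded: "\<exists>n. \<forall>i. n \<le> \<bar>i\<bar> \<longrightarrow> r \<le> lz i"
proof -
  obtain n :: nat where n: "r / \<delta> \<le> real n" using real_arch_simple by blast
  have "r \<le> lz i" if "int n \<le> \<bar>i\<bar>" for i
  proof -
    have "r \<le> real n * \<delta>" using n delta_pos by (simp add: divide_le_eq)
    also have "\<dots> \<le> real (nat \<bar>i\<bar>) * \<delta>" using that delta_pos by (intro mult_right_mono) auto
    also have "\<dots> \<le> lz \<bar>i\<bar>" using lz_lower[of "nat \<bar>i\<bar>"] by simp
    also have "lz \<bar>i\<bar> = lz i" using lz_neg[of i] by (simp add: abs_if)
    finally show ?thesis .
  qed
  then show ?thesis by blast
qed

lemma z_same_side:
  assumes "0 \<le> i" "0 \<le> j" "e = 1 \<or> e = - 1"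
  shows "min (lz i) (lz j) - a \<le> gp (z (e * i) p) (z (e * j) p)"
proof -
  have le: "lz i - a \<le> gp (z (e * i) p) (z (e * j) p)" if ij: "0 \<le> i" "i \<le> j" for i j
  proof -
    have "lz i + lz (j - i) - 2 * a \<le> lz j" using lz_add_ge[of i "j - i"] ij by simp
    moreover have "dist (z (e * i) p) (z (e * j) p) = lz (j - i)"
      using z_dist[of "e * i" "e * j"] assms(3) lz_neg[of "j - i"] by auto
    moreover have "lz (e * i) = lz i" "lz (e * j) = lz j" using assms(3) lz_neg[of i] lz_neg[of j] by auto
    ultimately show ?thesis by (simp add: gromov_product_def dist_commute[of _ p] field_simps)
  qed
  show ?thesis
  proof (cases "i \<le> j")
    case True
    then show ?thesis using le[of i j] assms(1) by linarith
  next
    case False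
    then show ?thesis using le[of j i] assms(2) gp_sym[of "z (e * i) p"] by simp
  qed
qed

text \<open>A discrete intermediate value argument: the lengths start at 0, are unbounded and change
  by at most \<open>len F\<close> per step.\<close>

lemma lz_reach:
  assumes "0 \<le> r" obtains i where "0 \<le> i" "\<bar>lz i - r\<bar> \<le> len F"
proof -
  obtain n where n: "\<And>i. n \<le> \<bar>i\<bar> \<Longrightarrow> r \<le> lz i" using lz_unbounded by blast
  define m where "m = (LEAST k::nat. r \<le> lz (int k))"
  have ex: "r \<le> lz (int (nat \<bar>n\<bar>))" using n by simp
  have m: "r \<le> lz (int m)" unfolding m_def by (rule LeastI[of _ "nat \<bar>n\<bar>"]) (rule ex)
  show thesis
  proof (cases m)
    case 0
    then show thesis using that[of 0] m assms by simp
  next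
    case (Suc k)
    then have "\<not> r \<le> lz (int k)" using not_less_Least[of k "\<lambda>k. r \<le> lz (int k)"] by (simp add: m_def)
    have "int k + 1 = int m" using Suc by simp
    then have "lz (int m) \<le> lz (int k) + len F" using lz_step(1)[of "int k"] by metis
    then show thesis using that[of "int m"] m \<open>\<not> r \<le> lz (int k)\<close> by simp
  qed
qed

text \<open>Both points almost lie on geodesics from \<open>p\<close> to \<open>y\<close>, at almost
  the same distance from \<open>p\<close>, and such geodesics run close together.\<close>

lemma near_segment:
  assumes "nrm x - c \<le> gp x y" "nrm x' - c \<le> gp x' y" "\<bar>nrm x' - nrm x\<bar> \<le> d"
  shows "dist x x' \<le> 3 * d + 2 * c + 2 * \<delta>"
proof -
  have "nrm x - d - c - \<delta> \<le> gp x x'"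
    using gp_hyp[of "nrm x - d - c" x y x'] assms gp_sym[of y x'] by linarith
  then show ?thesis using assms(3) by (simp add: gromov_product_def dist_commute[of _ p] field_simps)
qed

end

context hyp_action
begin

lemma subgroup_isom: "subgroup \<Gamma> isom_group"
proof (rule subgroup.intro)
  show "\<Gamma> \<subseteq> carrier isom_group" using G_isom by (auto simp: carrier_isom_group)
  show "x \<otimes>\<^bsub>isom_group\<^esub> y \<in> \<Gamma>" if "x \<in> \<Gamma>" "y \<in> \<Gamma>" for x y using G_comp that by simp
  show "\<one>\<^bsub>isom_group\<^esub> \<in> \<Gamma>" using G_id by simp
  show "inv\<^bsub>isom_group\<^esub> x \<in> \<Gamma>" if "x \<in> \<Gamma>" for x using that G_ivt isom_group_inv[OF G_isom] by simp
qed

lemma inv_subgrp: assumes "x \<in> \<Gamma>" shows "inv\<^bsub>subgrp \<Gamma>\<^esub> x = ivt x"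
proof (rule group.inv_equality)
  show "group (subgrp \<Gamma>)" by (rule group.subgroup_imp_group[OF group_isom_group subgroup_isom])
  show "ivt x \<otimes>\<^bsub>subgrp \<Gamma>\<^esub> x = \<one>\<^bsub>subgrp \<Gamma>\<^esub>" using G_isom[OF assms] by (simp add: isom_group_def)
qed (use assms G_ivt in auto)

end

context lox_action
begin

subsection \<open>Directions away from the axis\<close>

lemma gp_isometry_ge:
  assumes "isometry g" shows "gp x y - len g \<le> gp (g x) (g y)"
  using gp_isometry[OF assms, of x y] gp_le(2)[of x "ivt g p"] gp_le(2)[of y "ivt g p"] len_ivt[OF assms]
  by linarith

lemma gpw_sym: "gromov_product (w :: 'a) x y = gromov_product w y x"
  by (simp add: gromov_product_def dist_commute)

lemma gpw_hyp_less:
  "gromov_product (w :: 'a) x y \<le> c \<Longrightarrow> c + \<delta> < gromov_product w y u \<Longrightarrow> gromov_product w x u \<le> c + \<delta>"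
  using hyp_min[of w x u y] gpw_sym[of w y u] by linarith

lemma gpw_sum: "gromov_product (y :: 'a) p u = nrm y - gp y u"
  by (simp add: gromov_product_def dist_commute[of _ p] dist_commute[of u y] field_simps)

lemma gpw_isometry:
  assumes "isometry g" shows "gromov_product (g w) (g x) (g y) = gromov_product w x y"
  by (simp add: gromov_product_def isometry_dist[OF assms])

lemma gpw_base_ge: "gp x y - nrm w \<le> gromov_product w x y"
  using dist_triangle[of x p w] dist_triangle[of y p w]
  by (simp add: gromov_product_def dist_commute[of w p] field_simps)

text \<open>The inverse of \<open>b\<close> carries the end \<open>e\<close> of the axis to the end
  \<open>e'\<close>, expressed by diverging Gromov products so that no boundary points are involved.
  The signs 1 and -1 stand for the two ends.\<close>

definition asym :: "('a \<Rightarrow> 'a) \<Rightarrow> int \<Rightarrow> int \<Rightarrow> bool" where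
  "asym b e e' \<longleftrightarrow> (\<forall>r. \<exists>M. \<forall>i\<ge>M. r \<le> gp (ivt b (z (e * i) p)) (z (e' * i) p))"

lemma asym_comp:
  assumes "b \<in> \<Gamma>" "b' \<in> \<Gamma>" "asym b e e'" "asym b' e e'"
  shows "asym (b \<circ> ivt b') e e"
  unfolding asym_def
proof
  fix r
  have ib: "isometry b" "isometry b'" using assms G_isom by auto
  obtain M where M: "\<And>i. i \<ge> M \<Longrightarrow> r + len b' + \<delta> \<le> gp (ivt b (z (e * i) p)) (z (e' * i) p)"
    using assms(3) unfolding asym_def by blast
  obtain M' where M': "\<And>i. i \<ge> M' \<Longrightarrow> r + len b' + \<delta> \<le> gp (ivt b' (z (e * i) p)) (z (e' * i) p)"
    using assms(4) unfolding asym_def by blast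
  have "r \<le> gp (ivt (b \<circ> ivt b') (z (e * i) p)) (z (e * i) p)" if i: "i \<ge> max M M'" for i
  proof -
    have "r + len b' \<le> gp (ivt b (z (e * i) p)) (ivt b' (z (e * i) p))"
      using gp_hyp[OF M[of i], of "ivt b' (z (e * i) p)"] M'[of i] i gp_sym[of "z (e' * i) p"] by simp
    then have "r \<le> gp (b' (ivt b (z (e * i) p))) (b' (ivt b' (z (e * i) p)))"
      using gp_isometry_ge[OF ib(2), of "ivt b (z (e * i) p)" "ivt b' (z (e * i) p)"] by linarith
    then show ?thesis using ivt_comp[OF ib(1) isometry_ivt[OF ib(2)]] ib by simp
  qed
  then show "\<exists>M. \<forall>i\<ge>M. r \<le> gp (ivt (b \<circ> ivt b') (z (e * i) p)) (z (e * i) p)" by blast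
qed

text \<open>Rays towards the same end eventually run close together; that the bound is the same for
  all large \<open>i\<close> is what the pigeonhole argument of \<open>asym_conj\<close>
  uses.\<close>

lemma asym_close:
  assumes b: "b \<in> \<Gamma>" "asym b e e" and e: "e = 1 \<or> e = - 1"
  shows "\<exists>M. \<forall>i\<ge>M. \<exists>i'\<ge>0. dist (ivt b (z (e * i) p)) (z (e * i') p) \<le> 3 * len F + 2 * (a + 2 * \<delta>) + 2 * \<delta>"
proof -
  have ib: "isometry b" "isometry (ivt b)" using b G_isom isometry_ivt by auto
  obtain M where M: "\<And>i. M \<le> \<bar>i\<bar> \<Longrightarrow> a + 3 * \<delta> + len b \<le> lz i" using lz_unbounded by blast
  have le: "lz (e * k) = lz k" for k using e lz_neg[of k] by auto
  have "\<exists>i'\<ge>0. dist (ivt b (z (e * i) p)) (z (e * i') p) \<le> 3 * len F + 2 * (a + 2 * \<delta>) + 2 * \<delta>"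
    if i: "i \<ge> max 0 M" for i
  proof -
    define y where "y k = ivt b (z (e * k) p)" for k
    define w where "w = ivt b p"
    obtain i' where i': "0 \<le> i'" "\<bar>lz i' - nrm (y i)\<bar> \<le> len F" using lz_reach[of "nrm (y i)"] by auto
    obtain K1 where K1: "\<And>k. k \<ge> K1 \<Longrightarrow> a + 2 * \<delta> + nrm (y i) \<le> gp (y k) (z (e * k) p)"
      using b(2) unfolding asym_def y_def by blast
    obtain K2 where K2: "\<And>k. K2 \<le> \<bar>k\<bar> \<Longrightarrow> nrm (y i) + len F \<le> lz k" using lz_unbounded by blast
    define k where "k = max i (max K1 K2)"
    define \<zeta> where "\<zeta> = z (e * k) p"
    \<comment> \<open>From \<open>y i\<close> the directions of \<open>w\<close> and
      \<open>y k\<close> are separated, because the three points lie on a translate of the axis.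
      Replacing \<open>y k\<close> by \<zeta> and then \<open>w\<close> by \<open>p\<close> costs
      \<delta> each, so \<open>y i\<close> almost lies on a geodesic from \<open>p\<close> to
      \<zeta>, as does a suitable axis point.\<close>
    have "gromov_product (y i) w (y k) = gromov_product (z (e * i) p) p (z (e * k) p)"
      unfolding y_def w_def by (rule gpw_isometry[OF ib(2)])
    also have "\<dots> = gromov_product (z (- (e * i)) (z (e * i) p)) (z (- (e * i)) p) (z (- (e * i)) (z (e * k) p))"
      by (rule gpw_isometry[OF z_isom, symmetric])
    also have "\<dots> = gp (z (- (e * i)) p) (z (e * (k - i)) p)" by (simp add: z_apply right_diff_distrib)
    also have "\<dots> \<le> a"
      using e z_axis[of i "k - i"] i by (auto simp: k_def)
    finally have 1: "gromov_product (y i) w (y k) \<le> a" .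
    have "a + 2 * \<delta> \<le> gromov_product (y i) (y k) \<zeta>"
    proof -
      have "k \<ge> K1" by (simp add: k_def)
      then show ?thesis using K1[of k] gpw_base_ge[of "y k" \<zeta> "y i"] unfolding \<zeta>_def by linarith
    qed
    then have 2: "gromov_product (y i) w \<zeta> \<le> a + \<delta>"
      using gpw_hyp_less[OF 1, of \<zeta>] delta_pos by simp
    have "dist (y i) w = lz i" unfolding y_def w_def
      using isometry_dist[OF ib(2), of "z (e * i) p" p] le[of i] by (simp add: dist_commute)
    moreover have "nrm w = len b" unfolding w_def by (rule len_ivt[OF ib(1)])
    ultimately have "lz i - len b \<le> gromov_product (y i) w p"
      using dist_triangle[of "y i" w p] by (simp add: gromov_product_def dist_commute[of _ p] dist_commute[of w "y i"] field_simps)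
    moreover have "a + 3 * \<delta> + len b \<le> lz i" using M[of i] i by simp
    ultimately have "a + \<delta> + \<delta> < gromov_product (y i) w p" using delta_pos by linarith
    then have "gromov_product (y i) \<zeta> p \<le> a + \<delta> + \<delta>"
      using gpw_hyp_less[of "y i" \<zeta> w "a + \<delta>" p] 2 by (simp add: gromov_product_def dist_commute add.commute)
    then have g1: "nrm (y i) - (a + 2 * \<delta>) \<le> gp (y i) \<zeta>"
      using gpw_sum[of "y i" \<zeta>] by (simp add: gromov_product_def dist_commute add.commute)
    have "K2 \<le> k" by (simp add: k_def)
    then have "lz i' \<le> lz k" using K2[of k] i'(2) by linarith
    then have "lz i' - a \<le> gp (z (e * i') p) \<zeta>"
    proof -
      have "0 \<le> k" using i unfolding k_def by linarith
      then show ?thesis using z_same_side[OF i'(1) _ e, of k] \<open>lz i' \<le> lz k\<close> unfolding \<zeta>_def by simp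
    qed
    then have g2: "nrm (z (e * i') p) - (a + 2 * \<delta>) \<le> gp (z (e * i') p) \<zeta>"
      using le[of i'] delta_pos by simp
    have "dist (y i) (z (e * i') p) \<le> 3 * len F + 2 * (a + 2 * \<delta>) + 2 * \<delta>"
      by (rule near_segment[OF g1 g2]) (use le[of i'] i' in simp)
    then show ?thesis using i'(1) unfolding y_def by blast
  qed
  then show ?thesis by blast
qed

lemma z_eq_id_iff: "z s = id \<longleftrightarrow> s = 0"
proof
  assume "z s = id"
  then have id: "z (s * n) = id" for n using zp_mult[OF F_isom, of s n, symmetric] group.int_pow_one[OF group_isom_group]
    by (simp add: zp_def)
  show "s = 0"
  proof (rule ccontr)
    assume "s \<noteq> 0"
    obtain n where n: "\<And>i. n \<le> \<bar>i\<bar> \<Longrightarrow> 1 \<le> lz i" using lz_unbounded by blast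
    have "\<bar>n\<bar> \<le> \<bar>s * n\<bar>" using \<open>s \<noteq> 0\<close> mult_right_mono[of 1 "\<bar>s\<bar>" "\<bar>n\<bar>"] by (simp add: abs_mult)
    then have "1 \<le> lz (s * n)" by (intro n) linarith
    then show False using id[of n] by simp
  qed
qed simp

lemma conj_power:
  assumes ib: "isometry b" and c: "ivt b \<circ> z s \<circ> b = z t"
  shows "ivt b \<circ> z (s * int n) \<circ> b = z (t * int n)"
proof (induction n)
  case 0
  then show ?case using ib by simp
next
  case (Suc n)
  have "ivt b \<circ> z (s * int (Suc n)) \<circ> b = ivt b \<circ> (z s \<circ> z (s * int n)) \<circ> b"
    by (simp add: z_comp distrib_left)
  also have "\<dots> = (ivt b \<circ> z s \<circ> b) \<circ> (ivt b \<circ> z (s * int n) \<circ> b)"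
    using ib by (auto simp: fun_eq_iff)
  also have "\<dots> = z (t * int (Suc n))" unfolding c Suc z_comp by (simp add: distrib_left)
  finally show ?case .
qed

text \<open>Pulling the translated axis points back by powers of \<open>F\<close> gives elements
  \<phi> that move \<open>p\<close> by a bounded amount, so by properness two of them coincide.
  Comparing the two indices shows that \<open>b\<close> conjugates a nontrivial power of
  \<open>F\<close> to a power of \<open>F\<close>, which is then nontrivial as well.\<close>

lemma asym_conj:
  assumes b: "b \<in> \<Gamma>" "asym b e e" and e: "e = 1 \<or> e = - 1"
  shows "\<exists>s t. s \<noteq> 0 \<and> t \<noteq> 0 \<and> ivt b \<circ> z s \<circ> b = z t"
proof -
  have ib: "isometry b" using b G_isom by auto
  define C0 where "C0 = 3 * len F + 2 * (a + 2 * \<delta>) + 2 * \<delta>"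
  have "\<exists>M. \<forall>i\<ge>M. \<exists>i'\<ge>0. dist (ivt b (z (e * i) p)) (z (e * i') p) \<le> C0"
    unfolding C0_def by (rule asym_close[OF b e])
  then obtain M where "\<forall>i\<ge>M. \<exists>i'\<ge>0. dist (ivt b (z (e * i) p)) (z (e * i') p) \<le> C0" ..
  then have "\<forall>i\<in>{M..}. \<exists>i'. dist (ivt b (z (e * i) p)) (z (e * i') p) \<le> C0" by auto
  from bchoice[OF this] obtain \<iota> where io: "\<forall>i\<in>{M..}. dist (ivt b (z (e * i) p)) (z (e * \<iota> i) p) \<le> C0" ..
  define \<phi> where "\<phi> i = z (- (e * \<iota> i)) \<circ> ivt b \<circ> z (e * i)" for i
  have "\<phi> i \<in> {g \<in> \<Gamma>. len g \<le> C0}" if "i \<in> {M..}" for i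
  proof -
    have "dist (\<phi> i p) (z (- (e * \<iota> i)) (z (e * \<iota> i) p)) \<le> C0"
      using io that isometry_dist[OF z_isom] by (simp add: \<phi>_def)
    then have "len (\<phi> i) \<le> C0" by (simp add: z_apply dist_commute)
    moreover have "\<phi> i \<in> \<Gamma>" unfolding \<phi>_def using G_comp zG G_ivt b(1) by blast
    ultimately show ?thesis by simp
  qed
  then have "finite (\<phi> ` {M..})" by (intro finite_subset[OF _ finite_ball[of C0]]) auto
  moreover have "infinite {M..}" by (rule infinite_Ici)
  ultimately obtain i0 where i0: "i0 \<in> {M..}" "infinite {i \<in> {M..}. \<phi> i = \<phi> i0}"
    using pigeonhole_infinite by blast
  then have "infinite ({i \<in> {M..}. \<phi> i = \<phi> i0} - {i0})" by simp
  then have "{i \<in> {M..}. \<phi> i = \<phi> i0} - {i0} \<noteq> {}" by (rule infinite_imp_nonempty)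
  then obtain k where "k \<in> {i \<in> {M..}. \<phi> i = \<phi> i0} - {i0}" unfolding ex_in_conv[symmetric] ..
  then have k: "k \<in> {M..}" "\<phi> k = \<phi> i0" "k \<noteq> i0" by simp_all
  have iv: "ivt b (z (e * i) x) = z (e * \<iota> i) (\<phi> i x)" for i x
    by (simp add: \<phi>_def z_apply)
  have iphi: "isometry (\<phi> i)" for i unfolding \<phi>_def using ib z_isom by (intro isometry_comp isometry_ivt)
  have bb: "b x = z (e * i0) (ivt (\<phi> i0) (z (- (e * \<iota> i0)) x))" for x
  proof -
    have "ivt b (z (e * i0) (ivt (\<phi> i0) (z (- (e * \<iota> i0)) x))) = x"
      unfolding iv using iphi by (simp add: z_apply)
    then show ?thesis using ib by (metis isometry_ivt_apply(1))
  qed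
  have "ivt b (z (e * (k - i0)) (b x)) = z (e * (\<iota> k - \<iota> i0)) x" for x
  proof -
    have "ivt b (z (e * (k - i0)) (b x)) = ivt b (z (e * k) (ivt (\<phi> i0) (z (- (e * \<iota> i0)) x)))"
      unfolding bb z_apply by (simp add: right_diff_distrib)
    also have "\<dots> = z (e * \<iota> k) (z (- (e * \<iota> i0)) x)" unfolding iv k(2) using iphi by simp
    also have "\<dots> = z (e * (\<iota> k - \<iota> i0)) x" by (simp add: z_apply right_diff_distrib)
    finally show ?thesis .
  qed
  then have c: "ivt b \<circ> z (e * (k - i0)) \<circ> b = z (e * (\<iota> k - \<iota> i0))" by auto
  have s: "e * (k - i0) \<noteq> 0" using k(3) e by auto
  moreover have "e * (\<iota> k - \<iota> i0) \<noteq> 0"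
  proof
    assume "e * (\<iota> k - \<iota> i0) = 0"
    then have "ivt b (z (e * (k - i0)) (b (ivt b x))) = ivt b x" for x using c by (metis comp_apply id_apply zp_0)
    then have "z (e * (k - i0)) x = x" for x using ib by (metis isometry_ivt_apply(1))
    then have "z (e * (k - i0)) = id" by (simp add: fun_eq_iff)
    then show False using s z_eq_id_iff[of "e * (k - i0)"] by simp
  qed
  ultimately show ?thesis using c by blast
qed

text \<open>By \<open>asym_conj\<close>, two opposite far points of the axis look separated from
  \<open>b p\<close>, up to a bounded error, just as they do from \<open>p\<close>; hence
  \<open>b p\<close> is close to the axis. The bound depends on \<open>F\<close>, \<open>a\<close>
  and \<delta> but not on \<open>b\<close>, which is what makes the number of cosets finite.\<close>

lemma asym_near_axis:
  assumes b: "b \<in> \<Gamma>" "asym b e e" and e: "e = 1 \<or> e = - 1"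
  shows "\<exists>m. dist (b p) (z m p) \<le> 3 * len F + 4 * a + 13 * \<delta>"
proof -
  have ib: "isometry b" "isometry (ivt b)" using b G_isom isometry_ivt by auto
  obtain s t where st: "s \<noteq> 0" "t \<noteq> 0" "ivt b \<circ> z s \<circ> b = z t" using asym_conj[OF b e] by blast
  define q where "q = b p"
  show ?thesis
  proof (cases "nrm q \<le> 2 * a + 5 * \<delta>")
    case True
    moreover have "dist (b p) (z 0 p) = nrm q" by (simp add: q_def dist_commute)
    ultimately have "dist (b p) (z 0 p) \<le> 3 * len F + 4 * a + 13 * \<delta>"
      using F_a delta_pos zero_le_dist[of p "F p"] by linarith
    then show ?thesis by blast
  next
    case False
    obtain n1 where n1: "\<And>i. n1 \<le> \<bar>i\<bar> \<Longrightarrow> nrm q + len F \<le> lz i" using lz_unbounded by blast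
    obtain n2 where n2: "\<And>i. n2 \<le> \<bar>i\<bar> \<Longrightarrow> len b + a + 3 * \<delta> \<le> lz i" using lz_unbounded by blast
    \<comment> \<open>A multiplier so large that \<open>u * N\<close> passes both length thresholds
      for every nonzero \<open>u\<close>, in particular for \<open>s\<close> and \<open>t\<close>
      and their negatives.\<close>
    define N where "N = int (nat \<bar>n1\<bar> + nat \<bar>n2\<bar>)"
    have big: "\<bar>n1\<bar> \<le> \<bar>u * N\<bar>" "\<bar>n2\<bar> \<le> \<bar>u * N\<bar>" if "u \<noteq> 0" for u
    proof -
      have "N \<le> \<bar>u\<bar> * N" using that mult_right_mono[of 1 "\<bar>u\<bar>" N] by (simp add: N_def)
      then show "\<bar>n1\<bar> \<le> \<bar>u * N\<bar>" "\<bar>n2\<bar> \<le> \<bar>u * N\<bar>" by (auto simp: abs_mult N_def)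
    qed
    have lsN: "nrm q + len F \<le> lz (u * N)" if "u \<noteq> 0" for u
      by (rule n1) (use big(1)[OF that] in linarith)
    have ltN: "len b + a + 3 * \<delta> \<le> lz (u * N)" if "u \<noteq> 0" for u
      by (rule n2) (use big(2)[OF that] in linarith)
    have conj: "ivt b (z (s * N) x) = z (t * N) (ivt b x)" "ivt b (z (- (s * N)) x) = z (- (t * N)) (ivt b x)" for x
    proof -
      have c1: "ivt b (z (s * N) (b y)) = z (t * N) y" for y
        using conj_power[OF ib(1) st(3), of "nat \<bar>n1\<bar> + nat \<bar>n2\<bar>"] unfolding N_def[symmetric] by (metis comp_apply)
      then show "ivt b (z (s * N) x) = z (t * N) (ivt b x)" using c1[of "ivt b x"] ib by simp
      have "z (- (t * N)) (ivt b (z (s * N) (b (ivt b (z (- (s * N)) x))))) = ivt b (z (- (s * N)) x)"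
        unfolding c1 by (simp add: z_apply)
      then show "ivt b (z (- (s * N)) x) = z (- (t * N)) (ivt b x)" using ib by (simp add: z_apply)
    qed
    have pm: "gp (z (u * N) p) (z (- (u * N)) p) \<le> a" for u
    proof (cases "0 \<le> u * N")
      case True
      then show ?thesis using z_axis(2)[of "u * N" "u * N"] by simp
    next
      case False
      then show ?thesis using z_axis(1)[of "- (u * N)" "- (u * N)"] by simp
    qed
    define w where "w = ivt b p"
    have nw: "nrm w = len b" unfolding w_def by (rule len_ivt[OF ib(1)])
    have vz: "lz k - len b \<le> gp (z k w) (z k p)" for k
    proof -
      have "dist (z k w) (z k p) = len b" using isometry_dist[OF z_isom, of k w p] nw by (simp add: dist_commute)
      then show ?thesis using gp_lipschitz[of "z k p" "z k p" "z k w"] gp_sym[of "z k w" "z k p"] by (simp add: dist_commute)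
    qed
    have "gp (z (- (t * N)) w) (z (t * N) w) \<le> a + \<delta> + \<delta>"
    proof (rule gp_hyp_less)
      show "a + \<delta> + \<delta> < gp (z (t * N) w) (z (t * N) p)" using vz[of "t * N"] ltN[OF st(2)] delta_pos by linarith
      have "gp (z (t * N) p) (z (- (t * N)) w) \<le> a + \<delta>"
        by (rule gp_hyp_less[OF pm]) (use vz[of "- (t * N)"] ltN[OF st(2)] lz_neg[of "t * N"] delta_pos in linarith)
      then show "gp (z (- (t * N)) w) (z (t * N) p) \<le> a + \<delta>" using gp_sym by metis
    qed
    then have "gromov_product (ivt b q) (ivt b (z (- (s * N)) p)) (ivt b (z (s * N) p)) \<le> a + \<delta> + \<delta>"
      unfolding conj w_def[symmetric] q_def using ib by simp
    then have 1: "gromov_product q (z (- (s * N)) p) (z (s * N) p) \<le> a + 2 * \<delta>"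
      unfolding gpw_isometry[OF ib(2)] by simp
    \<comment> \<open>From \<open>p\<close>, the point \<open>q\<close> cannot look towards both
      ends. If it does not look towards the end of \<open>- (s' * N)\<close>, then from
      \<open>q\<close> that end lies in the direction of \<open>p\<close>, hence opposite to the
      other end, and \<open>q\<close> is close to the half axis towards
      \<open>s' * N\<close>.\<close>
    have "gp q (z (s * N) p) \<le> a + \<delta> \<or> gp q (z (- (s * N)) p) \<le> a + \<delta>"
      using gp_hyp_less[OF pm[of s], of q] gp_sym[of q] gp_sym[of "z (s * N) p" q] by (smt (verit))
    then obtain s' where s': "s' = s \<or> s' = - s" "gp q (z (- (s' * N)) p) \<le> a + \<delta>" by force
    have h1': "gromov_product q (z (s' * N) p) (z (- (s' * N)) p) \<le> a + 2 * \<delta>"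
      using 1 s'(1) by (auto simp: gromov_product_def dist_commute add.commute)
    have "a + 2 * \<delta> + \<delta> < gromov_product q (z (- (s' * N)) p) p"
      using gpw_sum[of q "z (- (s' * N)) p"] s'(2) False delta_pos
      by (simp add: gromov_product_def dist_commute add.commute)
    with h1' have "gromov_product q (z (s' * N) p) p \<le> a + 2 * \<delta> + \<delta>" by (rule gpw_hyp_less)
    then have g1: "nrm q - (a + 3 * \<delta>) \<le> gp q (z (s' * N) p)"
      using gpw_sum[of q "z (s' * N) p"] by (simp add: gromov_product_def dist_commute add.commute)
    obtain i where i: "0 \<le> i" "\<bar>lz i - nrm q\<bar> \<le> len F" using lz_reach[of "nrm q"] by auto
    define e' :: int where "e' = (if 0 \<le> s' * N then 1 else - 1)"
    have e': "e' = 1 \<or> e' = - 1" "s' * N = e' * \<bar>s' * N\<bar>" by (auto simp: e'_def)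
    have lei: "lz (e' * i) = lz i" using e'(1) lz_neg[of i] by auto
    have s'0: "s' \<noteq> 0" using s'(1) st(1) by auto
    have la: "lz \<bar>s' * N\<bar> = lz (s' * N)" using lz_neg[of "s' * N"] by (simp add: abs_if)
    have "lz i - a \<le> gp (z (e' * i) p) (z (s' * N) p)"
      using z_same_side[OF i(1) _ e'(1), of "\<bar>s' * N\<bar>"] lsN[OF s'0] i(2) la e'(2) by simp
    then have g2: "nrm (z (e' * i) p) - (a + 3 * \<delta>) \<le> gp (z (e' * i) p) (z (s' * N) p)"
      using lei delta_pos by simp
    have "dist q (z (e' * i) p) \<le> 3 * len F + 2 * (a + 3 * \<delta>) + 2 * \<delta>"
      by (rule near_segment[OF g1 g2]) (use lei i in simp)
    moreover have "3 * len F + 2 * (a + 3 * \<delta>) + 2 * \<delta> \<le> 3 * len F + 4 * a + 13 * \<delta>"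
      using F_a delta_pos by (simp add: algebra_simps)
    ultimately have "dist q (z (e' * i) p) \<le> 3 * len F + 4 * a + 13 * \<delta>" by (rule order_trans)
    then show ?thesis unfolding q_def by blast
  qed
qed

text \<open>Such a covering would give the infinite cyclic group generated by \<open>F\<close>
  finite index in \<Gamma>, against non-elementarity.\<close>

lemma not_finite_cosets:
  assumes "finite \<Phi>" "\<Gamma> \<subseteq> (\<Union>m. (\<lambda>\<phi>. z m \<circ> \<phi>) ` \<Phi>)" shows False
proof -
  define G where "G = subgrp \<Gamma>"
  define K where "K = range z"
  have Kz: "z j \<in> K" for j by (simp add: K_def)
  have K: "subgroup K G"
  proof (rule subgroup.intro)
    show "K \<subseteq> carrier G" using zG by (auto simp: K_def G_def)
    show "x \<otimes>\<^bsub>G\<^esub> y \<in> K" if "x \<in> K" "y \<in> K" for x y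
      using that by (auto simp: K_def G_def isom_group_def z_comp)
    show "\<one>\<^bsub>G\<^esub> \<in> K" using Kz[of 0] by (simp add: G_def isom_group_def)
    show "inv\<^bsub>G\<^esub> x \<in> K" if "x \<in> K" for x
      using that inv_subgrp[OF zG] Kz ivt_z by (auto simp: K_def G_def)
  qed
  have "finite (rcosets\<^bsub>G\<^esub> K)"
  proof (rule finite_subset)
    show "rcosets\<^bsub>G\<^esub> K \<subseteq> (\<lambda>\<phi>. (\<lambda>k. k \<circ> \<phi>) ` K) ` \<Phi>"
    proof
      fix C assume "C \<in> rcosets\<^bsub>G\<^esub> K"
      then obtain x where x: "x \<in> \<Gamma>" "C = (\<lambda>k. k \<circ> x) ` K"
        by (auto simp: RCOSETS_def r_coset_def G_def isom_group_def)
      then obtain m \<phi> where m: "\<phi> \<in> \<Phi>" "x = z m \<circ> \<phi>" using assms(2) by blast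
      have "(\<lambda>k. k \<circ> x) ` K = (\<lambda>k. k \<circ> \<phi>) ` K"
      proof
        show "(\<lambda>k. k \<circ> x) ` K \<subseteq> (\<lambda>k. k \<circ> \<phi>) ` K"
          using m(2) z_comp by (auto simp: K_def simp flip: comp_assoc)
        show "(\<lambda>k. k \<circ> \<phi>) ` K \<subseteq> (\<lambda>k. k \<circ> x) ` K"
        proof clarsimp
          fix k assume "k \<in> K"
          then obtain j where j: "k = z j" by (auto simp: K_def)
          have "k \<circ> \<phi> = z (j - m) \<circ> x" unfolding m(2) j by (simp add: z_comp flip: comp_assoc)
          then show "k \<circ> \<phi> \<in> (\<lambda>k. k \<circ> x) ` K" using Kz by blast
        qed
      qed
      then show "C \<in> (\<lambda>\<phi>. (\<lambda>k. k \<circ> \<phi>) ` K) ` \<Phi>" using x m by blast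
    qed
  qed (use assms(1) in simp)
  moreover have "G\<lparr>carrier := K\<rparr> \<cong> integer_group"
  proof (rule group.iso_sym)
    show "group integer_group" by simp
    have inj: "inj z"
    proof (rule injI)
      fix i j assume "z i = z j"
      then have "z (- j) \<circ> z i = z (- j) \<circ> z j" by simp
      then have "z (i - j) = id" by (simp add: z_comp add.commute)
      then show "i = j" using z_eq_id_iff by simp
    qed
    have "z \<in> iso integer_group (G\<lparr>carrier := K\<rparr>)"
      unfolding iso_def hom_def using inj
      by (auto simp: integer_group_def K_def G_def isom_group_def z_comp bij_betw_def)
    then show "integer_group \<cong> G\<lparr>carrier := K\<rparr>" by (rule is_isoI)
  qed
  ultimately have "virtually_Z G" using K unfolding virtually_Z_def by blast
  then show False using nonelem by (simp add: elementary_def G_def)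
qed

text \<open>Otherwise every element maps one fixed end of the axis to an end of the axis, and \<open>\<Gamma>\<close> is a
  finite union of cosets of the cyclic group generated by \<open>F\<close>.\<close>

lemma direction_lemma:
  "\<exists>B R. finite B \<and> B \<subseteq> \<Gamma> \<and> (\<forall>x. \<exists>b\<in>B. \<forall>j. gp (ivt b x) (z j p) \<le> R)"
proof (rule ccontr)
  assume no: "\<not> ?thesis"
  have "\<forall>n::nat. \<exists>x. \<forall>b\<in>{g \<in> \<Gamma>. len g \<le> real n}. \<exists>j. real n < gp (ivt b x) (z j p)"
  proof
    fix n :: nat
    have "finite {g \<in> \<Gamma>. len g \<le> real n}" "{g \<in> \<Gamma>. len g \<le> real n} \<subseteq> \<Gamma>" using finite_ball by auto
    then show "\<exists>x. \<forall>b\<in>{g \<in> \<Gamma>. len g \<le> real n}. \<exists>j. real n < gp (ivt b x) (z j p)"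
      using no by (meson not_less)
  qed
  \<comment> \<open>As counterexamples, the points \<open>X n\<close> look along the axis even after
    pulling back by any \<open>b\<close> of length at most \<open>n\<close>. Below,
    \<open>S b e n\<close> records towards which end.\<close>
  from choice[OF this] obtain X where
    "\<forall>n::nat. \<forall>b\<in>{g \<in> \<Gamma>. len g \<le> real n}. \<exists>j. real n < gp (ivt b (X n)) (z j p)" ..
  then have X: "\<exists>j. real n < gp (ivt b (X n)) (z j p)" if "b \<in> \<Gamma>" "len b \<le> real n" for n b
    using that by blast
  define S where "S b e n \<longleftrightarrow> (\<exists>j\<ge>0. real n < gp (ivt b (X n)) (z (e * j) p))" for b e n
  have S: "S b 1 n \<or> S b (- 1) n" if bn: "b \<in> \<Gamma>" "len b \<le> real n" for b n
  proof -
    obtain j where j: "real n < gp (ivt b (X n)) (z j p)" using X[OF bn] by blast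
    show ?thesis
    proof (cases "0 \<le> j")
      case True
      then show ?thesis using j unfolding S_def by (intro disjI1 exI[of _ j]) simp
    next
      case False
      then show ?thesis using j unfolding S_def by (intro disjI2 exI[of _ "- j"]) simp
    qed
  qed
  have far: "\<exists>M. \<forall>i\<ge>M. real n - a - \<delta> \<le> gp (ivt b (X n)) (z (e * i) p)" if Sb: "S b e n" and ee: "e = 1 \<or> e = - 1" for b e n
  proof -
    obtain j where j: "0 \<le> j" "real n < gp (ivt b (X n)) (z (e * j) p)" using Sb unfolding S_def by blast
    have "lz (e * j) = lz j" using ee lz_neg[of j] by auto
    then have lj: "real n < lz j" using j(2) gp_le(2)[of "ivt b (X n)" "z (e * j) p"] by linarith
    obtain M where M: "\<And>i. M \<le> \<bar>i\<bar> \<Longrightarrow> real n \<le> lz i" using lz_unbounded by blast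
    have "real n - a - \<delta> \<le> gp (ivt b (X n)) (z (e * i) p)" if i: "i \<ge> max 0 M" for i
    proof (rule gp_hyp)
      show "real n - a \<le> gp (ivt b (X n)) (z (e * j) p)" using j(2) F_a by linarith
      show "real n - a \<le> gp (z (e * j) p) (z (e * i) p)"
        using z_same_side[OF j(1) _ ee, of i] i M[of i] lj by simp
    qed
    then show ?thesis by blast
  qed
  \<comment> \<open>If \<open>X n\<close> looks towards \<open>e\<close> while its pullback by
    \<open>b\<close> looks towards \<open>e'\<close>, then, up to an error depending on
    \<open>b\<close> alone, the inverse of \<open>b\<close> sends far points near \<open>e\<close>
    to points near \<open>e'\<close>; infinitely many \<open>n\<close> make the depth
    arbitrary.\<close>
  have asymI: "asym b e e'" if b: "b \<in> \<Gamma>" and e: "e = 1 \<or> e = - 1" "e' = 1 \<or> e' = - 1"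
    and inf: "infinite {n. S id e n \<and> S b e' n}" for b e e'
    unfolding asym_def
  proof
    fix r
    have ib: "isometry (ivt b)" using b G_isom isometry_ivt by auto
    obtain m :: nat where m: "r + len b + a + 2 * \<delta> \<le> real m" using real_arch_simple by blast
    obtain n where n: "m \<le> n" "S id e n" "S b e' n"
      using inf unfolding infinite_nat_iff_unbounded_le by blast
    obtain M1 where M1: "\<And>i. i \<ge> M1 \<Longrightarrow> real n - a - \<delta> \<le> gp (X n) (z (e * i) p)"
      using far[OF n(2) e(1)] by auto
    obtain M2 where M2: "\<And>i. i \<ge> M2 \<Longrightarrow> real n - a - \<delta> \<le> gp (ivt b (X n)) (z (e' * i) p)"
      using far[OF n(3) e(2)] by auto
    have "r \<le> gp (ivt b (z (e * i) p)) (z (e' * i) p)" if i: "i \<ge> max M1 M2" for i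
    proof -
      have c: "real n - a - \<delta> - len b \<le> gp (ivt b (X n)) (ivt b (z (e * i) p))"
        using gp_isometry_ge[OF ib, of "X n" "z (e * i) p"] M1[of i] i len_ivt[of b] G_isom[OF b] by simp
      then have "real n - a - \<delta> - len b - \<delta> \<le> gp (ivt b (z (e * i) p)) (z (e' * i) p)"
      proof (intro gp_hyp)
        show "real n - a - \<delta> - len b \<le> gp (ivt b (z (e * i) p)) (ivt b (X n))"
          using c gp_sym by metis
        show "real n - a - \<delta> - len b \<le> gp (ivt b (X n)) (z (e' * i) p)"
          using M2[of i] i zero_le_dist[of p "b p"] by linarith
      qed
      then show ?thesis using m n(1) by linarith
    qed
    then show "\<exists>M. \<forall>i\<ge>M. r \<le> gp (ivt b (z (e * i) p)) (z (e' * i) p)" by blast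
  qed
  have "UNIV = {n. S id 1 n} \<union> {n. S id (- 1) n}" using S[OF G_id] by auto
  then have "infinite {n. S id 1 n} \<or> infinite {n. S id (- 1) n}"
    by (metis finite_Un infinite_UNIV_nat)
  then obtain e where e: "e = 1 \<or> e = - 1" "infinite {n. S id e n}" by blast
  \<comment> \<open>Among the infinitely many \<open>n\<close> for which \<open>X n\<close> looks
    towards \<open>e\<close>, the pullback by \<open>b\<close> looks infinitely often towards one of
    the two ends.\<close>
  have dich: "asym b e e \<or> asym b e (- e)" if b: "b \<in> \<Gamma>" for b
  proof -
    obtain m :: nat where m: "len b \<le> real m" using real_arch_simple by blast
    have "{n. S id e n} \<subseteq> {..m} \<union> {n. S id e n \<and> S b e n} \<union> {n. S id e n \<and> S b (- e) n}"
    proof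
      fix n assume n: "n \<in> {n. S id e n}"
      have "S b e n \<or> S b (- e) n" if "m < n" using S[OF b, of n] m that e(1) by auto
      then show "n \<in> {..m} \<union> {n. S id e n \<and> S b e n} \<union> {n. S id e n \<and> S b (- e) n}"
        using n by (cases "n \<le> m") auto
    qed
    then have "infinite {n. S id e n \<and> S b e n} \<or> infinite {n. S id e n \<and> S b (- e) n}"
      using e(2) finite_subset by (metis finite_Un finite_atMost)
    then show ?thesis using asymI[OF b e(1), of e] asymI[OF b e(1), of "- e"] e(1) by auto
  qed
  define C where "C = 3 * len F + 4 * a + 13 * \<delta>"
  define \<Phi>1 where "\<Phi>1 = {g \<in> \<Gamma>. len g \<le> C}"
  have near: "\<exists>m. \<exists>\<phi>\<in>\<Phi>1. b = z m \<circ> \<phi>" if b: "b \<in> \<Gamma>" "asym b e e" for b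
  proof -
    obtain m where m: "dist (b p) (z m p) \<le> C" unfolding C_def using asym_near_axis[OF b e(1)] by blast
    have "dist (z (- m) (b p)) (z (- m) (z m p)) \<le> C" using m isometry_dist[OF z_isom] by simp
    then have "len (z (- m) \<circ> b) \<le> C" by (simp add: z_apply dist_commute)
    then have "z (- m) \<circ> b \<in> \<Phi>1" using G_comp[OF zG b(1)] by (simp add: \<Phi>1_def)
    moreover have "b = z m \<circ> (z (- m) \<circ> b)" by (simp add: z_comp flip: comp_assoc)
    ultimately show ?thesis by blast
  qed
  have f1: "finite \<Phi>1" unfolding \<Phi>1_def by (rule finite_ball)
  show False
  proof (cases "\<exists>b\<in>\<Gamma>. asym b e (- e)")
    case False
    have "\<Gamma> \<subseteq> (\<Union>m. (\<lambda>\<phi>. z m \<circ> \<phi>) ` \<Phi>1)"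
    proof
      fix b assume b: "b \<in> \<Gamma>"
      then have "asym b e e" using dich[OF b] False by blast
      then obtain m \<phi> where "\<phi> \<in> \<Phi>1" "b = z m \<circ> \<phi>" using near[OF b] by blast
      then show "b \<in> (\<Union>m. (\<lambda>\<phi>. z m \<circ> \<phi>) ` \<Phi>1)" by blast
    qed
    then show False by (rule not_finite_cosets[OF f1])
  next
    case True
    then obtain b2 where b2: "b2 \<in> \<Gamma>" "asym b2 e (- e)" by blast
    \<comment> \<open>An element sending \<open>e\<close> to the other end differs from the fixed
      \<open>b2\<close> by one that preserves \<open>e\<close>, so one more finite family of cosets
      suffices.\<close>
    define \<Phi>2 where "\<Phi>2 = \<Phi>1 \<union> (\<lambda>\<phi>. \<phi> \<circ> b2) ` \<Phi>1"
    have "b \<in> (\<Union>m. (\<lambda>\<phi>. z m \<circ> \<phi>) ` \<Phi>2)" if b: "b \<in> \<Gamma>" for b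
    proof (cases "asym b e e")
      case True
      then obtain m \<phi> where "\<phi> \<in> \<Phi>1" "b = z m \<circ> \<phi>" using near[OF b] by blast
      then show ?thesis by (auto simp: \<Phi>2_def)
    next
      case False
      then have "asym b e (- e)" using dich[OF b] by blast
      then have "asym (b \<circ> ivt b2) e e" using asym_comp[OF b b2(1) _ b2(2)] by blast
      then obtain m \<phi> where m: "\<phi> \<in> \<Phi>1" "b \<circ> ivt b2 = z m \<circ> \<phi>" using near[OF G_comp[OF b G_ivt[OF b2(1)]]] by blast
      have "b = (b \<circ> ivt b2) \<circ> b2" using G_isom[OF b2(1)] by (simp add: comp_assoc)
      also have "\<dots> = z m \<circ> (\<phi> \<circ> b2)" unfolding m(2) by (simp add: comp_assoc)
      finally have "b = z m \<circ> (\<phi> \<circ> b2)" .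
      then show ?thesis using m(1) unfolding \<Phi>2_def by blast
    qed
    then have "\<Gamma> \<subseteq> (\<Union>m. (\<lambda>\<phi>. z m \<circ> \<phi>) ` \<Phi>2)" by (rule subsetI)
    moreover have "finite \<Phi>2" using f1 by (simp add: \<Phi>2_def)
    ultimately show False by (intro not_finite_cosets[of \<Phi>2])
  qed
qed

end

section \<open>Ping-pong sets of a loxodromic element\<close>

locale psl_action = ps_action p \<delta> \<Gamma> \<nu> + lox_action p \<delta> \<Gamma> F a
  for p :: "'a::metric_space" and \<delta> :: real and \<Gamma> and \<nu> :: "'a bordification measure" and F a

context hyp_space
begin

lemma bp_opposite:
  assumes "\<zeta> \<in> Z" "gp x y \<le> c" "c + 4 * \<delta> \<le> bp \<zeta> x" shows "bp \<zeta> y \<le> c + 4 * \<delta>"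
proof (rule ccontr)
  assume "\<not> bp \<zeta> y \<le> c + 4 * \<delta>"
  then have "c + 4 * \<delta> - 3 * \<delta> \<le> gp x y" by (intro gp_bp_hyp[OF assms(1,3)]) simp
  then show False using assms(2) delta_pos by simp
qed

end

context psl_action
begin

section \<open>The ends of the axis have measure zero\<close>

abbreviation W :: "int \<Rightarrow> real \<Rightarrow> 'a bordification set" where
  "W i r \<equiv> T interior_of Sh (z i p) r"

lemma W_D: assumes "\<zeta> \<in> W i r" shows "\<zeta> \<in> Z" "r \<le> bp \<zeta> (z i p)"
  using interior_of_subset[of T "Sh (z i p) r"] assms unfolding Sh_def by blast+

lemma W_I: assumes "\<zeta> \<in> Z" "r + 31 * \<delta> \<le> bp \<zeta> (z i p)" shows "\<zeta> \<in> W i r"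
  by (rule Sh_interior) (use assms delta_pos in auto)

lemma W_mono: "r \<le> s \<Longrightarrow> W i s \<subseteq> W i r"
  by (intro interior_of_mono Sh_mono)

lemma W_sets: "W i r \<in> sets \<nu>"
  by (intro open_sets openin_interior_of)

text \<open>The fixed point of \<open>F\<close> on the boundary to which \<open>z (e * i) p\<close> converges.\<close>

definition fixset :: "int \<Rightarrow> 'a bordification set" where
  "fixset e = (\<Inter>n::nat. \<Union>i. W i (real n)) \<inter>
     (\<Union>n::nat. Z - (\<Union>i\<in>{0..}. W (- (e * i)) (real n)))"

lemma fixset_sets: "fixset e \<in> sets \<nu>"
proof -
  have "Z \<in> sets \<nu>" using sets.top[of \<nu>] by simp
  then show ?thesis unfolding fixset_def
    by (intro sets.Int sets.countable_INT' sets.countable_UN' sets.Diff W_sets) (auto intro: W_sets)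
qed

text \<open>The definition by open sets gives measurability, this description the estimates. They
  agree because both conditions ask for unbounded or bounded products only, so the
  \<open>31 * \<delta>\<close> between a shadow and its interior does not matter.\<close>

lemma fixset_iff:
  "\<zeta> \<in> fixset e \<longleftrightarrow> \<zeta> \<in> Z \<and> (\<forall>r. \<exists>i. r \<le> bp \<zeta> (z i p)) \<and> (\<exists>c. \<forall>i\<ge>0. bp \<zeta> (z (- (e * i)) p) \<le> c)"
proof
  assume z: "\<zeta> \<in> fixset e"
  then obtain n :: nat where n: "\<zeta> \<in> Z" "\<And>i. 0 \<le> i \<Longrightarrow> \<zeta> \<notin> W (- (e * i)) (real n)"
    unfolding fixset_def by auto
  have "bp \<zeta> (z (- (e * i)) p) \<le> real n + 31 * \<delta>" if "0 \<le> i" for i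
    using W_I[OF n(1), of "real n" "- (e * i)"] n(2)[OF that] by (meson linear)
  moreover have "\<exists>i. r \<le> bp \<zeta> (z i p)" for r
  proof -
    obtain k :: nat where k: "r \<le> real k" using real_arch_simple by blast
    have "\<zeta> \<in> (\<Union>i. W i (real k))" using z unfolding fixset_def by blast
    then obtain i where "\<zeta> \<in> W i (real k)" by blast
    then have "r \<le> bp \<zeta> (z i p)" using W_D(2)[of \<zeta> i "real k"] k by linarith
    then show ?thesis by blast
  qed
  ultimately show "\<zeta> \<in> Z \<and> (\<forall>r. \<exists>i. r \<le> bp \<zeta> (z i p)) \<and> (\<exists>c. \<forall>i\<ge>0. bp \<zeta> (z (- (e * i)) p) \<le> c)"
    using n(1) by blast
next
  assume z: "\<zeta> \<in> Z \<and> (\<forall>r. \<exists>i. r \<le> bp \<zeta> (z i p)) \<and> (\<exists>c. \<forall>i\<ge>0. bp \<zeta> (z (- (e * i)) p) \<le> c)"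
  then obtain c where c: "\<And>i. 0 \<le> i \<Longrightarrow> bp \<zeta> (z (- (e * i)) p) \<le> c" by blast
  obtain n :: nat where n: "c < real n" using reals_Archimedean2 by blast
  have "\<zeta> \<notin> W (- (e * i)) (real n)" if "0 \<le> i" for i
    using W_D(2)[of \<zeta> "- (e * i)" "real n"] c[OF that] n by linarith
  then have "\<zeta> \<in> Z - (\<Union>i\<in>{0..}. W (- (e * i)) (real n))" using z by auto
  moreover have "\<zeta> \<in> (\<Union>i. W i (real k))" for k :: nat
  proof -
    obtain i where "real k + 31 * \<delta> \<le> bp \<zeta> (z i p)" using z by blast
    then have "\<zeta> \<in> W i (real k)" using z by (intro W_I) auto
    then show ?thesis by blast
  qed
  ultimately show "\<zeta> \<in> fixset e" unfolding fixset_def by blast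
qed

text \<open>A point that is deep towards one end has product at most \<open>a + 4 * \<delta>\<close>
  with everything on the other side, so an unspecified bound improves to a uniform one.\<close>

lemma fixset_uniform:
  assumes "\<zeta> \<in> fixset e" "e = 1 \<or> e = - 1" "0 \<le> j"
  shows "bp \<zeta> (z (- (e * j)) p) \<le> a + 4 * \<delta>"
proof -
  obtain c where c: "\<And>i. 0 \<le> i \<Longrightarrow> bp \<zeta> (z (- (e * i)) p) \<le> c" using assms(1) unfolding fixset_iff by blast
  obtain i where i: "max (c + 1) (a + 4 * \<delta>) \<le> bp \<zeta> (z i p)" using assms(1) unfolding fixset_iff by blast
  have "0 \<le> e * i"
  proof (rule ccontr)
    assume "\<not> 0 \<le> e * i"
    then have "bp \<zeta> (z (- (e * (- (e * i)))) p) \<le> c" by (intro c) linarith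
    moreover have "- (e * (- (e * i))) = i" using assms(2) by (elim disjE) simp_all
    ultimately have "bp \<zeta> (z i p) \<le> c" by (simp only:)
    then show False using i by linarith
  qed
  then have "gp (z i p) (z (- (e * j)) p) \<le> a"
    using z_axis[of "e * i" j] assms(2,3) by auto
  moreover have "\<zeta> \<in> Z" using assms(1) unfolding fixset_iff by blast
  ultimately show ?thesis using bp_opposite[of \<zeta> "z i p" "z (- (e * j)) p" a] i by simp
qed

lemma fixset_act: assumes "\<zeta> \<in> fixset e" shows "act (z j) \<zeta> \<in> fixset e"
proof -
  obtain c where zz: "\<zeta> \<in> Z" "\<And>r. \<exists>i. r \<le> bp \<zeta> (z i p)" and c: "\<And>i. 0 \<le> i \<Longrightarrow> bp \<zeta> (z (- (e * i)) p) \<le> c"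
    using assms unfolding fixset_iff by blast
  have d: "\<bar>bp (act (z j) \<zeta>) (z (j + i) p) - bp \<zeta> (z i p)\<bar> \<le> lz j + 8 * \<delta>" for i
    using bp_act_diff[OF z_isom zz(1), of j "z i p"] by (simp add: z_apply)
  have "\<exists>i. r \<le> bp (act (z j) \<zeta>) (z i p)" for r
  proof -
    obtain i where "r + lz j + 8 * \<delta> \<le> bp \<zeta> (z i p)" using zz(2) by blast
    then have "r \<le> bp (act (z j) \<zeta>) (z (j + i) p)" using d[of i] by linarith
    then show ?thesis by blast
  qed
  moreover have "bp (act (z j) \<zeta>) (z (- (e * i)) p) \<le> c + 2 * lz j + 12 * \<delta>" if "0 \<le> i" for i
  proof -
    have "dist (z (- (e * i) - j) p) (z (- (e * i)) p) = lz j" by (simp add: z_dist)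
    then show ?thesis
      using d[of "- (e * i) - j"] c[OF that] bp_lipschitz[OF zz(1), of "z (- (e * i) - j) p" "z (- (e * i)) p"] by simp
  qed
  ultimately show ?thesis unfolding fixset_iff using act_Z[OF z_isom zz(1)] by blast
qed

text \<open>The set is invariant under powers of \<open>F\<close>, while its points have bounded
  product with \<open>z j p\<close> for \<open>j\<close> on the opposite side, so a long power would
  scale its measure by a factor below 1.\<close>

lemma fixset_null: assumes e: "e = 1 \<or> e = - 1" shows "measure \<nu> (fixset e) = 0"
proof -
  define c where "c = a + 4 * \<delta>"
  obtain J where "\<And>i. J \<le> \<bar>i\<bar> \<Longrightarrow> 2 * c + 70 * \<delta> + 1 \<le> lz i" using lz_unbounded by blast
  then have J: "2 * c + 70 * \<delta> + 1 \<le> lz \<bar>J\<bar>" by simp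
  define j where "j = - (e * \<bar>J\<bar>)"
  have lj: "lz j = lz \<bar>J\<bar>" using e lz_neg[of "\<bar>J\<bar>"] by (auto simp: j_def)
  have "act (ivt (z j)) ` fixset e = fixset e"
  proof
    show "act (ivt (z j)) ` fixset e \<subseteq> fixset e" unfolding ivt_z using fixset_act by blast
    show "fixset e \<subseteq> act (ivt (z j)) ` fixset e"
    proof
      fix \<zeta> assume "\<zeta> \<in> fixset e"
      then have "act (z j) \<zeta> \<in> fixset e" by (rule fixset_act)
      moreover have "\<zeta> = act (ivt (z j)) (act (z j) \<zeta>)" using z_isom by simp
      ultimately show "\<zeta> \<in> act (ivt (z j)) ` fixset e" by (metis image_eqI)
    qed
  qed
  moreover have "measure \<nu> (act (ivt (z j)) ` fixset e) \<le> exp (om * (2 * c + 70 * \<delta> - lz j)) * measure \<nu> (fixset e)"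
  proof (rule quasi_conformal[OF zG fixset_sets])
    fix \<zeta> assume "\<zeta> \<in> fixset e"
    then show "bp \<zeta> (z j p) \<le> c" unfolding j_def c_def by (rule fixset_uniform[OF _ e]) simp
  qed
  ultimately have le: "measure \<nu> (fixset e) \<le> exp (om * (2 * c + 70 * \<delta> - lz j)) * measure \<nu> (fixset e)" by simp
  have "om * (2 * c + 70 * \<delta> - lz j) < 0" using J lj om_pos by (intro mult_pos_neg) auto
  then have "exp (om * (2 * c + 70 * \<delta> - lz j)) < 1" by simp
  show ?thesis
  proof (rule ccontr)
    assume "measure \<nu> (fixset e) \<noteq> 0"
    then have "0 < measure \<nu> (fixset e)" by (simp add: zero_less_measure_iff)
    then have "exp (om * (2 * c + 70 * \<delta> - lz j)) * measure \<nu> (fixset e) < 1 * measure \<nu> (fixset e)"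
      using \<open>exp (om * (2 * c + 70 * \<delta> - lz j)) < 1\<close> by (intro mult_strict_right_mono)
    then show False using le by simp
  qed
qed

text \<open>The sets decrease into the union of the two ends of the axis, which is null. Points
  outside one of them have bounded product with the whole axis; they become the source of the set
  \<open>A\<close>.\<close>

lemma axis_complement: "\<exists>n::nat. measure \<nu> (\<Union>i. W i (real n)) < 1 / 2"
proof -
  define A where "A n = (\<Union>i. W i (real n))" for n :: nat
  have As: "A n \<in> sets \<nu>" for n unfolding A_def by (rule sets.countable_UN') (auto intro: W_sets)
  have "decseq A" unfolding decseq_def A_def using W_mono by (meson SUP_mono UNIV_I of_nat_le_iff)
  then have lim: "(\<lambda>n. measure \<nu> (A n)) \<longlonglongrightarrow> measure \<nu> (\<Inter>n. A n)"
    by (intro finite_Lim_measure_decseq) (auto simp: As)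
  have sub: "(\<Inter>n. A n) \<subseteq> fixset 1 \<union> fixset (- 1)"
  proof
    fix \<zeta> assume z: "\<zeta> \<in> (\<Inter>n. A n)"
    have zZ: "\<zeta> \<in> Z" using z W_D(1) unfolding A_def by blast
    have un: "\<exists>i. r \<le> bp \<zeta> (z i p)" for r
    proof -
      obtain k :: nat where k: "r \<le> real k" using real_arch_simple by blast
      have "\<zeta> \<in> A k" using z by blast
      then obtain i where "\<zeta> \<in> W i (real k)" unfolding A_def by blast
      then have "r \<le> bp \<zeta> (z i p)" using W_D(2)[of \<zeta> i "real k"] k by linarith
      then show ?thesis by blast
    qed
    show "\<zeta> \<in> fixset 1 \<union> fixset (- 1)"
    proof (rule ccontr)
      assume no: "\<zeta> \<notin> fixset 1 \<union> fixset (- 1)"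
      have "\<exists>i\<ge>0. a + 4 * \<delta> < bp \<zeta> (z (- (e * i)) p)" if "e = 1 \<or> e = - 1" for e
      proof (rule ccontr)
        assume "\<not> ?thesis"
        then have "\<forall>i\<ge>0. bp \<zeta> (z (- (e * i)) p) \<le> a + 4 * \<delta>" by (meson not_less)
        then have "\<zeta> \<in> fixset e" unfolding fixset_iff using zZ un by blast
        then show False using no that by blast
      qed
      from this[of 1] this[of "- 1"] obtain i j where ij: "0 \<le> i" "a + 4 * \<delta> < bp \<zeta> (z (- i) p)"
        "0 \<le> j" "a + 4 * \<delta> < bp \<zeta> (z j p)" by auto
      then show False using bp_opposite[OF zZ z_axis(1)[of i j]] by simp
    qed
  qed
  have "measure \<nu> (\<Inter>n. A n) \<le> measure \<nu> (fixset 1 \<union> fixset (- 1))"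
    by (rule nu_mono[OF sub]) (intro sets.Un fixset_sets)
  also have "\<dots> \<le> measure \<nu> (fixset 1) + measure \<nu> (fixset (- 1))"
    by (intro measure_Un_le fixset_sets)
  finally have "measure \<nu> (\<Inter>n. A n) < 1 / 2" using fixset_null by simp
  with lim have "\<forall>\<^sub>F n in sequentially. measure \<nu> (A n) < 1 / 2" by (rule order_tendstoD)
  then show ?thesis unfolding A_def eventually_sequentially by blast
qed

text \<open>A conical element \<open>u\<close> is replaced by \<open>u \<circ> b\<close>, with
  \<open>b\<close> from the finite set of \<open>direction_lemma\<close> chosen for the point
  \<open>ivt u p\<close>. Lengths and products change by bounded amounts, controlled by the maximal
  length \<open>M\<close> in \<open>B\<close>.\<close>

lemma aligned_family:
  "\<exists>R \<rho>. \<exists>N\<in>null_sets \<nu>. \<forall>\<xi>\<in>Bd - N. \<forall>L. \<exists>g\<in>\<Gamma>. L \<le> len g \<and> len g - \<rho> \<le> bp \<xi> (g p) \<and>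
     (\<forall>j. gp (ivt g p) (z j p) \<le> R)"
proof -
  obtain B R where B: "finite B" "B \<subseteq> \<Gamma>" and dir: "\<forall>x. \<exists>b\<in>B. \<forall>j. gp (ivt b x) (z j p) \<le> R"
    using direction_lemma by blast
  obtain \<rho> N where N: "N \<in> null_sets \<nu>"
    and con: "\<forall>\<xi>\<in>Bd - N. \<forall>R. \<exists>u\<in>\<Gamma>. R \<le> len u \<and> len u - \<rho> \<le> bp \<xi> (u p)"
    using conical_ae by blast
  define M where "M = Max (insert 0 ((\<lambda>b. len b) ` B))"
  have M: "len b \<le> M" if "b \<in> B" for b unfolding M_def using B(1) that by (intro Max_ge) auto
  show ?thesis
  proof (rule exI[of _ R], rule exI[of _ "\<rho> + 2 * M + 4 * \<delta>"], rule bexI[OF _ N], intro ballI allI)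
    fix \<xi> L assume xi: "\<xi> \<in> Bd - N"
    obtain u where u: "u \<in> \<Gamma>" "L + M \<le> len u" "len u - \<rho> \<le> bp \<xi> (u p)"
      using bspec[OF con xi] by blast
    obtain b where b: "b \<in> B" "\<forall>j. gp (ivt b (ivt u p)) (z j p) \<le> R" using dir by blast
    have bG: "b \<in> \<Gamma>" using b B by blast
    have iu: "isometry u" "isometry b" using u bG G_isom by auto
    have d: "dist (u p) ((u \<circ> b) p) = len b" using isometry_dist[OF iu(1), of p "b p"] by simp
    have l: "\<bar>len (u \<circ> b) - len u\<bar> \<le> len b"
      using d dist_triangle[of p "(u \<circ> b) p" "u p"] dist_triangle[of p "u p" "(u \<circ> b) p"]
      by (simp add: dist_commute)
    have "bp \<xi> (u p) \<le> bp \<xi> ((u \<circ> b) p) + len b + 4 * \<delta>"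
      using bp_lipschitz[of \<xi> "u p" "(u \<circ> b) p"] d xi Bd_in_Z by auto
    then have "len (u \<circ> b) - (\<rho> + 2 * M + 4 * \<delta>) \<le> bp \<xi> ((u \<circ> b) p)" "L \<le> len (u \<circ> b)"
      using u M[OF b(1)] l by linarith+
    moreover have "ivt (u \<circ> b) p = ivt b (ivt u p)" using ivt_comp[OF iu] by simp
    ultimately show "\<exists>g\<in>\<Gamma>. L \<le> len g \<and> len g - (\<rho> + 2 * M + 4 * \<delta>) \<le> bp \<xi> (g p) \<and>
        (\<forall>j. gp (ivt g p) (z j p) \<le> R)"
      using b(2) G_comp[OF u(1) bG] by (intro bexI[of _ "u \<circ> b"]) auto
  qed
qed

end

text \<open>The data on which the ping-pong construction below is based: \<open>k\<close> maps the exterior of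
  \<open>Dm\<close> into \<open>Dp\<close>, and almost every boundary point is approached conically by elements \<open>g\<close> for which
  \<open>p\<close> is seen from \<open>g p\<close> in a direction away from the translates of \<open>Dp\<close>, \<open>Dm\<close> and \<open>A\<close>.\<close>

locale pingpong = ps_action p \<delta> \<Gamma> \<nu> for p :: "'a::metric_space" and \<delta> :: real and \<Gamma>
    and \<nu> :: "'a bordification measure" +
  fixes k :: "'a \<Rightarrow> 'a" and Dp Dm A :: "'a bordification set" and R \<rho> :: real and N :: "'a bordification set"
  assumes kG: "k \<in> \<Gamma>"
    and Dp_closed: "closedin T Dp" and Dm_closed: "closedin T Dm" and A_closed: "closedin T A"
    and DpDm: "Dp \<inter> Dm = {}" and ADp: "A \<inter> Dp = {}" and ADm: "A \<inter> Dm = {}"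
    and p_Dp: "Inl p \<notin> Dp" and p_Dm: "Inl p \<notin> Dm"
    and k_fwd: "act k ` (Z - Dm) \<subseteq> Dp" and k_bwd: "act (ivt k) ` (Z - Dp) \<subseteq> Dm"
    and frontier_null: "measure \<nu> (Dp \<inter> act k ` Dm) = 0"
    and A_pos: "0 < measure \<nu> A"
    and N_null: "N \<in> null_sets \<nu>"
    and family: "\<xi> \<in> Bd - N \<Longrightarrow> \<exists>g\<in>\<Gamma>. L \<le> len g \<and> len g - \<rho> \<le> bp \<xi> (g p) \<and>
      (\<forall>\<zeta>\<in>Dp \<union> Dm \<union> A. bp \<zeta> (ivt g p) \<le> R)"

context psl_action
begin

text \<open>The image measure on the reals is finite, so it has at most countably many
  atoms.\<close>

lemma level_null:
  assumes "testfun \<phi>"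
  shows "\<exists>t. 0 < t \<and> t < 1 \<and> measure \<nu> {\<zeta> \<in> Z. \<phi> \<zeta> = t} = 0"
proof -
  have m: "\<phi> \<in> borel_measurable \<nu>" using assms continuous_measurable unfolding testfun_def by blast
  interpret D: finite_measure "distr \<nu> borel \<phi>" by (rule finite_measure_distr[OF m])
  have "countable {t. measure (distr \<nu> borel \<phi>) {t} \<noteq> 0}" by (rule D.countable_support)
  moreover have "uncountable {0<..<1::real}" by (simp add: uncountable_open_interval)
  ultimately have "\<not> {0<..<1} \<subseteq> {t. measure (distr \<nu> borel \<phi>) {t} \<noteq> 0}" using countable_subset by blast
  then obtain t where t: "0 < t" "t < 1" "measure (distr \<nu> borel \<phi>) {t} = 0" by auto
  have "measure (distr \<nu> borel \<phi>) {t} = measure \<nu> (\<phi> -` {t} \<inter> Z)" using m by (simp add: measure_distr)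
  moreover have "\<phi> -` {t} \<inter> Z = {\<zeta> \<in> Z. \<phi> \<zeta> = t}" by auto
  ultimately show ?thesis using t by auto
qed

lemma act_z: "act (z i) (act (z j) \<zeta>) = act (z (i + j)) \<zeta>"
  using act_comp[of "z i" "z j" \<zeta>] by (simp add: z_comp)

lemma push:
  assumes "\<zeta> \<in> Z" "bp \<zeta> (z (- i) p) \<le> c" shows "lz i - c - 8 * \<delta> \<le> bp (act (z i) \<zeta>) (z i p)"
  using bp_act_base[OF z_isom assms(1), of i] assms(2) unfolding ivt_z by linarith

lemma near_side:
  assumes "w \<in> Z" "r \<le> bp w (z (e * i) p)" "r \<le> lz i - a" "r \<le> lz j - a" "0 \<le> i" "0 \<le> j" "e = 1 \<or> e = - 1"
  shows "r - 5 * \<delta> \<le> bp w (z (e * j) p)"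
  by (rule bp_hyp[OF assms(1,2)]) (use z_same_side[OF assms(5,6,7)] assms(3,4) in linarith)

text \<open>The sets \<open>Dp\<close> and \<open>Dm\<close> are translates by \<open>F\<^sup>2\<^sup>m\<close> and its inverse of the two sides of a level set
  of a function separating the ends of the axis, at a level of measure zero, so that \<open>Dp\<close> and
  \<open>act k ` Dm\<close> meet in a null set. The set \<open>A\<close> is the translate by \<open>F\<^sup>m\<close> of the points which stay at
  bounded distance from \<open>p\<close> as seen along the axis.\<close>

lemma exists_pingpong: "\<exists>m\<ge>M. \<exists>Dp Dm A R \<rho> N. pingpong p \<delta> \<Gamma> \<nu> (z m) Dp Dm A R \<rho> N"
proof -
  obtain R \<rho> N where N: "N \<in> null_sets \<nu>"
    and fam: "\<forall>\<xi>\<in>Bd - N. \<forall>L. \<exists>g\<in>\<Gamma>. L \<le> len g \<and> len g - \<rho> \<le> bp \<xi> (g p) \<and>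
     (\<forall>j. gp (ivt g p) (z j p) \<le> R)" using aligned_family by blast
  obtain n :: nat where n: "measure \<nu> (\<Union>i. W i (real n)) < 1 / 2" using axis_complement by blast
  define S where "S = Z - (\<Union>i. W i (real n))"
  have oU: "openin T (\<Union>i. W i (real n))" by (intro openin_Union) auto
  have S_closed: "closedin T S" unfolding S_def using oU by (metis closedin_def Diff_subset double_diff openin_subset subset_refl topspace_T)
  have "measure \<nu> S = measure \<nu> Z - measure \<nu> (\<Union>i. W i (real n))" unfolding S_def
    using finite_measure_compl[OF open_sets[OF oU]] by simp
  then have S_pos: "0 < measure \<nu> S" using n nu_Z by simp
  have S_Z: "S \<subseteq> Z" by (simp add: S_def)
  define R0 where "R0 = real n + 31 * \<delta>"
  have S_bp: "bp \<sigma> (z i p) \<le> R0" if "\<sigma> \<in> S" for \<sigma> i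
  proof (rule ccontr)
    assume "\<not> bp \<sigma> (z i p) \<le> R0"
    then have "\<sigma> \<in> W i (real n)" using that S_Z by (intro W_I) (auto simp: R0_def)
    then show False using that by (auto simp: S_def)
  qed
  \<comment> \<open>Opposite axis points have product at most \<open>a\<close>; the
    \<open>40 * \<delta>\<close> keeps the closures of their shadows at level \<open>t1\<close>
    disjoint. Level \<open>t2\<close> leaves room to verify membership through any sufficiently far
    axis point instead of \<open>z j0 p\<close> or \<open>z (- j0) p\<close>.\<close>
  define t1 where "t1 = a + 40 * \<delta>"
  define t2 where "t2 = t1 + 6 * \<delta>"
  obtain j1 where "\<And>i. j1 \<le> \<bar>i\<bar> \<Longrightarrow> t2 + a \<le> lz i" using lz_unbounded by blast
  then obtain j0 where j0: "0 \<le> j0" "t2 + a \<le> lz j0" by (metis abs_abs abs_ge_self abs_ge_zero)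
  define K0 where "K0 = T closure_of Sh (z (- j0) p) t1"
  define K1 where "K1 = T closure_of Sh (z j0 p) t1"
  have K01: "K0 \<inter> K1 = {}"
  proof (rule ccontr)
    assume "K0 \<inter> K1 \<noteq> {}"
    then obtain w where "w \<in> K0" "w \<in> K1" by blast
    then have "w \<in> Sh (z (- j0) p) (t1 - 30 * \<delta>)" "w \<in> Sh (z j0 p) (t1 - 30 * \<delta>)"
      unfolding K0_def K1_def using Sh_closure by blast+
    then have "t1 - 30 * \<delta> - 3 * \<delta> \<le> gp (z (- j0) p) (z j0 p)" unfolding Sh_def by (intro gp_bp_hyp) auto
    then show False using z_axis(1)[OF j0(1) j0(1)] delta_pos unfolding t1_def by linarith
  qed
  obtain \<phi> where phi: "testfun \<phi>" "\<forall>z\<in>K0. \<phi> z = 0" "\<forall>z\<in>K1. \<phi> z = 1"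
    using Urysohn_T[OF _ _ K01] unfolding K0_def K1_def by (meson closedin_closure_of)
  obtain t where t: "0 < t" "t < 1" "measure \<nu> {\<zeta> \<in> Z. \<phi> \<zeta> = t} = 0" using level_null[OF phi(1)] by blast
  have phic: "continuous_map T euclideanreal \<phi>" using phi(1) unfolding testfun_def by blast
  \<comment> \<open>Two closed sides that cover \<open>Z\<close> and overlap exactly in the null
    level set.\<close>
  define P where "P = {\<zeta> \<in> Z. t \<le> \<phi> \<zeta>}"
  define Q where "Q = {\<zeta> \<in> Z. \<phi> \<zeta> \<le> t}"
  have P_closed: "closedin T P" and Q_closed: "closedin T Q"
    using closedin_continuous_map_preimage[OF phic, of "{t..}"] closedin_continuous_map_preimage[OF phic, of "{..t}"]
    by (auto simp: P_def Q_def)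
  have inK: "\<zeta> \<in> T closure_of Sh x t1" if "\<zeta> \<in> Z" "t1 \<le> bp \<zeta> x" for \<zeta> x
  proof -
    have "Sh x t1 \<subseteq> T closure_of Sh x t1" by (rule closure_of_subset) (auto simp: Sh_def)
    then show ?thesis using that by (auto simp: Sh_def)
  qed
  \<comment> \<open>A length of axis steps beyond all thresholds met below: \<open>R0\<close> for
    points of \<open>S\<close>, \<open>t2\<close> for the two sides, \<open>R\<close> for the
    aligned elements.\<close>
  define Big where "Big = 2 * R0 + 3 * t2 + \<bar>R\<bar> + a + 100 * \<delta>"
  have pos: "0 \<le> R0" "0 < t2" "0 \<le> a" using F_a delta_pos by (auto simp: R0_def t1_def t2_def)
  obtain m1 where m1: "\<And>i. m1 \<le> \<bar>i\<bar> \<Longrightarrow> Big \<le> lz i" using lz_unbounded by blast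
  define m where "m = \<bar>M\<bar> + \<bar>m1\<bar>"
  have m0: "0 \<le> m" and mM: "M \<le> 4 * m" by (auto simp: m_def)
  have big: "Big \<le> lz i" if "m \<le> i" for i by (rule m1) (use that m_def in linarith)
  have Bt: "t2 + a \<le> lz i" "t2 \<le> lz i - a" if "m \<le> i" for i
    using big[OF that] pos delta_pos unfolding Big_def by linarith+
  have t2j: "t2 \<le> lz j0 - a" using j0(2) by simp
  have notQ: "w \<notin> Q" if w: "w \<in> Z" "t2 \<le> bp w (z i p)" "m \<le> i" for w i
  proof -
    have "t2 - 5 * \<delta> \<le> bp w (z (1 * j0) p)"
      using near_side[OF w(1), of t2 1 i j0] w Bt(2)[OF w(3)] t2j j0(1) m0 by simp
    then have "w \<in> K1" unfolding K1_def using w delta_pos by (intro inK) (auto simp: t2_def)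
    then show ?thesis using phi(3) t by (auto simp: Q_def)
  qed
  have notP: "w \<notin> P" if w: "w \<in> Z" "t2 \<le> bp w (z (- i) p)" "m \<le> i" for w i
  proof -
    have "t2 - 5 * \<delta> \<le> bp w (z (- 1 * j0) p)"
      using near_side[OF w(1), of t2 "- 1" i j0] w Bt(2)[OF w(3)] t2j j0(1) m0 by simp
    then have "w \<in> K0" unfolding K0_def using w delta_pos by (intro inK) (auto simp: t2_def)
    then show ?thesis using phi(2) t by (auto simp: P_def)
  qed
  have PZ: "P \<subseteq> Z" and QZ: "Q \<subseteq> Z" by (auto simp: P_def Q_def)
  have Pbp: "bp \<zeta> (z (- i) p) \<le> t2" if "\<zeta> \<in> P" "m \<le> i" for \<zeta> i
  proof (rule ccontr)
    assume "\<not> ?thesis"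
    then have "\<zeta> \<notin> P" using that PZ by (intro notP[OF _ _ that(2)]) auto
    then show False using that(1) by contradiction
  qed
  have Qbp: "bp \<zeta> (z i p) \<le> t2" if "\<zeta> \<in> Q" "m \<le> i" for \<zeta> i
  proof (rule ccontr)
    assume "\<not> ?thesis"
    then have "\<zeta> \<notin> Q" using that QZ by (intro notQ[OF _ _ that(2)]) auto
    then show False using that(1) by contradiction
  qed
  have pushP: "Big - t2 - 8 * \<delta> \<le> bp (act (z i) \<zeta>) (z i p)" if "\<zeta> \<in> P" "m \<le> i" for \<zeta> i
  proof -
    have "\<zeta> \<in> Z" using that(1) PZ by (rule subsetD[rotated])
    then show ?thesis using push[OF _ Pbp[OF that]] big[OF that(2)] by linarith
  qed
  have pushQ: "Big - t2 - 8 * \<delta> \<le> bp (act (z (- i)) \<zeta>) (z (- i) p)" if "\<zeta> \<in> Q" "m \<le> i" for \<zeta> i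
  proof -
    have "\<zeta> \<in> Z" using that(1) QZ by (rule subsetD[rotated])
    then show ?thesis using push[of \<zeta> "- i" t2] Qbp[OF that] big[OF that(2)] lz_neg[of i] by simp
  qed
  have pushS: "Big - R0 - 8 * \<delta> \<le> bp (act (z i) \<sigma>) (z i p)" if "\<sigma> \<in> S" "m \<le> \<bar>i\<bar>" for \<sigma> i
  proof -
    have "Big \<le> lz i" using big[OF that(2)] lz_neg[of i] by (cases "0 \<le> i") auto
    moreover have "\<sigma> \<in> Z" using that(1) S_Z by (rule subsetD[rotated])
    ultimately show ?thesis using push[OF _ S_bp[OF that(1), of "- i"]] by linarith
  qed
  \<comment> \<open>With \<open>k = z (4 * m)\<close>, the image of the complement of
    \<open>Dm\<close> is the translate by \<open>z (2 * m)\<close> of the complement of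
    \<open>Q\<close>, which lies in \<open>P\<close>. Shifting \<open>S\<close> by
    \<open>z m\<close> separates it from both domains and gives its points a large product with an
    axis point, as alignment requires.\<close>
  define Dp where "Dp = act (z (2 * m)) ` P"
  define Dm where "Dm = act (z (- (2 * m))) ` Q"
  define A where "A = act (z m) ` S"
  have m2: "m \<le> 2 * m" "m \<le> 3 * m" "m \<le> 4 * m" using m0 by auto
  have cl: "closedin T Dp" "closedin T Dm" "closedin T A" unfolding Dp_def Dm_def A_def
    by (rule closedin_act[OF z_isom P_closed] closedin_act[OF z_isom Q_closed] closedin_act[OF z_isom S_closed])+
  have d1: "Dp \<inter> Dm = {}"
  proof (rule ccontr)
    assume "Dp \<inter> Dm \<noteq> {}"
    then obtain \<zeta> \<zeta>' where zz: "\<zeta> \<in> P" "\<zeta>' \<in> Q" "act (z (2 * m)) \<zeta> = act (z (- (2 * m))) \<zeta>'"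
      unfolding Dp_def Dm_def by blast
    then have "act (z (2 * m)) (act (z (2 * m)) \<zeta>) = act (z (2 * m)) (act (z (- (2 * m))) \<zeta>')" by simp
    then have e: "\<zeta>' = act (z (4 * m)) \<zeta>" unfolding act_z by simp
    have "t2 \<le> bp \<zeta>' (z (4 * m) p)"
      using pushP[OF zz(1) m2(3)] pos delta_pos unfolding e Big_def by linarith
    then show False using notQ[OF _ _ m2(3), of \<zeta>'] zz(2) QZ by blast
  qed
  have d2: "A \<inter> Dp = {}"
  proof (rule ccontr)
    assume "A \<inter> Dp \<noteq> {}"
    then obtain \<zeta> \<sigma> where zz: "\<zeta> \<in> P" "\<sigma> \<in> S" "act (z m) \<sigma> = act (z (2 * m)) \<zeta>"
      unfolding Dp_def A_def by blast
    then have "act (z (- m)) (act (z m) \<sigma>) = act (z (- m)) (act (z (2 * m)) \<zeta>)" by simp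
    then have e: "\<sigma> = act (z m) \<zeta>" unfolding act_z by simp
    show False using pushP[OF zz(1), of m] S_bp[OF zz(2), of m] pos delta_pos unfolding e Big_def by linarith
  qed
  have d3: "A \<inter> Dm = {}"
  proof (rule ccontr)
    assume "A \<inter> Dm \<noteq> {}"
    then obtain \<zeta> \<sigma> where zz: "\<zeta> \<in> Q" "\<sigma> \<in> S" "act (z m) \<sigma> = act (z (- (2 * m))) \<zeta>"
      unfolding Dm_def A_def by blast
    then have "act (z (2 * m)) (act (z m) \<sigma>) = act (z (2 * m)) (act (z (- (2 * m))) \<zeta>)" by simp
    then have "act (z (3 * m)) \<sigma> = \<zeta>" unfolding act_z by simp
    then have e: "\<zeta> = act (z (3 * m)) \<sigma>" by (rule sym)
    have "t2 \<le> bp \<zeta> (z (3 * m) p)"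
      using pushS[OF zz(2), of "3 * m"] m0 pos delta_pos unfolding e Big_def by linarith
    then show False using notQ[OF _ _ m2(2), of \<zeta>] zz(1) QZ by blast
  qed
  have pn: "Inl p \<notin> Dp" "Inl p \<notin> Dm"
  proof -
    have no: "\<not> Big - t2 - 8 * \<delta> \<le> bp (Inl p) x" for x
      using pos delta_pos unfolding Big_def by simp
    show "Inl p \<notin> Dp" using pushP[OF _ m2(1)] no unfolding Dp_def by (metis imageE)
    show "Inl p \<notin> Dm" using pushQ[OF _ m2(1)] no unfolding Dm_def by (metis imageE)
  qed
  have fwd: "act (z (4 * m)) ` (Z - Dm) \<subseteq> Dp"
  proof (rule image_subsetI)
    fix w assume w: "w \<in> Z - Dm"
    have zz: "act (z (2 * m)) w \<in> Z" using w act_Z[OF z_isom] by blast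
    have "act (z (2 * m)) w \<notin> Q"
    proof
      assume "act (z (2 * m)) w \<in> Q"
      then have "act (z (- (2 * m))) (act (z (2 * m)) w) \<in> Dm" unfolding Dm_def by blast
      then show False using w unfolding act_z by simp
    qed
    then have "act (z (2 * m)) w \<in> P" using zz by (auto simp: P_def Q_def)
    then have "act (z (2 * m)) (act (z (2 * m)) w) \<in> Dp" unfolding Dp_def by blast
    then show "act (z (4 * m)) w \<in> Dp" unfolding act_z by simp
  qed
  have bwd: "act (ivt (z (4 * m))) ` (Z - Dp) \<subseteq> Dm"
  proof (rule image_subsetI)
    fix w assume w: "w \<in> Z - Dp"
    have zz: "act (z (- (2 * m))) w \<in> Z" using w act_Z[OF z_isom] by blast
    have "act (z (- (2 * m))) w \<notin> P"
    proof
      assume "act (z (- (2 * m))) w \<in> P"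
      then have "act (z (2 * m)) (act (z (- (2 * m))) w) \<in> Dp" unfolding Dp_def by blast
      then show False using w unfolding act_z by simp
    qed
    then have "act (z (- (2 * m))) w \<in> Q" using zz by (auto simp: P_def Q_def)
    then have "act (z (- (2 * m))) (act (z (- (2 * m))) w) \<in> Dm" unfolding Dm_def by blast
    then show "act (ivt (z (4 * m))) w \<in> Dm" unfolding act_z ivt_z by simp
  qed
  \<comment> \<open>Both sets are translates by \<open>z (2 * m)\<close>, so they meet in the
    translate of the null set \<open>P \<inter> Q\<close>, and quasi-conformality preserves null
    sets.\<close>
  have null: "measure \<nu> (Dp \<inter> act (z (4 * m)) ` Dm) = 0"
  proof -
    have lev: "{\<zeta> \<in> Z. \<phi> \<zeta> = t} = P \<inter> Q" by (auto simp: P_def Q_def)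
    have PQs: "P \<inter> Q \<in> sets \<nu>" using closed_sets P_closed Q_closed by blast
    have "act (z (4 * m)) ` Dm = act (z (2 * m)) ` Q"
      unfolding Dm_def image_image act_z by simp
    then have "Dp \<inter> act (z (4 * m)) ` Dm = act (z (2 * m)) ` (P \<inter> Q)"
      unfolding Dp_def using image_Int[OF act_inj[OF z_isom]] by simp
    moreover have "measure \<nu> (act (ivt (z (- (2 * m)))) ` (P \<inter> Q))
      \<le> exp (om * (2 * (lz (- (2 * m)) + 2 * \<delta>) + 70 * \<delta> - lz (- (2 * m)))) * measure \<nu> (P \<inter> Q)"
      by (rule quasi_conformal[OF zG PQs]) (use bp_bounds(2) Bd_in_Z in blast)
    moreover have "measure \<nu> (P \<inter> Q) = 0" using t(3) unfolding lev .
    ultimately have "measure \<nu> (Dp \<inter> act (z (4 * m)) ` Dm) \<le> 0" unfolding ivt_z by simp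
    then show ?thesis using measure_nonneg[of \<nu> "Dp \<inter> act (z (4 * m)) ` Dm"] by linarith
  qed
  have Apos: "0 < measure \<nu> A"
  proof -
    have As: "A \<in> sets \<nu>" using closed_sets cl(3) by blast
    have "measure \<nu> (act (ivt (z m)) ` A)
      \<le> exp (om * (2 * (lz m + 2 * \<delta>) + 70 * \<delta> - lz m)) * measure \<nu> A"
      by (rule quasi_conformal[OF zG As]) (use bp_bounds(2) Bd_in_Z in blast)
    moreover have "act (ivt (z m)) ` A = S" unfolding A_def ivt_z image_image act_z by simp
    ultimately have "measure \<nu> S \<le> exp (om * (2 * (lz m + 2 * \<delta>) + 70 * \<delta> - lz m)) * measure \<nu> A" by simp
    then have "measure \<nu> A \<noteq> 0" using S_pos by (intro notI) simp
    then show ?thesis by (simp add: zero_less_measure_iff)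
  qed
  \<comment> \<open>Every point of \<open>Dp\<close>, \<open>Dm\<close> and \<open>A\<close> has a
    large product with some axis point, while \<open>ivt g p\<close> has product at most
    \<open>R\<close> with all axis points; so the two directions differ.\<close>
  have align: "bp \<zeta> (ivt g p) \<le> R + 4 * \<delta>"
    if z: "\<zeta> \<in> Dp \<union> Dm \<union> A" and g: "\<forall>j. gp (ivt g p) (z j p) \<le> R" for g \<zeta>
  proof -
    have AZ: "\<zeta> \<in> Z" using z PZ QZ S_Z act_Z[OF z_isom] unfolding Dp_def Dm_def A_def by blast
    have "\<exists>j. R + 4 * \<delta> \<le> bp \<zeta> (z j p)"
      using z unfolding Un_iff
    proof (elim disjE)
      assume "\<zeta> \<in> Dp"
      then obtain w where "w \<in> P" "\<zeta> = act (z (2 * m)) w" unfolding Dp_def by blast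
      then have "R + 4 * \<delta> \<le> bp \<zeta> (z (2 * m) p)" using pushP[OF _ m2(1), of w] pos delta_pos unfolding Big_def by simp
      then show ?thesis by blast
    next
      assume "\<zeta> \<in> Dm"
      then obtain w where "w \<in> Q" "\<zeta> = act (z (- (2 * m))) w" unfolding Dm_def by blast
      then have "R + 4 * \<delta> \<le> bp \<zeta> (z (- (2 * m)) p)" using pushQ[OF _ m2(1), of w] pos delta_pos unfolding Big_def by simp
      then show ?thesis by blast
    next
      assume "\<zeta> \<in> A"
      then obtain w where "w \<in> S" "\<zeta> = act (z m) w" unfolding A_def by blast
      then have "R + 4 * \<delta> \<le> bp \<zeta> (z m p)" using pushS[of w m] pos m0 delta_pos unfolding Big_def by simp
      then show ?thesis by blast
    qed
    then obtain j where j: "R + 4 * \<delta> \<le> bp \<zeta> (z j p)" by blast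
    have "gp (z j p) (ivt g p) \<le> R" using spec[OF g, of j] gp_sym by metis
    then show ?thesis using j by (rule bp_opposite[OF AZ])
  qed
  have "pingpong p \<delta> \<Gamma> \<nu> (z (4 * m)) Dp Dm A (R + 4 * \<delta>) \<rho> N"
  proof (unfold_locales)
    fix \<xi> L assume "\<xi> \<in> Bd - N"
    from bspec[OF fam this] obtain g where g: "g \<in> \<Gamma>" "L \<le> len g" "len g - \<rho> \<le> bp \<xi> (g p)"
      "\<forall>j. gp (ivt g p) (z j p) \<le> R" by blast
    show "\<exists>g\<in>\<Gamma>. L \<le> len g \<and> len g - \<rho> \<le> bp \<xi> (g p) \<and>
      (\<forall>\<zeta>\<in>Dp \<union> Dm \<union> A. bp \<zeta> (ivt g p) \<le> R + 4 * \<delta>)"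
      using align[OF _ g(4)] g(1-3) by (intro bexI[of _ g] conjI ballI) simp_all
  qed (fact zG cl d1 d2 d3 pn fwd bwd null Apos N)+
  then show ?thesis using mM by blast
qed

end

section \<open>Ping-pong groups\<close>

context ps_action
begin

text \<open>A Lebesgue number argument: interiors of finitely many shadows contained in
  \<open>V\<close> cover the compact set, and a deep enough shadow around a point of one of them
  stays in the slightly larger shadow.\<close>

lemma uniform_shadow:
  assumes "closedin T K" "openin T V" "K \<subseteq> V"
  shows "\<exists>r. \<forall>\<xi>\<in>K \<inter> Bd. \<forall>x. r \<le> bp \<xi> x \<longrightarrow> Sh x r \<subseteq> V"
proof -
  define I where "I = {(x, r). Sh x r \<subseteq> V}"
  define O' where "O' = (\<lambda>(x, r). T interior_of Sh x (r + 9 * \<delta>))"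
  have O': "O' (x, r) = T interior_of Sh x (r + 9 * \<delta>)" for x r by (simp add: O'_def)
  have "closedin T (K \<inter> Bd)" using assms(1) closedin_Bd by (rule closedin_Int)
  then have "compactin T (K \<inter> Bd)" using compact_T closedin_compact_space by blast
  moreover have "\<forall>U\<in>O' ` I. openin T U" unfolding O'_def by auto
  moreover have "K \<inter> Bd \<subseteq> \<Union>(O' ` I)"
  proof
    fix \<xi> assume xi: "\<xi> \<in> K \<inter> Bd"
    then have "\<xi> \<in> V" using assms(3) by blast
    with assms(2) obtain r where r: "\<forall>x. r \<le> bp \<xi> x \<longrightarrow> Sh x r \<subseteq> V" using open_shadow xi by blast
    have "\<xi> \<in> Bd" using xi by blast
    then obtain x where x: "r + 40 * \<delta> \<le> bp \<xi> x" using bp_deep_ex by blast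
    have "(x, r) \<in> I" using r x delta_pos unfolding I_def by auto
    moreover have "\<xi> \<in> O' (x, r)" unfolding O'
      by (rule Sh_interior) (use xi Bd_in_Z x delta_pos in auto)
    ultimately show "\<xi> \<in> \<Union>(O' ` I)" by blast
  qed
  ultimately have "\<exists>\<F>. finite \<F> \<and> \<F> \<subseteq> O' ` I \<and> K \<inter> Bd \<subseteq> \<Union>\<F>" unfolding compactin_def by simp
  then obtain \<F> where F: "finite \<F>" "\<F> \<subseteq> O' ` I" "K \<inter> Bd \<subseteq> \<Union>\<F>" by blast
  obtain Q where Q: "Q \<subseteq> I" "finite Q" "\<F> = O' ` Q" using finite_subset_image[OF F(1,2)] by blast
  define rr where "rr = Max (insert 0 ((\<lambda>q. snd q + 9 * \<delta>) ` Q))"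
  have rr: "snd q + 9 * \<delta> \<le> rr" if "q \<in> Q" for q
    unfolding rr_def using Q(2) that by (intro Max_ge) auto
  show ?thesis
  proof (rule exI[of _ rr], intro ballI allI impI)
    fix \<xi> x assume xi: "\<xi> \<in> K \<inter> Bd" and x: "rr \<le> bp \<xi> x"
    then obtain q where q: "q \<in> Q" "\<xi> \<in> O' q" using F(3) Q(3) by blast
    obtain y r where yr: "q = (y, r)" by (cases q)
    have "\<xi> \<in> Sh y (r + 9 * \<delta>)" using q(2) unfolding yr O' by (rule subsetD[OF interior_of_subset])
    then have y: "\<xi> \<in> Z" "r + 9 * \<delta> \<le> bp \<xi> y" by (auto simp: Sh_def)
    have rle: "r + 9 * \<delta> \<le> rr" using rr[OF q(1)] by (simp add: yr)
    have "r + 9 * \<delta> - 3 * \<delta> \<le> gp x y" by (rule gp_bp_hyp[OF y(1) _ y(2)]) (use x rle in linarith)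
    then have "\<zeta> \<in> Sh y r" if "\<zeta> \<in> Sh x rr" for \<zeta>
      using bp_hyp[of \<zeta> "r + 6 * \<delta>" x y] that rle delta_pos by (auto simp: Sh_def)
    then show "Sh x rr \<subseteq> V" using q(1) Q(1) unfolding yr I_def by blast
  qed
qed

lemma separated:
  assumes "closedin T K" "closedin T K'" "K \<inter> K' = {}"
  shows "\<exists>r. \<forall>\<zeta>\<in>K \<inter> Bd. \<forall>x. Inl x \<in> K' \<longrightarrow> bp \<zeta> x \<le> r"
proof -
  have "openin T (Z - K')" using assms(2) by (simp add: closedin_def)
  moreover have "K \<subseteq> Z - K'" using assms closedin_subset[OF assms(1)] by auto
  ultimately obtain r where r: "\<forall>\<xi>\<in>K \<inter> Bd. \<forall>x. r \<le> bp \<xi> x \<longrightarrow> Sh x r \<subseteq> Z - K'"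
    using uniform_shadow[OF assms(1)] by blast
  have "bp \<zeta> x \<le> r + 2 * \<delta>" if z: "\<zeta> \<in> K \<inter> Bd" and x: "Inl x \<in> K'" for \<zeta> x
  proof (rule ccontr)
    assume no: "\<not> bp \<zeta> x \<le> r + 2 * \<delta>"
    then have "Sh x r \<subseteq> Z - K'" using bspec[OF r z] delta_pos by auto
    moreover have "Inl x \<in> Sh x r" using no bp_bounds(2)[of \<zeta> x] z Bd_in_Z by (auto simp: Sh_def)
    ultimately show False using x by blast
  qed
  then show ?thesis by blast
qed

text \<open>Quasi-conformality with the trivial bound \<open>len h + 2 * \<delta>\<close> on
  products; 74 is 70 plus twice 2.\<close>

lemma nu_act_lower:
  assumes "h \<in> \<Gamma>" "E \<in> sets \<nu>"
  shows "exp (- (om * (len h + 74 * \<delta>))) * measure \<nu> E \<le> measure \<nu> (act h ` E)"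
proof -
  have ih: "isometry h" using assms G_isom by blast
  have "measure \<nu> (act (ivt h) ` act h ` E) \<le> exp (om * (2 * (len h + 2 * \<delta>) + 70 * \<delta> - len h)) * measure \<nu> (act h ` E)"
    by (rule quasi_conformal[OF assms(1) act_sets[OF ih assms(2)]]) (use bp_bounds(2) Bd_in_Z in blast)
  moreover have "act (ivt h) ` act h ` E = E" using ih by (simp add: image_image)
  ultimately have "measure \<nu> E \<le> exp (om * (len h + 74 * \<delta>)) * measure \<nu> (act h ` E)" by (simp add: algebra_simps)
  then have "exp (- (om * (len h + 74 * \<delta>))) * measure \<nu> E
      \<le> exp (- (om * (len h + 74 * \<delta>))) * (exp (om * (len h + 74 * \<delta>)) * measure \<nu> (act h ` E))"
    by (intro mult_left_mono) auto
  then show ?thesis by (simp add: mult.assoc[symmetric] exp_add[symmetric])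
qed

lemma nu_act_upper:
  assumes "h \<in> \<Gamma>" "E \<in> sets \<nu>" "\<And>\<zeta>. \<zeta> \<in> E \<Longrightarrow> \<zeta> \<in> Bd \<Longrightarrow> bp \<zeta> (ivt h p) \<le> c"
  shows "measure \<nu> (act h ` E) \<le> exp (om * (2 * c + 70 * \<delta> - len h)) * measure \<nu> E"
proof -
  have ih: "isometry h" using assms G_isom by blast
  show ?thesis using quasi_conformal[OF G_ivt[OF assms(1)] assms(2,3)] len_ivt[OF ih] ih by simp
qed

lemma nu_act_null:
  assumes "h \<in> \<Gamma>" "E \<in> null_sets \<nu>" shows "act h ` E \<in> null_sets \<nu>"
proof -
  have E: "E \<in> sets \<nu>" "measure \<nu> E = 0" using assms(2) by (auto simp: null_sets_def measure_def)
  have "measure \<nu> (act h ` E) \<le> exp (om * (2 * (len h + 2 * \<delta>) + 70 * \<delta> - len h)) * measure \<nu> E"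
  proof (rule nu_act_upper[OF assms(1) E(1)])
    fix \<zeta> assume "\<zeta> \<in> Bd"
    then show "bp \<zeta> (ivt h p) \<le> len h + 2 * \<delta>"
      using bp_bounds(2)[of \<zeta> "ivt h p"] Bd_in_Z len_ivt[OF G_isom[OF assms(1)]] by simp
  qed
  then have "measure \<nu> (act h ` E) = 0" using E(2) measure_nonneg[of \<nu> "act h ` E"] by simp
  then show ?thesis using act_sets[OF G_isom[OF assms(1)] E(1)] by (simp add: null_sets_def emeasure_eq_measure)
qed

end

section \<open>Reduced words\<close>

fun reduced :: "(('a \<Rightarrow> 'a) \<times> bool) list \<Rightarrow> bool" where
  "reduced [] \<longleftrightarrow> True"
| "reduced [_] \<longleftrightarrow> True"
| "reduced (x # y # w) \<longleftrightarrow> y \<noteq> (fst x, \<not> snd x) \<and> reduced (y # w)"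

lemma reduced_tl: "reduced (x # w) \<Longrightarrow> reduced w"
  by (cases w) auto

lemma reduced_append_Cons:
  "reduced (u @ [x]) \<Longrightarrow> reduced (x # w) \<Longrightarrow> reduced (u @ x # w)"
proof (induction u)
  case (Cons y u)
  then show ?case by (cases u) (auto)
qed simp

lemma reduced_appendD: "reduced (u @ w) \<Longrightarrow> reduced u \<and> reduced w"
proof (induction u)
  case (Cons y u)
  then show ?case by (cases u) (auto dest: reduced_tl)
qed simp

context pingpong
begin

abbreviation linv :: "('a \<Rightarrow> 'a) \<times> bool \<Rightarrow> ('a \<Rightarrow> 'a) \<times> bool" where
  "linv x \<equiv> (fst x, \<not> snd x)"

text \<open>A letter is a conjugating element with a sign, which stands for the conjugate of
  \<open>k\<close> or of its inverse. Keeping letters apart from group elements lets reducedness be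
  decided before freeness is known.\<close>

definition lt :: "('a \<Rightarrow> 'a) \<times> bool \<Rightarrow> 'a \<Rightarrow> 'a" where
  "lt x = fst x \<circ> (if snd x then k else ivt k) \<circ> ivt (fst x)"

definition Dom :: "('a \<Rightarrow> 'a) \<times> bool \<Rightarrow> 'a bordification set" where
  "Dom x = act (fst x) ` (if snd x then Dp else Dm)"

definition ev :: "(('a \<Rightarrow> 'a) \<times> bool) list \<Rightarrow> 'a \<Rightarrow> 'a" where
  "ev w = foldr (\<lambda>x h. lt x \<circ> h) w id"

lemma ev_Nil: "ev [] = id"
  by (simp only: ev_def foldr.simps id_apply)

lemma ev_Cons: "ev (x # w) = lt x \<circ> ev w"
  by (simp only: ev_def foldr.simps comp_apply)

definition words :: "('a \<Rightarrow> 'a) set \<Rightarrow> (('a \<Rightarrow> 'a) \<times> bool) list set" where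
  "words G = {w. reduced w \<and> fst ` set w \<subseteq> G}"

definition HG :: "('a \<Rightarrow> 'a) set \<Rightarrow> ('a \<Rightarrow> 'a) set" where
  "HG G = ev ` words G"

text \<open>The set \<open>Dp\<close> plays a second role: all configurations are kept disjoint from it, so that
  it becomes a wandering set for the groups \<open>HG G\<close>.\<close>

definition conf :: "('a \<Rightarrow> 'a) set \<Rightarrow> bool" where
  "conf G \<longleftrightarrow> G \<subseteq> \<Gamma> \<and>
     (\<forall>x y. fst x \<in> G \<and> fst y \<in> G \<and> x \<noteq> y \<longrightarrow> Dom x \<inter> Dom y = {}) \<and>
     (\<forall>x. fst x \<in> G \<longrightarrow> Dom x \<inter> Dp = {} \<and> Inl p \<notin> Dom x)"

text \<open>A fundamental domain for \<open>HG G\<close>. For a configuration it contains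
  \<open>p\<close>, so that freeness can be read off the orbit of \<open>p\<close>, and it contains
  \<open>Dp\<close>.\<close>

definition FD :: "('a \<Rightarrow> 'a) set \<Rightarrow> 'a bordification set" where
  "FD G = {\<zeta> \<in> Z. \<forall>x. fst x \<in> G \<longrightarrow> \<zeta> \<notin> Dom x}"

definition HU :: "('a \<Rightarrow> 'a) set \<Rightarrow> 'a bordification set" where
  "HU G = (\<Union>h\<in>HG G. act h ` Dp)"

lemma k_isom: "isometry k"
  using kG G_isom by blast

lemma lt_G: "fst x \<in> \<Gamma> \<Longrightarrow> lt x \<in> \<Gamma>"
  unfolding lt_def using G_comp G_ivt kG by simp

lemma lt_linv: assumes "fst x \<in> \<Gamma>" shows "lt (linv x) = ivt (lt x)"
proof -
  have i: "isometry (fst x)" "isometry (ivt (fst x))" "isometry k" "isometry (ivt k)"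
    using assms G_isom k_isom isometry_ivt by auto
  have c: "ivt (fst x \<circ> q \<circ> ivt (fst x)) = fst x \<circ> ivt q \<circ> ivt (fst x)" if "isometry q" for q
    using ivt_comp[OF isometry_comp[OF i(1) that] i(2)] ivt_comp[OF i(1) that] i(1) by (simp add: comp_assoc)
  show ?thesis using c[OF i(3)] c[OF i(4)] i(3) by (simp add: lt_def)
qed

lemma Dom_closed: "fst x \<in> \<Gamma> \<Longrightarrow> closedin T (Dom x)"
  unfolding Dom_def using closedin_act[OF G_isom] Dp_closed Dm_closed by simp

lemma Dom_Z: "fst x \<in> \<Gamma> \<Longrightarrow> Dom x \<subseteq> Z"
  using closedin_subset[OF Dom_closed] by simp

lemma Dom_sets: "fst x \<in> \<Gamma> \<Longrightarrow> Dom x \<in> sets \<nu>"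
  using closed_sets[OF Dom_closed] .

lemma lt_Dom:
  assumes "fst x \<in> \<Gamma>" "\<zeta> \<in> Z" "\<zeta> \<notin> Dom (linv x)" shows "act (lt x) \<zeta> \<in> Dom x"
proof -
  have i: "isometry (fst x)" "isometry (ivt (fst x))" using assms(1) G_isom isometry_ivt by auto
  define w where "w = act (ivt (fst x)) \<zeta>"
  have w: "w \<in> Z" "\<zeta> = act (fst x) w" using act_Z[OF i(2) assms(2)] i by (auto simp: w_def)
  have e: "act (lt x) \<zeta> = act (fst x) (act (if snd x then k else ivt k) w)"
    by (simp add: lt_def act_comp w_def)
  show ?thesis
  proof (cases "snd x")
    case True
    then have "w \<notin> Dm" using assms(3) w(2) by (auto simp: Dom_def)
    then have "act k w \<in> Dp" using k_fwd w(1) by blast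
    then show ?thesis unfolding e Dom_def using True by simp
  next
    case False
    then have "w \<notin> Dp" using assms(3) w(2) by (auto simp: Dom_def)
    then have "act (ivt k) w \<in> Dm" using k_bwd w(1) by blast
    then show ?thesis unfolding e Dom_def using False by simp
  qed
qed

lemma ev_append: "ev (u @ w) = ev u \<circ> ev w"
proof (induction u)
  case Nil
  show ?case unfolding ev_Nil append_Nil id_comp ..
next
  case (Cons x u)
  show ?case unfolding append_Cons ev_Cons Cons comp_assoc ..
qed

lemma words_Nil [simp]: "[] \<in> words G"
  by (simp add: words_def)

lemma words_ConsD: "x # w \<in> words G \<Longrightarrow> fst x \<in> G \<and> w \<in> words G"
  by (auto simp: words_def dest: reduced_tl)

lemma words_appendD: "u @ w \<in> words G \<Longrightarrow> u \<in> words G \<and> w \<in> words G"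
  by (auto simp: words_def dest: reduced_appendD)

lemma words_mono: "G \<subseteq> G' \<Longrightarrow> words G \<subseteq> words G'"
  by (auto simp: words_def)

lemma ev_G: "G \<subseteq> \<Gamma> \<Longrightarrow> w \<in> words G \<Longrightarrow> ev w \<in> \<Gamma>"
proof (induction w)
  case Nil
  show ?case unfolding ev_Nil by (rule G_id)
next
  case (Cons x w)
  then have "fst x \<in> \<Gamma>" "ev w \<in> \<Gamma>" using words_ConsD by blast+
  then show ?case unfolding ev_Cons by (intro lt_G G_comp)
qed

lemma HG_G: "G \<subseteq> \<Gamma> \<Longrightarrow> HG G \<subseteq> \<Gamma>"
  unfolding HG_def using ev_G by blast

lemma HG_mono: "G \<subseteq> G' \<Longrightarrow> HG G \<subseteq> HG G'"
  unfolding HG_def using words_mono by blast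

lemma HG_id: "id \<in> HG G"
  unfolding HG_def using words_Nil[of G] by (intro image_eqI[of _ _ "[]"] words_Nil ev_Nil[symmetric])

lemma lt_HG: "fst x \<in> G \<Longrightarrow> lt x \<in> HG G"
  unfolding HG_def by (intro image_eqI[of _ _ "[x]"]) (auto simp: words_def ev_Cons ev_Nil)

text \<open>Left multiplication by a letter either cancels the first letter or leaves a reduced
  word.\<close>

lemma HG_lt_comp:
  assumes "G \<subseteq> \<Gamma>" "fst x \<in> G" "h \<in> HG G" shows "lt x \<circ> h \<in> HG G"
proof -
  obtain w where w: "w \<in> words G" "h = ev w" using assms(3) unfolding HG_def by blast
  show ?thesis
  proof (cases "\<exists>u. w = linv x # u")
    case True
    then obtain u where u: "w = linv x # u" by blast
    have ix: "fst x \<in> \<Gamma>" using assms(1,2) by blast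
    have "lt x \<circ> h = lt x \<circ> ivt (lt x) \<circ> ev u" unfolding w(2) u ev_Cons lt_linv[OF ix] comp_assoc ..
    then have "lt x \<circ> h = ev u" using G_isom[OF lt_G[OF ix]] by simp
    moreover have "u \<in> words G" using w(1) unfolding u by (blast dest: words_ConsD)
    ultimately show ?thesis unfolding HG_def by blast
  next
    case False
    then have "x # w \<in> words G" using w(1) assms(2) by (cases w) (auto simp: words_def)
    moreover have "lt x \<circ> h = ev (x # w)" unfolding w(2) ev_Cons ..
    ultimately show ?thesis unfolding HG_def by blast
  qed
qed

lemma HG_comp: assumes "G \<subseteq> \<Gamma>" "h \<in> HG G" "h' \<in> HG G" shows "h \<circ> h' \<in> HG G"
proof -
  have "ev w \<circ> h' \<in> HG G" if "w \<in> words G" for w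
    using that
  proof (induction w)
    case (Cons x w)
    then have "lt x \<circ> (ev w \<circ> h') \<in> HG G" using words_ConsD by (intro HG_lt_comp[OF assms(1)]) blast+
    then show ?case unfolding ev_Cons comp_assoc .
  next
    case Nil
    show ?case unfolding ev_Nil id_comp by (rule assms(3))
  qed
  then show ?thesis using assms(2) unfolding HG_def by blast
qed

lemma HG_ivt: assumes "G \<subseteq> \<Gamma>" "h \<in> HG G" shows "ivt h \<in> HG G"
proof -
  have "ivt (ev w) \<in> HG G" if "w \<in> words G" for w
    using that
  proof (induction w)
    case (Cons x w)
    have x: "fst x \<in> G" "w \<in> words G" using words_ConsD Cons.prems by blast+
    have xg: "fst x \<in> \<Gamma>" using assms(1) x(1) by blast
    have "ivt (ev w) \<circ> lt (linv x) \<in> HG G"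
      by (rule HG_comp[OF assms(1) Cons.IH[OF x(2)] lt_HG]) (use x(1) in simp)
    moreover have "ivt (ev (x # w)) = ivt (ev w) \<circ> lt (linv x)"
      unfolding lt_linv[OF xg] ev_Cons by (rule ivt_comp[OF G_isom[OF lt_G[OF xg]] G_isom[OF ev_G[OF assms(1) x(2)]]])
    ultimately show ?case by (simp only:)
  next
    case Nil
    show ?case unfolding ev_Nil ivt_id by (rule HG_id)
  qed
  then show ?thesis using assms(2) unfolding HG_def by blast
qed

lemma confD:
  assumes "conf G"
  shows "G \<subseteq> \<Gamma>" "fst x \<in> G \<Longrightarrow> fst y \<in> G \<Longrightarrow> x \<noteq> y \<Longrightarrow> Dom x \<inter> Dom y = {}"
    "fst x \<in> G \<Longrightarrow> Dom x \<inter> Dp = {}" "fst x \<in> G \<Longrightarrow> Inl p \<notin> Dom x"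
  using assms unfolding conf_def by blast+

text \<open>The ping-pong argument: only the domain of the inverse of the last letter is dangerous
  at the start, and reducedness keeps each intermediate image out of the dangerous domain of the
  next letter to act.\<close>

lemma ev_Dom:
  assumes "conf G" "w \<in> words G" "w \<noteq> []" "\<zeta> \<in> Z" "\<zeta> \<notin> Dom (linv (last w))"
  shows "act (ev w) \<zeta> \<in> Dom (hd w)"
  using assms(2,3,5)
proof (induction w)
  case (Cons x w)
  have x: "fst x \<in> G" "fst x \<in> \<Gamma>" "w \<in> words G" using words_ConsD[OF Cons.prems(1)] confD(1)[OF assms(1)] by blast+
  show ?case
  proof (cases w)
    case Nil
    then show ?thesis using lt_Dom[OF x(2) assms(4)] Cons.prems(3) unfolding Nil ev_Cons ev_Nil by simp
  next
    case (Cons y u)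
    have yx: "y \<noteq> linv x" "fst y \<in> G" using Cons.prems(1) Cons by (auto simp: words_def)
    have "act (ev w) \<zeta> \<in> Dom y" using Cons.IH[OF x(3)] Cons.prems(3) unfolding Cons by simp
    moreover have "Dom y \<inter> Dom (linv x) = {}" by (rule confD(2)[OF assms(1)]) (use yx x in auto)
    ultimately have "act (ev w) \<zeta> \<notin> Dom (linv x)" by blast
    moreover have "act (ev w) \<zeta> \<in> Z" using act_Z[OF G_isom[OF ev_G[OF confD(1)[OF assms(1)] x(3)]] assms(4)] .
    ultimately show ?thesis using lt_Dom[OF x(2)] unfolding ev_Cons act_comp by simp
  qed
qed simp

text \<open>Applied to \<open>Inl p\<close> this locates \<open>ivt (ev w) p\<close>, and hence the
  direction that governs how \<open>ev w\<close> distorts the measure.\<close>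

lemma ev_ivt_Dom:
  assumes "conf G" "w \<in> words G" "w \<noteq> []" "\<zeta> \<in> Z" "\<zeta> \<notin> Dom (hd w)"
  shows "act (ivt (ev w)) \<zeta> \<in> Dom (linv (last w))"
  using assms(2-5)
proof (induction w arbitrary: \<zeta>)
  case (Cons x w)
  have x: "fst x \<in> G" "fst x \<in> \<Gamma>" "w \<in> words G" using words_ConsD[OF Cons.prems(1)] confD(1)[OF assms(1)] by blast+
  have lx: "fst (linv x) \<in> \<Gamma>" using x by simp
  have "ivt (ev (x # w)) = ivt (ev w) \<circ> lt (linv x)"
    unfolding lt_linv[OF x(2)] ev_Cons
    by (rule ivt_comp[OF G_isom[OF lt_G[OF x(2)]] G_isom[OF ev_G[OF confD(1)[OF assms(1)] x(3)]]])
  then have e: "act (ivt (ev (x # w))) \<zeta> = act (ivt (ev w)) (act (lt (linv x)) \<zeta>)" by (simp add: act_comp)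
  have D: "act (lt (linv x)) \<zeta> \<in> Dom (linv x)"
    by (rule lt_Dom[OF lx Cons.prems(3)]) (use Cons.prems(4) in simp)
  show ?case
  proof (cases w)
    case Nil
    then show ?thesis using D unfolding e unfolding Nil ev_Nil by simp
  next
    case (Cons y u)
    have yx: "y \<noteq> linv x" "fst y \<in> G" using Cons.prems(1) Cons by (auto simp: words_def)
    have "Dom y \<inter> Dom (linv x) = {}" by (rule confD(2)[OF assms(1)]) (use yx x in auto)
    then have "act (lt (linv x)) \<zeta> \<notin> Dom (hd w)" using D Cons by auto
    moreover have "act (lt (linv x)) \<zeta> \<in> Z" using D Dom_Z[OF lx] by blast
    ultimately have "act (ivt (ev w)) (act (lt (linv x)) \<zeta>) \<in> Dom (linv (last w))"
      using Cons by (intro Cons.IH[OF x(3)]) auto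
    then show ?thesis unfolding e using Cons by (simp only: last.simps list.distinct if_False)
  qed
qed simp

lemma FD_Z: "FD G \<subseteq> Z"
  by (auto simp: FD_def)

lemma FD_open: assumes "finite G" "G \<subseteq> \<Gamma>" shows "openin T (FD G)"
proof -
  have "FD G = Z - (\<Union>x\<in>G \<times> UNIV. Dom x)" by (auto simp: FD_def)
  moreover have "closedin T (\<Union>x\<in>G \<times> UNIV. Dom x)"
    using assms by (intro closedin_Union) (auto intro!: Dom_closed)
  ultimately show ?thesis by (simp add: closedin_def)
qed

lemma FD_p: "conf G \<Longrightarrow> Inl p \<in> FD G"
  using confD(4) by (auto simp: FD_def)

lemma FD_Dp: assumes "conf G" shows "Dp \<subseteq> FD G"
  using confD(3)[OF assms] closedin_subset[OF Dp_closed] unfolding FD_def topspace_T by blast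

lemma ev_FD:
  assumes "conf G" "w \<in> words G" "w \<noteq> []" "\<zeta> \<in> FD G" shows "act (ev w) \<zeta> \<in> Dom (hd w)"
proof (rule ev_Dom[OF assms(1-3)])
  have "last w \<in> set w" using assms(3) by simp
  then have "fst (last w) \<in> G" using assms(2) by (auto simp: words_def)
  then have "fst (linv (last w)) \<in> G" by simp
  then show "\<zeta> \<notin> Dom (linv (last w))" using assms(4) unfolding FD_def by blast
qed (use assms(4) FD_Z in blast)

text \<open>The first letter is determined by the domain containing the common point, so letters
  cancel one at a time. Freeness of \<open>HG G\<close> and disjointness of the translates of
  \<open>FD G\<close> come out together.\<close>

lemma ev_FD_disjoint:
  assumes "conf G" "u \<in> words G" "w \<in> words G" "\<zeta> \<in> FD G" "\<zeta>' \<in> FD G"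
    and "act (ev u) \<zeta> = act (ev w) \<zeta>'"
  shows "u = w"
  using assms(2,3,6)
proof (induction u arbitrary: w)
  case Nil
  show ?case
  proof (rule ccontr)
    assume "[] \<noteq> w"
    then have "\<zeta> \<in> Dom (hd w)"
      using ev_FD[OF assms(1) Nil.prems(2) _ assms(5)] unfolding Nil.prems(3)[symmetric] ev_Nil act_id by blast
    moreover have "fst (hd w) \<in> G" using \<open>[] \<noteq> w\<close> Nil.prems(2) by (cases w) (auto simp: words_def)
    ultimately show False using assms(4) unfolding FD_def by blast
  qed
next
  case (Cons x u)
  have x: "fst x \<in> G" "fst x \<in> \<Gamma>" "u \<in> words G" using words_ConsD[OF Cons.prems(1)] confD(1)[OF assms(1)] by blast+
  have Dx: "act (ev (x # u)) \<zeta> \<in> Dom x" using ev_FD[OF assms(1) Cons.prems(1) _ assms(4)] by simp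
  show ?case
  proof (cases w)
    case Nil
    have "act (ev (x # u)) \<zeta> = \<zeta>'" using Cons.prems(3) unfolding Nil ev_Nil act_id .
    then show ?thesis using Dx x(1) assms(5) unfolding FD_def by blast
  next
    case (Cons y v)
    have y: "fst y \<in> G" "v \<in> words G" using words_ConsD Cons.prems(2) unfolding Cons by blast+
    have "act (ev (y # v)) \<zeta>' \<in> Dom y" using ev_FD[OF assms(1) Cons.prems(2) _ assms(5)] Cons by simp
    then have "Dom x \<inter> Dom y \<noteq> {}" using Dx Cons.prems(3) unfolding Cons by auto
    then have xy: "x = y" using confD(2)[OF assms(1) x(1) y(1)] by blast
    have "act (lt x) (act (ev u) \<zeta>) = act (lt x) (act (ev v) \<zeta>')"
      using Cons.prems(3) unfolding Cons xy ev_Cons act_comp .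
    then have "act (ev u) \<zeta> = act (ev v) \<zeta>'" using act_inj[OF G_isom[OF lt_G[OF x(2)]]] by (rule injD[rotated])
    then have "u = v" by (rule Cons.IH[OF x(3) y(2)])
    then show ?thesis using xy Cons by simp
  qed
qed

lemma HG_FD_disjoint:
  assumes "conf G" "h \<in> HG G" "h' \<in> HG G" "\<zeta> \<in> act h ` FD G" "\<zeta> \<in> act h' ` FD G"
  shows "h = h'"
proof -
  obtain u w where u: "u \<in> words G" "h = ev u" "w \<in> words G" "h' = ev w"
    using assms(2,3) unfolding HG_def by blast
  obtain x y where x: "x \<in> FD G" "\<zeta> = act (ev u) x" "y \<in> FD G" "\<zeta> = act (ev w) y"
    using assms(4,5) u by blast
  have "u = w" by (rule ev_FD_disjoint[OF assms(1) u(1,3) x(1,3)]) (use x(2,4) in simp)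
  then show ?thesis using u by simp
qed

lemma HG_countable: "G \<subseteq> \<Gamma> \<Longrightarrow> countable (HG G)"
  by (rule countable_subset[OF HG_G countable_G])

lemma act_HG_sets: "G \<subseteq> \<Gamma> \<Longrightarrow> h \<in> HG G \<Longrightarrow> E \<in> sets \<nu> \<Longrightarrow> act h ` E \<in> sets \<nu>"
  by (rule act_sets[OF G_isom[OF subsetD[OF HG_G]]])

lemma HU_sets: "G \<subseteq> \<Gamma> \<Longrightarrow> HU G \<in> sets \<nu>"
  unfolding HU_def by (intro sets.countable_UN'' HG_countable act_HG_sets closed_sets[OF Dp_closed])

lemma Dp_HU: "Dp \<subseteq> HU G"
proof -
  have "act id ` Dp \<subseteq> HU G" unfolding HU_def using HG_id by blast
  then show ?thesis by simp
qed

lemma HU_FD: assumes "conf G" shows "HU G \<inter> FD G = Dp"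
proof
  show "HU G \<inter> FD G \<subseteq> Dp"
  proof
    fix \<zeta> assume z: "\<zeta> \<in> HU G \<inter> FD G"
    then obtain h where h: "h \<in> HG G" "\<zeta> \<in> act h ` Dp" unfolding HU_def by blast
    have "act h ` Dp \<subseteq> act h ` FD G" using FD_Dp[OF assms] by blast
    then have "h = id" using z h by (intro HG_FD_disjoint[OF assms h(1) HG_id, of \<zeta>]) auto
    then show "\<zeta> \<in> Dp" using h(2) by simp
  qed
qed (use Dp_HU FD_Dp[OF assms] in blast)

lemma Dp_pos: "0 < measure \<nu> Dp"
proof -
  have As: "A \<in> sets \<nu>" "Dp \<in> sets \<nu>" using closed_sets A_closed Dp_closed by auto
  have "0 < exp (- (om * (len k + 74 * \<delta>))) * measure \<nu> A" using A_pos by simp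
  also have "\<dots> \<le> measure \<nu> (act k ` A)" by (rule nu_act_lower[OF kG As(1)])
  also have "\<dots> \<le> measure \<nu> Dp"
    by (rule nu_mono[OF _ As(2)]) (use k_fwd ADm closedin_subset[OF A_closed] in auto)
  finally show ?thesis .
qed

lemma disjoint_sum_le:
  assumes "finite I" "\<And>i. i \<in> I \<Longrightarrow> E i \<in> sets \<nu>" "\<And>i j. i \<in> I \<Longrightarrow> j \<in> I \<Longrightarrow> i \<noteq> j \<Longrightarrow> E i \<inter> E j = {}"
    and "\<And>i. i \<in> I \<Longrightarrow> E i \<subseteq> D" "D \<in> sets \<nu>"
  shows "(\<Sum>i\<in>I. measure \<nu> (E i)) \<le> measure \<nu> D"
proof -
  have "(\<Sum>i\<in>I. measure \<nu> (E i)) = measure \<nu> (\<Union>i\<in>I. E i)"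
    using assms by (intro finite_measure_finite_Union[symmetric]) (auto simp: disjoint_family_on_def)
  also have "\<dots> \<le> measure \<nu> D" using assms(4,5) by (intro nu_mono) auto
  finally show ?thesis .
qed

text \<open>The translates of \<open>Dp\<close> are disjoint, each has measure at least a constant
  times \<open>exp (- om * len h)\<close>, and the total mass is 1. So the Poincare series of
  \<open>HG G\<close> converges at \<open>om\<close>, in contrast to that of \<Gamma>.\<close>

lemma HG_sum_bound:
  assumes "conf G"
  shows "\<exists>C. \<forall>X. finite X \<and> X \<subseteq> HG G \<longrightarrow> (\<Sum>h\<in>X. exp (- om * len h)) \<le> C"
proof -
  have G: "G \<subseteq> \<Gamma>" using assms by (rule confD)
  have Ds: "Dp \<in> sets \<nu>" using closed_sets Dp_closed by auto
  define c where "c = exp (- (om * 74 * \<delta>)) * measure \<nu> Dp"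
  have c: "0 < c" using Dp_pos by (simp add: c_def)
  have "(\<Sum>h\<in>X. exp (- om * len h)) \<le> 1 / c" if X: "finite X" "X \<subseteq> HG G" for X
  proof -
    have "(\<Sum>h\<in>X. exp (- om * len h)) * c = (\<Sum>h\<in>X. exp (- (om * (len h + 74 * \<delta>))) * measure \<nu> Dp)"
      unfolding c_def sum_distrib_right by (intro sum.cong) (auto simp: algebra_simps exp_add[symmetric] simp flip: mult.assoc)
    also have "\<dots> \<le> (\<Sum>h\<in>X. measure \<nu> (act h ` Dp))"
      by (intro sum_mono nu_act_lower[OF _ Ds]) (use X HG_G[OF G] in blast)
    also have "\<dots> \<le> measure \<nu> Z"
    proof (rule disjoint_sum_le[OF X(1)])
      fix h assume h: "h \<in> X"
      then have hi: "isometry h" using X HG_G[OF G] G_isom by blast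
      show "act h ` Dp \<in> sets \<nu>" using act_sets[OF hi Ds] .
      show "act h ` Dp \<subseteq> Z" using act_Z[OF hi] closedin_subset[OF Dp_closed] by auto
    next
      fix h h' assume h: "h \<in> X" "h' \<in> X" "h \<noteq> h'"
      have "h = h'" if "\<zeta> \<in> act h ` Dp" "\<zeta> \<in> act h' ` Dp" for \<zeta>
        using that X h FD_Dp[OF assms] by (intro HG_FD_disjoint[OF assms, of h h' \<zeta>]) auto
      then show "act h ` Dp \<inter> act h' ` Dp = {}" using h(3) by blast
    qed (use sets.top[of \<nu>] in simp)
    finally show ?thesis using c nu_Z by (simp add: pos_le_divide_eq)
  qed
  then show ?thesis by blast
qed

text \<open>On this set the letter \<open>x\<close> of a coding could be followed by its own
  inverse. It is a translate of the null frontier between \<open>Dp\<close> and the image of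
  \<open>Dm\<close>.\<close>

lemma Dom_frontier_null:
  assumes "fst x \<in> \<Gamma>" shows "Dom x \<inter> act (lt x) ` Dom (linv x) \<in> null_sets \<nu>"
proof -
  have i: "isometry (fst x)" using assms G_isom by blast
  have s: "Dp \<in> sets \<nu>" "Dm \<in> sets \<nu>" using closed_sets Dp_closed Dm_closed by auto
  have n1: "Dp \<inter> act k ` Dm \<in> null_sets \<nu>"
    using frontier_null s act_sets[OF k_isom s(2)] by (simp add: null_sets_def emeasure_eq_measure)
  have e: "act (lt x) ` act (fst x) ` E = act (fst x) ` act (if snd x then k else ivt k) ` E" for E
    using i by (simp add: lt_def act_comp image_image)
  show ?thesis
  proof (cases "snd x")
    case True
    then have "Dom x \<inter> act (lt x) ` Dom (linv x) = act (fst x) ` (Dp \<inter> act k ` Dm)"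
      unfolding Dom_def by (simp add: e image_Int[OF act_inj[OF i]])
    then show ?thesis using nu_act_null[OF assms n1] by simp
  next
    case False
    have "act (ivt k) ` (Dp \<inter> act k ` Dm) = act (ivt k) ` Dp \<inter> Dm"
      using image_Int[OF act_inj[OF isometry_ivt[OF k_isom]], of Dp "act k ` Dm"] k_isom by (simp add: image_image)
    then have "Dom x \<inter> act (lt x) ` Dom (linv x) = act (fst x) ` act (ivt k) ` (Dp \<inter> act k ` Dm)"
      using False unfolding Dom_def by (simp add: e image_Int[OF act_inj[OF i]] Int_commute)
    then show ?thesis using nu_act_null[OF assms nu_act_null[OF G_ivt[OF kG] n1]] by simp
  qed
qed

lemma Dom_separated:
  assumes "conf G" "finite G"
  shows "\<exists>r. \<forall>x\<in>G \<times> UNIV. \<forall>y\<in>G \<times> UNIV. x \<noteq> y \<longrightarrow> (\<forall>\<zeta>\<in>Dom x \<inter> Bd. \<forall>q. Inl q \<in> Dom y \<longrightarrow> bp \<zeta> q \<le> r)"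
proof -
  define P :: "((('a \<Rightarrow> 'a) \<times> bool) \<times> (('a \<Rightarrow> 'a) \<times> bool)) set"
    where "P = {(x, y). fst x \<in> G \<and> fst y \<in> G \<and> x \<noteq> y}"
  have fP: "finite P"
    by (rule finite_subset[of _ "(G \<times> UNIV) \<times> (G \<times> UNIV)"]) (use assms(2) in \<open>auto simp: P_def intro!: finite_cartesian_product finite\<close>)
  have "\<forall>q\<in>P. \<exists>r. \<forall>\<zeta>\<in>Dom (fst q) \<inter> Bd. \<forall>t. Inl t \<in> Dom (snd q) \<longrightarrow> bp \<zeta> t \<le> r"
  proof
    fix q assume "q \<in> P"
    then have q: "fst (fst q) \<in> G" "fst (snd q) \<in> G" "fst q \<noteq> snd q" by (auto simp: P_def)
    show "\<exists>r. \<forall>\<zeta>\<in>Dom (fst q) \<inter> Bd. \<forall>t. Inl t \<in> Dom (snd q) \<longrightarrow> bp \<zeta> t \<le> r"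
      using q confD(1)[OF assms(1)] by (intro separated Dom_closed confD(2)[OF assms(1)]) auto
  qed
  from bchoice[OF this] obtain r where
    r: "\<forall>q\<in>P. \<forall>\<zeta>\<in>Dom (fst q) \<inter> Bd. \<forall>t. Inl t \<in> Dom (snd q) \<longrightarrow> bp \<zeta> t \<le> r q" ..
  define rr where "rr = Max (insert 0 (r ` P))"
  have rr: "r q \<le> rr" if "q \<in> P" for q unfolding rr_def using fP that by (intro Max_ge) auto
  show ?thesis
  proof (rule exI[of _ rr], intro ballI allI impI)
    fix x y \<zeta> q assume h: "x \<in> G \<times> UNIV" "y \<in> G \<times> UNIV" "x \<noteq> y" "\<zeta> \<in> Dom x \<inter> Bd" "Inl q \<in> Dom y"
    have xy: "(x, y) \<in> P" using h by (auto simp: P_def)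
    from bspec[OF r xy] have "bp \<zeta> q \<le> r (x, y)" using h by simp
    then show "bp \<zeta> q \<le> rr" using rr[OF xy] by linarith
  qed
qed

end

context ps_action
begin

lemma nu_act_le:
  assumes "h \<in> \<Gamma>" "E \<in> sets \<nu>"
  shows "measure \<nu> (act h ` E) \<le> exp (om * (len h + 74 * \<delta>)) * measure \<nu> E"
proof -
  have "measure \<nu> (act h ` E) \<le> exp (om * (2 * (len h + 2 * \<delta>) + 70 * \<delta> - len h)) * measure \<nu> E"
  proof (rule nu_act_upper[OF assms])
    fix \<zeta> assume "\<zeta> \<in> Bd"
    then show "bp \<zeta> (ivt h p) \<le> len h + 2 * \<delta>"
      using bp_bounds(2)[of \<zeta> "ivt h p"] Bd_in_Z len_ivt[OF G_isom[OF assms(1)]] by simp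
  qed
  then show ?thesis by (simp add: algebra_simps)
qed

lemma measure_UN_le_finite:
  assumes "countable I" "\<And>i. i \<in> I \<Longrightarrow> X i \<in> sets \<nu>"
    and bound: "\<And>J. finite J \<Longrightarrow> J \<subseteq> I \<Longrightarrow> measure \<nu> (\<Union>i\<in>J. X i) \<le> c"
  shows "measure \<nu> (\<Union>i\<in>I. X i) \<le> c"
proof (cases "I = {}")
  case True
  then show ?thesis using bound[of "{}"] by simp
next
  case False
  define Y where "Y n = (\<Union>i\<in>from_nat_into I ` {..n::nat}. X i)" for n
  have sub: "from_nat_into I ` {..n} \<subseteq> I" for n using from_nat_into[OF False] by blast
  have "incseq Y" unfolding incseq_def Y_def by (intro allI impI UN_mono image_mono) auto
  moreover have "range Y \<subseteq> sets \<nu>"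
    unfolding Y_def using sub assms(2) by (intro image_subsetI sets.finite_UN) auto
  ultimately have "(\<lambda>n. measure \<nu> (Y n)) \<longlonglongrightarrow> measure \<nu> (\<Union>n. Y n)"
    by (intro finite_Lim_measure_incseq)
  moreover have "measure \<nu> (Y n) \<le> c" for n unfolding Y_def using sub by (intro bound) auto
  ultimately have "measure \<nu> (\<Union>n. Y n) \<le> c" by (intro LIMSEQ_le_const2) auto
  moreover have "(\<Union>n. Y n) = (\<Union>i\<in>I. X i)"
  proof
    show "(\<Union>n. Y n) \<subseteq> (\<Union>i\<in>I. X i)" unfolding Y_def using sub by blast
    show "(\<Union>i\<in>I. X i) \<subseteq> (\<Union>n. Y n)"
    proof
      fix x assume "x \<in> (\<Union>i\<in>I. X i)"
      then obtain i where i: "i \<in> I" "x \<in> X i" by blast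
      obtain n where "from_nat_into I n = i" using from_nat_into_surj[OF assms(1) i(1)] by blast
      then have "x \<in> Y n" using i(2) unfolding Y_def by blast
      then show "x \<in> (\<Union>n. Y n)" by blast
    qed
  qed
  ultimately show ?thesis by simp
qed

end

lemma reduced_snoc_neq: "reduced (w @ [x]) \<Longrightarrow> w \<noteq> [] \<Longrightarrow> x \<noteq> (fst (last w), \<not> snd (last w))"
proof (induction w)
  case (Cons y w)
  then show ?case by (cases w) auto
qed simp

text \<open>As in Vitali's lemma, an element of least \<open>f\<close> is kept, everything related
  to it is discarded, and the process repeats. With \<open>f\<close> the length, large shadows are
  kept first.\<close>

lemma greedy_selection:
  fixes f :: "'b \<Rightarrow> real"
  assumes "finite F" "\<And>x. rel x x" "\<And>x y. rel x y \<Longrightarrow> rel y x"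
  shows "\<exists>G\<subseteq>F. (\<forall>x\<in>G. \<forall>y\<in>G. x \<noteq> y \<longrightarrow> \<not> rel x y) \<and> (\<forall>x\<in>F. \<exists>y\<in>G. rel x y \<and> f y \<le> f x)"
  using assms(1)
proof (induction "card F" arbitrary: F rule: less_induct)
  case less
  show ?case
  proof (cases "F = {}")
    case False
    obtain x0 where x0: "x0 \<in> F" "\<And>x. x \<in> F \<Longrightarrow> f x0 \<le> f x"
      using arg_min_if_finite(1)[OF less.prems False, of f] arg_min_least[OF less.prems False, of _ f] by blast
    define F' where "F' = {x \<in> F. \<not> rel x x0}"
    have "card F' < card F" using less.prems x0 assms(2) by (intro psubset_card_mono) (auto simp: F'_def)
    then obtain G where G: "G \<subseteq> F'" "\<forall>x\<in>G. \<forall>y\<in>G. x \<noteq> y \<longrightarrow> \<not> rel x y"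
      "\<forall>x\<in>F'. \<exists>y\<in>G. rel x y \<and> f y \<le> f x"
      using less.hyps[of F'] less.prems by (auto simp: F'_def)
    show ?thesis
    proof (intro exI[of _ "insert x0 G"] conjI)
      show "insert x0 G \<subseteq> F" using G(1) x0(1) by (auto simp: F'_def)
      have n: "\<not> rel x x0" if "x \<in> G" for x using G(1) that by (auto simp: F'_def)
      then have "\<not> rel x0 x" if "x \<in> G" for x using that assms(3) by blast
      then show "\<forall>x\<in>insert x0 G. \<forall>y\<in>insert x0 G. x \<noteq> y \<longrightarrow> \<not> rel x y" using G(2) n by simp
      show "\<forall>x\<in>F. \<exists>y\<in>insert x0 G. rel x y \<and> f y \<le> f x"
      proof
        fix x assume x: "x \<in> F"
        show "\<exists>y\<in>insert x0 G. rel x y \<and> f y \<le> f x"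
        proof (cases "rel x x0")
          case True
          then show ?thesis using x0(2)[OF x] by blast
        next
          case False
          then have "x \<in> F'" using x by (simp add: F'_def)
          then show ?thesis using G(3) by blast
        qed
      qed
    qed
  qed auto
qed

context pingpong
begin

section \<open>Coding of almost every point\<close>

lemma ev_inj: assumes "conf G" shows "inj_on ev (words G)"
proof (rule inj_onI)
  fix u w assume "u \<in> words G" "w \<in> words G" "ev u = ev w"
  then show "u = w" using FD_p[OF assms] by (intro ev_FD_disjoint[OF assms, of u w "Inl p" "Inl p"]) simp_all
qed

lemma words_length_finite: assumes "finite G" shows "finite {w \<in> words G. length w = n}"
proof (rule finite_subset)
  show "{w \<in> words G. length w = n} \<subseteq> {w. set w \<subseteq> G \<times> UNIV \<and> length w = n}"
    by (auto simp: words_def)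
  have "finite (G \<times> (UNIV :: bool set))" using assms by (intro finite_cartesian_product finite)
  then show "finite {w. set w \<subseteq> G \<times> (UNIV :: bool set) \<and> length w = n}" by (rule finite_lists_length_eq)
qed

text \<open>As \<open>x\<close> is not the inverse of the last letter of \<open>w\<close>, its
  domain is separated from the one containing \<open>ivt (ev w) p\<close>, with a bound uniform over
  the finitely many pairs of letters. So \<open>ev w\<close> shrinks it by the full exponential
  factor.\<close>

lemma ev_last_bound:
  assumes "conf G" "finite G"
  shows "\<exists>C. \<forall>w x. w @ [x] \<in> words G \<longrightarrow> measure \<nu> (act (ev w) ` Dom x) \<le> C * exp (- om * len (ev w))"
proof -
  obtain r where r: "\<forall>x\<in>G \<times> UNIV. \<forall>y\<in>G \<times> UNIV. x \<noteq> y \<longrightarrow> (\<forall>\<zeta>\<in>Dom x \<inter> Bd. \<forall>q. Inl q \<in> Dom y \<longrightarrow> bp \<zeta> q \<le> r)"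
    using Dom_separated[OF assms] by blast
  have sep: "bp \<zeta> q \<le> r" if "x \<in> G \<times> UNIV" "y \<in> G \<times> UNIV" "x \<noteq> y" "\<zeta> \<in> Dom x" "\<zeta> \<in> Bd" "Inl q \<in> Dom y" for x y \<zeta> q
    by (rule mp[OF spec[OF bspec[OF mp[OF bspec[OF bspec[OF r that(1)] that(2)] that(3)] IntI[OF that(4,5)]]] that(6)])
  define C where "C = exp (om * (2 * \<bar>r\<bar> + 70 * \<delta>))"
  have C1: "1 \<le> C" unfolding C_def using om_pos delta_pos by simp
  have le1: "measure \<nu> E \<le> 1" if "E \<in> sets \<nu>" for E
    using nu_mono[of E Z] sets.sets_into_space[OF that] nu_Z sets.top[of \<nu>] by simp
  have "measure \<nu> (act (ev w) ` Dom x) \<le> C * exp (- om * len (ev w))" if wx: "w @ [x] \<in> words G" for w x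
  proof -
    have w: "w \<in> words G" by (rule conjunct1[OF words_appendD[OF wx]])
    have x: "fst x \<in> G" using wx unfolding words_def by simp
    have xG: "fst x \<in> \<Gamma>" by (rule subsetD[OF confD(1)[OF assms(1)] x])
    have wG: "ev w \<in> \<Gamma>" by (rule ev_G[OF confD(1)[OF assms(1)] w])
    show ?thesis
    proof (cases "w = []")
      case True
      then show ?thesis using le1[OF Dom_sets[OF xG]] C1 unfolding True ev_Nil by simp
    next
      case False
      have last: "fst (last w) \<in> G" "x \<noteq> linv (last w)"
        using False w reduced_snoc_neq[OF _ False, of x] wx by (auto simp: words_def)
      have hd: "fst (hd w) \<in> G" using False w by (cases w) (auto simp: words_def)
      have "measure \<nu> (act (ev w) ` Dom x) \<le> exp (om * (2 * \<bar>r\<bar> + 70 * \<delta> - len (ev w))) * measure \<nu> (Dom x)"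
      proof (rule nu_act_upper[OF wG Dom_sets[OF xG]])
        fix \<zeta> assume z: "\<zeta> \<in> Dom x" "\<zeta> \<in> Bd"
        have "act (ivt (ev w)) (Inl p) \<in> Dom (linv (last w))"
          by (rule ev_ivt_Dom[OF assms(1) w False]) (use confD(4)[OF assms(1) hd] in auto)
        then have "Inl (ivt (ev w) p) \<in> Dom (linv (last w))" by simp
        moreover have "x \<in> G \<times> UNIV" "linv (last w) \<in> G \<times> UNIV" using x last(1) by (cases x, auto)
        ultimately have "bp \<zeta> (ivt (ev w) p) \<le> r" using last(2) z by (intro sep[of x "linv (last w)"])
        then show "bp \<zeta> (ivt (ev w) p) \<le> \<bar>r\<bar>" by linarith
      qed
      also have "\<dots> \<le> exp (om * (2 * \<bar>r\<bar> + 70 * \<delta> - len (ev w))) * 1"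
        by (intro mult_left_mono le1 Dom_sets xG) simp
      also have "\<dots> = C * exp (- om * len (ev w))"
        unfolding C_def exp_add[symmetric] by (simp add: algebra_simps)
      finally show ?thesis .
    qed
  qed
  then show ?thesis by blast
qed

text \<open>Outside a null set, a point which is in no translate of \<open>FD G\<close> has an infinite reduced coding, and
  the sets of points whose coding has length at least \<open>n\<close> have summable measures.\<close>

lemma ae_cover:
  assumes "conf G" "finite G"
  shows "Z - (\<Union>h\<in>HG G. act h ` FD G) \<in> null_sets \<nu>"
proof -
  have G: "G \<subseteq> \<Gamma>" using assms(1) by (rule confD)
  define L where "L = G \<times> (UNIV :: bool set)"
  have fL: "finite L" unfolding L_def using assms(2) by (intro finite_cartesian_product finite)
  \<comment> \<open>All points whose coding could backtrack at some step; null, as there are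
    countably many words.\<close>
  define M where "M = (\<Union>q\<in>words G \<times> L. act (ev (fst q)) ` (Dom (snd q) \<inter> act (lt (snd q)) ` Dom (linv (snd q))))"
  have M: "M \<in> null_sets \<nu>" unfolding M_def
  proof (rule null_sets_UN')
    have "countable (lists L)" using fL by (intro countable_lists countable_finite)
    moreover have "words G \<subseteq> lists L" by (auto simp: words_def L_def)
    ultimately have "countable (words G)" by (rule countable_subset[rotated])
    then show "countable (words G \<times> L)" by (rule countable_SIGMA) (rule countable_finite[OF fL])
    fix q assume "q \<in> words G \<times> L"
    then have q: "fst q \<in> words G" "fst (snd q) \<in> G" by (auto simp: L_def)
    show "act (ev (fst q)) ` (Dom (snd q) \<inter> act (lt (snd q)) ` Dom (linv (snd q))) \<in> null_sets \<nu>"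
      by (intro nu_act_null ev_G[OF G q(1)] Dom_frontier_null) (use q(2) G in blast)
  qed
  define W where "W n = {w \<in> words G. length w = n}" for n
  define I where "I n = {(w, x). w \<in> W n \<and> x \<in> L \<and> w @ [x] \<in> words G}" for n
  define V where "V n = (\<Union>q\<in>I n. act (ev (fst q)) ` Dom (snd q))" for n
  have fW: "finite (W n)" for n unfolding W_def by (rule words_length_finite[OF assms(2)])
  have IWL: "I n \<subseteq> W n \<times> L" for n by (auto simp: I_def)
  have fI: "finite (I n)" for n by (rule finite_subset[OF IWL]) (use fW fL in blast)
  have Qs: "act (ev (fst q)) ` Dom (snd q) \<in> sets \<nu>" if "q \<in> W n \<times> L" for q n
  proof -
    have q: "fst q \<in> words G" "fst (snd q) \<in> \<Gamma>" using that G by (auto simp: W_def L_def)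
    show ?thesis by (intro act_sets[OF G_isom[OF ev_G[OF G q(1)]]] Dom_sets q(2))
  qed
  have Vs: "V n \<in> sets \<nu>" for n unfolding V_def
    by (intro sets.finite_UN fI) (rule Qs[OF subsetD[OF IWL]])
  \<comment> \<open>After undoing the letters read so far, the point still lies outside
    \<open>FD G\<close>, so there is a next letter, and off \<open>M\<close> it does not cancel the
    previous one.\<close>
  have out: "\<zeta> \<in> V n" if z: "\<zeta> \<in> Z - (\<Union>h\<in>HG G. act h ` FD G) - M" for \<zeta> n
  proof (induction n)
    case 0
    have "act id ` FD G \<subseteq> (\<Union>h\<in>HG G. act h ` FD G)" using HG_id by blast
    then have "\<zeta> \<notin> FD G" using z by auto
    then obtain x where x: "fst x \<in> G" "\<zeta> \<in> Dom x" using z unfolding FD_def by blast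
    have "([], x) \<in> I 0" using x(1) by (cases x) (auto simp: I_def W_def L_def words_def)
    moreover have "\<zeta> \<in> act (ev (fst ([], x))) ` Dom (snd ([], x))" using x(2) by (simp add: ev_Nil)
    ultimately show ?case unfolding V_def by blast
  next
    case (Suc n)
    then obtain q where q: "q \<in> I n" "\<zeta> \<in> act (ev (fst q)) ` Dom (snd q)" unfolding V_def by blast
    define w x where "w = fst q" and "x = snd q"
    have wx: "w \<in> words G" "length w = n" "x \<in> L" "w @ [x] \<in> words G"
      using q(1) by (auto simp: I_def W_def w_def x_def)
    have xG: "fst x \<in> G" "fst x \<in> \<Gamma>" using wx(3) G by (auto simp: L_def)
    obtain y where y: "y \<in> Dom x" "\<zeta> = act (ev w) y" using q(2) unfolding w_def x_def by blast
    define y' where "y' = act (ivt (lt x)) y"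
    have il: "isometry (lt x)" using G_isom[OF lt_G[OF xG(2)]] .
    have y': "y = act (lt x) y'" using il by (simp add: y'_def)
    have y'Z: "y' \<in> Z" unfolding y'_def using act_Z[OF isometry_ivt[OF il]] y(1) Dom_Z[OF xG(2)] by blast
    have z': "\<zeta> = act (ev (w @ [x])) y'"
      unfolding ev_append ev_Cons ev_Nil comp_id act_comp y(2) y' ..
    have "y' \<notin> FD G"
    proof
      assume "y' \<in> FD G"
      then have "\<zeta> \<in> act (ev (w @ [x])) ` FD G" using z' by blast
      moreover have "ev (w @ [x]) \<in> HG G" using wx(4) unfolding HG_def by blast
      ultimately show False using z by blast
    qed
    then obtain x' where x': "fst x' \<in> G" "y' \<in> Dom x'" using y'Z unfolding FD_def by blast
    have "x' \<noteq> linv x"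
    proof
      assume "x' = linv x"
      then have "y \<in> Dom x \<inter> act (lt x) ` Dom (linv x)" using x'(2) y' y(1) by blast
      then have "\<zeta> \<in> act (ev w) ` (Dom x \<inter> act (lt x) ` Dom (linv x))" using y(2) by blast
      then have "\<zeta> \<in> M" unfolding M_def using wx(1,3) by force
      then show False using z by blast
    qed
    then have wxx: "(w @ [x]) @ [x'] \<in> words G"
      using wx(4) x'(1) reduced_append_Cons[of w x "[x']"] by (cases x) (auto simp: words_def)
    have "(w @ [x], x') \<in> I (Suc n)" using wx wxx x'(1) by (cases x') (auto simp: I_def W_def L_def)
    moreover have "\<zeta> \<in> act (ev (fst (w @ [x], x'))) ` Dom (snd (w @ [x], x'))"
      using z' x'(2) unfolding fst_conv snd_conv by blast
    ultimately show ?case unfolding V_def by blast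
  qed
  obtain C where C: "\<forall>w x. w @ [x] \<in> words G \<longrightarrow> measure \<nu> (act (ev w) ` Dom x) \<le> C * exp (- om * len (ev w))"
    using ev_last_bound[OF assms] by blast
  obtain C1 where C1: "\<forall>X. finite X \<and> X \<subseteq> HG G \<longrightarrow> (\<Sum>h\<in>X. exp (- om * len h)) \<le> C1"
    using HG_sum_bound[OF assms(1)] by blast
  have C0: "measure \<nu> (V n) \<le> real (card L) * \<bar>C\<bar> * (\<Sum>w\<in>W n. exp (- om * len (ev w)))" for n
  proof -
    have "measure \<nu> (V n) \<le> (\<Sum>q\<in>I n. measure \<nu> (act (ev (fst q)) ` Dom (snd q)))"
      unfolding V_def by (intro finite_measure_subadditive_finite fI image_subsetI Qs[OF subsetD[OF IWL]])
    also have "\<dots> \<le> (\<Sum>q\<in>I n. \<bar>C\<bar> * exp (- om * len (ev (fst q))))"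
    proof (rule sum_mono)
      fix q assume "q \<in> I n"
      then have "fst q @ [snd q] \<in> words G" by (auto simp: I_def)
      then have "measure \<nu> (act (ev (fst q)) ` Dom (snd q)) \<le> C * exp (- om * len (ev (fst q)))" using C by blast
      also have "\<dots> \<le> \<bar>C\<bar> * exp (- om * len (ev (fst q)))" by (intro mult_right_mono) auto
      finally show "measure \<nu> (act (ev (fst q)) ` Dom (snd q)) \<le> \<bar>C\<bar> * exp (- om * len (ev (fst q)))" .
    qed
    also have "\<dots> \<le> (\<Sum>q\<in>W n \<times> L. \<bar>C\<bar> * exp (- om * len (ev (fst q))))"
      by (intro sum_mono2 IWL finite_cartesian_product fW fL) auto
    also have "\<dots> = (\<Sum>w\<in>W n. \<Sum>x\<in>L. \<bar>C\<bar> * exp (- om * len (ev w)))"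
      using sum.cartesian_product[of "\<lambda>w x. \<bar>C\<bar> * exp (- om * len (ev w))" L "W n"] by (simp add: case_prod_unfold)
    also have "\<dots> = real (card L) * \<bar>C\<bar> * (\<Sum>w\<in>W n. exp (- om * len (ev w)))"
      by (simp add: sum_distrib_left mult.assoc)
    finally show ?thesis .
  qed
  \<comment> \<open>Different reduced words give different elements, so the sums over all lengths
    together are bounded by the convergent series of \<open>HG G\<close>.\<close>
  have "summable (\<lambda>n. \<Sum>w\<in>W n. exp (- om * len (ev w)))"
  proof (rule summableI_nonneg_bounded)
    fix n
    have "(\<Sum>i<n. \<Sum>w\<in>W i. exp (- om * len (ev w))) = (\<Sum>w\<in>(\<Union>i<n. W i). exp (- om * len (ev w)))"
      by (rule sum.UNION_disjoint[symmetric]) (use fW in \<open>auto simp: W_def\<close>)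
    also have "\<dots> = (\<Sum>h\<in>ev ` (\<Union>i<n. W i). exp (- om * len h))"
    proof -
      have "inj_on ev (\<Union>i<n. W i)" by (rule inj_on_subset[OF ev_inj[OF assms(1)]]) (auto simp: W_def)
      then show ?thesis by (simp add: sum.reindex)
    qed
    also have "\<dots> \<le> C1"
    proof -
      have "finite (ev ` (\<Union>i<n. W i))" using fW by (intro finite_imageI finite_UN_I) auto
      moreover have "ev ` (\<Union>i<n. W i) \<subseteq> HG G" unfolding HG_def W_def by blast
      ultimately show ?thesis using C1 by blast
    qed
    finally show "(\<Sum>i<n. \<Sum>w\<in>W i. exp (- om * len (ev w))) \<le> C1" .
  qed (auto intro: sum_nonneg)
  then have "summable (\<lambda>n. real (card L) * \<bar>C\<bar> * (\<Sum>w\<in>W n. exp (- om * len (ev w))))"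
    by (rule summable_mult)
  then have "summable (\<lambda>n. measure \<nu> (V n))"
    by (rule summable_comparison_test'[where N = 0]) (use C0 in simp)
  then have ae: "AE \<zeta> in \<nu>. eventually (\<lambda>n. \<zeta> \<in> space \<nu> - V n) sequentially"
    by (intro borel_cantelli_AE1 Vs) (auto simp: emeasure_eq_measure)
  have "AE \<zeta> in \<nu>. \<zeta> \<notin> Z - (\<Union>h\<in>HG G. act h ` FD G)"
    using ae AE_not_in[OF M]
  proof eventually_elim
    case (elim \<zeta>)
    obtain n where "\<zeta> \<notin> V n" using elim(1) unfolding eventually_sequentially by blast
    then show ?case using out[of \<zeta> n] elim(2) by blast
  qed
  moreover have "Z - (\<Union>h\<in>HG G. act h ` FD G) \<in> sets \<nu>"
  proof -
    have "(\<Union>h\<in>HG G. act h ` FD G) \<in> sets \<nu>"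
      by (intro sets.countable_UN'' HG_countable[OF G] act_HG_sets[OF G] open_sets FD_open assms(2) G)
    moreover have "Z \<in> sets \<nu>" using sets.top[of \<nu>] by simp
    ultimately show ?thesis by (rule sets.Diff[rotated])
  qed
  ultimately show ?thesis by (simp add: AE_iff_null_sets)
qed

end

context pingpong
begin

subsection \<open>Adding generators\<close>

lemma confI:
  assumes "G \<subseteq> \<Gamma>" "\<And>x y. fst x \<in> G \<Longrightarrow> fst y \<in> G \<Longrightarrow> x \<noteq> y \<Longrightarrow> Dom x \<inter> Dom y = {}"
    "\<And>x. fst x \<in> G \<Longrightarrow> Dom x \<inter> Dp = {}" "\<And>x. fst x \<in> G \<Longrightarrow> Inl p \<notin> Dom x"
  shows "conf G"
  unfolding conf_def
proof (intro conjI allI impI)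
  fix x y :: "('a \<Rightarrow> 'a) \<times> bool"
  assume "fst x \<in> G \<and> fst y \<in> G \<and> x \<noteq> y"
  then show "Dom x \<inter> Dom y = {}" using assms(2) by simp
qed (fact assms(1), erule assms(3), erule assms(4))

lemma conf_mono: assumes "conf G'" "G \<subseteq> G'" shows "conf G"
proof (rule confI)
  show "G \<subseteq> \<Gamma>" using assms(2) confD(1)[OF assms(1)] by (rule subset_trans)
  show "Dom x \<inter> Dom y = {}" if "fst x \<in> G" "fst y \<in> G" "x \<noteq> y" for x y
    by (rule confD(2)[OF assms(1) subsetD[OF assms(2) that(1)] subsetD[OF assms(2) that(2)] that(3)])
  show "Dom x \<inter> Dp = {}" "Inl p \<notin> Dom x" if "fst x \<in> G" for x
    by (rule confD(3,4)[OF assms(1) subsetD[OF assms(2) that]])+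
qed

text \<open>A margin meeting all conditions of \<open>sigma_ge\<close>: the shadow of
  \<open>g\<close> has to contain the images of \<open>Dp\<close>, \<open>Dm\<close> and
  \<open>A\<close> under \<open>g\<close>, and to contain in its interior the boundary points for
  which \<open>g\<close> is a conical witness.\<close>

definition \<sigma> :: real where "\<sigma> = \<bar>R\<bar> + \<bar>\<rho>\<bar> + 60 * \<delta>"

definition fam :: "('a \<Rightarrow> 'a) \<Rightarrow> bool" where
  "fam g \<longleftrightarrow> g \<in> \<Gamma> \<and> (\<forall>\<zeta>\<in>Dp \<union> Dm \<union> A. bp \<zeta> (ivt g p) \<le> R)"

definition Shd :: "('a \<Rightarrow> 'a) \<Rightarrow> 'a bordification set" where
  "Shd g = Sh (g p) (len g - \<sigma>)"

text \<open>The extra \<open>8 * \<delta>\<close> is how far an intersecting shadow of a longer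
  element can stick out; taking the closure makes the set measurable.\<close>

definition Enl :: "('a \<Rightarrow> 'a) \<Rightarrow> 'a bordification set" where
  "Enl g = T closure_of Sh (g p) (len g - \<sigma> - 8 * \<delta>)"

lemma sigma_ge: "R + 6 * \<delta> \<le> \<sigma>" "R + 8 * \<delta> \<le> \<sigma>" "\<rho> + 31 * \<delta> \<le> \<sigma>" "\<rho> \<le> \<sigma>" "0 < \<sigma>"
  using delta_pos by (auto simp: \<sigma>_def abs_if)

lemma sets_Z: "Dp \<in> sets \<nu>" "Dm \<in> sets \<nu>" "A \<in> sets \<nu>" "Dp \<subseteq> Z" "Dm \<subseteq> Z" "A \<subseteq> Z" "Z \<in> sets \<nu>"
  using closed_sets[OF Dp_closed] closed_sets[OF Dm_closed] closed_sets[OF A_closed] closedin_subset[OF Dp_closed]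
    closedin_subset[OF Dm_closed] closedin_subset[OF A_closed] sets.top[of \<nu>] by simp_all

lemma famD: "fam g \<Longrightarrow> g \<in> \<Gamma>" "fam g \<Longrightarrow> isometry g"
  "fam g \<Longrightarrow> \<zeta> \<in> Dp \<union> Dm \<union> A \<Longrightarrow> bp \<zeta> (ivt g p) \<le> R"
  using G_isom unfolding fam_def by blast+

lemma act_Shd:
  assumes "fam g" "\<zeta> \<in> Dp \<union> Dm \<union> A" shows "act g \<zeta> \<in> Shd g"
proof -
  have z: "\<zeta> \<in> Z" using assms(2) sets_Z by blast
  have "len g - R - 8 * \<delta> \<le> bp (act g \<zeta>) (g p)"
    using bp_act_base[OF famD(2)[OF assms(1)] z] famD(3)[OF assms] by linarith
  then show ?thesis using act_Z[OF famD(2)[OF assms(1)] z] sigma_ge(2) by (simp add: Shd_def Sh_def)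
qed

lemma Dom_Shd: "fam (fst x) \<Longrightarrow> Dom x \<subseteq> Shd (fst x)"
  unfolding Dom_def using act_Shd by (auto split: if_splits)

lemma A_Shd: "fam g \<Longrightarrow> act g ` A \<subseteq> Shd g"
  using act_Shd by blast

text \<open>A point outside the shadow of \<open>g\<close> is pulled back by \<open>g\<close> to
  nearly the direction of \<open>ivt g p\<close>, which \<open>Dp\<close>, \<open>Dm\<close> and
  \<open>A\<close> avoid by the choice of \<open>g\<close>.\<close>

lemma fam_outside:
  assumes "fam g" "\<zeta> \<in> Dp \<union> Dm \<union> A" "Inl x \<notin> Shd g"
  shows "bp \<zeta> (ivt g x) \<le> R + 6 * \<delta>"
proof (rule ccontr)
  assume no: "\<not> ?thesis"
  have ig: "isometry g" using famD(2)[OF assms(1)] .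
  have "gp x (g p) < len g - \<sigma>" using assms(3) by (simp add: Shd_def Sh_def)
  moreover have "gp (ivt g p) (ivt g x) = len g - gp x (g p)"
    using gp_translate[OF isometry_ivt[OF ig], of x] ig len_ivt[OF ig] by simp
  ultimately have "R + 6 * \<delta> \<le> gp (ivt g x) (ivt g p)" using sigma_ge(1) gp_sym[of "ivt g x"] by simp
  then have "R + 6 * \<delta> - 5 * \<delta> \<le> bp \<zeta> (ivt g p)"
    using no sets_Z assms(2) by (intro bp_hyp[of \<zeta> _ "ivt g x"]) auto
  then show False using famD(3)[OF assms(1,2)] delta_pos by linarith
qed

text \<open>Shadows that meet are nested up to bounded depth, the one of the longer element being
  the smaller; this is the covering property behind the Vitali selection.\<close>

lemma Shd_Enl:
  assumes "w \<in> Shd g" "w \<in> Shd g'" "len g' \<le> len g" "\<xi> \<in> Shd g" shows "\<xi> \<in> Enl g'"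
proof -
  have "len g' - \<sigma> - 3 * \<delta> \<le> gp (g p) (g' p)"
    by (rule gp_bp_hyp[of w]) (use assms in \<open>auto simp: Shd_def Sh_def\<close>)
  then have "len g' - \<sigma> - 3 * \<delta> - 5 * \<delta> \<le> bp \<xi> (g' p)"
    using assms(3,4) delta_pos by (intro bp_hyp[of \<xi> _ "g p"]) (auto simp: Shd_def Sh_def)
  then have "\<xi> \<in> Sh (g' p) (len g' - \<sigma> - 8 * \<delta>)" using assms(4) by (simp add: Shd_def Sh_def)
  moreover have "Sh (g' p) (len g' - \<sigma> - 8 * \<delta>) \<subseteq> T closure_of Sh (g' p) (len g' - \<sigma> - 8 * \<delta>)"
    by (rule closure_of_subset) (auto simp: Sh_def)
  ultimately show ?thesis unfolding Enl_def by blast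
qed

lemma Enl_closed: "closedin T (Enl g)"
  by (simp add: Enl_def)

lemma Enl_Sh: "Enl g \<subseteq> Sh (g p) (len g - \<sigma> - 38 * \<delta>)"
  using Sh_closure[of "g p" "len g - \<sigma> - 8 * \<delta>"] by (simp add: Enl_def)

lemma Shd_sub_Enl: "Shd g \<subseteq> Enl g"
  using Shd_Enl[of _ g g] by blast

definition c0 :: real where "c0 = exp (- (om * (2 * (\<sigma> + 52 * \<delta>) + 144 * \<delta>))) * measure \<nu> A"

lemma c0_pos: "0 < c0"
  using A_pos by (simp add: c0_def)

text \<open>Both sides are comparable to \<open>exp (- om * len (h \<circ> g))\<close>. The upper
  bound holds because the pullback of the enlarged shadow avoids the direction of
  \<open>ivt (h \<circ> g) p\<close>, the lower one is the general one. The length of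
  \<open>g\<close> relative to \<open>h\<close> keeps \<open>ivt h p\<close> away from the shadow,
  so that \<open>c0\<close> does not depend on \<open>h\<close>.\<close>

lemma Enl_measure:
  assumes "fam g" "h \<in> \<Gamma>" "len h + \<sigma> + 60 * \<delta> \<le> len g"
  shows "c0 * measure \<nu> (act h ` Enl g) \<le> measure \<nu> (act (h \<circ> g) ` A)"
proof -
  have ig: "isometry g" "isometry h" using famD(2)[OF assms(1)] G_isom assms(2) by auto
  have hg: "h \<circ> g \<in> \<Gamma>" using G_comp[OF assms(2) famD(1)[OF assms(1)]] .
  define X where "X = act (ivt g) ` Enl g"
  have Xs: "X \<in> sets \<nu>" unfolding X_def by (rule act_sets[OF isometry_ivt[OF ig(1)] closed_sets[OF Enl_closed]])
  have hX: "act h ` Enl g = act (h \<circ> g) ` X"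
    unfolding X_def act_comp_image using ig(1) by (simp add: image_image)
  have "measure \<nu> (act (h \<circ> g) ` X) \<le> exp (om * (2 * (\<sigma> + 52 * \<delta>) + 70 * \<delta> - len (h \<circ> g))) * measure \<nu> X"
  proof (rule nu_act_upper[OF hg Xs])
    fix \<zeta> assume z: "\<zeta> \<in> X" "\<zeta> \<in> Bd"
    then obtain w where w: "w \<in> Enl g" "\<zeta> = act (ivt g) w" unfolding X_def by blast
    then have wS: "w \<in> Z" "len g - \<sigma> - 38 * \<delta> \<le> bp w (g p)" using Enl_Sh unfolding Sh_def by blast+
    have b: "bp \<zeta> (ivt g p) \<le> \<sigma> + 46 * \<delta>"
      using bp_act_base[OF isometry_ivt[OF ig(1)] wS(1)] wS(2) ig(1) len_ivt[OF ig(1)] unfolding w(2) by simp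
    have "gp (ivt h p) (g p) \<le> len h" using gp_le(1)[of "ivt h p" "g p"] len_ivt[OF ig(2)] by simp
    then have "\<sigma> + 52 * \<delta> \<le> gp (ivt g p) (ivt g (ivt h p))"
      using gp_translate[OF isometry_ivt[OF ig(1)], of "ivt h p"] ig(1) len_ivt[OF ig(1)] assms(3) delta_pos by simp
    then have g2: "\<sigma> + 52 * \<delta> \<le> gp (ivt g (ivt h p)) (ivt g p)" using gp_sym[of "ivt g p"] by simp
    have "bp \<zeta> (ivt g (ivt h p)) \<le> \<sigma> + 52 * \<delta>"
    proof (rule ccontr)
      assume no: "\<not> ?thesis"
      have "\<sigma> + 52 * \<delta> - 5 * \<delta> \<le> bp \<zeta> (ivt g p)"
        by (rule bp_hyp[OF Bd_in_Z[OF z(2)] _ g2]) (use no in simp)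
      then show False using b delta_pos by linarith
    qed
    then show "bp \<zeta> (ivt (h \<circ> g) p) \<le> \<sigma> + 52 * \<delta>" using ivt_comp[OF ig(2,1)] by simp
  qed
  also have "\<dots> \<le> exp (om * (2 * (\<sigma> + 52 * \<delta>) + 70 * \<delta> - len (h \<circ> g))) * 1"
    using nu_mono[OF sets.sets_into_space[OF Xs], unfolded space_nu, OF sets_Z(7)] nu_Z by (intro mult_left_mono) auto
  finally have u: "measure \<nu> (act h ` Enl g) \<le> exp (om * (2 * (\<sigma> + 52 * \<delta>) + 70 * \<delta> - len (h \<circ> g)))"
    unfolding hX by simp
  have "c0 * measure \<nu> (act h ` Enl g) \<le> c0 * exp (om * (2 * (\<sigma> + 52 * \<delta>) + 70 * \<delta> - len (h \<circ> g)))"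
    using u c0_pos by (intro mult_left_mono) auto
  also have "\<dots> = exp (- (om * (2 * (\<sigma> + 52 * \<delta>) + 144 * \<delta>))) * exp (om * (2 * (\<sigma> + 52 * \<delta>) + 70 * \<delta> - len (h \<circ> g))) * measure \<nu> A"
    unfolding c0_def by (simp only: mult.assoc mult.commute mult.left_commute)
  also have "\<dots> = exp (- (om * (len (h \<circ> g) + 74 * \<delta>))) * measure \<nu> A"
    unfolding exp_add[symmetric] by (simp add: algebra_simps)
  also have "\<dots> \<le> measure \<nu> (act (h \<circ> g) ` A)" by (rule nu_act_lower[OF hg sets_Z(3)])
  finally show ?thesis .
qed

definition c1 :: real where "c1 = exp (- (om * (len k + 230 * \<delta> + 2 * R)))"

text \<open>The element attached to a pair; it maps \<open>act (h \<circ> g) ` act (ivt k) ` A\<close> to \<open>act (h \<circ> g) ` A\<close>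
  and distorts the measure of subsets by a bounded factor only.\<close>

definition elt :: "('a \<Rightarrow> 'a) \<times> ('a \<Rightarrow> 'a) \<Rightarrow> 'a \<Rightarrow> 'a" where
  "elt q = fst q \<circ> lt (snd q, True) \<circ> ivt (fst q)"

definition Ast :: "('a \<Rightarrow> 'a) \<times> ('a \<Rightarrow> 'a) \<Rightarrow> 'a bordification set" where
  "Ast q = act (fst q \<circ> snd q) ` A"

definition gain :: "('a \<Rightarrow> 'a) \<times> ('a \<Rightarrow> 'a) \<Rightarrow> bool" where
  "gain q \<longleftrightarrow> (\<forall>S\<in>sets \<nu>. S \<subseteq> Ast q \<longrightarrow> c1 * measure \<nu> S \<le> measure \<nu> (act (ivt (elt q)) ` S))"

text \<open>With \<open>q = h \<circ> g\<close> the element is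
  \<open>q \<circ> k \<circ> ivt q\<close>. By alignment \<open>q\<close> scales subsets of
  \<open>A\<close> by at most a constant times \<open>exp (- om * len q)\<close>, and it scales any
  set by at least such a factor; the terms in \<open>len q\<close> cancel and only the distortion of
  \<open>k\<close> remains.\<close>

lemma gainI:
  assumes "fam g" "h \<in> \<Gamma>" "len h + \<sigma> + 60 * \<delta> \<le> len g"
  shows "gain (h, g)"
  unfolding gain_def
proof (intro ballI impI)
  fix S assume S: "S \<in> sets \<nu>" "S \<subseteq> Ast (h, g)"
  have ig: "isometry g" "isometry h" using famD(2)[OF assms(1)] G_isom assms(2) by auto
  define q where "q = h \<circ> g"
  have qG: "q \<in> \<Gamma>" using G_comp[OF assms(2) famD(1)[OF assms(1)]] by (simp add: q_def)
  have iq: "isometry q" using G_isom qG by blast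
  define S' where "S' = act (ivt q) ` S"
  have S's: "S' \<in> sets \<nu>" unfolding S'_def by (rule act_sets[OF isometry_ivt[OF iq] S(1)])
  have SS': "S = act q ` S'" unfolding S'_def using iq by (simp add: image_image)
  have S'A: "S' \<subseteq> A" unfolding S'_def using S(2) iq by (auto simp: Ast_def q_def[symmetric])
  have "ivt (elt (h, g)) = q \<circ> ivt k \<circ> ivt q"
  proof -
    have e: "elt (h, g) = q \<circ> k \<circ> ivt q" unfolding elt_def lt_def q_def using ivt_comp[OF ig(2,1)] by (simp add: comp_assoc)
    show ?thesis unfolding e
      using ivt_comp[OF isometry_comp[OF iq k_isom] isometry_ivt[OF iq]] ivt_comp[OF iq k_isom] iq by (simp add: comp_assoc)
  qed
  then have e: "act (ivt (elt (h, g))) ` S = act q ` act (ivt k) ` S'"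
    unfolding S'_def by (simp add: act_comp_image)
  have ik: "ivt k \<in> \<Gamma>" using kG G_ivt by blast
  have up: "measure \<nu> S \<le> exp (om * (2 * (R + 6 * \<delta>) + 70 * \<delta> - len q)) * measure \<nu> S'"
    unfolding SS'
  proof (rule nu_act_upper[OF qG S's])
    fix \<zeta> assume "\<zeta> \<in> S'"
    then have z: "\<zeta> \<in> Dp \<union> Dm \<union> A" using S'A by blast
    have "gp (ivt h p) (g p) \<le> len h" using gp_le(1)[of "ivt h p" "g p"] len_ivt[OF ig(2)] by simp
    then have "Inl (ivt h p) \<notin> Shd g" using assms(3) delta_pos by (simp add: Shd_def Sh_def)
    then show "bp \<zeta> (ivt q p) \<le> R + 6 * \<delta>"
      using fam_outside[OF assms(1) z] ivt_comp[OF ig(2,1)] by (simp add: q_def)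
  qed
  have "exp (- (om * (len k + 74 * \<delta>))) * measure \<nu> S' \<le> measure \<nu> (act (ivt k) ` S')"
    using nu_act_lower[OF ik S's] len_ivt[OF k_isom] by simp
  then have "exp (- (om * (len q + 74 * \<delta>))) * (exp (- (om * (len k + 74 * \<delta>))) * measure \<nu> S')
      \<le> exp (- (om * (len q + 74 * \<delta>))) * measure \<nu> (act (ivt k) ` S')" by (intro mult_left_mono) auto
  also have "\<dots> \<le> measure \<nu> (act q ` act (ivt k) ` S')"
    by (rule nu_act_lower[OF qG act_sets[OF isometry_ivt[OF k_isom] S's]])
  finally have low: "exp (- (om * (len q + 74 * \<delta>))) * (exp (- (om * (len k + 74 * \<delta>))) * measure \<nu> S')
      \<le> measure \<nu> (act (ivt (elt (h, g))) ` S)" unfolding e .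
  have "c1 * measure \<nu> S \<le> c1 * (exp (om * (2 * (R + 6 * \<delta>) + 70 * \<delta> - len q)) * measure \<nu> S')"
    using up by (intro mult_left_mono) (auto simp: c1_def)
  also have "\<dots> = exp (- (om * (len q + 74 * \<delta>))) * (exp (- (om * (len k + 74 * \<delta>))) * measure \<nu> S')"
    unfolding c1_def mult.assoc[symmetric] exp_add[symmetric] by (simp add: algebra_simps)
  also note low
  finally show "c1 * measure \<nu> S \<le> measure \<nu> (act (ivt (elt (h, g))) ` S)" .
qed

lemma DpDm_separated: "\<exists>r. \<forall>\<zeta>\<in>Bd. \<forall>x. \<zeta> \<in> Dp \<and> Inl x \<in> Dm \<or> \<zeta> \<in> Dm \<and> Inl x \<in> Dp \<longrightarrow> bp \<zeta> x \<le> r"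
proof -
  obtain r where r: "\<forall>\<zeta>\<in>Dp \<inter> Bd. \<forall>x. Inl x \<in> Dm \<longrightarrow> bp \<zeta> x \<le> r"
    using separated[OF Dp_closed Dm_closed DpDm] by blast
  have "Dm \<inter> Dp = {}" using DpDm by blast
  then obtain r' where r': "\<forall>\<zeta>\<in>Dm \<inter> Bd. \<forall>x. Inl x \<in> Dp \<longrightarrow> bp \<zeta> x \<le> r'"
    using separated[OF Dm_closed Dp_closed] by blast
  have "bp \<zeta> x \<le> max r r'"
    if z: "\<zeta> \<in> Bd" and d: "\<zeta> \<in> Dp \<and> Inl x \<in> Dm \<or> \<zeta> \<in> Dm \<and> Inl x \<in> Dp" for \<zeta> x
    using d
  proof
    assume h: "\<zeta> \<in> Dp \<and> Inl x \<in> Dm"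
    then have "\<zeta> \<in> Dp \<inter> Bd" using z by blast
    from bspec[OF r this] have "bp \<zeta> x \<le> r" using h by blast
    then show ?thesis by simp
  next
    assume h: "\<zeta> \<in> Dm \<and> Inl x \<in> Dp"
    then have "\<zeta> \<in> Dm \<inter> Bd" using z by blast
    from bspec[OF r' this] have "bp \<zeta> x \<le> r'" using h by blast
    then show ?thesis by simp
  qed
  then show ?thesis by blast
qed

text \<open>The words over \<open>G \<union> G'\<close> which contain a letter from \<open>G'\<close> are split after the last such letter.\<close>

lemma HU_decompose:
  "HU (G \<union> G') \<subseteq> HU G \<union> (\<Union>q\<in>{(v, x). v @ [x] \<in> words (G \<union> G') \<and> fst x \<in> G'}. act (ev (fst q)) ` act (lt (snd q)) ` HU G)"
proof
  fix \<zeta> assume "\<zeta> \<in> HU (G \<union> G')"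
  then obtain w where w: "w \<in> words (G \<union> G')" "\<zeta> \<in> act (ev w) ` Dp" unfolding HU_def HG_def by blast
  show "\<zeta> \<in> HU G \<union> (\<Union>q\<in>{(v, x). v @ [x] \<in> words (G \<union> G') \<and> fst x \<in> G'}. act (ev (fst q)) ` act (lt (snd q)) ` HU G)"
  proof (cases "\<exists>x\<in>set w. fst x \<in> G'")
    case False
    then have "w \<in> words G" using w(1) by (auto simp: words_def)
    then show ?thesis using w(2) unfolding HU_def HG_def by blast
  next
    case True
    then obtain v x u where vx: "w = v @ x # u" "fst x \<in> G'" "\<forall>y\<in>set u. fst y \<notin> G'"
      using split_list_last_prop[of w "\<lambda>x. fst x \<in> G'"] by blast
    have "(v @ [x]) @ u \<in> words (G \<union> G')" using w(1) vx(1) by simp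
    then have vu: "v @ [x] \<in> words (G \<union> G')" "u \<in> words (G \<union> G')" using words_appendD by blast+
    have "u \<in> words G" using vu(2) vx(3) by (auto simp: words_def)
    then have "act (ev u) ` Dp \<subseteq> HU G" unfolding HU_def HG_def by blast
    moreover have "act (ev w) ` Dp = act (ev v) ` act (lt x) ` act (ev u) ` Dp"
      unfolding vx(1) ev_append ev_Cons act_comp_image ..
    ultimately have "\<zeta> \<in> act (ev v) ` act (lt x) ` HU G" using w(2) by blast
    moreover have "(v, x) \<in> {(v, x). v @ [x] \<in> words (G \<union> G') \<and> fst x \<in> G'}" using vu(1) vx(2) by blast
    ultimately show ?thesis by (intro UnI2) (rule UN_I, assumption, simp)
  qed
qed

text \<open>Each new piece \<open>act (ev v) ` act (lt x) ` HU G\<close> of the orbit of \<open>Dp\<close>, with \<open>x\<close> a letter of \<open>g\<close>, is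
  compared with \<open>act (ev v) ` act g ` A\<close>; these sets are disjoint, as \<open>act g ` A\<close> lies in the
  fundamental domain of the enlarged group.\<close>

lemma HU_cost:
  "\<exists>C>0. \<forall>G G' r L. conf (G \<union> G') \<and> (\<forall>g\<in>G'. fam g \<and> L \<le> len g \<and> \<sigma> < len g \<and> Shd g \<subseteq> FD G - Dp \<and> Sh (g p) r \<subseteq> FD G - Dp) \<and>
     (\<forall>g\<in>G'. \<forall>g'\<in>G'. g \<noteq> g' \<longrightarrow> Shd g \<inter> Shd g' = {}) \<longrightarrow>
     measure \<nu> (HU (G \<union> G')) \<le> measure \<nu> (HU G) + C * exp (om * (2 * r - L))"
proof -
  obtain s where s: "\<forall>\<zeta>\<in>Bd. \<forall>x. \<zeta> \<in> Dp \<and> Inl x \<in> Dm \<or> \<zeta> \<in> Dm \<and> Inl x \<in> Dp \<longrightarrow> bp \<zeta> x \<le> s"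
    using DpDm_separated by blast
  define r0 where "r0 = max (R + 6 * \<delta>) s"
  define C where "C = exp (om * (2 * r0 + 70 * \<delta> + 74 * \<delta> + len k + 74 * \<delta> + 70 * \<delta>)) / measure \<nu> A"
  have Cpos: "0 < C" unfolding C_def using A_pos by simp
  have main: "measure \<nu> (HU (G \<union> G')) \<le> measure \<nu> (HU G) + 2 * C * exp (om * (2 * r - L))"
    if cf: "conf (G \<union> G')"
      and new: "\<And>g. g \<in> G' \<Longrightarrow> fam g \<and> L \<le> len g \<and> \<sigma> < len g \<and> Shd g \<subseteq> FD G - Dp \<and> Sh (g p) r \<subseteq> FD G - Dp"
      and dj: "\<And>g g'. g \<in> G' \<Longrightarrow> g' \<in> G' \<Longrightarrow> g \<noteq> g' \<Longrightarrow> Shd g \<inter> Shd g' = {}"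
    for G G' r L
  proof -
    have GG: "G \<union> G' \<subseteq> \<Gamma>" using cf by (rule confD)
    have cG: "conf G" using cf by (rule conf_mono) simp
    have Gsub: "G \<subseteq> \<Gamma>" using GG by blast
    define I where "I = {(v, x). v @ [x] \<in> words (G \<union> G') \<and> fst x \<in> G'}"
    define X where "X q = act (ev (fst q)) ` act (lt (snd q)) ` HU G" for q
    define Y where "Y q = act (ev (fst q)) ` act (fst (snd q)) ` A" for q :: "(('a \<Rightarrow> 'a) \<times> bool) list \<times> (('a \<Rightarrow> 'a) \<times> bool)"
    have ID: "fst q @ [snd q] \<in> words (G \<union> G')" "fst (snd q) \<in> G'" "fst q \<in> words (G \<union> G')" "fst (snd q) \<in> \<Gamma>"
      "ev (fst q) \<in> \<Gamma>" if "q \<in> I" for q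
    proof -
      show 1: "fst q @ [snd q] \<in> words (G \<union> G')" and 2: "fst (snd q) \<in> G'" using that by (auto simp: I_def)
      show 3: "fst q \<in> words (G \<union> G')" by (rule conjunct1[OF words_appendD[OF 1]])
      show "fst (snd q) \<in> \<Gamma>" using 2 GG by blast
      show "ev (fst q) \<in> \<Gamma>" by (rule ev_G[OF GG 3])
    qed
    have Xs: "X q \<in> sets \<nu>" if "q \<in> I" for q unfolding X_def
      by (intro act_sets[OF G_isom[OF ID(5)[OF that]]] act_sets[OF G_isom[OF lt_G[OF ID(4)[OF that]]]] HU_sets Gsub)
    have Ys: "Y q \<in> sets \<nu>" if "q \<in> I" for q unfolding Y_def
      by (intro act_sets[OF G_isom[OF ID(5)[OF that]]] act_sets[OF G_isom[OF ID(4)[OF that]]] sets_Z)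
    have HUout: "HU G \<inter> (FD G - Dp) = {}" using HU_FD[OF cG] by blast
    have XY: "measure \<nu> (X q) \<le> C * exp (om * (2 * r - L)) * measure \<nu> (Y q)" if q: "q \<in> I" for q
    proof -
      define v x g where "v = fst q" and "x = snd q" and "g = fst x"
      have gG': "g \<in> G'" "g \<in> \<Gamma>" using ID[OF q] by (auto simp: g_def x_def)
      have v: "v \<in> words (G \<union> G')" "v @ [x] \<in> words (G \<union> G')" "ev v \<in> \<Gamma>" using ID[OF q] by (auto simp: v_def x_def)
      note ng = new[OF gG'(1)]
      have fg: "fam g" and Lg: "L \<le> len g" and sg: "\<sigma> < len g" using ng by auto
      have ig: "isometry g" using famD(2)[OF fg] .
      define \<kappa> where "\<kappa> = (if snd x then k else ivt k)"
      define D where "D = (if snd x then Dp else Dm)"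
      have kap: "\<kappa> \<in> \<Gamma>" "len \<kappa> = len k" using kG G_ivt len_ivt[OF k_isom] by (auto simp: \<kappa>_def)
      define H where "H = act (ivt g) ` HU G"
      have HUs: "HU G \<in> sets \<nu>" by (rule HU_sets[OF Gsub])
      have Hs: "H \<in> sets \<nu>" unfolding H_def by (rule act_sets[OF isometry_ivt[OF ig] HUs])
      \<comment> \<open>The orbit \<open>HU G\<close> avoids \<open>Sh (g p) r\<close>, since it
        meets \<open>FD G\<close> only in \<open>Dp\<close>. Hence \<open>ivt g\<close> compresses
        it exponentially in \<open>len g\<close>, which is the source of the small cost for large
        \<open>L\<close>.\<close>
      have Hm: "measure \<nu> H \<le> exp (om * (2 * r + 70 * \<delta> - len g))"
      proof -
        have "measure \<nu> H \<le> exp (om * (2 * r + 70 * \<delta> - len g)) * measure \<nu> (HU G)" unfolding H_def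
        proof (rule quasi_conformal[OF gG'(2) HUs])
          fix \<zeta> assume z: "\<zeta> \<in> HU G" "\<zeta> \<in> Bd"
          show "bp \<zeta> (g p) \<le> r"
          proof (rule ccontr)
            assume "\<not> ?thesis"
            then have "\<zeta> \<in> Sh (g p) r" using Bd_in_Z[OF z(2)] by (simp add: Sh_def)
            then show False using ng HUout z(1) by blast
          qed
        qed
        also have "\<dots> \<le> exp (om * (2 * r + 70 * \<delta> - len g)) * 1"
          using nu_mono[OF sets.sets_into_space[OF HUs], unfolded space_nu, OF sets_Z(7)] nu_Z by (intro mult_left_mono) auto
        finally show ?thesis by simp
      qed
      define K where "K = act \<kappa> ` H"
      have Ks: "K \<in> sets \<nu>" unfolding K_def by (rule act_sets[OF G_isom[OF kap(1)] Hs])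
      have Km: "measure \<nu> K \<le> exp (om * (len k + 74 * \<delta>)) * measure \<nu> H"
        unfolding K_def using nu_act_le[OF kap(1) Hs] kap(2) by simp
      have gK: "act (lt x) ` HU G = act g ` K"
        unfolding K_def H_def lt_def act_comp_image g_def \<kappa>_def ..
      \<comment> \<open>Ping-pong for a single letter: the domain of \<open>linv x\<close> lies in
        \<open>FD G - Dp\<close>, which \<open>HU G\<close> does not meet.\<close>
      have KD: "K \<subseteq> D"
      proof
        fix y assume y: "y \<in> K"
        then have "act g y \<in> act (lt x) ` HU G" unfolding gK by blast
        then obtain u where u: "u \<in> HU G" "act g y = act (lt x) u" by blast
        have "fam (fst (linv x))" using fg by (simp add: g_def)
        then have "Dom (linv x) \<subseteq> FD G - Dp" using Dom_Shd[of "linv x"] ng by (simp add: g_def) blast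
        then have "u \<notin> Dom (linv x)" using u(1) HUout by blast
        moreover have "u \<in> Z" using u(1) sets.sets_into_space[OF HUs] by auto
        ultimately have "act (lt x) u \<in> Dom x" using gG'(2) by (intro lt_Dom) (auto simp: g_def)
        then have "act g y \<in> act g ` D" unfolding u(2)[symmetric] Dom_def D_def g_def .
        then show "y \<in> D" using act_inj[OF ig] by (simp add: inj_image_mem_iff)
      qed
      have DD: "D \<subseteq> Dp \<union> Dm \<union> A" by (auto simp: D_def)
      \<comment> \<open>The distortion of \<open>ev v \<circ> g\<close> on \<open>K\<close> depends
        on the position of \<open>ivt (ev v) p\<close>, which ping-pong places in the domain of the
        inverse of the last letter of \<open>v\<close>.\<close>
      have bnd: "bp \<zeta> (ivt (ev v \<circ> g) p) \<le> r0" if z: "\<zeta> \<in> K" "\<zeta> \<in> Bd" for \<zeta>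
      proof -
        define y where "y = ivt (ev v) p"
        have iv: "ivt (ev v \<circ> g) p = ivt g y" unfolding y_def using ivt_comp[OF G_isom[OF v(3)] ig] by simp
        have zD: "\<zeta> \<in> D" using z(1) KD by blast
        have outs: "bp \<zeta> (ivt g y) \<le> r0" if "Inl y \<notin> Shd g"
          using fam_outside[OF fg subsetD[OF DD zD] that] by (simp add: r0_def)
        show ?thesis unfolding iv
        proof (cases "v = []")
          case True
          then have "y = p" by (simp add: y_def ev_Nil)
          then have "Inl y \<notin> Shd g" using sg by (simp add: Shd_def Sh_def)
          then show "bp \<zeta> (ivt g y) \<le> r0" by (rule outs)
        next
          case False
          define l where "l = last v"
          have "fst l \<in> fst ` set v" unfolding l_def by (rule imageI) (use False in simp)
          then have lG: "fst l \<in> G \<union> G'" using v(1) unfolding words_def by blast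
          have lx: "x \<noteq> linv l" using reduced_snoc_neq[of v x] False v(2) by (simp add: words_def l_def)
          have hd: "fst (hd v) \<in> G \<union> G'" using False v(1) by (cases v) (auto simp: words_def)
          have "act (ivt (ev v)) (Inl p) \<in> Dom (linv (last v))"
            by (rule ev_ivt_Dom[OF cf v(1) False]) (use confD(4)[OF cf hd] in auto)
          then have yD: "Inl y \<in> Dom (linv l)" by (simp add: y_def l_def)
          show "bp \<zeta> (ivt g y) \<le> r0"
          proof (cases "fst l = g")
            case True
            \<comment> \<open>For the same conjugating element reducedness leaves only the same
              sign, so the point is pulled back into the domain opposite to \<open>D\<close>, and
              the separation of \<open>Dp\<close> and \<open>Dm\<close> gives the bound.\<close>
            have "snd l = snd x" using lx True by (cases l, cases x) (auto simp: g_def)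
            then have ll: "linv l = linv x" using True by (simp add: g_def)
            have "Inl y \<in> act g ` (if snd x then Dm else Dp)"
              using yD unfolding ll Dom_def g_def by (cases "snd x") simp_all
            then have "act (ivt g) (Inl y) \<in> (if snd x then Dm else Dp)" using ig by (auto simp del: act_Inl)
            then have iy: "Inl (ivt g y) \<in> (if snd x then Dm else Dp)" by simp
            have "bp \<zeta> (ivt g y) \<le> s"
            proof (rule mp[OF spec[OF bspec[OF s z(2)]]])
              show "\<zeta> \<in> Dp \<and> Inl (ivt g y) \<in> Dm \<or> \<zeta> \<in> Dm \<and> Inl (ivt g y) \<in> Dp"
                using zD iy unfolding D_def by (cases "snd x") simp_all
            qed
            then show ?thesis by (simp add: r0_def)
          next
            case ne: False
            have "Inl y \<notin> Shd g"
            proof (cases "fst l \<in> G'")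
              case True
              have "fam (fst (linv l))" using new[OF True] by simp
              then have "Inl y \<in> Shd (fst l)" using Dom_Shd[of "linv l"] yD by auto
              then show ?thesis using dj[OF gG'(1) True] ne by blast
            next
              case False
              then have "fst (linv l) \<in> G" using lG by simp
              then have "Inl y \<notin> FD G" using yD unfolding FD_def by blast
              then show ?thesis using ng by blast
            qed
            then show ?thesis by (rule outs)
          qed
        qed
      qed
      have vg: "ev v \<circ> g \<in> \<Gamma>" by (rule G_comp[OF v(3) gG'(2)])
      have Xe: "X q = act (ev v \<circ> g) ` K" unfolding X_def v_def[symmetric] x_def[symmetric] gK act_comp_image ..
      have Ye: "Y q = act (ev v \<circ> g) ` A" unfolding Y_def v_def[symmetric] x_def[symmetric] g_def[symmetric] act_comp_image ..
      define l where "l = len (ev v \<circ> g)"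
      have "measure \<nu> (X q) \<le> exp (om * (2 * r0 + 70 * \<delta> - l)) * measure \<nu> K"
        unfolding Xe l_def by (rule nu_act_upper[OF vg Ks bnd])
      also have "\<dots> \<le> exp (om * (2 * r0 + 70 * \<delta> - l)) * (exp (om * (len k + 74 * \<delta>)) * exp (om * (2 * r + 70 * \<delta> - len g)))"
        by (intro mult_left_mono order_trans[OF Km] mult_left_mono Hm) auto
      also have "\<dots> = exp (om * (2 * r0 + 70 * \<delta> + 74 * \<delta> + len k + 74 * \<delta> + 70 * \<delta>)) * exp (om * (2 * r - len g)) * exp (- (om * (l + 74 * \<delta>)))"
        unfolding exp_add[symmetric] by (simp add: algebra_simps)
      also have "\<dots> = C * exp (om * (2 * r - len g)) * (exp (- (om * (l + 74 * \<delta>))) * measure \<nu> A)"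
        unfolding C_def using A_pos by simp
      also have "\<dots> \<le> C * exp (om * (2 * r - L)) * measure \<nu> (Y q)"
      proof (intro mult_mono)
        show "exp (- (om * (l + 74 * \<delta>))) * measure \<nu> A \<le> measure \<nu> (Y q)"
          unfolding Ye l_def by (rule nu_act_lower[OF vg sets_Z(3)])
        show "exp (om * (2 * r - len g)) \<le> exp (om * (2 * r - L))" using om_pos Lg by simp
      qed (use Cpos in auto)
      finally show ?thesis .
    qed
    have AFD: "act g ` A \<subseteq> FD (G \<union> G')" if g: "g \<in> G'" for g
    proof
      fix \<zeta> assume z: "\<zeta> \<in> act g ` A"
      have fg: "fam g" and sh: "Shd g \<subseteq> FD G - Dp" using new[OF g] by auto
      have ig: "isometry g" using famD(2)[OF fg] .
      have zS: "\<zeta> \<in> Shd g" using A_Shd[OF fg] z by blast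
      have zF: "\<zeta> \<in> FD G" using zS sh by blast
      have "\<zeta> \<notin> Dom x" if x: "fst x \<in> G \<union> G'" for x
      proof (cases "fst x = g")
        case True
        have "inj (act g)" by (rule act_inj[OF ig])
        then have "act g ` A \<inter> act g ` Dp = {}" "act g ` A \<inter> act g ` Dm = {}"
          using image_Int[of "act g" A] ADp ADm by auto
        then show ?thesis using z unfolding Dom_def True by auto
      next
        case ne: False
        show ?thesis
        proof (cases "fst x \<in> G'")
          case True
          have "fam (fst x)" using new[OF True] by simp
          then have "Dom x \<subseteq> Shd (fst x)" by (rule Dom_Shd)
          then show ?thesis using dj[OF g True] ne zS by blast
        next
          case False
          then have "fst x \<in> G" using x by blast
          then show ?thesis using zF unfolding FD_def by blast
        qed
      qed
      then show "\<zeta> \<in> FD (G \<union> G')" using zF FD_Z unfolding FD_def by blast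
    qed
    have fin: "measure \<nu> (\<Union>q\<in>J. X q) \<le> 2 * C * exp (om * (2 * r - L))" if J: "finite J" "J \<subseteq> I" for J
    proof -
      \<comment> \<open>\<open>Y\<close> ignores the sign of the letter, so the comparison sets are
        disjoint only among letters of equal sign; this doubles the constant.\<close>
      define Js where "Js b = {q \<in> J. snd (snd q) = b}" for b
      have one: "(\<Sum>q\<in>Js b. measure \<nu> (Y q)) \<le> 1" for b
      proof -
        have "(\<Sum>q\<in>Js b. measure \<nu> (Y q)) \<le> measure \<nu> Z"
        proof (rule disjoint_sum_le)
          show "finite (Js b)" using J by (simp add: Js_def)
          show "Y q \<in> sets \<nu>" if "q \<in> Js b" for q using that J by (intro Ys) (auto simp: Js_def)
          show "Y q \<subseteq> Z" if "q \<in> Js b" for q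
            using sets.sets_into_space[OF Ys, of q] that J by (auto simp: Js_def)
          fix q q' assume q: "q \<in> Js b" "q' \<in> Js b" "q \<noteq> q'"
          have qI: "q \<in> I" "q' \<in> I" using q J by (auto simp: Js_def)
          show "Y q \<inter> Y q' = {}"
          proof (rule ccontr)
            assume "Y q \<inter> Y q' \<noteq> {}"
            then obtain \<zeta> \<xi> where w: "\<zeta> \<in> act (fst (snd q)) ` A" "\<xi> \<in> act (fst (snd q')) ` A"
              "act (ev (fst q)) \<zeta> = act (ev (fst q')) \<xi>" unfolding Y_def by blast
            have f: "fst q = fst q'"
              by (rule ev_FD_disjoint[OF cf ID(3)[OF qI(1)] ID(3)[OF qI(2)] _ _ w(3)])
                (use w(1,2) AFD[OF ID(2)[OF qI(1)]] AFD[OF ID(2)[OF qI(2)]] in blast)+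
            have "\<zeta> = \<xi>" using w(3) act_inj[OF G_isom[OF ID(5)[OF qI(2)]]] unfolding f by (rule injD[rotated])
            then have "\<zeta> \<in> Shd (fst (snd q)) \<inter> Shd (fst (snd q'))"
              using w(1,2) A_Shd new[OF ID(2)[OF qI(1)]] new[OF ID(2)[OF qI(2)]] by blast
            then have "fst (snd q) = fst (snd q')" using dj[OF ID(2)[OF qI(1)] ID(2)[OF qI(2)]] by blast
            then have "q = q'" using f q(1,2) by (auto simp: Js_def prod_eq_iff)
            then show False using q(3) by contradiction
          qed
        qed (use sets_Z in simp)
        then show ?thesis using nu_Z by simp
      qed
      have "measure \<nu> (\<Union>q\<in>J. X q) \<le> (\<Sum>q\<in>J. measure \<nu> (X q))"
        using J Xs by (intro finite_measure_subadditive_finite) auto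
      also have "\<dots> \<le> (\<Sum>q\<in>J. C * exp (om * (2 * r - L)) * measure \<nu> (Y q))"
        using J XY by (intro sum_mono) blast
      also have "\<dots> = C * exp (om * (2 * r - L)) * (\<Sum>q\<in>J. measure \<nu> (Y q))" by (simp add: sum_distrib_left)
      also have "(\<Sum>q\<in>J. measure \<nu> (Y q)) = (\<Sum>q\<in>Js True. measure \<nu> (Y q)) + (\<Sum>q\<in>Js False. measure \<nu> (Y q))"
      proof -
        have "J = Js True \<union> Js False" "Js True \<inter> Js False = {}" "finite (Js b)" for b
          using J(1) by (auto simp: Js_def)
        then show ?thesis using sum.union_disjoint[of "Js True" "Js False"] by simp
      qed
      also have "C * exp (om * (2 * r - L)) * \<dots> \<le> C * exp (om * (2 * r - L)) * 2"
        using one[of True] one[of False] Cpos by (intro mult_left_mono) auto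
      finally show ?thesis by (simp add: mult.assoc mult.commute)
    qed
    have cI: "countable I"
    proof -
      have "countable \<Gamma>" by (rule countable_G)
      then have c: "countable (\<Gamma> \<times> (UNIV :: bool set))" by (rule countable_SIGMA) simp
      have "I \<subseteq> lists (\<Gamma> \<times> UNIV) \<times> (\<Gamma> \<times> UNIV)"
      proof
        fix q assume q: "q \<in> I"
        have "y \<in> \<Gamma> \<times> UNIV" if "y \<in> set (fst q)" for y
        proof -
          have "fst y \<in> fst ` set (fst q)" using that by (rule imageI)
          then have "fst y \<in> G \<union> G'" using ID(3)[OF q] unfolding words_def by blast
          then show ?thesis using GG by (auto simp: mem_Times_iff)
        qed
        then have "fst q \<in> lists (\<Gamma> \<times> UNIV)" by (intro in_listsI ballI)
        moreover have "snd q \<in> \<Gamma> \<times> UNIV" using ID(4)[OF q] by (simp add: mem_Times_iff)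
        ultimately show "q \<in> lists (\<Gamma> \<times> UNIV) \<times> (\<Gamma> \<times> UNIV)" by (simp add: mem_Times_iff)
      qed
      moreover have "countable (lists (\<Gamma> \<times> (UNIV :: bool set)) \<times> (\<Gamma> \<times> (UNIV :: bool set)))"
        by (intro countable_SIGMA countable_lists c)
      ultimately show ?thesis by (rule countable_subset)
    qed
    have "measure \<nu> (HU (G \<union> G')) \<le> measure \<nu> (HU G \<union> (\<Union>q\<in>I. X q))"
      using HU_decompose[of G G'] unfolding I_def[symmetric] X_def[symmetric]
      by (rule nu_mono) (intro sets.Un HU_sets Gsub sets.countable_UN'' cI Xs)
    also have "\<dots> \<le> measure \<nu> (HU G) + measure \<nu> (\<Union>q\<in>I. X q)"
      by (intro measure_Un_le HU_sets Gsub sets.countable_UN'' cI Xs)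
    also have "measure \<nu> (\<Union>q\<in>I. X q) \<le> 2 * C * exp (om * (2 * r - L))"
      by (rule measure_UN_le_finite[OF cI Xs fin])
    finally show ?thesis by simp
  qed
  show ?thesis
  proof (rule exI[of _ "2 * C"], intro conjI allI impI)
    show "0 < 2 * C" using Cpos by simp
    fix G G' r L
    assume h: "conf (G \<union> G') \<and> (\<forall>g\<in>G'. fam g \<and> L \<le> len g \<and> \<sigma> < len g \<and> Shd g \<subseteq> FD G - Dp \<and> Sh (g p) r \<subseteq> FD G - Dp) \<and>
     (\<forall>g\<in>G'. \<forall>g'\<in>G'. g \<noteq> g' \<longrightarrow> Shd g \<inter> Shd g' = {})"
    show "measure \<nu> (HU (G \<union> G')) \<le> measure \<nu> (HU G) + 2 * C * exp (om * (2 * r - L))"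
    proof (rule main)
      show "conf (G \<union> G')" using h by (rule conjunct1)
      show "fam g \<and> L \<le> len g \<and> \<sigma> < len g \<and> Shd g \<subseteq> FD G - Dp \<and> Sh (g p) r \<subseteq> FD G - Dp" if "g \<in> G'" for g
        by (rule bspec[OF conjunct1[OF conjunct2[OF h]] that])
      show "Shd g \<inter> Shd g' = {}" if "g \<in> G'" "g' \<in> G'" "g \<noteq> g'" for g g'
        by (rule mp[OF bspec[OF bspec[OF conjunct2[OF conjunct2[OF h]] that(1)] that(2)] that(3)])
    qed
  qed
qed

end

section \<open>One stage: selecting new generators\<close>

context pingpong
begin

text \<open>By \<open>ae_cover\<close> the translates of \<open>FD G\<close> fill \<open>B\<close>
  up to a null set. Finitely many carry more than three quarters of its measure, and closed subsets
  lose at most another quarter. Leaving out the translates of \<open>N\<close> makes every remaining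
  point, pulled back by its \<open>h\<close>, approachable by aligned conical elements.\<close>

lemma exhaust:
  assumes "conf G" "finite G" "B \<in> sets \<nu>" "B \<subseteq> Bd" "0 < measure \<nu> B"
  shows "\<exists>\<Phi> C. finite \<Phi> \<and> \<Phi> \<subseteq> HG G \<and>
    (\<forall>h\<in>\<Phi>. closedin T (C h) \<and> C h \<subseteq> B \<inter> act h ` FD G - act h ` N) \<and> measure \<nu> B / 2 < measure \<nu> (\<Union>h\<in>\<Phi>. C h)"
proof -
  have G: "G \<subseteq> \<Gamma>" using assms(1) by (rule confD)
  define E where "E h = B \<inter> act h ` FD G - act h ` N" for h
  have FDs: "FD G \<in> sets \<nu>" by (rule open_sets[OF FD_open[OF assms(2) G]])
  have Ns: "N \<in> sets \<nu>" using N_null by blast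
  have Es: "E h \<in> sets \<nu>" if "h \<in> HG G" for h
    unfolding E_def by (intro sets.Diff sets.Int assms(3) act_HG_sets[OF G that] FDs Ns)
  define M where "M = (Z - (\<Union>h\<in>HG G. act h ` FD G)) \<union> (\<Union>h\<in>HG G. act h ` N)"
  have M: "M \<in> null_sets \<nu>" unfolding M_def
    by (intro null_sets.Un ae_cover assms(1,2) null_sets_UN' HG_countable G nu_act_null N_null) (use HG_G[OF G] in blast)
  have sub: "B \<subseteq> (\<Union>h\<in>HG G. E h) \<union> M"
  proof
    fix \<zeta> assume z: "\<zeta> \<in> B"
    then have "\<zeta> \<in> Z" using assms(4) Bd_in_Z by blast
    then show "\<zeta> \<in> (\<Union>h\<in>HG G. E h) \<union> M" using z unfolding E_def M_def by blast
  qed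
  have EUs: "(\<Union>h\<in>HG G. E h) \<in> sets \<nu>" by (intro sets.countable_UN'' HG_countable G Es)
  have "measure \<nu> B \<le> measure \<nu> ((\<Union>h\<in>HG G. E h) \<union> M)" using sub M EUs by (intro nu_mono) auto
  also have "\<dots> = measure \<nu> (\<Union>h\<in>HG G. E h)" using EUs M by (rule measure_Un_null_set)
  finally have big: "measure \<nu> B \<le> measure \<nu> (\<Union>h\<in>HG G. E h)" .
  have "\<exists>\<Phi>. finite \<Phi> \<and> \<Phi> \<subseteq> HG G \<and> 3 / 4 * measure \<nu> B < measure \<nu> (\<Union>h\<in>\<Phi>. E h)"
  proof (rule ccontr)
    assume no: "\<not> ?thesis"
    have "measure \<nu> (\<Union>h\<in>HG G. E h) \<le> 3 / 4 * measure \<nu> B"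
    proof (rule measure_UN_le_finite[OF HG_countable[OF G] Es])
      fix J assume "finite J" "J \<subseteq> HG G"
      then show "measure \<nu> (\<Union>h\<in>J. E h) \<le> 3 / 4 * measure \<nu> B" using no by (meson not_less)
    qed
    then show False using big assms(5) by linarith
  qed
  then obtain \<Phi> where Phi: "finite \<Phi>" "\<Phi> \<subseteq> HG G" "3 / 4 * measure \<nu> B < measure \<nu> (\<Union>h\<in>\<Phi>. E h)" by blast
  define e where "e = measure \<nu> B / (4 * (real (card \<Phi>) + 1))"
  have e: "0 < e" "real (card \<Phi>) * e \<le> measure \<nu> B / 4"
    using assms(5) by (auto simp: e_def field_simps)
  have "\<forall>h\<in>\<Phi>. \<exists>C. closedin T C \<and> C \<subseteq> E h \<and> C \<subseteq> Bd \<and> measure \<nu> (E h) - e < measure \<nu> C"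
  proof
    fix h assume "h \<in> \<Phi>"
    then have "E h \<in> sets \<nu>" using Phi(2) by (intro Es) blast
    then show "\<exists>C. closedin T C \<and> C \<subseteq> E h \<and> C \<subseteq> Bd \<and> measure \<nu> (E h) - e < measure \<nu> C"
      using e(1) by (rule inner_regular)
  qed
  from bchoice[OF this] obtain C where
    C: "\<forall>h\<in>\<Phi>. closedin T (C h) \<and> C h \<subseteq> E h \<and> C h \<subseteq> Bd \<and> measure \<nu> (E h) - e < measure \<nu> (C h)" ..
  have Ch: "closedin T (C h)" "C h \<subseteq> E h" "measure \<nu> (E h) - e < measure \<nu> (C h)" "C h \<in> sets \<nu>" "E h \<in> sets \<nu>" if "h \<in> \<Phi>" for h
    using bspec[OF C that] closed_sets Es[OF subsetD[OF Phi(2) that]] by auto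
  have "measure \<nu> (\<Union>h\<in>\<Phi>. E h) \<le> measure \<nu> ((\<Union>h\<in>\<Phi>. C h) \<union> (\<Union>h\<in>\<Phi>. E h - C h))"
    by (rule nu_mono) (blast, intro sets.Un sets.finite_UN Phi(1) Ch sets.Diff, assumption+)
  also have "\<dots> \<le> measure \<nu> (\<Union>h\<in>\<Phi>. C h) + measure \<nu> (\<Union>h\<in>\<Phi>. E h - C h)"
    by (intro measure_Un_le sets.finite_UN Phi(1) Ch sets.Diff) assumption+
  also have "measure \<nu> (\<Union>h\<in>\<Phi>. E h - C h) \<le> (\<Sum>h\<in>\<Phi>. measure \<nu> (E h - C h))"
    using Ch by (intro finite_measure_subadditive_finite Phi(1) image_subsetI sets.Diff) auto
  also have "\<dots> \<le> (\<Sum>h\<in>\<Phi>. e)"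
  proof (rule sum_mono)
    fix h assume h: "h \<in> \<Phi>"
    have "measure \<nu> (E h - C h) = measure \<nu> (E h) - measure \<nu> (C h)"
      by (rule finite_measure_Diff[OF Ch(5)[OF h] Ch(4)[OF h] Ch(2)[OF h]])
    then show "measure \<nu> (E h - C h) \<le> e" using Ch(3)[OF h] by linarith
  qed
  finally have "measure \<nu> B / 2 < measure \<nu> (\<Union>h\<in>\<Phi>. C h)" using Phi(3) e(2) by simp
  moreover have "\<forall>h\<in>\<Phi>. closedin T (C h) \<and> C h \<subseteq> B \<inter> act h ` FD G - act h ` N"
    using Ch(1,2) unfolding E_def by blast
  ultimately show ?thesis using Phi(1,2) by blast
qed

lemma finite_shadow_cover:
  assumes "closedin T K" "K \<subseteq> Bd - N"
  shows "\<exists>Q. finite Q \<and> K \<subseteq> (\<Union>g\<in>Q. Shd g) \<and> (\<forall>g\<in>Q. fam g \<and> L \<le> len g \<and> (\<exists>\<xi>\<in>K. len g - \<rho> \<le> bp \<xi> (g p)))"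
proof -
  define I where "I = {g. fam g \<and> L \<le> len g \<and> (\<exists>\<xi>\<in>K. len g - \<rho> \<le> bp \<xi> (g p))}"
  define O' where "O' g = T interior_of Shd g" for g
  have "compactin T K" using assms(1) compact_T closedin_compact_space by blast
  moreover have "\<forall>U\<in>O' ` I. openin T U" unfolding O'_def by auto
  moreover have "K \<subseteq> \<Union>(O' ` I)"
  proof
    fix \<xi> assume xi: "\<xi> \<in> K"
    then have "\<xi> \<in> Bd - N" using assms(2) by blast
    from family[OF this, of L] obtain g where g: "g \<in> \<Gamma>" "L \<le> len g" "len g - \<rho> \<le> bp \<xi> (g p)"
      "\<forall>\<zeta>\<in>Dp \<union> Dm \<union> A. bp \<zeta> (ivt g p) \<le> R" by blast
    have "g \<in> I" unfolding I_def fam_def using g xi by blast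
    moreover have "\<xi> \<in> O' g" unfolding O'_def Shd_def
      by (rule Sh_interior) (use \<open>\<xi> \<in> Bd - N\<close> Bd_in_Z g(3) sigma_ge(3) delta_pos in auto)
    ultimately show "\<xi> \<in> \<Union>(O' ` I)" by blast
  qed
  ultimately have "\<exists>\<F>. finite \<F> \<and> \<F> \<subseteq> O' ` I \<and> K \<subseteq> \<Union>\<F>" unfolding compactin_def by simp
  then obtain \<F> where F: "finite \<F>" "\<F> \<subseteq> O' ` I" "K \<subseteq> \<Union>\<F>" by blast
  obtain Q where Q: "Q \<subseteq> I" "finite Q" "\<F> = O' ` Q" using finite_subset_image[OF F(1,2)] by blast
  have "O' g \<subseteq> Shd g" for g unfolding O'_def by (rule interior_of_subset)
  then have "K \<subseteq> (\<Union>g\<in>Q. Shd g)" using F(3) unfolding Q(3) by blast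
  then show ?thesis using Q(1,2) unfolding I_def by blast
qed

lemma conf_extend:
  assumes "conf G"
    and new: "\<And>g. g \<in> G' \<Longrightarrow> fam g \<and> \<sigma> < len g \<and> Shd g \<subseteq> FD G - Dp"
    and dj: "\<And>g g'. g \<in> G' \<Longrightarrow> g' \<in> G' \<Longrightarrow> g \<noteq> g' \<Longrightarrow> Shd g \<inter> Shd g' = {}"
  shows "conf (G \<union> G')" "G' \<inter> G = {}"
proof -
  have DS: "Dom x \<subseteq> Shd (fst x)" "Shd (fst x) \<subseteq> FD G - Dp" "\<sigma> < len (fst x)" if "fst x \<in> G'" for x
  proof -
    have "fam (fst x) \<and> \<sigma> < len (fst x) \<and> Shd (fst x) \<subseteq> FD G - Dp" by (rule new[OF that])
    then show "Dom x \<subseteq> Shd (fst x)" "Shd (fst x) \<subseteq> FD G - Dp" "\<sigma> < len (fst x)" using Dom_Shd by auto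
  qed
  have old: "Dom x \<inter> FD G = {}" if "fst x \<in> G" for x using that unfolding FD_def by blast
  show "G' \<inter> G = {}"
  proof (rule ccontr)
    assume "G' \<inter> G \<noteq> {}"
    then obtain g where g: "fst (g, True) \<in> G'" "fst (g, True) \<in> G" by auto
    have "Dom (g, True) = {}" using DS(1,2)[OF g(1)] old[OF g(2)] by blast
    then have "Dp = {}" by (simp add: Dom_def)
    then show False using Dp_pos by simp
  qed
  show "conf (G \<union> G')"
  proof (rule confI)
    show "G \<union> G' \<subseteq> \<Gamma>" using confD(1)[OF assms(1)] new famD(1) by blast
    fix x :: "('a \<Rightarrow> 'a) \<times> bool" assume x: "fst x \<in> G \<union> G'"
    show "Dom x \<inter> Dp = {}"
    proof (cases "fst x \<in> G'")
      case True
      then show ?thesis using DS(1,2)[OF True] by blast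
    next
      case False
      then show ?thesis using x confD(3)[OF assms(1), of x] by blast
    qed
    show "Inl p \<notin> Dom x"
    proof (cases "fst x \<in> G'")
      case True
      have "Inl p \<notin> Shd (fst x)" using DS(3)[OF True] by (simp add: Shd_def Sh_def)
      then show ?thesis using DS(1)[OF True] by blast
    next
      case False
      then show ?thesis using x confD(4)[OF assms(1), of x] by blast
    qed
  next
    fix x y :: "('a \<Rightarrow> 'a) \<times> bool"
    assume x: "fst x \<in> G \<union> G'" and y: "fst y \<in> G \<union> G'" and xy: "x \<noteq> y"
    show "Dom x \<inter> Dom y = {}"
    proof (cases "fst x \<in> G'")
      case xT: True
      show ?thesis
      proof (cases "fst y \<in> G'")
        case yT: True
        show ?thesis
        proof (cases "fst x = fst y")
          case True
          then have s: "snd x \<noteq> snd y" using xy by (simp add: prod_eq_iff)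
          have "isometry (fst y)" using new[OF yT] famD(2) by blast
          then have "act (fst y) ` Dp \<inter> act (fst y) ` Dm = act (fst y) ` (Dp \<inter> Dm)"
            by (intro image_Int[symmetric] act_inj)
          then show ?thesis using s DpDm unfolding Dom_def True by (auto split: if_splits)
        next
          case False
          then show ?thesis using dj[OF xT yT False] DS(1)[OF xT] DS(1)[OF yT] by blast
        qed
      next
        case False
        then have "fst y \<in> G" using y by blast
        then show ?thesis using old[of y] DS(1,2)[OF xT] by blast
      qed
    next
      case False
      then have xG: "fst x \<in> G" using x by blast
      show ?thesis
      proof (cases "fst y \<in> G'")
        case True
        then show ?thesis using old[OF xG] DS(1,2)[OF True] by blast
      next
        case False
        then have "fst y \<in> G" using y by blast
        then show ?thesis using confD(2)[OF assms(1) xG _ xy] by blast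
      qed
    qed
  qed
qed

text \<open>Vitali covering: a disjoint family of shadows is selected greedily among the shadows covering
  the relevant part of \<open>FD G\<close>. The enlarged shadows still cover it, and \<open>act g ` A\<close> fills a definite
  proportion of the enlarged shadow of \<open>g\<close>.\<close>

lemma stage:
  assumes cf: "conf G" and fin: "finite G" and B: "B \<in> sets \<nu>" "B \<subseteq> Bd - HU G" and eps: "0 < \<epsilon>"
  shows "\<exists>G' S. finite G' \<and> G' \<inter> G = {} \<and> conf (G \<union> G') \<and> measure \<nu> (HU (G \<union> G')) \<le> measure \<nu> (HU G) + \<epsilon> \<and>
    finite S \<and> S \<subseteq> HG G \<times> G' \<and> (\<forall>q\<in>S. gain q) \<and> c0 / 4 * measure \<nu> B \<le> measure \<nu> (B \<inter> (\<Union>q\<in>S. Ast q))"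
proof (cases "measure \<nu> B = 0")
  case True
  show ?thesis by (rule exI[of _ "{}"], rule exI[of _ "{}"]) (use True cf eps in simp)
next
  case False
  have G: "G \<subseteq> \<Gamma>" using cf by (rule confD)
  have Bpos: "0 < measure \<nu> B" using False by (simp add: zero_less_measure_iff)
  have BBd: "B \<subseteq> Bd" using B(2) by blast
  obtain \<Phi> C where Phi: "finite \<Phi>" "\<Phi> \<subseteq> HG G" and
    C: "\<forall>h\<in>\<Phi>. closedin T (C h) \<and> C h \<subseteq> B \<inter> act h ` FD G - act h ` N" and
    CB: "measure \<nu> B / 2 < measure \<nu> (\<Union>h\<in>\<Phi>. C h)"
    using exhaust[OF cf fin B(1) BBd Bpos] by blast
  have hG: "h \<in> HG G" "h \<in> \<Gamma>" "isometry h" if "h \<in> \<Phi>" for h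
  proof -
    show 1: "h \<in> HG G" using Phi(2) that by (rule subsetD)
    show "h \<in> \<Gamma>" by (rule subsetD[OF HG_G[OF G] 1])
    then show "isometry h" by (rule G_isom)
  qed
  define CC where "CC = (\<Union>h\<in>\<Phi>. C h)"
  have CCB: "CC \<subseteq> B" unfolding CC_def using C by blast
  have CCs: "CC \<in> sets \<nu>" unfolding CC_def using C closed_sets by (intro sets.finite_UN Phi(1)) blast
  have CCpos: "0 < measure \<nu> CC" using CB Bpos unfolding CC_def by linarith
  define K where "K h = act (ivt h) ` C h" for h
  have CK: "C h = act h ` K h" if "h \<in> \<Phi>" for h unfolding K_def using hG(3)[OF that] by (simp add: image_image)
  have K_closed: "closedin T (K h)" if "h \<in> \<Phi>" for h
    unfolding K_def using bspec[OF C that] by (intro closedin_act isometry_ivt hG(3)[OF that]) blast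
  have K_sub: "\<xi> \<in> FD G" "\<xi> \<notin> Dp" "\<xi> \<notin> N" "\<xi> \<in> Bd" if h: "h \<in> \<Phi>" and xi: "\<xi> \<in> K h" for h \<xi>
  proof -
    have i: "inj (act h)" by (rule act_inj[OF hG(3)[OF h]])
    have z: "act h \<xi> \<in> C h" using xi CK[OF h] by blast
    then have z': "act h \<xi> \<in> B" "act h \<xi> \<in> act h ` FD G" "act h \<xi> \<notin> act h ` N" using bspec[OF C h] by blast+
    show "\<xi> \<in> FD G" using z'(2) inj_image_mem_iff[OF i] by blast
    show "\<xi> \<notin> N" using z'(3) by blast
    show "\<xi> \<notin> Dp"
    proof
      assume "\<xi> \<in> Dp"
      then have "act h \<xi> \<in> HU G" unfolding HU_def using hG(1)[OF h] by blast
      then show False using z'(1) B(2) by blast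
    qed
    have "act (ivt h) (act h \<xi>) \<in> Bd" by (rule act_Bd[OF isometry_ivt[OF hG(3)[OF h]] subsetD[OF BBd z'(1)]])
    then show "\<xi> \<in> Bd" using hG(3)[OF h] by simp
  qed
  have "0 < c0 / 2 * measure \<nu> CC" using c0_pos CCpos by simp
  \<comment> \<open>The sets \<open>Ast q\<close> constructed below lie in \<open>V\<close> and have
    total measure at least \<open>c0 * measure \<nu> CC\<close>. As \<open>V\<close> exceeds
    \<open>CC\<close> by less than half of this, at least half falls into \<open>B\<close>.\<close>
  then obtain V where V: "openin T V" "CC \<subseteq> V" "measure \<nu> V < measure \<nu> CC + c0 / 2 * measure \<nu> CC"
    using outer_regular[OF CCs] by blast
  \<comment> \<open>A shadow inside \<open>Vh h\<close> avoids the existing domains and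
    \<open>Dp\<close>, and its translate by \<open>h\<close> stays in \<open>V\<close>.\<close>
  define Vh where "Vh h = (FD G - Dp) \<inter> act (ivt h) ` V" for h
  have "\<forall>h\<in>\<Phi>. \<exists>r. \<forall>\<xi>\<in>K h \<inter> Bd. \<forall>x. r \<le> bp \<xi> x \<longrightarrow> Sh x r \<subseteq> Vh h"
  proof
    fix h assume h: "h \<in> \<Phi>"
    show "\<exists>r. \<forall>\<xi>\<in>K h \<inter> Bd. \<forall>x. r \<le> bp \<xi> x \<longrightarrow> Sh x r \<subseteq> Vh h"
    proof (rule uniform_shadow[OF K_closed[OF h]])
      show "openin T (Vh h)" unfolding Vh_def
        by (intro openin_Int openin_diff FD_open fin G Dp_closed openin_act isometry_ivt hG(3)[OF h] V(1))
      have "K h \<subseteq> act (ivt h) ` V" unfolding K_def using V(2) h unfolding CC_def by blast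
      then show "K h \<subseteq> Vh h" unfolding Vh_def using K_sub(1,2)[OF h] by blast
    qed
  qed
  from bchoice[OF this] obtain rf where rf: "\<forall>h\<in>\<Phi>. \<forall>\<xi>\<in>K h \<inter> Bd. \<forall>x. rf h \<le> bp \<xi> x \<longrightarrow> Sh x (rf h) \<subseteq> Vh h" ..
  define r where "r = Max (insert 0 (rf ` \<Phi>))"
  have r: "rf h \<le> r" if "h \<in> \<Phi>" for h unfolding r_def using Phi(1) that by (intro Max_ge) auto
  have us: "Sh x r \<subseteq> Vh h" if h: "h \<in> \<Phi>" and xi: "\<xi> \<in> K h" and b: "r \<le> bp \<xi> x" for h \<xi> x
  proof -
    have "\<xi> \<in> K h \<inter> Bd" using K_sub(4)[OF h xi] xi by blast
    from spec[OF bspec[OF bspec[OF rf h] this], of x] have "Sh x (rf h) \<subseteq> Vh h" using b r[OF h] by linarith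
    then show ?thesis using Sh_mono[OF r[OF h], of x] by (rule subset_trans[rotated])
  qed
  obtain C2 where C2: "0 < C2" and
    cost: "\<forall>G G' r L. conf (G \<union> G') \<and> (\<forall>g\<in>G'. fam g \<and> L \<le> len g \<and> \<sigma> < len g \<and> Shd g \<subseteq> FD G - Dp \<and> Sh (g p) r \<subseteq> FD G - Dp) \<and>
     (\<forall>g\<in>G'. \<forall>g'\<in>G'. g \<noteq> g' \<longrightarrow> Shd g \<inter> Shd g' = {}) \<longrightarrow>
     measure \<nu> (HU (G \<union> G')) \<le> measure \<nu> (HU G) + C2 * exp (om * (2 * r - L))"
    using HU_cost by blast
  define M where "M = Max (insert 0 ((\<lambda>h. len h) ` \<Phi>))"
  have M: "len h \<le> M" "0 \<le> M" if "h \<in> \<Phi>" for h unfolding M_def using Phi(1) that by (auto intro!: Max_ge)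
  have M0: "0 \<le> M" unfolding M_def using Phi(1) by (auto intro!: Max_ge)
  have r0: "0 \<le> r" unfolding r_def using Phi(1) by (auto intro!: Max_ge)
  \<comment> \<open>The first term makes the cost in \<open>HU_cost\<close> at most \<epsilon>, the
    second puts enlarged shadows inside \<open>Vh h\<close>, and the third meets the length
    conditions of \<open>Enl_measure\<close> and \<open>gainI\<close> for all \<open>h\<close> in
    \<Phi>.\<close>
  define L where "L = \<bar>2 * r - ln (\<epsilon> / C2) / om\<bar> + r + \<sigma> + 60 * \<delta> + M"
  have L: "2 * r - ln (\<epsilon> / C2) / om \<le> L" "r + \<sigma> + 38 * \<delta> \<le> L" "\<sigma> + 60 * \<delta> + M \<le> L"
    using sigma_ge(5) delta_pos M0 r0 unfolding L_def by linarith+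
  have Lcost: "C2 * exp (om * (2 * r - L)) \<le> \<epsilon>"
  proof -
    have "om * (2 * r - L) \<le> om * (ln (\<epsilon> / C2) / om)" using L(1) om_pos by (intro mult_left_mono) auto
    then have "om * (2 * r - L) \<le> ln (\<epsilon> / C2)" using om_pos by simp
    then have "exp (om * (2 * r - L)) \<le> exp (ln (\<epsilon> / C2))" by (simp only: exp_le_cancel_iff)
    also have "\<dots> = \<epsilon> / C2" using eps C2 by simp
    finally show ?thesis using C2 by (simp add: field_simps)
  qed
  define KK where "KK = (\<Union>h\<in>\<Phi>. K h)"
  have clKK: "closedin T KK" unfolding KK_def using K_closed Phi(1) by (intro closedin_Union) auto
  have subKK: "KK \<subseteq> Bd - N" unfolding KK_def using K_sub(3,4) by blast
  obtain Q where Q: "finite Q" "KK \<subseteq> (\<Union>g\<in>Q. Shd g)"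
    and Qf: "\<forall>g\<in>Q. fam g \<and> L \<le> len g \<and> (\<exists>\<xi>\<in>KK. len g - \<rho> \<le> bp \<xi> (g p))"
    using finite_shadow_cover[OF clKK subKK, of L] by (elim exE conjE)
  define rel where "rel g g' \<longleftrightarrow> g = g' \<or> Shd g \<inter> Shd g' \<noteq> {}" for g g'
  have rr: "rel x x" and rs: "rel x y \<Longrightarrow> rel y x" for x y unfolding rel_def by blast+
  have "\<exists>G'\<subseteq>Q. (\<forall>x\<in>G'. \<forall>y\<in>G'. x \<noteq> y \<longrightarrow> \<not> rel x y) \<and> (\<forall>x\<in>Q. \<exists>y\<in>G'. rel x y \<and> len y \<le> len x)"
    using Q(1) rr by (rule greedy_selection) (rule rs)
  then obtain G' where G': "G' \<subseteq> Q" "\<forall>x\<in>G'. \<forall>y\<in>G'. x \<noteq> y \<longrightarrow> \<not> rel x y" "\<forall>x\<in>Q. \<exists>y\<in>G'. rel x y \<and> len y \<le> len x"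
    by (elim exE conjE)
  have fG': "finite G'" using G'(1) Q(1) by (rule finite_subset)
  have dj: "Shd g \<inter> Shd g' = {}" if "g \<in> G'" "g' \<in> G'" "g \<noteq> g'" for g g'
    using mp[OF bspec[OF bspec[OF G'(2) that(1)] that(2)] that(3)] unfolding rel_def by blast
  have new: "fam g \<and> L \<le> len g \<and> \<sigma> < len g \<and> Shd g \<subseteq> FD G - Dp \<and> Sh (g p) r \<subseteq> FD G - Dp" if g: "g \<in> G'" for g
  proof -
    have gQ: "fam g" "L \<le> len g" "\<exists>\<xi>\<in>KK. len g - \<rho> \<le> bp \<xi> (g p)" using bspec[OF Qf subsetD[OF G'(1) g]] by simp_all
    then obtain h \<xi> where h: "h \<in> \<Phi>" "\<xi> \<in> K h" "len g - \<rho> \<le> bp \<xi> (g p)" unfolding KK_def by blast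
    have "r \<le> bp \<xi> (g p)" using h(3) gQ(2) L(2) sigma_ge(4) delta_pos by linarith
    then have s: "Sh (g p) r \<subseteq> Vh h" by (rule us[OF h(1,2)])
    then have s1: "Sh (g p) r \<subseteq> FD G - Dp" unfolding Vh_def by blast
    have "Shd g \<subseteq> Sh (g p) r" unfolding Shd_def by (rule Sh_mono) (use gQ(2) L(2) delta_pos in linarith)
    moreover have "\<sigma> < len g" using gQ(2) L(3) M0 delta_pos by linarith
    ultimately show ?thesis using gQ s1 by simp
  qed
  have cf': "conf (G \<union> G')" and GG': "G' \<inter> G = {}"
    using conf_extend[OF cf _ dj] new by simp_all
  have HUle: "measure \<nu> (HU (G \<union> G')) \<le> measure \<nu> (HU G) + \<epsilon>"
  proof -
    have "conf (G \<union> G') \<and> (\<forall>g\<in>G'. fam g \<and> L \<le> len g \<and> \<sigma> < len g \<and> Shd g \<subseteq> FD G - Dp \<and> Sh (g p) r \<subseteq> FD G - Dp) \<and>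
     (\<forall>g\<in>G'. \<forall>g'\<in>G'. g \<noteq> g' \<longrightarrow> Shd g \<inter> Shd g' = {})"
      by (intro conjI ballI impI cf' new dj)
    from mp[OF spec[OF spec[OF spec[OF spec[OF cost]]]] this]
    show ?thesis using Lcost by linarith
  qed
  \<comment> \<open>Pairs whose enlarged shadow misses \<open>K\<close> are dropped: for the others
    a point of \<open>K\<close> forces the whole enlarged shadow into \<open>Vh\<close>, and hence
    \<open>Ast q\<close> into \<open>V\<close>.\<close>
  define S where "S = {q \<in> \<Phi> \<times> G'. Enl (snd q) \<inter> K (fst q) \<noteq> {}}"
  have Sfin: "finite S" unfolding S_def using Phi(1) fG' by simp
  have SD: "fst q \<in> \<Phi>" "snd q \<in> G'" "Enl (snd q) \<inter> K (fst q) \<noteq> {}" if "q \<in> S" for q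
    using that by (auto simp: S_def)
  have deep: "len (fst q) + \<sigma> + 60 * \<delta> \<le> len (snd q)" "fam (snd q)" "fst q \<in> \<Gamma>" if "q \<in> S" for q
    using M(1)[OF SD(1)[OF that]] new[OF SD(2)[OF that]] L(3) hG(2)[OF SD(1)[OF that]] by auto
  have gains: "gain q" if "q \<in> S" for q using gainI[OF deep(2)[OF that] deep(3)[OF that] deep(1)[OF that]] by simp
  have EnlV: "Enl (snd q) \<subseteq> Vh (fst q)" if qS: "q \<in> S" for q
  proof -
    obtain \<xi> where xi: "\<xi> \<in> Enl (snd q)" "\<xi> \<in> K (fst q)" using SD(3)[OF qS] by blast
    have Lq: "r \<le> len (snd q) - \<sigma> - 38 * \<delta>" using new[OF SD(2)[OF qS]] L(2) by linarith
    have "len (snd q) - \<sigma> - 38 * \<delta> \<le> bp \<xi> (snd q p)" using Enl_Sh xi(1) unfolding Sh_def by blast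
    then have "r \<le> bp \<xi> (snd q p)" using Lq by linarith
    then have "Sh (snd q p) r \<subseteq> Vh (fst q)" by (rule us[OF SD(1)[OF qS] xi(2)])
    moreover have "Enl (snd q) \<subseteq> Sh (snd q p) r" using Enl_Sh Sh_mono[OF Lq] by (rule subset_trans)
    ultimately show ?thesis by (rule subset_trans[rotated])
  qed
  have AE: "Ast q \<subseteq> act (fst q) ` Shd (snd q)" if "q \<in> S" for q
    unfolding Ast_def act_comp_image using A_Shd[OF deep(2)[OF that]] by (rule image_mono)
  have As: "Ast q \<in> sets \<nu>" if "q \<in> S" for q
    unfolding Ast_def using G_isom[OF G_comp[OF deep(3)[OF that] famD(1)[OF deep(2)[OF that]]]] by (rule act_sets) (rule sets_Z)
  define X where "X = (\<Union>q\<in>S. Ast q)"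
  have Xs: "X \<in> sets \<nu>" unfolding X_def by (intro sets.finite_UN Sfin As)
  have XV: "X \<subseteq> V"
  proof
    fix \<zeta> assume "\<zeta> \<in> X"
    then obtain q where q: "q \<in> S" "\<zeta> \<in> Ast q" unfolding X_def by blast
    then obtain \<xi> where xi: "\<xi> \<in> Shd (snd q)" "\<zeta> = act (fst q) \<xi>" using AE by blast
    have "\<xi> \<in> Vh (fst q)" using xi(1) Shd_sub_Enl EnlV[OF q(1)] by blast
    then obtain v where v: "v \<in> V" "\<xi> = act (ivt (fst q)) v" unfolding Vh_def by blast
    then have "\<zeta> = v" using xi(2) hG(3)[OF SD(1)[OF q(1)]] by simp
    then show "\<zeta> \<in> V" using v(1) by simp
  qed
  have cov: "CC \<subseteq> (\<Union>q\<in>S. act (fst q) ` Enl (snd q))"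
  proof
    fix \<zeta> assume "\<zeta> \<in> CC"
    then obtain h where h: "h \<in> \<Phi>" "\<zeta> \<in> C h" unfolding CC_def by blast
    then obtain \<xi> where xi: "\<xi> \<in> K h" "\<zeta> = act h \<xi>" unfolding CK[OF h(1)] by blast
    have "\<xi> \<in> KK" using xi(1) h(1) unfolding KK_def by blast
    then obtain g0 where g0: "g0 \<in> Q" "\<xi> \<in> Shd g0" using Q(2) by blast
    from bspec[OF G'(3) g0(1)] obtain g where g: "g \<in> G'" "rel g0 g" "len g \<le> len g0" by blast
    have "\<xi> \<in> Enl g"
    proof (cases "g0 = g")
      case True
      then show ?thesis using g0(2) Shd_sub_Enl by blast
    next
      case False
      then obtain w where w: "w \<in> Shd g0" "w \<in> Shd g" using g(2) unfolding rel_def by blast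
      show ?thesis by (rule Shd_Enl[OF w g(3) g0(2)])
    qed
    then have "(h, g) \<in> S" using h(1) g(1) xi(1) unfolding S_def by auto
    moreover have "\<zeta> \<in> act (fst (h, g)) ` Enl (snd (h, g))" using \<open>\<xi> \<in> Enl g\<close> xi(2) by simp
    ultimately show "\<zeta> \<in> (\<Union>q\<in>S. act (fst q) ` Enl (snd q))" by blast
  qed
  have Es: "act (fst q) ` Enl (snd q) \<in> sets \<nu>" if "q \<in> S" for q
    using G_isom[OF deep(3)[OF that]] closed_sets[OF Enl_closed] by (rule act_sets)
  have "measure \<nu> CC \<le> measure \<nu> (\<Union>q\<in>S. act (fst q) ` Enl (snd q))"
    by (rule nu_mono[OF cov]) (intro sets.finite_UN Sfin Es)
  also have "\<dots> \<le> (\<Sum>q\<in>S. measure \<nu> (act (fst q) ` Enl (snd q)))"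
    using Es by (intro finite_measure_subadditive_finite Sfin) auto
  finally have "c0 * measure \<nu> CC \<le> c0 * (\<Sum>q\<in>S. measure \<nu> (act (fst q) ` Enl (snd q)))"
    using c0_pos by (intro mult_left_mono) auto
  also have "\<dots> \<le> (\<Sum>q\<in>S. measure \<nu> (Ast q))"
    unfolding sum_distrib_left Ast_def using Enl_measure[OF deep(2,3,1)] by (intro sum_mono) blast
  \<comment> \<open>For different \<open>h\<close> the sets are separated by the translates of
    \<open>FD G\<close>, for equal \<open>h\<close> by the disjointness of the selected shadows;
    hence the measures add up.\<close>
  also have "\<dots> \<le> measure \<nu> X"
  proof (rule disjoint_sum_le[OF Sfin As])
    fix q q' assume q: "q \<in> S" "q' \<in> S" "q \<noteq> q'"
    show "Ast q \<inter> Ast q' = {}"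
    proof (rule ccontr)
      assume "Ast q \<inter> Ast q' \<noteq> {}"
      then obtain \<zeta> where "\<zeta> \<in> Ast q" "\<zeta> \<in> Ast q'" by blast
      then have z: "\<zeta> \<in> act (fst q) ` Shd (snd q)" "\<zeta> \<in> act (fst q') ` Shd (snd q')"
        using AE[OF q(1)] AE[OF q(2)] by blast+
      have F: "Shd (snd q) \<subseteq> FD G" "Shd (snd q') \<subseteq> FD G" using new[OF SD(2)[OF q(1)]] new[OF SD(2)[OF q(2)]] by blast+
      have hh: "fst q = fst q'"
        using z image_mono[OF F(1), of "act (fst q)"] image_mono[OF F(2), of "act (fst q')"]
        by (intro HG_FD_disjoint[OF cf hG(1)[OF SD(1)[OF q(1)]] hG(1)[OF SD(1)[OF q(2)]], of \<zeta>]) blast+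
      have "act (fst q') ` Shd (snd q) \<inter> act (fst q') ` Shd (snd q') = act (fst q') ` (Shd (snd q) \<inter> Shd (snd q'))"
        by (intro image_Int[symmetric] act_inj hG(3) SD(1) q(2))
      then have "Shd (snd q) \<inter> Shd (snd q') \<noteq> {}" using z unfolding hh by blast
      then have "snd q = snd q'" using dj[OF SD(2)[OF q(1)] SD(2)[OF q(2)]] by blast
      then show False using hh q(3) by (simp add: prod_eq_iff)
    qed
  qed (use Xs X_def in auto)
  finally have XC: "c0 * measure \<nu> CC \<le> measure \<nu> X" .
  have Vs: "V \<in> sets \<nu>" using V(1) by (rule open_sets)
  have "X \<subseteq> (B \<inter> X) \<union> (V - CC)" using XV CCB by blast
  then have "measure \<nu> X \<le> measure \<nu> ((B \<inter> X) \<union> (V - CC))"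
    by (rule nu_mono) (intro sets.Un sets.Int sets.Diff B(1) Xs Vs CCs)
  also have "\<dots> \<le> measure \<nu> (B \<inter> X) + measure \<nu> (V - CC)"
    by (intro measure_Un_le sets.Int sets.Diff B(1) Xs Vs CCs)
  also have "measure \<nu> (V - CC) = measure \<nu> V - measure \<nu> CC"
    by (rule finite_measure_Diff[OF Vs CCs V(2)])
  finally have "c0 / 2 * measure \<nu> CC \<le> measure \<nu> (B \<inter> X)" using XC V(3) by linarith
  moreover have "c0 / 2 * (measure \<nu> B / 2) \<le> c0 / 2 * measure \<nu> CC"
    using CB c0_pos unfolding CC_def by (intro mult_left_mono) auto
  moreover have "c0 / 4 * measure \<nu> B = c0 / 2 * (measure \<nu> B / 2)" by simp
  ultimately have fin4: "c0 / 4 * measure \<nu> B \<le> measure \<nu> (B \<inter> X)" by linarith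
  have Ssub: "S \<subseteq> HG G \<times> G'"
  proof
    fix q assume "q \<in> S"
    then show "q \<in> HG G \<times> G'" using hG(1)[OF SD(1)] SD(2) by (simp add: mem_Times_iff)
  qed
  show ?thesis
    by (rule exI[of _ G'], rule exI[of _ S])
      (intro conjI ballI fG' GG' cf' HUle Sfin Ssub gains fin4[unfolded X_def])
qed

end

lemma reduced_successively: "reduced w \<longleftrightarrow> successively (\<lambda>x y. y \<noteq> (fst x, \<not> snd x)) w"
  by (induction w rule: reduced.induct) simp_all

context pingpong
begin

subsection \<open>The limit group\<close>

definition winv :: "(('a \<Rightarrow> 'a) \<times> bool) list \<Rightarrow> (('a \<Rightarrow> 'a) \<times> bool) list" where
  "winv w = rev (map linv w)"

lemma ev_winv: assumes "G \<subseteq> \<Gamma>" "w \<in> words G" shows "ev (winv w) = ivt (ev w)"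
  using assms(2)
proof (induction w)
  case Nil
  show ?case unfolding winv_def list.map rev.simps ev_Nil ivt_id ..
next
  case (Cons x w)
  have x: "fst x \<in> G" "w \<in> words G" using words_ConsD[OF Cons.prems] by blast+
  have xG: "fst x \<in> \<Gamma>" by (rule subsetD[OF assms(1) x(1)])
  have "winv (x # w) = winv w @ [linv x]" by (simp add: winv_def)
  then have "ev (winv (x # w)) = ivt (ev w) \<circ> lt (linv x)"
    by (simp only: ev_append ev_Cons ev_Nil comp_id Cons.IH[OF x(2)])
  then show ?case unfolding ev_Cons lt_linv[OF xG]
      ivt_comp[OF G_isom[OF lt_G[OF xG]] G_isom[OF ev_G[OF assms(1) x(2)]]] .
qed

lemma reduced_winv: "reduced w \<Longrightarrow> reduced (winv w)"
  unfolding reduced_successively winv_def successively_rev successively_map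
  by (erule successively_mono) (auto simp: prod_eq_iff)

text \<open>Excluding \<open>snd q\<close> from the generators of \<open>fst q\<close> keeps the
  middle letter of the conjugate from cancelling, so \<open>elt q\<close> has an explicit reduced
  word from which \<open>q\<close> can be recovered.\<close>

definition pairok :: "('a \<Rightarrow> 'a) set \<Rightarrow> ('a \<Rightarrow> 'a) \<times> ('a \<Rightarrow> 'a) \<Rightarrow> bool" where
  "pairok G q \<longleftrightarrow> snd q \<in> G \<and> fst q \<in> HG (G - {snd q}) \<and> gain q"

lemma pairok_mono: assumes "pairok G q" "G \<subseteq> G'" shows "pairok G' q"
  using assms HG_mono[of "G - {snd q}" "G' - {snd q}"] unfolding pairok_def by blast

lemma pairok_word:
  assumes "G \<subseteq> \<Gamma>" "pairok G q"
  shows "\<exists>u. fst q = ev u \<and> u @ (snd q, True) # winv u \<in> words G \<and> elt q = ev (u @ (snd q, True) # winv u)"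
proof -
  obtain u where u: "u \<in> words (G - {snd q})" "fst q = ev u" using assms(2) unfolding pairok_def HG_def by blast
  have uG: "u \<in> words G" using words_mono[of "G - {snd q}" G] u(1) by blast
  have e: "elt q = ev (u @ (snd q, True) # winv u)"
    unfolding elt_def ev_append ev_Cons ev_winv[OF assms(1) uG] u(2) comp_assoc ..
  have ne: "fst x \<noteq> snd q" if "x \<in> set u" for x using u(1) that unfolding words_def by blast
  have ru: "reduced u" using u(1) by (simp add: words_def)
  have rw: "reduced (winv u)" by (rule reduced_winv[OF ru])
  have "reduced (u @ (snd q, True) # winv u)"
  proof (cases "u = []")
    case True
    then show ?thesis by (simp add: winv_def)
  next
    case False
    have l: "fst (last u) \<noteq> snd q" using ne False by simp
    have w: "winv u \<noteq> []" "hd (winv u) = linv (last u)" using False by (simp_all add: winv_def hd_rev last_map)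
    show ?thesis using ru rw l w unfolding reduced_successively
      by (cases "winv u") (auto simp: successively_append_iff prod_eq_iff)
  qed
  moreover have "fst ` set (u @ (snd q, True) # winv u) \<subseteq> G"
    using uG assms(2) by (auto simp: words_def winv_def pairok_def)
  ultimately show ?thesis using e u(2) unfolding words_def by blast
qed

text \<open>An element has only one reduced word, and equal total lengths put the middle letter at
  the same place; conjugator and middle letter can then be read off.\<close>

lemma elt_inj: assumes "conf G" shows "inj_on elt {q. pairok G q}"
proof (rule inj_onI)
  fix q q' assume q: "q \<in> {q. pairok G q}" "q' \<in> {q. pairok G q}" and e: "elt q = elt q'"
  have G: "G \<subseteq> \<Gamma>" using assms by (rule confD)
  obtain u where u: "fst q = ev u" "u @ (snd q, True) # winv u \<in> words G" "elt q = ev (u @ (snd q, True) # winv u)"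
    using pairok_word[OF G] q(1) by blast
  obtain v where v: "fst q' = ev v" "v @ (snd q', True) # winv v \<in> words G" "elt q' = ev (v @ (snd q', True) # winv v)"
    using pairok_word[OF G] q(2) by blast
  have eq: "u @ (snd q, True) # winv u = v @ (snd q', True) # winv v"
    by (rule inj_onD[OF ev_inj[OF assms] _ u(2) v(2)]) (use e u(3) v(3) in simp)
  then have "length (u @ (snd q, True) # winv u) = length (v @ (snd q', True) # winv v)" by simp
  then have "length u = length v" by (simp add: winv_def)
  then have "u = v \<and> (snd q, True) # winv u = (snd q', True) # winv v" using eq by (simp add: append_eq_append_conv)
  then show "q = q'" using u(1) v(1) by (simp add: prod_eq_iff)
qed

lemma elt_HG: assumes "G \<subseteq> \<Gamma>" "pairok G q" shows "elt q \<in> HG G"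
  using pairok_word[OF assms] unfolding HG_def by blast

lemma HU_mono: "G \<subseteq> G' \<Longrightarrow> HU G \<subseteq> HU G'"
  unfolding HU_def using HG_mono[of G G'] by (intro UN_mono) auto

lemma Ast_sets: assumes "G \<subseteq> \<Gamma>" "pairok G q" shows "Ast q \<in> sets \<nu>"
proof -
  have "fst q \<in> HG (G - {snd q})" "snd q \<in> G" using assms(2) unfolding pairok_def by blast+
  then have "fst q \<in> \<Gamma>" "snd q \<in> \<Gamma>" using HG_G[of "G - {snd q}"] assms(1) by blast+
  then show ?thesis unfolding Ast_def by (intro act_sets[OF G_isom[OF G_comp]] sets_Z)
qed

text \<open>Each use of \<open>stage\<close> on the part not yet caught removes a fraction
  \<open>c0 / 4\<close> of it, with the same \<open>c0\<close>, so the remainder decays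
  geometrically. Pairs found earlier remain valid, and a larger orbit of \<open>Dp\<close> only
  shrinks the remainder.\<close>

lemma stage_iterate:
  assumes "conf G" "finite G" "0 < \<epsilon>"
  shows "\<exists>G' S. finite G' \<and> G \<subseteq> G' \<and> conf G' \<and> measure \<nu> (HU G') \<le> measure \<nu> (HU G) + real n * \<epsilon> \<and>
    finite S \<and> (\<forall>q\<in>S. pairok G' q \<and> snd q \<notin> G) \<and> measure \<nu> (Bd - HU G' - (\<Union>q\<in>S. Ast q)) \<le> (1 - c0 / 4) ^ n"
proof (induction n)
  case 0
  have "measure \<nu> (Bd - HU G) \<le> measure \<nu> Z" using Bd_in_Z by (intro nu_mono sets_Z) blast
  then have "measure \<nu> (Bd - HU G - (\<Union>q\<in>{}. Ast q)) \<le> (1 - c0 / 4) ^ 0" using nu_Z by simp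
  then show ?case using assms by (intro exI[of _ G] exI[of _ "{} :: (('a \<Rightarrow> 'a) \<times> ('a \<Rightarrow> 'a)) set"]) simp
next
  case (Suc n)
  then obtain G1 S1 where 1: "finite G1" "G \<subseteq> G1" "conf G1" "measure \<nu> (HU G1) \<le> measure \<nu> (HU G) + real n * \<epsilon>"
    "finite S1" "\<forall>q\<in>S1. pairok G1 q \<and> snd q \<notin> G" "measure \<nu> (Bd - HU G1 - (\<Union>q\<in>S1. Ast q)) \<le> (1 - c0 / 4) ^ n"
    by (elim exE conjE)
  have G1: "G1 \<subseteq> \<Gamma>" using 1(3) by (rule confD)
  define B where "B = Bd - HU G1 - (\<Union>q\<in>S1. Ast q)"
  have Bs: "B \<in> sets \<nu>" unfolding B_def
    using 1(6) by (intro sets.Diff Bd_sets HU_sets G1 sets.finite_UN 1(5)) (auto intro: Ast_sets[OF G1])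
  have Bsub: "B \<subseteq> Bd - HU G1" unfolding B_def by blast
  obtain G' S where 2: "finite G'" "G' \<inter> G1 = {}" "conf (G1 \<union> G')" "measure \<nu> (HU (G1 \<union> G')) \<le> measure \<nu> (HU G1) + \<epsilon>"
    "finite S" "S \<subseteq> HG G1 \<times> G'" "\<forall>q\<in>S. gain q" "c0 / 4 * measure \<nu> B \<le> measure \<nu> (B \<inter> (\<Union>q\<in>S. Ast q))"
    using stage[OF 1(3,1) Bs Bsub assms(3)] by (elim exE conjE)
  have G2: "G1 \<union> G' \<subseteq> \<Gamma>" using 2(3) by (rule confD)
  have ok: "pairok (G1 \<union> G') q \<and> snd q \<notin> G" if q: "q \<in> S \<union> S1" for q
  proof (cases "q \<in> S1")
    case True
    then show ?thesis using bspec[OF 1(6) True] pairok_mono[of G1 q "G1 \<union> G'"] by blast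
  next
    case False
    then have qS: "q \<in> S" using q by blast
    have q2: "fst q \<in> HG G1" "snd q \<in> G'" using subsetD[OF 2(6) qS] by (auto simp: mem_Times_iff)
    have "snd q \<notin> G1" using q2(2) 2(2) by blast
    then have "G1 \<subseteq> G1 \<union> G' - {snd q}" by blast
    then have "fst q \<in> HG (G1 \<union> G' - {snd q})" using q2(1) HG_mono by blast
    then show ?thesis unfolding pairok_def using q2(2) bspec[OF 2(7) qS] \<open>snd q \<notin> G1\<close> 1(2) by blast
  qed
  have As: "(\<Union>q\<in>S. Ast q) \<in> sets \<nu>"
    by (intro sets.finite_UN 2(5) Ast_sets[OF G2]) (use ok in blast)
  have HUm: "HU G1 \<subseteq> HU (G1 \<union> G')" by (intro HU_mono) blast
  have "Bd - HU (G1 \<union> G') - (\<Union>q\<in>S \<union> S1. Ast q) \<subseteq> B - (B \<inter> (\<Union>q\<in>S. Ast q))"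
    unfolding B_def using HUm by blast
  then have "measure \<nu> (Bd - HU (G1 \<union> G') - (\<Union>q\<in>S \<union> S1. Ast q)) \<le> measure \<nu> (B - (B \<inter> (\<Union>q\<in>S. Ast q)))"
    by (rule nu_mono) (intro sets.Diff sets.Int Bs As)
  also have "\<dots> = measure \<nu> B - measure \<nu> (B \<inter> (\<Union>q\<in>S. Ast q))"
    by (intro finite_measure_Diff sets.Int Bs As) blast
  also have "\<dots> \<le> (1 - c0 / 4) * measure \<nu> B" using 2(8) by (simp add: left_diff_distrib)
  also have "\<dots> \<le> (1 - c0 / 4) * (1 - c0 / 4) ^ n"
  proof (rule mult_left_mono)
    show "measure \<nu> B \<le> (1 - c0 / 4) ^ n" unfolding B_def by (rule 1(7))
    have "c0 \<le> 1 * 1" unfolding c0_def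
    proof (rule mult_mono)
      have "0 \<le> \<sigma>" using sigma_ge(5) by simp
      then show "exp (- (om * (2 * (\<sigma> + 52 * \<delta>) + 144 * \<delta>))) \<le> 1" using om_pos delta_pos by simp
      show "measure \<nu> A \<le> 1" using nu_mono[OF sets_Z(6,7)] nu_Z by simp
    qed auto
    then show "0 \<le> 1 - c0 / 4" by simp
  qed
  finally have fin: "measure \<nu> (Bd - HU (G1 \<union> G') - (\<Union>q\<in>S \<union> S1. Ast q)) \<le> (1 - c0 / 4) ^ Suc n" by simp
  have cost: "measure \<nu> (HU (G1 \<union> G')) \<le> measure \<nu> (HU G) + real (Suc n) * \<epsilon>"
    using 1(4) 2(4) by (simp add: algebra_simps)
  have oks: "\<forall>q\<in>S \<union> S1. pairok (G1 \<union> G') q \<and> snd q \<notin> G" using ok by (rule ballI)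
  have fins: "finite (G1 \<union> G')" "G \<subseteq> G1 \<union> G'" "finite (S \<union> S1)" using 1(1,2,5) 2(1,5) by auto
  show ?case
    by (rule exI[of _ "G1 \<union> G'"], rule exI[of _ "S \<union> S1"]) (intro conjI fins fin cost 2(3) oks)
qed

lemma big_stage:
  assumes "conf G" "finite G" "0 < \<epsilon>"
  shows "\<exists>G' S. finite G' \<and> G \<subseteq> G' \<and> conf G' \<and> measure \<nu> (HU G') \<le> measure \<nu> (HU G) + \<epsilon> \<and>
    finite S \<and> (\<forall>q\<in>S. pairok G' q \<and> snd q \<notin> G) \<and> measure \<nu> (Bd - HU G' - (\<Union>q\<in>S. Ast q)) \<le> \<epsilon>"
proof -
  have "1 - c0 / 4 < 1" using c0_pos by simp
  then obtain n where n: "(1 - c0 / 4) ^ n < \<epsilon>" using real_arch_pow_inv[OF assms(3)] by blast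
  define e where "e = \<epsilon> / (real n + 1)"
  have e: "0 < e" "real n * e \<le> \<epsilon>" using assms(3) by (auto simp: e_def field_simps)
  obtain G' S where "finite G'" "G \<subseteq> G'" "conf G'" and 1: "measure \<nu> (HU G') \<le> measure \<nu> (HU G) + real n * e" and
    "finite S" "\<forall>q\<in>S. pairok G' q \<and> snd q \<notin> G" and 2: "measure \<nu> (Bd - HU G' - (\<Union>q\<in>S. Ast q)) \<le> (1 - c0 / 4) ^ n"
    using stage_iterate[OF assms(1,2) e(1), of n] by (elim exE conjE)
  moreover have "measure \<nu> (HU G') \<le> measure \<nu> (HU G) + \<epsilon>" using 1 e(2) by linarith
  moreover have "measure \<nu> (Bd - HU G' - (\<Union>q\<in>S. Ast q)) \<le> \<epsilon>" using 2 n by linarith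
  ultimately show ?thesis by (intro exI[of _ G'] exI[of _ S] conjI)
qed

lemma conf_empty: "conf {}"
  by (rule confI) auto

lemma HU_empty: "HU {} = Dp"
proof -
  have "words {} = {[]}" by (auto simp: words_def)
  then show ?thesis unfolding HU_def HG_def by (simp add: ev_Nil)
qed

text \<open>The condition \<open>snd q \<notin> G n\<close> makes the sets \<open>S n\<close> of
  different stages disjoint, so that a sum over stages counts no element \<open>elt q\<close>
  twice.\<close>

lemma stages:
  assumes "\<And>n. 0 < \<epsilon> n"
  shows "\<exists>G S. G 0 = {} \<and> (\<forall>n. conf (G n) \<and> G n \<subseteq> G (Suc n) \<and> measure \<nu> (HU (G (Suc n))) \<le> measure \<nu> (HU (G n)) + \<epsilon> n \<and>
    finite (S n) \<and> (\<forall>q\<in>S n. pairok (G (Suc n)) q \<and> snd q \<notin> G n) \<and>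
    measure \<nu> (Bd - HU (G (Suc n)) - (\<Union>q\<in>S n. Ast q)) \<le> \<epsilon> n)"
proof -
  define P where "P n x \<longleftrightarrow> finite (fst x) \<and> conf (fst x) \<and> (n = 0 \<longrightarrow> fst x = {})"
    for n :: nat and x :: "('a \<Rightarrow> 'a) set \<times> (('a \<Rightarrow> 'a) \<times> ('a \<Rightarrow> 'a)) set"
  define Q where "Q n x y \<longleftrightarrow> fst x \<subseteq> fst y \<and> measure \<nu> (HU (fst y)) \<le> measure \<nu> (HU (fst x)) + \<epsilon> n \<and>
    finite (snd y) \<and> (\<forall>q\<in>snd y. pairok (fst y) q \<and> snd q \<notin> fst x) \<and>
    measure \<nu> (Bd - HU (fst y) - (\<Union>q\<in>snd y. Ast q)) \<le> \<epsilon> n"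
    for n :: nat and x y :: "('a \<Rightarrow> 'a) set \<times> (('a \<Rightarrow> 'a) \<times> ('a \<Rightarrow> 'a)) set"
  have "\<exists>f. \<forall>n. P n (f n) \<and> Q n (f n) (f (Suc n))"
  proof (rule dependent_nat_choice)
    show "\<exists>x. P 0 x" by (rule exI[of _ "({}, {})"]) (simp add: P_def conf_empty)
    fix x n assume "P n x"
    then have x: "finite (fst x)" "conf (fst x)" by (auto simp: P_def)
    obtain G' S where g: "finite G'" "fst x \<subseteq> G'" "conf G'" "measure \<nu> (HU G') \<le> measure \<nu> (HU (fst x)) + \<epsilon> n"
      "finite S" "\<forall>q\<in>S. pairok G' q \<and> snd q \<notin> fst x" "measure \<nu> (Bd - HU G' - (\<Union>q\<in>S. Ast q)) \<le> \<epsilon> n"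
      using big_stage[OF x(2,1) assms[of n]] by (elim exE conjE)
    have "P (Suc n) (G', S)" using g(1,3) by (simp add: P_def)
    moreover have "Q n x (G', S)" unfolding Q_def fst_conv snd_conv by (intro conjI g)
    ultimately show "\<exists>y. P (Suc n) y \<and> Q n x y" by blast
  qed
  then obtain f where f: "\<And>n. P n (f n)" "\<And>n. Q n (f n) (f (Suc n))" by blast
  show ?thesis
  proof (rule exI[of _ "\<lambda>n. fst (f n)"], rule exI[of _ "\<lambda>n. snd (f (Suc n))"], intro conjI allI)
    show "fst (f 0) = {}" using f(1)[of 0] by (simp add: P_def)
    fix n
    show "conf (fst (f n))" using f(1)[of n] by (simp add: P_def)
    note q = f(2)[of n, unfolded Q_def]
    show "fst (f n) \<subseteq> fst (f (Suc n))" using q by (elim conjE)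
    show "measure \<nu> (HU (fst (f (Suc n)))) \<le> measure \<nu> (HU (fst (f n))) + \<epsilon> n" using q by (elim conjE)
    show "finite (snd (f (Suc n)))" using q by (elim conjE)
    show "\<forall>q\<in>snd (f (Suc n)). pairok (fst (f (Suc n))) q \<and> snd q \<notin> fst (f n)" using q by (elim conjE)
    show "measure \<nu> (Bd - HU (fst (f (Suc n))) - (\<Union>q\<in>snd (f (Suc n)). Ast q)) \<le> \<epsilon> n" using q by (elim conjE)
  qed
qed

lemma conf_Union:
  assumes "incseq G" "\<And>n :: nat. conf (G n)" shows "conf (\<Union>n. G n)"
proof (rule confI)
  show "(\<Union>n. G n) \<subseteq> \<Gamma>" using confD(1)[OF assms(2)] by blast
  fix x :: "('a \<Rightarrow> 'a) \<times> bool" assume "fst x \<in> (\<Union>n. G n)"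
  then obtain n where n: "fst x \<in> G n" by blast
  show "Dom x \<inter> Dp = {}" "Inl p \<notin> Dom x" by (rule confD(3,4)[OF assms(2) n])+
next
  fix x y :: "('a \<Rightarrow> 'a) \<times> bool" assume xy: "fst x \<in> (\<Union>n. G n)" "fst y \<in> (\<Union>n. G n)" "x \<noteq> y"
  then obtain m n where m: "fst x \<in> G m" "fst y \<in> G n" by blast
  have "fst x \<in> G (max m n)" "fst y \<in> G (max m n)"
    using m incseqD[OF assms(1), of m "max m n"] incseqD[OF assms(1), of n "max m n"] by auto
  then show "Dom x \<inter> Dom y = {}" using xy(3) by (rule confD(2)[OF assms(2)])
qed

lemma words_Union: assumes "incseq G" shows "words (\<Union>n. G n) = (\<Union>n :: nat. words (G n))"
proof
  show "words (\<Union>n. G n) \<subseteq> (\<Union>n. words (G n))"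
  proof
    fix w assume w: "w \<in> words (\<Union>n. G n)"
    have "\<exists>n. fst ` set u \<subseteq> G n" if "fst ` set u \<subseteq> (\<Union>n. G n)" for u :: "(('a \<Rightarrow> 'a) \<times> bool) list"
      using that
    proof (induction u)
      case (Cons x u)
      then obtain m n where "fst ` set u \<subseteq> G n" "fst x \<in> G m" by auto
      then have "fst ` set (x # u) \<subseteq> G (max m n)"
        using incseqD[OF assms, of m "max m n"] incseqD[OF assms, of n "max m n"] by auto
      then show ?case by blast
    qed simp
    then obtain n where "fst ` set w \<subseteq> G n" using w unfolding words_def by blast
    then show "w \<in> (\<Union>n. words (G n))" using w unfolding words_def by blast
  qed
  show "(\<Union>n. words (G n)) \<subseteq> words (\<Union>n. G n)" using words_mono[of "G _" "\<Union>n. G n"] by blast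
qed

lemma HU_Union: "incseq G \<Longrightarrow> HU (\<Union>n. G n) = (\<Union>n :: nat. HU (G n))"
  unfolding HU_def HG_def words_Union by blast

text \<open>A wandering set \<open>W\<close> has disjoint translates under the inverses of the elements \<open>elt q\<close>. By bounded
  distortion the measures of \<open>W \<inter> Ast q\<close> are therefore summable, whereas almost every point outside
  the orbit of \<open>Dp\<close> lies in infinitely many of the sets \<open>Ast q\<close>.\<close>

lemma limit_group:
  assumes "measure \<nu> Dp < 1"
  shows "\<exists>G. conf G \<and> measure \<nu> (HU G) < 1 \<and>
    (\<forall>W\<in>sets \<nu>. W \<subseteq> Bd \<and> (\<forall>h\<in>HG G. h \<noteq> id \<longrightarrow> act h ` W \<inter> W = {}) \<longrightarrow> W - HU G \<in> null_sets \<nu>)"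
proof -
  \<comment> \<open>Half of the gap to full measure: the total growth of the orbit of
    \<open>Dp\<close> then leaves its complement with positive measure. The same summable sequence
    bounds the uncaught sets \<open>Y n\<close>.\<close>
  define e0 where "e0 = (1 - measure \<nu> Dp) / 2"
  have e0: "0 < e0" using assms by (simp add: e0_def)
  define \<epsilon> where "\<epsilon> n = e0 * (1 / 2) ^ Suc n" for n
  have eps: "0 < \<epsilon> n" for n using e0 by (simp add: \<epsilon>_def)
  have epsums: "\<epsilon> sums e0"
    using sums_mult[OF power_half_series, of e0] unfolding \<epsilon>_def by simp
  obtain G S where G0: "G 0 = {}" and
    GS: "\<forall>n. conf (G n) \<and> G n \<subseteq> G (Suc n) \<and> measure \<nu> (HU (G (Suc n))) \<le> measure \<nu> (HU (G n)) + \<epsilon> n \<and>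
    finite (S n) \<and> (\<forall>q\<in>S n. pairok (G (Suc n)) q \<and> snd q \<notin> G n) \<and>
    measure \<nu> (Bd - HU (G (Suc n)) - (\<Union>q\<in>S n. Ast q)) \<le> \<epsilon> n"
    using stages[of \<epsilon>, OF eps] by (elim exE conjE)
  note GS' = spec[OF GS]
  have cf: "conf (G n)" for n by (rule conjunct1[OF GS'])
  have Gstep: "G n \<subseteq> G (Suc n)" for n by (rule conjunct1[OF conjunct2[OF GS']])
  have HUstep: "measure \<nu> (HU (G (Suc n))) \<le> measure \<nu> (HU (G n)) + \<epsilon> n" for n
    by (rule conjunct1[OF conjunct2[OF conjunct2[OF GS']]])
  have fS: "finite (S n)" for n by (rule conjunct1[OF conjunct2[OF conjunct2[OF conjunct2[OF GS']]]])
  have Sok: "\<forall>q\<in>S n. pairok (G (Suc n)) q \<and> snd q \<notin> G n" for n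
    by (rule conjunct1[OF conjunct2[OF conjunct2[OF conjunct2[OF conjunct2[OF GS']]]]])
  have rest: "measure \<nu> (Bd - HU (G (Suc n)) - (\<Union>q\<in>S n. Ast q)) \<le> \<epsilon> n" for n
    by (rule conjunct2[OF conjunct2[OF conjunct2[OF conjunct2[OF conjunct2[OF GS']]]]])
  have inc: "incseq G" using Gstep by (rule incseq_SucI)
  define GG where "GG = (\<Union>n. G n)"
  have GGsup: "G n \<subseteq> GG" for n unfolding GG_def by blast
  have cGG: "conf GG" unfolding GG_def by (rule conf_Union[OF inc cf])
  have GGG: "GG \<subseteq> \<Gamma>" using cGG by (rule confD)
  have Gn: "G n \<subseteq> \<Gamma>" for n using cf by (rule confD)
  have HUGG: "HU GG = (\<Union>n. HU (G n))" unfolding GG_def by (rule HU_Union[OF inc])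
  have "measure \<nu> (HU (G n)) \<le> measure \<nu> Dp + (\<Sum>i<n. \<epsilon> i)" for n
  proof (induction n)
    case 0
    then show ?case unfolding G0 HU_empty by simp
  next
    case (Suc n)
    then show ?case using HUstep[of n] by simp
  qed
  moreover have "(\<Sum>i<n. \<epsilon> i) \<le> e0" for n
    using sum_le_suminf[OF sums_summable[OF epsums], of "{..<n}"] eps epsums by (simp add: sums_iff less_imp_le)
  ultimately have HUn: "measure \<nu> (HU (G n)) \<le> measure \<nu> Dp + e0" for n by (meson add_left_mono order_trans)
  have "incseq (\<lambda>n. HU (G n))" using Gstep by (intro incseq_SucI HU_mono)
  then have "(\<lambda>n. measure \<nu> (HU (G n))) \<longlonglongrightarrow> measure \<nu> (HU GG)"
    unfolding HUGG using HU_sets[OF Gn] by (intro finite_Lim_measure_incseq) auto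
  then have "measure \<nu> (HU GG) \<le> measure \<nu> Dp + e0" by (rule LIMSEQ_le_const2) (use HUn in blast)
  also have "\<dots> < 1" using assms by (simp add: e0_def field_simps)
  finally have small: "measure \<nu> (HU GG) < 1" .
  have okGG: "pairok GG q" if "q \<in> S n" for q n
  proof -
    have "pairok (G (Suc n)) q" using bspec[OF Sok that] by (rule conjunct1)
    then show ?thesis using GGsup by (rule pairok_mono)
  qed
  have Sdisj: "S m \<inter> S n = {}" if "m < n" for m n
  proof (rule ccontr)
    assume "S m \<inter> S n \<noteq> {}"
    then obtain q where q: "q \<in> S m" "q \<in> S n" by blast
    have "snd q \<in> G (Suc m)" using bspec[OF Sok q(1)] unfolding pairok_def by (elim conjE)
    moreover have "G (Suc m) \<subseteq> G n" using incseqD[OF inc, of "Suc m" n] \<open>m < n\<close> by simp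
    moreover have "snd q \<notin> G n" using bspec[OF Sok q(2)] by (rule conjunct2)
    ultimately show False by blast
  qed
  define E where "E n = (\<Union>q\<in>S n. Ast q)" for n
  have Es: "E n \<in> sets \<nu>" for n unfolding E_def by (intro sets.finite_UN fS Ast_sets[OF GGG] okGG)
  define Y where "Y n = Bd - HU (G (Suc n)) - E n" for n
  have Ys: "Y n \<in> sets \<nu>" for n unfolding Y_def by (intro sets.Diff Bd_sets HU_sets Gn Es)
  have "summable (\<lambda>n. measure \<nu> (Y n))"
    by (rule summable_comparison_test'[OF sums_summable[OF epsums], of 0]) (use rest in \<open>simp add: Y_def E_def\<close>)
  then have aeY: "AE \<zeta> in \<nu>. eventually (\<lambda>n. \<zeta> \<in> space \<nu> - Y n) sequentially"
    by (intro borel_cantelli_AE1 Ys) (auto simp: emeasure_eq_measure)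
  have c1: "0 < c1" by (simp add: c1_def)
  have cons: "W - HU GG \<in> null_sets \<nu>"
    if W: "W \<in> sets \<nu>" "W \<subseteq> Bd" and wan: "\<forall>h\<in>HG GG. h \<noteq> id \<longrightarrow> act h ` W \<inter> W = {}" for W
  proof -
    define X where "X n = W \<inter> E n" for n
    have Xs: "X n \<in> sets \<nu>" for n unfolding X_def by (intro sets.Int W Es)
    have WAs: "W \<inter> Ast q \<in> sets \<nu>" if "q \<in> S n" for q n by (intro sets.Int W Ast_sets[OF GGG] okGG[OF that])
    have bnd: "(\<Sum>n<m. measure \<nu> (X n)) \<le> 1 / c1" for m
    proof -
      define Q where "Q = (\<Union>n<m. S n)"
      have fQ: "finite Q" unfolding Q_def using fS by blast
      have Qok: "pairok GG q" "elt q \<in> HG GG" "isometry (elt q)" "W \<inter> Ast q \<in> sets \<nu>" if qQ: "q \<in> Q" for q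
      proof -
        obtain n where n: "q \<in> S n" using qQ unfolding Q_def by blast
        show 1: "pairok GG q" by (rule okGG[OF n])
        show 2: "elt q \<in> HG GG" by (rule elt_HG[OF GGG 1])
        show "isometry (elt q)" by (rule G_isom[OF subsetD[OF HG_G[OF GGG] 2]])
        show "W \<inter> Ast q \<in> sets \<nu>" by (rule WAs[OF n])
      qed
      have "(\<Sum>n<m. measure \<nu> (X n)) \<le> (\<Sum>n<m. \<Sum>q\<in>S n. measure \<nu> (W \<inter> Ast q))"
      proof (rule sum_mono)
        fix n
        have "X n = (\<Union>q\<in>S n. W \<inter> Ast q)" unfolding X_def E_def by blast
        then show "measure \<nu> (X n) \<le> (\<Sum>q\<in>S n. measure \<nu> (W \<inter> Ast q))"
          using WAs by (simp only:) (intro finite_measure_subadditive_finite fS, blast)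
      qed
      also have "\<dots> = (\<Sum>q\<in>Q. measure \<nu> (W \<inter> Ast q))"
        unfolding Q_def
      proof (rule sum.UNION_disjoint[symmetric])
        show "\<forall>i\<in>{..<m}. \<forall>j\<in>{..<m}. i \<noteq> j \<longrightarrow> S i \<inter> S j = {}"
        proof (intro ballI impI)
          fix i j :: nat assume "i \<noteq> j"
          then consider "i < j" | "j < i" by linarith
          then show "S i \<inter> S j = {}" using Sdisj[of i j] Sdisj[of j i] by cases (simp_all add: Int_commute)
        qed
      qed (use fS in simp_all)
      finally have "c1 * (\<Sum>n<m. measure \<nu> (X n)) \<le> c1 * (\<Sum>q\<in>Q. measure \<nu> (W \<inter> Ast q))"
        using c1 by (intro mult_left_mono) auto
      also have "\<dots> \<le> (\<Sum>q\<in>Q. measure \<nu> (act (ivt (elt q)) ` (W \<inter> Ast q)))"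
        unfolding sum_distrib_left
      proof (rule sum_mono)
        fix q assume q: "q \<in> Q"
        have "gain q" using Qok(1)[OF q] unfolding pairok_def by (elim conjE)
        then have "W \<inter> Ast q \<subseteq> Ast q \<longrightarrow> c1 * measure \<nu> (W \<inter> Ast q) \<le> measure \<nu> (act (ivt (elt q)) ` (W \<inter> Ast q))"
          unfolding gain_def using Qok(4)[OF q] by (rule bspec)
        then show "c1 * measure \<nu> (W \<inter> Ast q) \<le> measure \<nu> (act (ivt (elt q)) ` (W \<inter> Ast q))"
          by (rule mp) (rule Int_lower2)
      qed
      also have "\<dots> \<le> measure \<nu> Z"
      proof (rule disjoint_sum_le[OF fQ])
        fix q assume q: "q \<in> Q"
        show s: "act (ivt (elt q)) ` (W \<inter> Ast q) \<in> sets \<nu>"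
          by (rule act_sets[OF isometry_ivt[OF Qok(3)[OF q]] Qok(4)[OF q]])
        show "act (ivt (elt q)) ` (W \<inter> Ast q) \<subseteq> Z" using sets.sets_into_space[OF s] by simp
      next
        fix q q' assume q: "q \<in> Q" "q' \<in> Q" "q \<noteq> q'"
        have ne: "elt q \<noteq> elt q'"
        proof
          assume "elt q = elt q'"
          then have "q = q'" using Qok(1)[OF q(1)] Qok(1)[OF q(2)] by (intro inj_onD[OF elt_inj[OF cGG]]) auto
          then show False using q(3) by contradiction
        qed
        \<comment> \<open>If the two preimages met, this element would carry a point of
          \<open>W\<close> into \<open>W\<close>; it is nontrivial by injectivity of
          \<open>elt\<close>.\<close>
        define h where "h = elt q' \<circ> ivt (elt q)"
        have hH: "h \<in> HG GG" unfolding h_def by (rule HG_comp[OF GGG Qok(2)[OF q(2)] HG_ivt[OF GGG Qok(2)[OF q(1)]]])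
        have "h \<noteq> id"
        proof
          assume "h = id"
          then have "elt q' \<circ> ivt (elt q) \<circ> elt q = elt q" unfolding h_def by simp
          then have "elt q' = elt q" using Qok(3)[OF q(1)] by (simp add: comp_assoc)
          then show False using ne by simp
        qed
        then have dis: "act h ` W \<inter> W = {}" using bspec[OF wan hH] by blast
        show "act (ivt (elt q)) ` (W \<inter> Ast q) \<inter> act (ivt (elt q')) ` (W \<inter> Ast q') = {}"
        proof (rule ccontr)
          assume "\<not> ?thesis"
          then obtain w w' where w: "w \<in> W" "w' \<in> W" "act (ivt (elt q)) w = act (ivt (elt q')) w'" by blast
          have "act h w = act (elt q') (act (ivt (elt q')) w')" unfolding h_def act_comp w(3) ..
          then have "act h w = w'" using Qok(3)[OF q(2)] by simp
          then show False using dis w(1,2) by blast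
        qed
      qed (rule sets_Z)
      finally have "c1 * (\<Sum>n<m. measure \<nu> (X n)) \<le> 1" using nu_Z by simp
      then show ?thesis using c1 by (simp add: pos_le_divide_eq mult.commute)
    qed
    have "summable (\<lambda>n. measure \<nu> (X n))" by (rule summableI_nonneg_bounded[OF _ bnd]) simp
    then have aeX: "AE \<zeta> in \<nu>. eventually (\<lambda>n. \<zeta> \<in> space \<nu> - X n) sequentially"
      by (intro borel_cantelli_AE1 Xs) (auto simp: emeasure_eq_measure)
    \<comment> \<open>Almost every point is eventually outside both \<open>X n\<close> and
      \<open>Y n\<close>, whereas a point of \<open>W - HU GG\<close> lies in one of the two for
      every \<open>n\<close>.\<close>
    have "AE \<zeta> in \<nu>. \<zeta> \<notin> W - HU GG"
      using aeX aeY
    proof eventually_elim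
      case (elim \<zeta>)
      from eventually_conj[OF elim] obtain n where n: "\<zeta> \<notin> X n" "\<zeta> \<notin> Y n" unfolding eventually_sequentially by blast
      show ?case
      proof
        assume z: "\<zeta> \<in> W - HU GG"
        then have "\<zeta> \<in> Bd" "\<zeta> \<notin> HU (G (Suc n))" using W(2) HUGG by blast+
        then show False using n z unfolding X_def Y_def by blast
      qed
    qed
    moreover have "W - HU GG \<in> sets \<nu>" by (intro sets.Diff W HU_sets GGG)
    ultimately show ?thesis by (simp add: AE_iff_null_sets)
  qed
  show ?thesis by (rule exI[of _ GG]) (use cGG small cons in blast)
qed

end

section \<open>The normal closure of a power of a loxodromic element\<close>

context pingpong
begin

lemma HG_subgroup: assumes "G \<subseteq> \<Gamma>" shows "subgroup (HG G) isom_group"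
proof (rule subgroup.intro)
  have i: "isometry h" if "h \<in> HG G" for h by (rule G_isom[OF subsetD[OF HG_G[OF assms] that]])
  show "HG G \<subseteq> carrier isom_group" using i by (auto simp: carrier_isom_group)
  show "x \<otimes>\<^bsub>isom_group\<^esub> y \<in> HG G" if "x \<in> HG G" "y \<in> HG G" for x y
    unfolding isom_group_mult by (rule HG_comp[OF assms that])
  show "\<one>\<^bsub>isom_group\<^esub> \<in> HG G" unfolding isom_group_one by (rule HG_id)
  show "inv\<^bsub>isom_group\<^esub> x \<in> HG G" if "x \<in> HG G" for x
    unfolding isom_group_inv[OF i[OF that]] by (rule HG_ivt[OF assms that])
qed

lemma HG_normal_closure: assumes "G \<subseteq> \<Gamma>" shows "HG G \<subseteq> normal_closure (subgrp \<Gamma>) {k}"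
  unfolding normal_closure_def
proof (rule Inter_greatest)
  fix N' assume "N' \<in> {N'. N' \<lhd> subgrp \<Gamma> \<and> {k} \<subseteq> N'}"
  then have nrm: "N' \<lhd> subgrp \<Gamma>" and kN: "k \<in> N'" by auto
  have sub: "subgroup N' (subgrp \<Gamma>)" using nrm by (rule normal_imp_subgroup)
  have comp: "x \<circ> y \<in> N'" if "x \<in> N'" "y \<in> N'" for x y
    using subgroup.m_closed[OF sub that] by (simp add: isom_group_def)
  have ik: "ivt k \<in> N'" using subgroup.m_inv_closed[OF sub kN] inv_subgrp[OF kG] by simp
  have conj: "g \<circ> h \<circ> ivt g \<in> N'" if "g \<in> \<Gamma>" "h \<in> N'" for g h
    using normal.inv_op_closed2[OF nrm, of g h] that inv_subgrp[OF that(1)] by (simp add: isom_group_def)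
  have lt: "lt x \<in> N'" if "fst x \<in> \<Gamma>" for x
    unfolding lt_def by (rule conj[OF that]) (use kN ik in simp)
  have one: "\<one>\<^bsub>subgrp \<Gamma>\<^esub> = id" by (simp add: isom_group_def)
  have "ev w \<in> N'" if "w \<in> words G" for w
    using that
  proof (induction w)
    case Nil
    show ?case unfolding ev_Nil using subgroup.one_closed[OF sub] unfolding one .
  next
    case (Cons x w)
    have x: "fst x \<in> G" "w \<in> words G" using words_ConsD[OF Cons.prems] by blast+
    show ?case unfolding ev_Cons by (rule comp[OF lt[OF subsetD[OF assms x(1)]] Cons.IH[OF x(2)]])
  qed
  then show "HG G \<subseteq> N'" unfolding HG_def by blast
qed

lemma interior_Dp: "openin T (act k ` (Z - Dm))" "act k ` (Z - Dm) \<subseteq> Dp" "0 < measure \<nu> (act k ` (Z - Dm))"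
proof -
  have o: "openin T (Z - Dm)" using Dm_closed by (simp add: closedin_def)
  show op: "openin T (act k ` (Z - Dm))" by (rule openin_act[OF k_isom o])
  show "act k ` (Z - Dm) \<subseteq> Dp" by (rule k_fwd)
  have "0 < exp (- (om * (len k + 74 * \<delta>))) * measure \<nu> A" using A_pos by simp
  also have "\<dots> \<le> measure \<nu> (act k ` A)" by (rule nu_act_lower[OF kG sets_Z(3)])
  also have "\<dots> \<le> measure \<nu> (act k ` (Z - Dm))"
    by (rule nu_mono[OF _ open_sets[OF op]]) (use ADm sets_Z(6) in blast)
  finally show "0 < measure \<nu> (act k ` (Z - Dm))" .
qed

lemma conical_limit: assumes "\<xi> \<in> Bd - N" shows "\<xi> \<in> limit_set p \<Gamma>"
proof -
  have xi: "\<xi> \<in> Bd" using assms by blast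
  have "\<exists>y. y \<noteq> \<xi> \<and> y \<in> Inl ` orbit_of p \<Gamma> \<and> y \<in> U" if U: "\<xi> \<in> U" "openin T U" for U
  proof -
    obtain r where r: "\<forall>x. r \<le> bp \<xi> x \<longrightarrow> Sh x r \<subseteq> U" using open_shadow[OF U(2,1) xi] by blast
    obtain g where g: "g \<in> \<Gamma>" "\<bar>r\<bar> + \<bar>\<rho>\<bar> \<le> len g" "len g - \<rho> \<le> bp \<xi> (g p)" using family[OF assms, of "\<bar>r\<bar> + \<bar>\<rho>\<bar>"] by blast
    have "r \<le> bp \<xi> (g p)" using g(2,3) by linarith
    then have "Sh (g p) r \<subseteq> U" using r by blast
    moreover have "Inl (g p) \<in> Sh (g p) r" using g(2) by (simp add: Sh_def)
    ultimately have "Inl (g p) \<in> U" by blast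
    moreover have "Inl (g p) \<noteq> \<xi>" using xi by auto
    moreover have "Inl (g p) \<in> Inl ` orbit_of p \<Gamma>" unfolding orbit_of_def using g(1) by blast
    ultimately show ?thesis by (intro exI[of _ "Inl (g p)"] conjI)
  qed
  then have "\<xi> \<in> T derived_set_of (Inl ` orbit_of p \<Gamma>)"
    unfolding in_derived_set_of using Bd_in_Z[OF xi] by simp
  then show ?thesis unfolding limit_set_def using xi by blast
qed

text \<open>The open subset \<open>V\<close> of \<open>Dp\<close> has positive measure and therefore
  contains a conical limit point of \<Gamma>. An orbit point \<open>h p\<close> in \<open>V\<close>
  would lie in the translates of \<open>FD G\<close> by \<open>h\<close> and by the identity, so
  \<open>h\<close> would be the identity, but \<open>p\<close> is outside \<open>Dp\<close>.\<close>

lemma HG_second_kind: assumes "conf G" shows "second_kind p \<Gamma> (HG G)"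
proof -
  have G: "G \<subseteq> \<Gamma>" using assms by (rule confD)
  define V where "V = act k ` (Z - Dm)"
  have V: "openin T V" "V \<subseteq> Dp" "0 < measure \<nu> V" unfolding V_def by (rule interior_Dp)+
  have sub: "limit_set p (HG G) \<subseteq> limit_set p \<Gamma>"
    unfolding limit_set_def using derived_set_of_mono[of "Inl ` orbit_of p (HG G)" "Inl ` orbit_of p \<Gamma>" T] HG_G[OF G]
    by (auto simp: orbit_of_def)
  have "\<not> V \<inter> Bd \<subseteq> N"
  proof
    assume "V \<inter> Bd \<subseteq> N"
    then have "measure \<nu> (V \<inter> Bd) \<le> measure \<nu> N" using N_null by (intro nu_mono) auto
    also have "measure \<nu> N = 0" using N_null by (simp add: measure_def null_setsD1)
    finally show False using V(3) nu_Int_Bd[OF open_sets[OF V(1)]] by simp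
  qed
  then obtain \<xi> where xi: "\<xi> \<in> V" "\<xi> \<in> Bd - N" by blast
  have "\<xi> \<notin> limit_set p (HG G)"
  proof
    assume "\<xi> \<in> limit_set p (HG G)"
    then have "\<xi> \<in> T derived_set_of (Inl ` orbit_of p (HG G))" unfolding limit_set_def by blast
    then obtain y where "y \<in> Inl ` orbit_of p (HG G)" "y \<in> V"
      unfolding in_derived_set_of using xi(1) V(1) by blast
    then obtain h where h: "h \<in> HG G" "Inl (h p) \<in> V" unfolding orbit_of_def by blast
    have pF: "Inl p \<in> FD G" by (rule FD_p[OF assms])
    have "Inl (h p) \<in> act h ` FD G" using imageI[OF pF, of "act h"] by simp
    moreover have "Inl (h p) \<in> act id ` FD G" using h(2) V(2) FD_Dp[OF assms] by auto
    ultimately have "h = id" by (rule HG_FD_disjoint[OF assms h(1) HG_id])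
    then show False using h(2) V(2) p_Dp by auto
  qed
  then show ?thesis unfolding second_kind_def using sub conical_limit[OF xi(2)] by blast
qed

lemma Dp_less_1: "measure \<nu> Dp < 1"
proof -
  have "measure \<nu> Dp \<le> measure \<nu> (Z - A)" using ADp sets_Z by (intro nu_mono sets.Diff) auto
  also have "\<dots> = measure \<nu> Z - measure \<nu> A" using finite_measure_compl[OF sets_Z(3)] by simp
  finally show ?thesis using A_pos nu_Z by simp
qed

text \<open>A wandering set of boundary points containing \<open>Dp \<inter> Bd\<close> meets the
  orbit of \<open>Dp\<close> in \<open>Dp\<close> only, since any other translate would bring in a
  point moved from within the set itself. What it has outside the orbit is null by
  \<open>cons\<close>, which gives maximality.\<close>

lemma hopf_HG:
  assumes cf: "conf G"
    and cons: "\<And>W. W \<in> sets \<nu> \<Longrightarrow> W \<subseteq> Bd \<Longrightarrow> \<forall>h\<in>HG G. h \<noteq> id \<longrightarrow> act h ` W \<inter> W = {} \<Longrightarrow> W - HU G \<in> null_sets \<nu>"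
  shows "hopf_decomposition (subgrp (HG G)) act (restrict_space \<nu> Bd) (Bd - HU G) (HU G \<inter> Bd)"
proof -
  have G: "G \<subseteq> \<Gamma>" using cf by (rule confD)
  have iso: "isometry h" if "h \<in> HG G" for h by (rule G_isom[OF subsetD[OF HG_G[OF G] that]])
  have Bs: "Bd \<inter> space \<nu> \<in> sets \<nu>" by (intro sets.Int Bd_sets sets.top)
  have sets_mu: "E \<in> sets (restrict_space \<nu> Bd) \<longleftrightarrow> E \<subseteq> Bd \<and> E \<in> sets \<nu>" for E
    by (rule sets_restrict_space_iff[OF Bs])
  have null_mu: "E \<in> null_sets (restrict_space \<nu> Bd) \<longleftrightarrow> E \<subseteq> Bd \<and> E \<in> null_sets \<nu>" for E
    by (rule null_sets_restrict_space[OF Bd_sets])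
  have space_mu: "space (restrict_space \<nu> Bd) = Bd"
    using Bd_in_Z by (auto simp: space_restrict_space)
  define A0 where "A0 = Dp \<inter> Bd"
  have A0s: "A0 \<in> sets \<nu>" unfolding A0_def by (intro sets.Int sets_Z Bd_sets)
  have wan: "act h ` A0 \<inter> A0 = {}" if h: "h \<in> HG G" "h \<noteq> id" for h
  proof (rule ccontr)
    assume "act h ` A0 \<inter> A0 \<noteq> {}"
    then obtain \<zeta> where z: "\<zeta> \<in> act h ` A0" "\<zeta> \<in> A0" by blast
    have sF: "A0 \<subseteq> FD G" unfolding A0_def using FD_Dp[OF cf] by blast
    have "\<zeta> \<in> act h ` FD G" using z(1) sF by blast
    moreover have "\<zeta> \<in> act id ` FD G" using z(2) sF by auto
    ultimately have "h = id" by (rule HG_FD_disjoint[OF cf h(1) HG_id])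
    then show False using h(2) by contradiction
  qed
  have carrier: "carrier (subgrp (HG G)) = HG G" "\<one>\<^bsub>subgrp (HG G)\<^esub> = id" by (simp_all add: isom_group_def)
  have "wandering_set (subgrp (HG G)) act (restrict_space \<nu> Bd) A0"
    unfolding wandering_set_def carrier sets_mu using wan A0s by (auto simp: A0_def)
  moreover have "B - A0 \<in> null_sets (restrict_space \<nu> Bd)"
    if B: "wandering_set (subgrp (HG G)) act (restrict_space \<nu> Bd) B" "A0 \<subseteq> B" for B
  proof -
    have Bw: "B \<subseteq> Bd" "B \<in> sets \<nu>" "\<forall>h\<in>HG G. h \<noteq> id \<longrightarrow> act h ` B \<inter> B = {}"
      using B(1) unfolding wandering_set_def carrier sets_mu by blast+
    have "B - A0 \<subseteq> B - HU G"
    proof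
      fix \<zeta> assume z: "\<zeta> \<in> B - A0"
      have "\<zeta> \<notin> HU G"
      proof
        assume "\<zeta> \<in> HU G"
        then obtain h \<xi> where h: "h \<in> HG G" "\<xi> \<in> Dp" "\<zeta> = act h \<xi>" unfolding HU_def by blast
        have ih: "isometry h" by (rule iso[OF h(1)])
        have "act (ivt h) \<zeta> \<in> Bd" by (rule act_Bd[OF isometry_ivt[OF ih]]) (use z Bw(1) in blast)
        then have xi: "\<xi> \<in> A0" using h(2) unfolding h(3) A0_def by (simp add: ih)
        show False
        proof (cases "h = id")
          case True
          then show False using z xi h(3) by simp
        next
          case False
          have "\<zeta> \<in> act h ` B" using xi B(2) unfolding h(3) by blast
          moreover have "act h ` B \<inter> B = {}" using bspec[OF Bw(3) h(1)] False by blast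
          ultimately show False using z by blast
        qed
      qed
      then show "\<zeta> \<in> B - HU G" using z by blast
    qed
    then have "B - A0 \<in> null_sets \<nu>"
      using cons[OF Bw(2,1,3)] by (rule null_sets_subset[rotated 2]) (intro sets.Diff Bw A0s)
    then show ?thesis unfolding null_mu using Bw(1) by blast
  qed
  ultimately have max: "maximal_wandering_set (subgrp (HG G)) act (restrict_space \<nu> Bd) A0"
    unfolding maximal_wandering_set_def by blast
  have eq: "(\<Union>h\<in>HG G. act h ` A0) = HU G \<inter> Bd"
  proof
    show "(\<Union>h\<in>HG G. act h ` A0) \<subseteq> HU G \<inter> Bd"
      unfolding A0_def HU_def using act_Bd[OF iso] by blast
    show "HU G \<inter> Bd \<subseteq> (\<Union>h\<in>HG G. act h ` A0)"
    proof
      fix \<zeta> assume z: "\<zeta> \<in> HU G \<inter> Bd"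
      then obtain h \<xi> where h: "h \<in> HG G" "\<xi> \<in> Dp" "\<zeta> = act h \<xi>" unfolding HU_def by blast
      have ih: "isometry h" by (rule iso[OF h(1)])
      have "act (ivt h) \<zeta> \<in> Bd" by (rule act_Bd[OF isometry_ivt[OF ih]]) (use z in blast)
      then have "\<xi> \<in> A0" using h(2) unfolding h(3) A0_def by (simp add: ih)
      then show "\<zeta> \<in> (\<Union>h\<in>HG G. act h ` A0)" using h(1,3) by blast
    qed
  qed
  have "HU G \<inter> Bd \<in> sets (restrict_space \<nu> Bd)" unfolding sets_mu using HU_sets[OF G] Bd_sets by blast
  moreover have "Bd - HU G = space (restrict_space \<nu> Bd) - HU G \<inter> Bd" unfolding space_mu by blast
  moreover have "sym_diff (HU G \<inter> Bd) (\<Union>h\<in>carrier (subgrp (HG G)). act h ` A0) \<in> null_sets (restrict_space \<nu> Bd)"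
    unfolding carrier eq by simp
  ultimately show ?thesis unfolding hopf_decomposition_def using max by blast
qed

theorem mixed_subgroup:
  "\<exists>H Con Dis. subgroup H isom_group \<and> H \<subseteq> normal_closure (subgrp \<Gamma>) {k} \<and> second_kind p \<Gamma> H \<and>
     hopf_decomposition (subgrp H) ext_action (restrict_space \<nu> Bd) Con Dis \<and>
     emeasure (restrict_space \<nu> Bd) Con > 0 \<and> emeasure (restrict_space \<nu> Bd) Dis > 0"
proof -
  obtain G where cf: "conf G" and small: "measure \<nu> (HU G) < 1"
    and cons: "\<forall>W\<in>sets \<nu>. W \<subseteq> Bd \<and> (\<forall>h\<in>HG G. h \<noteq> id \<longrightarrow> act h ` W \<inter> W = {}) \<longrightarrow> W - HU G \<in> null_sets \<nu>"
    using limit_group[OF Dp_less_1] by (elim exE conjE)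
  have G: "G \<subseteq> \<Gamma>" using cf by (rule confD)
  have Bs: "Bd \<inter> space \<nu> \<in> sets \<nu>" by (intro sets.Int Bd_sets sets.top)
  have hopf: "hopf_decomposition (subgrp (HG G)) act (restrict_space \<nu> Bd) (Bd - HU G) (HU G \<inter> Bd)"
    by (rule hopf_HG[OF cf]) (rule mp[OF bspec[OF cons]], assumption, rule conjI)
  have em: "emeasure (restrict_space \<nu> Bd) E = emeasure \<nu> E" if "E \<subseteq> Bd" for E
    by (rule emeasure_restrict_space[OF Bs that])
  have HUs: "HU G \<in> sets \<nu>" by (rule HU_sets[OF G])
  have "measure \<nu> Bd \<le> measure \<nu> ((Bd - HU G) \<union> HU G)"
    by (rule nu_mono) (blast, intro sets.Un sets.Diff Bd_sets HUs)
  also have "\<dots> \<le> measure \<nu> (Bd - HU G) + measure \<nu> (HU G)"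
    by (intro measure_Un_le sets.Diff Bd_sets HUs)
  finally have "0 < measure \<nu> (Bd - HU G)" using nu_Bd small by linarith
  then have con: "0 < emeasure (restrict_space \<nu> Bd) (Bd - HU G)"
    using em[of "Bd - HU G"] by (simp add: emeasure_eq_measure)
  have "measure \<nu> Dp \<le> measure \<nu> (HU G)" by (rule nu_mono[OF Dp_HU HUs])
  then have "0 < measure \<nu> (HU G \<inter> Bd)" using Dp_pos nu_Int_Bd[OF HUs] by linarith
  then have dis: "0 < emeasure (restrict_space \<nu> Bd) (HU G \<inter> Bd)"
    using em[of "HU G \<inter> Bd"] by (simp add: emeasure_eq_measure)
  show ?thesis
    by (rule exI[of _ "HG G"], rule exI[of _ "Bd - HU G"], rule exI[of _ "HU G \<inter> Bd"])
      (intro conjI HG_subgroup G HG_normal_closure HG_second_kind cf hopf con dis)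
qed

end

theorem theorem1p21:
  fixes p :: "'a::metric_space"
    and \<Gamma> :: "('a \<Rightarrow> 'a) set"
    and f :: "'a \<Rightarrow> 'a"
    and \<mu> :: "'a bordification measure"
  assumes "proper_space TYPE('a)"
    and "geodesic_space TYPE('a)"
    and "gromov_hyperbolic TYPE('a)"
    and "subgroup \<Gamma> isom_group"
    and "discrete \<Gamma>"
    and "\<not> elementary (subgrp \<Gamma>)"
    and "proper_action \<Gamma>"
    and "SCC p \<Gamma>"
    and "patterson_sullivan p \<Gamma> \<mu>"
    and "f \<in> \<Gamma>"
    and "loxodromic p f"
  shows "\<forall>N::nat. \<exists>n\<ge>N. \<exists>H Con Dis.
           subgroup H isom_group \<and>
           H \<subseteq> normal_closure (subgrp \<Gamma>) {f [^]\<^bsub>isom_group\<^esub> n} \<and>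
           second_kind p \<Gamma> H \<and>
           hopf_decomposition (subgrp H) ext_action \<mu> Con Dis \<and>
           emeasure \<mu> Con > 0 \<and> emeasure \<mu> Dis > 0"
proof
  fix N :: nat
  obtain \<delta>' where d': "0 \<le> \<delta>'" "\<And>w x y z :: 'a. min (gromov_product w x y) (gromov_product w y z) - \<delta>' \<le> gromov_product w x z"
    using assms(3) unfolding gromov_hyperbolic_def by blast
  \<comment> \<open>The given hyperbolicity constant may be 0; the locale needs a positive
    one.\<close>
  define \<delta> where "\<delta> = \<delta>' + 1"
  obtain \<nu> where nu: "ps_weak_limit p \<Gamma> \<nu>" "\<mu> = restrict_space \<nu> (gromov_boundary p)"
    using assms(9) unfolding patterson_sullivan_def by blast
  have iso: "isometry g" if "g \<in> \<Gamma>" for g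
    using subgroup.subset[OF assms(4)] that by (auto simp: carrier_isom_group)
  interpret ps_action p \<delta> \<Gamma> \<nu>
  proof
    show "compact (cball x r)" for x :: 'a and r using assms(1) unfolding proper_space_def by blast
    show "\<exists>c L. geodesic c L \<and> c 0 = x \<and> c L = y" for x y :: 'a using assms(2) unfolding geodesic_space_def by blast
    show "0 < \<delta>" using d'(1) by (simp add: \<delta>_def)
    show "min (gromov_product w x y) (gromov_product w y z) - \<delta> \<le> gromov_product w x z" for w x y z :: 'a
      using d'(2)[of w x y z] by (simp add: \<delta>_def)
    show "id \<in> \<Gamma>" using subgroup.one_closed[OF assms(4)] by simp
    show "g \<circ> h \<in> \<Gamma>" if "g \<in> \<Gamma>" "h \<in> \<Gamma>" for g h using subgroup.m_closed[OF assms(4) that] by simp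
    show "ivt g \<in> \<Gamma>" if "g \<in> \<Gamma>" for g using subgroup.m_inv_closed[OF assms(4) that] isom_group_inv[OF iso[OF that]] by simp
    show "isometry g" if "g \<in> \<Gamma>" for g by (rule iso[OF that])
  qed (fact assms(7), fact assms(8), fact nu(1))
  have fi: "isometry f" by (rule iso[OF assms(10)])
  have zG: "zp f (int n) \<in> \<Gamma>" for n
  proof (induction n)
    case 0
    show ?case unfolding of_nat_0 zp_0 by (rule G_id)
  next
    case (Suc n)
    have e: "zp f (int (Suc n)) = zp f (int n) \<circ> f" using zp_add[OF fi, of "int n" 1] zp_1[OF fi] by (simp add: add.commute)
    show ?case unfolding e by (rule G_comp[OF Suc assms(10)])
  qed
  obtain n0 a where n0: "0 < n0" and a: "gp (zp (zp f (int n0)) (- 1) p) (zp f (int n0) p) \<le> a"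
    "2 * a + 6 * \<delta> < dist p (zp f (int n0) p)"
    using loxodromic_power[OF assms(11)] by blast
  interpret psl_action p \<delta> \<Gamma> \<nu> "zp f (int n0)" "a + 2 * \<delta>"
  proof
    show "zp f (int n0) \<in> \<Gamma>" by (rule zG)
    show "gp (zp (zp f (int n0)) (- int i) p) (zp (zp f (int n0)) (int j) p) \<le> a + 2 * \<delta>" for i j
      by (rule zp_chain[OF zp_isometry[OF fi] a])
    show "2 * (a + 2 * \<delta>) + \<delta> < dist p (zp f (int n0) p)" using a(2) delta_pos by simp
    show "0 \<le> a + 2 * \<delta>" using order_trans[OF gp_nonneg a(1)] delta_pos by simp
  qed (fact assms(6))
  obtain m Dp Dm A R \<rho> N' where m: "int N + 1 \<le> m" and pp: "pingpong p \<delta> \<Gamma> \<nu> (zp (zp f (int n0)) m) Dp Dm A R \<rho> N'"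
    using exists_pingpong[of "int N + 1"] by blast
  \<comment> \<open>A multiple of \<open>n0\<close>, the power for which the axis estimates hold; as
    \<open>n0\<close> is positive, the lower bound on \<open>m\<close> carries over to the
    exponent.\<close>
  define n where "n = n0 * nat m"
  have k: "zp (zp f (int n0)) m = f [^]\<^bsub>isom_group\<^esub> n"
    unfolding zp_mult[OF fi] zp_nat n_def using m by simp
  have "1 * nat m \<le> n" unfolding n_def using n0 by (intro mult_le_mono1) simp
  then have "N \<le> n" using m by linarith
  moreover have "\<exists>H Con Dis. subgroup H isom_group \<and> H \<subseteq> normal_closure (subgrp \<Gamma>) {f [^]\<^bsub>isom_group\<^esub> n} \<and> second_kind p \<Gamma> H \<and>
     hopf_decomposition (subgrp H) ext_action \<mu> Con Dis \<and> emeasure \<mu> Con > 0 \<and> emeasure \<mu> Dis > 0"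
    unfolding nu(2) k[symmetric] by (rule pingpong.mixed_subgroup[OF pp])
  ultimately show "\<exists>n\<ge>N. \<exists>H Con Dis.
           subgroup H isom_group \<and>
           H \<subseteq> normal_closure (subgrp \<Gamma>) {f [^]\<^bsub>isom_group\<^esub> n} \<and>
           second_kind p \<Gamma> H \<and>
           hopf_decomposition (subgrp H) ext_action \<mu> Con Dis \<and>
           emeasure \<mu> Con > 0 \<and> emeasure \<mu> Dis > 0"
    by (intro exI[of _ n] conjI)
qed

end
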